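(* For the cyclic polling system with retrials and glue periods described in the context, the scaled steady-state joint queue length vector at the start of a switch-over period from station $1$ to station $2$ satisfies, as $\rho\uparrow1$, $$(1-\rho)\begin{pmatrix}Z_1^{(1)}\\ Z_2^{(1)}\\ \vdots\\ Z_N^{(1)}\end{pmatrix}\xrightarrow{\;d\;}\frac{b^{(2)}}{2b^{(1)}}\,\frac1\delta\begin{pmatrix}e^{-\nu_1G_1}\hat u_1^{(1)}+(1-e^{-\nu_1G_1})\hat u_1^{(1)}\hat\lambda_1\mathbb{E}[B_1]\\ \hat u_2^{(1)}+(1-e^{-\nu_1G_1})\hat u_1^{(1)}\hat\lambda_2\mathbb{E}[B_1]\\ \vdots\\ \hat u_N^{(1)}+(1-e^{-\nu_1G_1})\hat u_1^{(1)}\hat\lambda_N\mathbb{E}[B_1]\end{pmatrix}\Gamma(\alpha,1),$$ where $\xrightarrow{\;d\;}$ denotes convergence in distribution of random vectors and $\Gamma(\alpha,1)$ is a single scalar gamma-distributed random variable multiplying the deterministic vector.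
   Context: Model. A single server serves $N$ stations $Q_1,\dots,Q_N$ cyclically (after $Q_N$ comes $Q_1$). Customers of type $i$ arrive at $Q_i$ according to a Poisson process with rate $\lambda_i>0$. Service times at $Q_i$ are i.i.d. copies of $B_i$; switch-over times from $Q_i$ to $Q_{i+1}$ are i.i.d. copies of $S_i$; interarrival, service, switch-over and retrial times are all independent. After the server switches to $Q_i$ there is first a deterministic glue period of length $G_i>0$, then a visit period at $Q_i$, then a switch-over period to $Q_{i+1}$. Type-$i$ customers who arrive at $Q_i$ (as new arrivals or as retrials) during a glue period of $Q_i$ stick, joining the queue of $Q_i$. Those arriving at any other time immediately leave to the orbit of $Q_i$ and retry after an independent exponentially distributed time with parameter $\nu_i>0$ (repeatedly, until they arrive during a glue period of $Q_i$). During the visit period at $Q_i$ the server serves exactly the customers that are in the queue of $Q_i$ at the end of the glue period (none of those in orbit and none of the new arrivals); served customers leave the system. Let $\rho_i=\lambda_i\mathbb{E}[B_i]$, $\rho=\sum_{i=1}^N\rho_i$; the system is considered in steady state for $\rho<1$. The moments $\mathbb{E}[B_i]>0$, $\mathbb{E}[B_i^2]$, $\mathbb{E}[S_i]$ are finite. Heavy-traffic scaling. Service times, switch-over times, glue periods and retrial rates are fixed, and $\lambda_i=\rho\hat\lambda_i$ with $\hat\lambda_i>0$ fixed such that $\sum_{i=1}^N\hat\lambda_i\mathbb{E}[B_i]=1$. A hat on a quantity depending on $\rho$ denotes its value at $\rho=1$; thus $\hat\rho_i=\hat\lambda_i\mathbb{E}[B_i]$. Notation. $(Z_1^{(1)},\dots,Z_N^{(1)})$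 has the limiting (steady-state) distribution of the numbers of customers of types $1,\dots,N$ in the system at the start of a switch-over period of station $1$ (i.e. from station $1$ to station $2$). For $j=1,\dots,N$, $$\hat u^{(1)}_j=\hat\lambda_j\left[\frac{e^{-\nu_jG_j}}{1-e^{-\nu_jG_j}}+\sum_{k=j}^N\hat\rho_k\right],\qquad \delta=\sum_{j=1}^N\hat u^{(1)}_j\mathbb{E}[B_j],$$ $$b^{(m)}=\frac{\sum_{i=1}^N\lambda_i\mathbb{E}[B_i^m]}{\sum_{i=1}^N\lambda_i}\ (m=1,2),\qquad r=\sum_{i=1}^N(\mathbb{E}[S_i]+G_i),\qquad \alpha=2r\delta\,\frac{b^{(1)}}{b^{(2)}}.$$ ($b^{(m)}$ does not depend on $\rho$.) $\Gamma(\alpha,\mu)$ denotes a gamma random variable with density $\frac{\mu^\alpha}{\Gamma(\alpha)}x^{\alpha-1}e^{-\mu x}$, $x>0$. *)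

theory Defs
  imports "HOL-Probability.Probability"
begin

section \<open>Stations\<close>

text \<open>The stations \<open>Q\<^sub>1, \<dots>, Q\<^sub>N\<close> are the elements of \<open>'n\<close> in increasing order, \<open>N = CARD('n)\<close>.
  The visits of the server are numbered \<open>0, 1, 2, \<dots>\<close>; visit \<open>m\<close> takes place at \<open>station m\<close>, so
  \<open>station 0\<close> is \<open>Q\<^sub>1\<close>, and the visits to \<open>Q\<^sub>1\<close> are those with number \<open>c * N\<close>.\<close>

definition station :: "nat \<Rightarrow> 'n::{finite,linorder}" where
  "station m = sorted_list_of_set UNIV ! (m mod CARD('n))"

section \<open>Sample paths\<close>

text \<open>The random times driving the system. All numberings start at 0:
  \<^item> \<open>Interarrival i n\<close>: time between the arrivals at \<open>i\<close> of customers \<open>n - 1\<close> and \<open>n\<close>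
    (from time 0 if \<open>n = 0\<close>);
  \<^item> \<open>Retrial i n k\<close>: time customer \<open>n\<close> of type \<open>i\<close> spends in orbit between its \<open>k\<close>-th and its
    \<open>(k + 1)\<close>-st attempt to join the queue, attempt 0 being its arrival;
  \<^item> \<open>Service m k\<close>: service time of the \<open>k\<close>-th customer served during visit \<open>m\<close>;
  \<^item> \<open>Switch m\<close>: duration of the switch-over following visit \<open>m\<close>.\<close>

datatype 'n source =
    Interarrival 'n nat
  | Retrial 'n nat nat
  | Service nat nat
  | Switch nat

definition arrival_time :: "('n source \<Rightarrow> real) \<Rightarrow> 'n \<Rightarrow> nat \<Rightarrow> real" where
  "arrival_time x i n = (\<Sum>l\<le>n. x (Interarrival i l))"

definition attempt_time :: "('n source \<Rightarrow> real) \<Rightarrow> 'n \<Rightarrow> nat \<Rightarrow> nat \<Rightarrow> real" where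
  "attempt_time x i n k = arrival_time x i n + (\<Sum>l<k. x (Retrial i n l))"

text \<open>Customers in the queue of \<open>i\<close> at the end of a glue period of \<open>i\<close> that starts at time \<open>t\<close>, when
  \<open>D\<close> are the customers of type \<open>i\<close> served before. A customer with an attempt in an earlier glue
  period of \<open>i\<close> has been served in the visit following that period and hence is in \<open>D\<close>; an attempt
  time that comes after the customer has joined the queue therefore has no influence.\<close>

definition glued ::
    "('n \<Rightarrow> real) \<Rightarrow> ('n source \<Rightarrow> real) \<Rightarrow> 'n \<Rightarrow> real \<Rightarrow> nat set \<Rightarrow> nat set" where
  "glued G x i t D = {n. n \<notin> D \<and> (\<exists>k. attempt_time x i n k \<in> {t..<t + G i})}"

definition visit_end_from ::
    "('n::{finite,linorder} \<Rightarrow> real) \<Rightarrow> ('n source \<Rightarrow> real) \<Rightarrow> nat \<Rightarrow> real \<times> ('n \<Rightarrow> nat set)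
      \<Rightarrow> real \<times> ('n \<Rightarrow> nat set)" where
  "visit_end_from G x m = (\<lambda>(t, D).
     let i = station m; W = glued G x i t (D i)
     in (t + G i + (\<Sum>k<card W. x (Service m k)), D(i := D i \<union> W)))"

text \<open>State of the server at the start of the glue period preceding visit \<open>m\<close>: the current time, and for
  each type the customers served so far. At time 0 the system is empty and a glue period of
  \<open>Q\<^sub>1\<close> starts.\<close>

primrec glue_start ::
    "('n::{finite,linorder} \<Rightarrow> real) \<Rightarrow> ('n source \<Rightarrow> real) \<Rightarrow> nat \<Rightarrow> real \<times> ('n \<Rightarrow> nat set)" where
  "glue_start G x 0 = (0, \<lambda>_. {})"
| "glue_start G x (Suc m) =
     (let (t, D) = visit_end_from G x m (glue_start G x m) in (t + x (Switch m), D))"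

definition visit_end ::
    "('n::{finite,linorder} \<Rightarrow> real) \<Rightarrow> ('n source \<Rightarrow> real) \<Rightarrow> nat \<Rightarrow> real \<times> ('n \<Rightarrow> nat set)" where
  "visit_end G x m = visit_end_from G x m (glue_start G x m)"

text \<open>Numbers of customers of all types in the system at the start of the switch-over period that
  follows visit \<open>m\<close>.\<close>

definition in_system ::
    "('n::{finite,linorder} \<Rightarrow> real) \<Rightarrow> ('n source \<Rightarrow> real) \<Rightarrow> nat \<Rightarrow> 'n \<Rightarrow> nat" where
  "in_system G x m =
     (\<lambda>j. card {n. arrival_time x j n \<le> fst (visit_end G x m) \<and> n \<notin> snd (visit_end G x m) j})"

section \<open>The stochastic model\<close>

text \<open>\<open>B i\<close> and \<open>S i\<close> are the laws of the service times at \<open>i\<close> and of the switch-over times from \<open>i\<close> to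
  the next station; \<open>lam i\<close> and \<open>nu i\<close> are the arrival and retrial rates.\<close>

locale glue_polling_system = prob_space M for M :: "'a measure" +
  fixes X :: "'n::{finite,linorder} source \<Rightarrow> 'a \<Rightarrow> real"
    and lam nu :: "'n \<Rightarrow> real"
    and B S :: "'n \<Rightarrow> real measure"
  assumes indep: "indep_vars (\<lambda>_. borel) X UNIV"
    and interarrival:
      "distributed M lborel (X (Interarrival i n)) (\<lambda>t. ennreal (exponential_density (lam i) t))"
    and retrial:
      "distributed M lborel (X (Retrial i n k)) (\<lambda>t. ennreal (exponential_density (nu i) t))"
    and service: "distr M borel (X (Service m k)) = B (station m)"
    and switch: "distr M borel (X (Switch m)) = S (station m)"

text \<open>\<open>p\<close> is the limiting distribution of the numbers of customers at the successive starts of a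
  switch-over period of \<open>Q\<^sub>1\<close>.\<close>

definition limiting_law_switch1 ::
    "('n::{finite,linorder} \<Rightarrow> real) \<Rightarrow> 'a measure \<Rightarrow> ('n source \<Rightarrow> 'a \<Rightarrow> real)
      \<Rightarrow> ('n \<Rightarrow> nat) pmf \<Rightarrow> bool" where
  "limiting_law_switch1 G M X p \<longleftrightarrow>
     (\<forall>z. (\<lambda>c. measure M {\<omega> \<in> space M. in_system G (\<lambda>s. X s \<omega>) (c * CARD('n)) = z})
            \<longlonglongrightarrow> pmf p z)"

section \<open>Constants of the heavy-traffic limit\<close>

definition moment :: "nat \<Rightarrow> real measure \<Rightarrow> real" where
  "moment m D = (\<integral>x. x ^ m \<partial>D)"

abbreviation mean :: "real measure \<Rightarrow> real" where
  "mean \<equiv> moment 1"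

definition u_hat :: "('n::{finite,linorder} \<Rightarrow> real) \<Rightarrow> ('n \<Rightarrow> real) \<Rightarrow> ('n \<Rightarrow> real) \<Rightarrow>
    ('n \<Rightarrow> real measure) \<Rightarrow> 'n \<Rightarrow> real" where
  "u_hat lam nu G B j =
     lam j * (exp (- nu j * G j) / (1 - exp (- nu j * G j)) + (\<Sum>k\<in>{j..}. lam k * mean (B k)))"

definition delta :: "('n::{finite,linorder} \<Rightarrow> real) \<Rightarrow> ('n \<Rightarrow> real) \<Rightarrow> ('n \<Rightarrow> real) \<Rightarrow>
    ('n \<Rightarrow> real measure) \<Rightarrow> real" where
  "delta lam nu G B = (\<Sum>j\<in>UNIV. u_hat lam nu G B j * mean (B j))"

definition mixed_moment :: "nat \<Rightarrow> ('n::finite \<Rightarrow> real) \<Rightarrow> ('n \<Rightarrow> real measure) \<Rightarrow> real" where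
  "mixed_moment m lam B = (\<Sum>i\<in>UNIV. lam i * moment m (B i)) / (\<Sum>i\<in>UNIV. lam i)"

definition alpha :: "('n::{finite,linorder} \<Rightarrow> real) \<Rightarrow> ('n \<Rightarrow> real) \<Rightarrow> ('n \<Rightarrow> real) \<Rightarrow>
    ('n \<Rightarrow> real measure) \<Rightarrow> ('n \<Rightarrow> real measure) \<Rightarrow> real" where
  "alpha lam nu G B S =
     2 * (\<Sum>i\<in>UNIV. mean (S i) + G i) * delta lam nu G B
       * (mixed_moment 1 lam B / mixed_moment 2 lam B)"

definition gamma_law :: "real \<Rightarrow> real \<Rightarrow> real measure" where
  "gamma_law a mu = density lborel (\<lambda>x. ennreal
     (if 0 < x then mu powr a / Gamma a * x powr (a - 1) * exp (- mu * x) else 0))"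

section \<open>Convergence in distribution\<close>

definition converges_in_distribution ::
    "('b \<Rightarrow> 'a::topological_space measure) \<Rightarrow> 'a measure \<Rightarrow> 'b filter \<Rightarrow> bool" where
  "converges_in_distribution \<mu> \<mu>' F \<longleftrightarrow>
     (\<forall>f :: 'a \<Rightarrow> real. continuous_on UNIV f \<and> bounded (range f) \<longrightarrow>
        ((\<lambda>t. \<integral>x. f x \<partial>\<mu> t) \<longlongrightarrow> (\<integral>x. f x \<partial>\<mu>')) F)"

end

theory Submission
  imports Defs
begin

text \<open>Given the service and switch-over times and the numbers of customers served in each visit, the
  customers of each type form a Poisson process that is thinned by the glue periods. Hence the generating
  function of the numbers in the system after \<open>m\<close> visits is a product over the visits, evaluated along a
  backward recursion \<open>y \<mapsto> offspring y\<close> started at \<open>y = 1 - z\<close>: every visit contributes a factor for the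
  immigrants of its glue and switch-over periods. With \<open>z j = exp (- \<epsilon> * s j)\<close> and \<open>\<epsilon> = 1 - \<rho>\<close>, the vector
  \<open>y j / mean (B j)\<close> becomes nearly constant after a bounded number of visits; its common value \<open>h\<close> then
  drops over one cycle by about \<open>(\<epsilon> * h + \<kappa> * h ^ 2) / \<delta>\<close>, while the logarithm of the immigration factor of
  the cycle is about \<open>- \<gamma> * h\<close>. Hence the sum of these logarithms telescopes to
  \<open>- \<alpha> * ln (1 + \<kappa> * h / \<epsilon>)\<close> at the initial \<open>h\<close>, which gives the Laplace transform of the gamma law.\<close>

section \<open>Renewal equation for marked Poisson arrivals\<close>

text \<open>Two obstacles shape the proof. The glue periods that thin the Poisson arrivals start at
  epochs that depend on these very arrivals, so Poisson computations are made only for prescribed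
  epochs. And the recursion runs through infinitely many cycles while \<open>h\<close> tends to 0,
  where additive errors would accumulate: all estimates are relative, with factors
  \<open>1 - \<eta>\<close> and \<open>1 + \<eta>\<close>, and \<open>\<eta>\<close> stays fixed
  until \<epsilon> has gone to 0. The scalar \<open>h\<close> is read off by a linear functional
  that the linearized critical recursion conserves. Its weights are the fluid numbers of customers;
  \<open>\<delta>\<close> is their workload, and their values at the end of a visit to the first
  station form the limiting vector. With \<open>L\<close> the current average, a visit to
  \<open>i\<close> loses \<open>\<epsilon> * L\<close> plus
  \<open>moment 2 (B i) / (2 * mean (B i)) * L ^ 2\<close>. Weighted by the loads this gives
  \<open>\<kappa> = (\<Sum>i. lam i * moment 2 (B i)) / 2\<close>; \<open>\<gamma>\<close> is the
  mean total of glue and switch-over times in a cycle, and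
  \<open>\<alpha> = \<gamma> * \<delta> / \<kappa>\<close>. The steady state enters as a pointwise
  limit of probabilities; Scheffe's lemma turns it into a limit of transforms.\<close>

lemma measurable_emeasure_greaterThan:
  fixes \<mu> :: "real measure"
  assumes sets: "sets \<mu> = sets borel" and fin: "finite_measure \<mu>"
  shows "(\<lambda>x. emeasure \<mu> {x<..}) \<in> borel_measurable borel"
    and "(\<lambda>x. emeasure \<mu> {t<..<x}) \<in> borel_measurable borel"
proof -
  interpret finite_measure \<mu> by fact
  have *: "sets (borel \<Otimes>\<^sub>M \<mu>) = sets (borel \<Otimes>\<^sub>M (borel :: real measure))"
    by (intro sets_pair_measure_cong refl sets)
  have "{p \<in> space (borel \<Otimes>\<^sub>M borel). fst p < (snd p :: real)} \<in> sets (borel \<Otimes>\<^sub>M borel)"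
    by measurable
  then have 1: "{p. fst p < snd p} \<in> sets (borel \<Otimes>\<^sub>M \<mu>)"
    unfolding * by (simp add: space_pair_measure)
  have "{p \<in> space (borel \<Otimes>\<^sub>M borel). t < snd p \<and> snd p < (fst p :: real)} \<in> sets (borel \<Otimes>\<^sub>M borel)"
    by measurable
  then have 2: "{p. t < snd p \<and> snd p < fst p} \<in> sets (borel \<Otimes>\<^sub>M \<mu>)"
    unfolding * by (simp add: space_pair_measure)
  show "(\<lambda>x. emeasure \<mu> {x<..}) \<in> borel_measurable borel"
    using measurable_emeasure_Pair[OF 1] by (simp add: vimage_def greaterThan_def)
  have "{t<..<x} = {y. t < y \<and> y < x}" for x by auto
  then show "(\<lambda>x. emeasure \<mu> {t<..<x}) \<in> borel_measurable borel"
    using measurable_emeasure_Pair[OF 2] by (simp add: vimage_def)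
qed

text \<open>Without atoms, integrating \<open>F ^ k\<close> against \<open>\<mu>\<close> amounts to
  integrating minus the differential of \<open>F ^ Suc k / Suc k\<close>, where \<open>F\<close> is
  the tail. Instead of a change of variables, an induction: the tail power under the integral is
  itself an integral by the induction hypothesis, and Fubini applies.\<close>

lemma nn_integral_tail_power:
  fixes \<mu> :: "real measure"
  assumes sets[measurable_cong, simp]: "sets \<mu> = sets borel" and fin: "finite_measure \<mu>"
    and atomless: "\<And>x. emeasure \<mu> {x} = 0"
  shows "of_nat (Suc k) * (\<integral>\<^sup>+x. indicator {t<..} x * emeasure \<mu> {x<..} ^ k \<partial>\<mu>)
    = emeasure \<mu> {t<..} ^ Suc k"
proof (induction k arbitrary: t)
  case 0
  then show ?case by simp
next
  case (Suc k)
  interpret finite_measure \<mu> by fact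
  have sp[simp]: "space \<mu> = UNIV"
    using sets_eq_imp_space_eq[OF sets] by simp
  interpret P: pair_sigma_finite \<mu> \<mu> ..
  define F where "F x = emeasure \<mu> {x<..}" for x
  have F_meas[measurable]: "F \<in> borel_measurable borel"
    unfolding F_def[abs_def] by (rule measurable_emeasure_greaterThan(1)[OF sets fin])
  define I where "I j t = (\<integral>\<^sup>+x. indicator {t<..} x * F x ^ j \<partial>\<mu>)" for j t
  have IH: "of_nat (Suc k) * I k t = F t ^ Suc k" for t
    using Suc[of t] by (simp add: I_def F_def)
  have meas: "(\<lambda>(x, y). of_nat (Suc k) * (indicator {t<..} x * indicator {x<..} y * F y ^ k))
      \<in> borel_measurable (\<mu> \<Otimes>\<^sub>M \<mu>)"
    by (simp add: indicator_def[abs_def] split_beta') 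
  have "I (Suc k) t = (\<integral>\<^sup>+x. indicator {t<..} x * (of_nat (Suc k) * I k x) \<partial>\<mu>)"
    by (simp only: I_def[of "Suc k"] IH)
  also have "\<dots> = (\<integral>\<^sup>+x. \<integral>\<^sup>+y. of_nat (Suc k) * (indicator {t<..} x * indicator {x<..} y * F y ^ k) \<partial>\<mu> \<partial>\<mu>)"
    unfolding I_def
    by (intro nn_integral_cong, subst nn_integral_cmult[symmetric], measurable,
        subst nn_integral_cmult[symmetric], measurable)
       (simp_all add: mult_ac)
  also have "\<dots> = (\<integral>\<^sup>+y. \<integral>\<^sup>+x. of_nat (Suc k) * (indicator {t<..} x * indicator {x<..} y * F y ^ k) \<partial>\<mu> \<partial>\<mu>)"
    by (rule P.Fubini'[OF meas, symmetric])
  also have "\<dots> = (\<integral>\<^sup>+y. of_nat (Suc k) * (indicator {t<..} y * (F y ^ k * emeasure \<mu> {t<..<y})) \<partial>\<mu>)"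
  proof (intro nn_integral_cong)
    fix y
    have "(\<integral>\<^sup>+x. of_nat (Suc k) * (indicator {t<..} x * indicator {x<..} y * F y ^ k) \<partial>\<mu>)
      = (\<integral>\<^sup>+x. of_nat (Suc k) * F y ^ k * indicator {t<..<y} x \<partial>\<mu>)"
      by (intro nn_integral_cong) (auto simp: indicator_def)
    also have "\<dots> = of_nat (Suc k) * F y ^ k * emeasure \<mu> {t<..<y}"
      by (rule nn_integral_cmult_indicator) simp
    also have "\<dots> = of_nat (Suc k) * (indicator {t<..} y * (F y ^ k * emeasure \<mu> {t<..<y}))"
      by (auto simp: indicator_def mult_ac)
    finally show "(\<integral>\<^sup>+x. of_nat (Suc k) * (indicator {t<..} x * indicator {x<..} y * F y ^ k) \<partial>\<mu>)
      = of_nat (Suc k) * (indicator {t<..} y * (F y ^ k * emeasure \<mu> {t<..<y}))" .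
  qed
  finally have 1: "I (Suc k) t
    = (\<integral>\<^sup>+y. of_nat (Suc k) * (indicator {t<..} y * (F y ^ k * emeasure \<mu> {t<..<y})) \<partial>\<mu>)" .
  \<comment> \<open>Atomlessness enters here: no mass sits at \<open>y\<close>, so the mass between
    \<open>t\<close> and \<open>y\<close> and the tail beyond \<open>y\<close> add up to
    \<open>F t\<close>, a constant factor.\<close>
  have split: "emeasure \<mu> {t<..<y} + F y = F t" if "t < y" for y
  proof -
    have "F t = emeasure \<mu> ({t<..<y} \<union> ({y} \<union> {y<..}))"
      unfolding F_def using that by (intro arg_cong[where f = "emeasure \<mu>"]) auto
    also have "\<dots> = emeasure \<mu> {t<..<y} + (emeasure \<mu> {y} + emeasure \<mu> {y<..})"
      by (subst plus_emeasure[symmetric], simp, simp, force, subst plus_emeasure) auto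
    finally show ?thesis by (simp add: atomless F_def)
  qed
  have m2: "(\<lambda>y. emeasure \<mu> {t<..<y}) \<in> borel_measurable borel"
    by (rule measurable_emeasure_greaterThan(2)[OF sets fin])
  note [measurable] = m2
  \<comment> \<open>Adding \<open>Suc k\<close> further copies of the integral completes the mass of
    \<open>{t<..<y}\<close> to \<open>F t\<close>; this produces the factor
    \<open>Suc (Suc k)\<close> of the claim.\<close>
  have "I (Suc k) t + of_nat (Suc k) * I (Suc k) t =
    (\<integral>\<^sup>+y. of_nat (Suc k) * (indicator {t<..} y * (F y ^ k * emeasure \<mu> {t<..<y}))
      + of_nat (Suc k) * (indicator {t<..} y * F y ^ Suc k) \<partial>\<mu>)"
    apply (subst 1)
    unfolding I_def
    by (subst nn_integral_cmult[symmetric], measurable, subst nn_integral_add) (simp_all, measurable)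
  also have "\<dots> = (\<integral>\<^sup>+y. (of_nat (Suc k) * F t) * (indicator {t<..} y * F y ^ k) \<partial>\<mu>)"
  proof (intro nn_integral_cong)
    fix y
    have "of_nat (Suc k) * (F y ^ k * emeasure \<mu> {t<..<y}) + of_nat (Suc k) * F y ^ Suc k
      = of_nat (Suc k) * (F y ^ k * (emeasure \<mu> {t<..<y} + F y))"
      by (simp add: distrib_left mult_ac)
    then show "of_nat (Suc k) * (indicator {t<..} y * (F y ^ k * emeasure \<mu> {t<..<y}))
      + of_nat (Suc k) * (indicator {t<..} y * F y ^ Suc k)
      = (of_nat (Suc k) * F t) * (indicator {t<..} y * F y ^ k)"
      using split[of y] by (cases "t < y") (simp_all add: mult_ac)
  qed
  also have "\<dots> = F t * (of_nat (Suc k) * I k t)"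
    unfolding I_def by (subst nn_integral_cmult) (simp_all add: mult_ac)
  also have "\<dots> = F t ^ Suc (Suc k)" by (simp only: IH power_Suc)
  finally show ?case
    by (simp add: I_def F_def distrib_right)
qed

lemma ennreal_exp_suminf:
  assumes "0 \<le> x"
  shows "ennreal (exp x) = (\<Sum>k. ennreal (inverse (fact k)) * ennreal x ^ k)"
proof -
  have "(\<lambda>k. x ^ k /\<^sub>R fact k) sums exp x"
    using exp_converges[of x] by (simp add: scaleR_conv_of_real)
  moreover have "0 \<le> x ^ k /\<^sub>R fact k" for k using assms by simp
  ultimately have "ennreal (exp x) = (\<Sum>k. ennreal (x ^ k /\<^sub>R fact k))"
    by (subst suminf_ennreal2) (auto simp: sums_iff)
  also have "\<dots> = (\<Sum>k. ennreal (inverse (fact k)) * ennreal x ^ k)"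
    using assms by (simp add: ennreal_mult[symmetric] ennreal_power)
  finally show ?thesis .
qed

text \<open>Expand the exponential: each power of the tail integrates to the next one, and the
  leading 1 is the term of order zero. This is the fundamental theorem of calculus for
  \<open>exp F\<close>.\<close>

lemma nn_integral_exp_tail:
  fixes \<mu> :: "real measure"
  assumes sets[measurable_cong, simp]: "sets \<mu> = sets borel" and fin: "finite_measure \<mu>"
    and atomless: "\<And>x. emeasure \<mu> {x} = 0"
  shows "1 + (\<integral>\<^sup>+x. indicator {t<..} x * ennreal (exp (measure \<mu> {x<..})) \<partial>\<mu>)
    = ennreal (exp (measure \<mu> {t<..}))"
proof -
  interpret finite_measure \<mu> by fact
  define F where "F x = emeasure \<mu> {x<..}" for x
  have F_meas[measurable]: "F \<in> borel_measurable borel"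
    unfolding F_def[abs_def] by (rule measurable_emeasure_greaterThan(1)[OF sets fin])
  have E: "ennreal (exp (measure \<mu> {x<..})) = (\<Sum>k. ennreal (inverse (fact k)) * F x ^ k)" for x
    by (simp add: ennreal_exp_suminf F_def emeasure_eq_measure)
  have c: "ennreal (inverse (fact k)) = ennreal (inverse (fact (Suc k))) * of_nat (Suc k)" for k
  proof -
    have "inverse (fact k) = inverse (fact (Suc k)) * real (Suc k)"
      by (simp del: of_nat_Suc add: fact_Suc)
    then show ?thesis
      by (metis ennreal_mult ennreal_of_nat_eq_real_of_nat inverse_nonnegative_iff_nonnegative fact_ge_zero of_nat_0_le_iff)
  qed
  have "(\<integral>\<^sup>+x. indicator {t<..} x * ennreal (exp (measure \<mu> {x<..})) \<partial>\<mu>)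
    = (\<integral>\<^sup>+x. (\<Sum>k. ennreal (inverse (fact k)) * (indicator {t<..} x * F x ^ k)) \<partial>\<mu>)"
    by (intro nn_integral_cong) (auto simp: E indicator_def)
  also have "\<dots> = (\<Sum>k. \<integral>\<^sup>+x. ennreal (inverse (fact k)) * (indicator {t<..} x * F x ^ k) \<partial>\<mu>)"
    by (rule nn_integral_suminf) measurable
  also have "\<dots> = (\<Sum>k. ennreal (inverse (fact k)) * (\<integral>\<^sup>+x. indicator {t<..} x * F x ^ k \<partial>\<mu>))"
    by (subst nn_integral_cmult) simp_all
  also have "\<dots> = (\<Sum>k. ennreal (inverse (fact (Suc k))) * F t ^ Suc k)"
  proof (rule suminf_cong)
    fix k
    show "ennreal (inverse (fact k)) * (\<integral>\<^sup>+x. indicator {t<..} x * F x ^ k \<partial>\<mu>)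
      = ennreal (inverse (fact (Suc k))) * F t ^ Suc k"
      unfolding c[of k] F_def mult.assoc nn_integral_tail_power[OF assms] ..
  qed
  finally have 1: "(\<integral>\<^sup>+x. indicator {t<..} x * ennreal (exp (measure \<mu> {x<..})) \<partial>\<mu>)
    = (\<Sum>k. ennreal (inverse (fact (Suc k))) * F t ^ Suc k)" .
  have "(\<Sum>k. ennreal (inverse (fact k)) * F t ^ k)
    = (\<Sum>k. ennreal (inverse (fact (k + 1))) * F t ^ (k + 1)) + (\<Sum>k<1. ennreal (inverse (fact k)) * F t ^ k)"
    by (rule suminf_offset) simp
  then show ?thesis unfolding 1 unfolding E by (simp add: add.commute)
qed

text \<open>For \<open>t \<le> T\<close> this is the probability that the first point after
  \<open>t\<close> comes later than \<open>T\<close>.\<close>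

lemma nn_integral_exp_cutoff:
  assumes "0 < l"
  shows "(\<integral>\<^sup>+s. indicator {T<..} s * ennreal (l * exp (- l * (s - t))) \<partial>lborel) = ennreal (exp (- l * (T - t)))"
proof -
  have "(\<integral>\<^sup>+s. ennreal (l * exp (- l * (s - t))) * indicator {T..} s \<partial>lborel) = ennreal (0 - (- exp (- l * (T - t))))"
  proof (rule nn_integral_FTC_atLeast)
    show "((\<lambda>s. - exp (- l * (s - t))) \<longlongrightarrow> 0) at_top"
    proof -
      have "filterlim (\<lambda>s. - l * (s - t)) at_bot at_top"
        using assms
        by (intro filterlim_tendsto_neg_mult_at_bot[OF tendsto_const]
            filterlim_tendsto_add_at_top[OF tendsto_const[of "- t"], simplified])
           (auto simp: filterlim_ident)
      then show ?thesis
        using tendsto_minus[OF filterlim_compose[OF exp_at_bot]] by simp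
    qed
    show "\<And>s. T \<le> s \<Longrightarrow> ((\<lambda>s. - exp (- l * (s - t))) has_real_derivative l * exp (- l * (s - t))) (at s)"
      by (auto intro!: derivative_eq_intros)
  qed (use assms in auto)
  moreover have "(\<integral>\<^sup>+s. ennreal (l * exp (- l * (s - t))) * indicator {T..} s \<partial>lborel)
     = (\<integral>\<^sup>+s. indicator {T<..} s * ennreal (l * exp (- l * (s - t))) \<partial>lborel)"
    using AE_lborel_singleton[of T]
    by (intro nn_integral_cong_AE) (auto elim!: eventually_mono simp: indicator_def)
  ultimately show ?thesis by simp
qed

text \<open>The Laplace functional of a rate \<open>l\<close> Poisson process after time \<open>t\<close>, each point at \<open>s\<close> contributing
  the factor \<open>H s\<close>. Conditioning on the first point gives a Volterra equation, whose iterates are \<open>picard\<close>.\<close>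

definition survivor :: "real \<Rightarrow> (real \<Rightarrow> real) \<Rightarrow> real \<Rightarrow> real" where
  "survivor l H t = exp (- l * (\<integral>s. indicator {t<..} s * (1 - H s) \<partial>lborel))"

lemma survivor_le_1:
  assumes "0 \<le> l" "\<And>s. H s \<le> 1" 
  shows "survivor l H t \<le> 1"
  unfolding survivor_def using assms by (auto intro!: integral_nonneg_AE simp: indicator_def)

text \<open>As \<open>H = 1\<close> beyond \<open>T\<close>, the exponent splits into that of a void
  probability and the integral of \<open>H\<close> over a bounded interval, where \<open>H\<close>
  can serve as the density of a finite measure.\<close>

lemma survivor_eq:
  fixes H :: "real \<Rightarrow> real"
  assumes H[measurable]: "H \<in> borel_measurable borel" and H01: "\<And>s. 0 \<le> H s" "\<And>s. H s \<le> 1"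
    and HT: "\<And>s. T < s \<Longrightarrow> H s = 1"
  shows "t \<le> T \<Longrightarrow> survivor l H t = exp (- l * (T - t) + l * (\<integral>s. indicator {t<..T} s * H s \<partial>lborel))"
    and "T \<le> t \<Longrightarrow> survivor l H t = 1"
proof -
  have int: "integrable lborel (\<lambda>s. indicator {t<..T} s * H s)"
    by (rule Bochner_Integration.integrable_bound[OF integrable_real_indicator[of "{t<..T}"]])
       (use H01 in \<open>auto simp: indicator_def intro!: emeasure_bounded_finite[unfolded infinity_ennreal_def]\<close>)
  show "survivor l H t = exp (- l * (T - t) + l * (\<integral>s. indicator {t<..T} s * H s \<partial>lborel))" if "t \<le> T"
  proof -
    have "(\<integral>s. indicator {t<..} s * (1 - H s) \<partial>lborel) = (\<integral>s. indicator {t<..T} s - indicator {t<..T} s * H s \<partial>lborel)"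
      by (intro Bochner_Integration.integral_cong) (use HT in \<open>auto simp: indicator_def\<close>)
    also have "\<dots> = (T - t) - (\<integral>s. indicator {t<..T} s * H s \<partial>lborel)"
      by (subst Bochner_Integration.integral_diff[OF _ int]) (use that in auto)
    finally have e: "(\<integral>s. indicator {t<..} s * (1 - H s) \<partial>lborel) = (T - t) - (\<integral>s. indicator {t<..T} s * H s \<partial>lborel)" .
    show ?thesis unfolding survivor_def e by (simp add: algebra_simps)
  qed
  show "survivor l H t = 1" if "T \<le> t"
  proof -
    have "(\<integral>s. indicator {t<..} s * (1 - H s) \<partial>lborel) = (\<integral>s. 0 \<partial>(lborel :: real measure))"
      by (intro Bochner_Integration.integral_cong) (use HT that in \<open>auto simp: indicator_def\<close>)
    then show ?thesis by (simp add: survivor_def)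
  qed
qed

text \<open>Condition on the first point after \<open>t\<close>. A first point beyond
  \<open>T\<close> contributes a void probability, the leading 1 of
  \<open>nn_integral_exp_tail\<close>; a first point before \<open>T\<close> contributes its
  integral.\<close>

lemma survivor_fixed_point:
  fixes H :: "real \<Rightarrow> real"
  assumes l: "0 < l" and H[measurable]: "H \<in> borel_measurable borel"
    and H01: "\<And>s. 0 \<le> H s" "\<And>s. H s \<le> 1" and HT: "\<And>s. T < s \<Longrightarrow> H s = 1"
  shows "(\<integral>\<^sup>+s. indicator {t<..} s * ennreal (l * exp (- l * (s - t)) * H s) * ennreal (survivor l H s) \<partial>lborel)
    = ennreal (survivor l H t)" (is "?L t = _")
proof (cases "T \<le> t")
  case True
  have "?L t = (\<integral>\<^sup>+s. indicator {t<..} s * ennreal (l * exp (- l * (s - t))) \<partial>lborel)"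
    by (intro nn_integral_cong)
       (use True in \<open>auto simp: indicator_def HT survivor_eq(2)[OF H H01 HT]\<close>)
  then show ?thesis
    using True nn_integral_exp_cutoff[OF l, of t t] by (simp add: survivor_eq(2)[OF H H01 HT])
next
  case False
  then have tT: "t < T" by simp
  \<comment> \<open>With this measure the exponents of the gap density and of
    \<open>survivor\<close> combine to the constant \<open>c\<close> below, and what remains is the
    exponential of a tail of \<open>\<mu>\<close>.\<close>
  define \<mu> where "\<mu> = density lborel (\<lambda>s. ennreal (l * (indicator {t<..T} s * H s)))"
  have sets[simp]: "sets \<mu> = sets borel" by (simp add: \<mu>_def)
  have em: "emeasure \<mu> {s<..} = ennreal (l * (\<integral>u. indicator {s<..T} u * H u \<partial>lborel))" if "t \<le> s" for s
  proof -
    have int: "integrable lborel (\<lambda>u. indicator {s<..T} u * H u)"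
      by (rule Bochner_Integration.integrable_bound[OF integrable_real_indicator[of "{s<..T}"]])
         (use H01 in \<open>auto simp: indicator_def intro!: emeasure_bounded_finite[unfolded infinity_ennreal_def]\<close>)
    have "emeasure \<mu> {s<..} = (\<integral>\<^sup>+u. ennreal (l * (indicator {s<..T} u * H u)) \<partial>lborel)"
      unfolding \<mu>_def by (subst emeasure_density)
        (use that in \<open>auto intro!: nn_integral_cong simp: indicator_def\<close>)
    also have "\<dots> = ennreal (\<integral>u. l * (indicator {s<..T} u * H u) \<partial>lborel)"
      by (rule nn_integral_eq_integral) (use int l H01 in \<open>auto simp: indicator_def\<close>)
    finally show ?thesis by simp
  qed
  have fin: "finite_measure \<mu>"
  proof
    have "emeasure \<mu> (space \<mu>) = emeasure \<mu> {t<..}"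
      unfolding \<mu>_def by (subst (1 2) emeasure_density)
        (auto intro!: nn_integral_cong simp: indicator_def)
    then show "emeasure \<mu> (space \<mu>) \<noteq> \<infinity>" by (simp add: em)
  qed
  interpret finite_measure \<mu> by fact
  have nn: "0 \<le> (\<integral>u. indicator {s<..T} u * H u \<partial>lborel)" for s
    using H01 by (intro integral_nonneg_AE) (auto simp: indicator_def)
  have me: "measure \<mu> {s<..} = l * (\<integral>u. indicator {s<..T} u * H u \<partial>lborel)" if "t \<le> s" for s
    using em[OF that] l nn by (simp add: emeasure_eq_measure)
  have atomless: "emeasure \<mu> {x} = 0" for x
    unfolding \<mu>_def using AE_lborel_singleton[of x]
    by (subst emeasure_density) (auto intro!: nn_integral_zero' elim!: eventually_mono simp: indicator_def)
  have m[measurable]: "(\<lambda>s. measure \<mu> {s<..}) \<in> borel_measurable borel"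
    using measurable_emeasure_greaterThan(1)[OF sets fin] unfolding measure_def by measurable
  have surv: "survivor l H s = exp (- l * (T - s) + measure \<mu> {s<..})" if "t \<le> s" "s \<le> T" for s
    using survivor_eq(1)[OF H H01 HT that(2)] me[OF that(1)] by simp
  define c where "c = ennreal (exp (- l * (T - t)))"
  have A: "(\<integral>\<^sup>+s. indicator {t<..T} s * ennreal (l * exp (- l * (s - t)) * H s) * ennreal (survivor l H s) \<partial>lborel)
    = c * (\<integral>\<^sup>+s. indicator {t<..} s * ennreal (exp (measure \<mu> {s<..})) \<partial>\<mu>)"
  proof -
    have "(\<integral>\<^sup>+s. indicator {t<..} s * ennreal (exp (measure \<mu> {s<..})) \<partial>\<mu>)
      = (\<integral>\<^sup>+s. ennreal (l * (indicator {t<..T} s * H s)) * (indicator {t<..} s * ennreal (exp (measure \<mu> {s<..}))) \<partial>lborel)"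
      unfolding \<mu>_def by (subst nn_integral_density) (auto simp: \<mu>_def[symmetric])
    then have "c * (\<integral>\<^sup>+s. indicator {t<..} s * ennreal (exp (measure \<mu> {s<..})) \<partial>\<mu>)
       = (\<integral>\<^sup>+s. c * (ennreal (l * (indicator {t<..T} s * H s)) * (indicator {t<..} s * ennreal (exp (measure \<mu> {s<..})))) \<partial>lborel)"
      by (simp add: nn_integral_cmult)
    also have "\<dots> = (\<integral>\<^sup>+s. indicator {t<..T} s * ennreal (l * exp (- l * (s - t)) * H s) * ennreal (survivor l H s) \<partial>lborel)"
    proof (intro nn_integral_cong)
      fix s
      show "c * (ennreal (l * (indicator {t<..T} s * H s)) * (indicator {t<..} s * ennreal (exp (measure \<mu> {s<..}))))
        = indicator {t<..T} s * ennreal (l * exp (- l * (s - t)) * H s) * ennreal (survivor l H s)"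
      proof (cases "s \<in> {t<..T}")
        case True
        have "exp (- l * (T - t)) * (l * H s * exp (measure \<mu> {s<..})) = l * exp (- l * (s - t)) * H s * survivor l H s"
          using True by (simp add: surv exp_add[symmetric] mult_ac exp_diff exp_minus field_simps)
        then show ?thesis using True l H01
          by (simp add: c_def ennreal_mult[symmetric] survivor_def)
      qed auto
    qed
    finally show ?thesis ..
  qed
  have "?L t = (\<integral>\<^sup>+s. indicator {t<..T} s * ennreal (l * exp (- l * (s - t)) * H s) * ennreal (survivor l H s)
      + indicator {T<..} s * ennreal (l * exp (- l * (s - t))) \<partial>lborel)"
    by (intro nn_integral_cong)
       (use tT in \<open>auto simp: indicator_def HT survivor_eq(2)[OF H H01 HT]\<close>)
  also have "\<dots> = (\<integral>\<^sup>+s. indicator {t<..T} s * ennreal (l * exp (- l * (s - t)) * H s) * ennreal (survivor l H s) \<partial>lborel)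
      + (\<integral>\<^sup>+s. indicator {T<..} s * ennreal (l * exp (- l * (s - t))) \<partial>lborel)"
  proof (rule nn_integral_add)
    have "(\<lambda>s. indicator {t<..T} s * ennreal (l * exp (- l * (s - t)) * H s) * ennreal (survivor l H s))
      = (\<lambda>s. indicator {t<..T} s * ennreal (l * exp (- l * (s - t)) * H s) * ennreal (exp (- l * (T - s) + measure \<mu> {s<..})))"
      by (auto simp: fun_eq_iff indicator_def surv)
    then show "(\<lambda>s. indicator {t<..T} s * ennreal (l * exp (- l * (s - t)) * H s) * ennreal (survivor l H s))
      \<in> borel_measurable lborel"
      by simp
  qed simp
  also have "\<dots> = c * (1 + (\<integral>\<^sup>+s. indicator {t<..} s * ennreal (exp (measure \<mu> {s<..})) \<partial>\<mu>))"
    unfolding A nn_integral_exp_cutoff[OF l] c_def by (simp add: distrib_left add.commute)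
  also have "\<dots> = ennreal (survivor l H t)"
    unfolding nn_integral_exp_tail[OF sets fin atomless]
    using tT by (simp add: c_def surv ennreal_mult[symmetric] exp_add[symmetric])
  finally show ?thesis .
qed

primrec picard :: "real \<Rightarrow> (real \<Rightarrow> real) \<Rightarrow> nat \<Rightarrow> real \<Rightarrow> ennreal" where
  "picard l H 0 t = 1"
| "picard l H (Suc k) t
     = (\<integral>\<^sup>+s. indicator {t<..} s * ennreal (l * exp (- l * (s - t)) * H s) * picard l H k s \<partial>lborel)"

lemma picard_measurable[measurable]:
  assumes H[measurable]: "H \<in> borel_measurable borel"
  shows "picard l H k \<in> borel_measurable borel"
proof (induction k)
  case (Suc k)
  note [measurable] = Suc
  have "{p \<in> space (borel \<Otimes>\<^sub>M borel). fst p < (snd p :: real)} \<in> sets (borel \<Otimes>\<^sub>M borel)"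
    by measurable
  then have [measurable]: "Measurable.pred (borel \<Otimes>\<^sub>M borel) (\<lambda>(x :: real, y). x < y)" by (simp add: split_beta')
  have "(\<lambda>(t, s). indicator {t<..} s * ennreal (l * exp (- l * (s - t)) * H s) * picard l H k s)
     = (\<lambda>(t, s). (if t < s then 1 else 0) * ennreal (l * exp (- l * (s - t)) * H s) * picard l H k s)"
    by (auto simp: fun_eq_iff)
  also have "\<dots> \<in> borel_measurable (borel \<Otimes>\<^sub>M lborel)"
    by measurable
  finally show ?case
    by (simp add: lborel.borel_measurable_nn_integral)
qed (simp add: picard.simps(1)[abs_def])

text \<open>The kernel is monotone and fixes \<open>survivor\<close>, so the lower bound persists
  from the initial value 1. Beyond \<open>T\<close> the kernel has total mass 1 and does not
  contract in the supremum norm; the weight \<open>exp (T - t)\<close> repairs this.\<close>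

lemma picard_bounds:
  fixes H :: "real \<Rightarrow> real"
  assumes l: "0 < l" and H[measurable]: "H \<in> borel_measurable borel"
    and H01: "\<And>s. 0 \<le> H s" "\<And>s. H s \<le> 1" and HT: "\<And>s. T < s \<Longrightarrow> H s = 1"
  shows "ennreal (survivor l H t) \<le> picard l H k t"
    and "picard l H k t \<le> ennreal (survivor l H t) + ennreal (exp (T - t) * (l / (l + 1)) ^ k)"
proof (induction k arbitrary: t)
  case 0
  case 1
  show ?case using survivor_le_1[of l H t] l H01 by (simp add: ennreal_le_1)
next
  case 0
  case 2
  show ?case
  proof (cases "T \<le> t")
    case True
    then show ?thesis by (simp add: survivor_eq(2)[OF H H01 HT])
  next
    case False
    then have "1 \<le> ennreal (exp (T - t))" by (simp add: ennreal_1[symmetric] del: ennreal_1)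
    then show ?thesis by (simp add: add_increasing)
  qed
next
  case (Suc k)
  {
    case 1
    have "ennreal (survivor l H t)
      = (\<integral>\<^sup>+s. indicator {t<..} s * ennreal (l * exp (- l * (s - t)) * H s) * ennreal (survivor l H s) \<partial>lborel)"
      by (rule survivor_fixed_point[OF l H H01 HT, symmetric])
    also have "\<dots> \<le> picard l H (Suc k) t"
      unfolding picard.simps by (intro nn_integral_mono mult_left_mono Suc.IH(1)) simp_all
    finally show ?case .
  next
    case 2
    let ?k = "\<lambda>s. indicator {t<..} s * ennreal (l * exp (- l * (s - t)) * H s)"
    let ?r = "(l / (l + 1)) ^ k"
    \<comment> \<open>\<open>exp (T - s)\<close> is an eigenfunction of the kernel with
      \<open>H = 1\<close>: the gap then has density of rate \<open>l + 1\<close> up to the factor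
      \<open>l / (l + 1)\<close>.\<close>
    have eq: "(\<integral>\<^sup>+s. indicator {t<..} s * ennreal (l * exp (- l * (s - t))) * ennreal (exp (T - s) * ?r) \<partial>lborel)
       = ennreal (exp (T - t) * (l / (l + 1)) ^ Suc k)"
    proof -
      have "(\<integral>\<^sup>+s. indicator {t<..} s * ennreal (l * exp (- l * (s - t))) * ennreal (exp (T - s) * ?r) \<partial>lborel)
         = (\<integral>\<^sup>+s. ennreal (exp (T - t) * (l / (l + 1)) ^ Suc k)
             * (indicator {t<..} s * ennreal ((l + 1) * exp (- (l + 1) * (s - t)))) \<partial>lborel)"
      proof (intro nn_integral_cong)
        fix s
        have "l * exp (- l * (s - t)) * (exp (T - s) * ?r)
          = exp (T - t) * (l / (l + 1)) ^ Suc k * ((l + 1) * exp (- (l + 1) * (s - t)))"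
        proof -
          have e: "exp (- l * (s - t)) * exp (T - s) = exp (T - t) * exp (- (l + 1) * (s - t))"
            by (simp add: exp_add[symmetric] algebra_simps)
          have "l * exp (- l * (s - t)) * (exp (T - s) * ?r) = (exp (- l * (s - t)) * exp (T - s)) * (l * ?r)"
            by simp
          also have "l * ?r = (l / (l + 1)) ^ Suc k * (l + 1)"
            using l by simp
          finally show ?thesis unfolding e by (simp only: mult_ac)
        qed
        then show "indicator {t<..} s * ennreal (l * exp (- l * (s - t))) * ennreal (exp (T - s) * ?r)
          = ennreal (exp (T - t) * (l / (l + 1)) ^ Suc k)
             * (indicator {t<..} s * ennreal ((l + 1) * exp (- (l + 1) * (s - t))))"
          using l by (simp add: indicator_def ennreal_mult[symmetric] del: power_Suc)
      qed
      also have "\<dots> = ennreal (exp (T - t) * (l / (l + 1)) ^ Suc k)"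
        by (subst nn_integral_cmult, simp, subst nn_integral_exp_cutoff) (use l in auto)
      finally show ?thesis .
    qed
    have Sm: "(\<lambda>s. survivor l H s) \<in> borel_measurable borel"
    proof -
      have "{p \<in> space (borel \<Otimes>\<^sub>M borel). fst p < (snd p :: real)} \<in> sets (borel \<Otimes>\<^sub>M borel)"
        by measurable
      then have [measurable]: "Measurable.pred (borel \<Otimes>\<^sub>M borel) (\<lambda>(x :: real, y). x < y)" by (simp add: split_beta')
      have "(\<lambda>(t, s). indicator {t<..} s * (1 - H s)) = (\<lambda>(t, s). (if t < s then 1 else 0) * (1 - H s))"
        by (auto simp: fun_eq_iff)
      also have "\<dots> \<in> borel_measurable (borel \<Otimes>\<^sub>M lborel)" by measurable
      finally have "(\<lambda>t. \<integral>s. indicator {t<..} s * (1 - H s) \<partial>lborel) \<in> borel_measurable borel"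
        by (rule lborel.borel_measurable_lebesgue_integral)
      then show ?thesis unfolding survivor_def[abs_def] by measurable
    qed
    have "picard l H (Suc k) t \<le> (\<integral>\<^sup>+s. ?k s * (ennreal (survivor l H s) + ennreal (exp (T - s) * ?r)) \<partial>lborel)"
      unfolding picard.simps by (intro nn_integral_mono mult_left_mono Suc.IH(2)) simp_all
    also have "\<dots> = (\<integral>\<^sup>+s. ?k s * ennreal (survivor l H s) \<partial>lborel) + (\<integral>\<^sup>+s. ?k s * ennreal (exp (T - s) * ?r) \<partial>lborel)"
      unfolding distrib_left by (rule nn_integral_add) (use Sm in measurable)
    also have "\<dots> \<le> ennreal (survivor l H t) + ennreal (exp (T - t) * (l / (l + 1)) ^ Suc k)"
    proof (intro add_mono)
      show "(\<integral>\<^sup>+s. ?k s * ennreal (survivor l H s) \<partial>lborel) \<le> ennreal (survivor l H t)"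
        by (rule eq_refl[OF survivor_fixed_point[OF l H H01 HT]])
      show "(\<integral>\<^sup>+s. ?k s * ennreal (exp (T - s) * ?r) \<partial>lborel) \<le> ennreal (exp (T - t) * (l / (l + 1)) ^ Suc k)"
        unfolding eq[symmetric]
        by (intro nn_integral_mono mult_right_mono mult_left_mono ennreal_leI)
           (use l H01 in \<open>auto simp: mult_left_le\<close>)
    qed
    finally show ?case .
  }
qed

lemma picard_tendsto:
  fixes H :: "real \<Rightarrow> real"
  assumes l: "0 < l" and H: "H \<in> borel_measurable borel"
    and H01: "\<And>s. 0 \<le> H s" "\<And>s. H s \<le> 1" and HT: "\<And>s. T < s \<Longrightarrow> H s = 1"
  shows "(\<lambda>k. picard l H k t) \<longlonglongrightarrow> ennreal (survivor l H t)"
proof (rule tendsto_sandwich[where f = "\<lambda>_. ennreal (survivor l H t)"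
      and h = "\<lambda>k. ennreal (survivor l H t) + ennreal (exp (T - t) * (l / (l + 1)) ^ k)"])
  have "(\<lambda>k. survivor l H t + exp (T - t) * (l / (l + 1)) ^ k) \<longlonglongrightarrow> survivor l H t + exp (T - t) * 0"
    using l by (intro tendsto_intros LIMSEQ_realpow_zero) auto
  then have "(\<lambda>k. ennreal (survivor l H t + exp (T - t) * (l / (l + 1)) ^ k)) \<longlonglongrightarrow> ennreal (survivor l H t)"
    by (intro tendsto_ennrealI) simp
  then show "(\<lambda>k. ennreal (survivor l H t) + ennreal (exp (T - t) * (l / (l + 1)) ^ k)) \<longlonglongrightarrow> ennreal (survivor l H t)"
    using l by (simp add: ennreal_plus[symmetric] survivor_def del: ennreal_plus)
qed (auto intro!: always_eventually picard_bounds[OF assms])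

text \<open>Split the first customer off the i.i.d. sequence; the rest is the same problem started
  at \<open>t + gap\<close>, hence the free \<open>t\<close>. The law of the marks enters only
  through \<open>disintegration\<close>, so that one proof serves both arrivals with marks and plain
  retrial processes.\<close>

lemma nn_integral_marked_points_eq_picard:
  fixes K :: "'k measure" and gap :: "'k \<Rightarrow> real" and h :: "real \<Rightarrow> 'k \<Rightarrow> real"
  assumes K: "prob_space K" and [measurable]: "gap \<in> borel_measurable K"
    and h[measurable]: "case_prod h \<in> borel_measurable (borel \<Otimes>\<^sub>M K)"
    and H[measurable]: "H \<in> borel_measurable borel"
    and disintegration: "\<And>t \<phi>. \<phi> \<in> borel_measurable borel \<Longrightarrow>
      (\<integral>\<^sup>+\<kappa>. ennreal (h (t + gap \<kappa>) \<kappa>) * \<phi> (t + gap \<kappa>) \<partial>K)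
        = (\<integral>\<^sup>+s. indicator {t<..} s * ennreal (l * exp (- l * (s - t)) * H s) * \<phi> s \<partial>lborel)"
  shows "(\<integral>\<^sup>+\<omega>. (\<Prod>n<k. ennreal (h (t + (\<Sum>i\<le>n. gap (\<omega> i))) (\<omega> n))) \<partial>PiM UNIV (\<lambda>_ :: nat. K)) = picard l H k t"
proof (induction k arbitrary: t)
  interpret K: prob_space K by fact
  interpret sequence_space K ..
  case 0
  show ?case by (simp add: emeasure_space_1)
next
  interpret K: prob_space K by fact
  interpret sequence_space K ..
  case (Suc k)
  have comp[measurable]: "(\<lambda>\<omega>. \<omega> i) \<in> measurable S K" for i
    by simp
  have m: "(\<lambda>\<omega>. (\<Prod>n<j. ennreal (h (t + (\<Sum>i\<le>n. gap (\<omega> i))) (\<omega> n)))) \<in> borel_measurable S" for j t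
    by measurable
  have cn: "(\<lambda>(s, \<omega>). case_nat s \<omega>) \<in> measurable (K \<Otimes>\<^sub>M S) S"
    by measurable
  have sh: "(\<Sum>i\<le>Suc n. gap (case i of 0 \<Rightarrow> s | Suc x \<Rightarrow> \<omega> x)) = gap s + (\<Sum>i\<le>n. gap (\<omega> i))" for s \<omega> n
    by (subst sum.atMost_Suc_shift) simp
  have "(\<integral>\<^sup>+\<omega>. (\<Prod>n<Suc k. ennreal (h (t + (\<Sum>i\<le>n. gap (\<omega> i))) (\<omega> n))) \<partial>S)
    = (\<integral>\<^sup>+\<omega>. (\<Prod>n<Suc k. ennreal (h (t + (\<Sum>i\<le>n. gap (\<omega> i))) (\<omega> n))) \<partial>distr (K \<Otimes>\<^sub>M S) S (\<lambda>(s, \<omega>). case_nat s \<omega>))"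
    by (simp only: PiM_iter)
  also have "\<dots> = (\<integral>\<^sup>+p. (case p of (s, \<omega>) \<Rightarrow> ennreal (h (t + gap s) s) *
       (\<Prod>n<k. ennreal (h ((t + gap s) + (\<Sum>i\<le>n. gap (\<omega> i))) (\<omega> n)))) \<partial>(K \<Otimes>\<^sub>M S))"
    by (subst nn_integral_distr[OF cn])
       (auto intro!: nn_integral_cong simp: m prod.lessThan_Suc_shift sh add.assoc simp del: sum.atMost_Suc prod.lessThan_Suc)
  also have "\<dots> = (\<integral>\<^sup>+s. \<integral>\<^sup>+\<omega>. ennreal (h (t + gap s) s) *
       (\<Prod>n<k. ennreal (h ((t + gap s) + (\<Sum>i\<le>n. gap (\<omega> i))) (\<omega> n))) \<partial>S \<partial>K)"
    by (subst P.nn_integral_fst[symmetric]) simp_all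
  also have "\<dots> = (\<integral>\<^sup>+s. ennreal (h (t + gap s) s) * picard l H k (t + gap s) \<partial>K)"
    by (intro nn_integral_cong, subst nn_integral_cmult[OF m]) (simp add: Suc)
  also have "\<dots> = picard l H (Suc k) t"
    by (subst disintegration) simp_all
  finally show ?case .
qed

section \<open>Marked Poisson points: Laplace functional and void probabilities\<close>

definition exp_law :: "real \<Rightarrow> real measure" where
  "exp_law l = density lborel (\<lambda>x. ennreal (exponential_density l x))"

lemma sets_exp_law[measurable_cong, simp]: "sets (exp_law l) = sets borel"
  and space_exp_law[simp]: "space (exp_law l) = UNIV"
  by (simp_all add: exp_law_def)

lemma prob_space_exp_law: "0 < l \<Longrightarrow> prob_space (exp_law l)"
  unfolding exp_law_def by (rule prob_space_exponential_density)

lemma nn_integral_exp_law_shift: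
  assumes l: "0 < l" and [measurable]: "f \<in> borel_measurable borel"
  shows "(\<integral>\<^sup>+x. f (t + x) \<partial>exp_law l) = (\<integral>\<^sup>+s. indicator {t<..} s * ennreal (l * exp (- l * (s - t))) * f s \<partial>lborel)"
proof -
  have "(\<integral>\<^sup>+x. f (t + x) \<partial>exp_law l) = (\<integral>\<^sup>+x. ennreal (exponential_density l x) * f (t + x) \<partial>lborel)"
    unfolding exp_law_def by (subst nn_integral_density) auto
  also have "\<dots> = (\<integral>\<^sup>+x. ennreal (exponential_density l (- t + 1 * x)) * f (t + (- t + 1 * x)) \<partial>lborel)"
    by (subst nn_integral_real_affine[where c = 1 and t = "- t"]) auto
  also have "\<dots> = (\<integral>\<^sup>+s. indicator {t<..} s * ennreal (l * exp (- l * (s - t))) * f s \<partial>lborel)"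
    using AE_lborel_singleton[of t]
    by (intro nn_integral_cong_AE)
       (auto elim!: eventually_mono simp: exponential_density_def indicator_def algebra_simps)
  finally show ?thesis .
qed

text \<open>The mark of a point is independent of its position, so each point contributes the mark
  average of \<open>h\<close>; the products over the first \<open>k\<close> points are then Picard
  iterates.\<close>

lemma marked_points_laplace:
  fixes N :: "'m measure" and h :: "real \<Rightarrow> 'm \<Rightarrow> real"
  assumes N: "prob_space N" and l: "0 < l"
    and h[measurable]: "case_prod h \<in> borel_measurable (borel \<Otimes>\<^sub>M N)"
    and h01: "\<And>s r. 0 \<le> h s r" "\<And>s r. h s r \<le> 1" and hT: "\<And>s. T < s \<Longrightarrow> (\<integral>r. h s r \<partial>N) = 1"
  shows "(\<lambda>k. \<integral>\<^sup>+\<omega>. (\<Prod>n<k. ennreal (h (\<Sum>i\<le>n. fst (\<omega> i)) (snd (\<omega> n))))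
      \<partial>PiM UNIV (\<lambda>_ :: nat. exp_law l \<Otimes>\<^sub>M N))
    \<longlonglongrightarrow> ennreal (survivor l (\<lambda>s. \<integral>r. h s r \<partial>N) 0)"
proof -
  interpret N: prob_space N by fact
  interpret E: prob_space "exp_law l" by (rule prob_space_exp_law[OF l])
  interpret EN: pair_prob_space "exp_law l" N ..
  define H where "H s = (\<integral>r. h s r \<partial>N)" for s
  have H[measurable]: "H \<in> borel_measurable borel"
    unfolding H_def[abs_def] by measurable
  have hm: "h s \<in> borel_measurable N" for s by measurable
  have int: "integrable N (h s)" for s
    by (rule N.integrable_const_bound[where B = 1]) (use h01 hm in auto)
  have H01: "0 \<le> H s" "H s \<le> 1" for s
    unfolding H_def using h01 int by (auto intro!: integral_nonneg_AE N.integral_le_const)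
  have HT: "H s = 1" if "T < s" for s
    using hT[OF that] by (simp add: H_def)
  have nnH: "(\<integral>\<^sup>+r. ennreal (h s r) \<partial>N) = ennreal (H s)" for s
    unfolding H_def by (rule nn_integral_eq_integral[OF int]) (use h01 in auto)
  have "(\<integral>\<^sup>+\<omega>. (\<Prod>n<k. ennreal ((\<lambda>s \<kappa>. h s (snd \<kappa>)) (0 + (\<Sum>i\<le>n. fst (\<omega> i))) (\<omega> n)))
      \<partial>PiM UNIV (\<lambda>_ :: nat. exp_law l \<Otimes>\<^sub>M N)) = picard l H k 0" for k
  proof (rule nn_integral_marked_points_eq_picard)
    show "prob_space (exp_law l \<Otimes>\<^sub>M N)" by (rule EN.P.prob_space_axioms)
    show "H \<in> borel_measurable borel" by fact
    fix t and \<phi> :: "real \<Rightarrow> ennreal" assume [measurable]: "\<phi> \<in> borel_measurable borel"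
    have "(\<integral>\<^sup>+\<kappa>. ennreal (h (t + fst \<kappa>) (snd \<kappa>)) * \<phi> (t + fst \<kappa>) \<partial>(exp_law l \<Otimes>\<^sub>M N))
      = (\<integral>\<^sup>+x. \<integral>\<^sup>+r. ennreal (h (t + x) r) * \<phi> (t + x) \<partial>N \<partial>exp_law l)"
      by (subst N.nn_integral_fst[symmetric]) auto
    also have "\<dots> = (\<integral>\<^sup>+x. ennreal (H (t + x)) * \<phi> (t + x) \<partial>exp_law l)"
      by (intro nn_integral_cong, subst nn_integral_multc) (simp_all add: nnH)
    also have "\<dots> = (\<integral>\<^sup>+s. indicator {t<..} s * ennreal (l * exp (- l * (s - t))) * (ennreal (H s) * \<phi> s) \<partial>lborel)"
      by (rule nn_integral_exp_law_shift[OF l]) simp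
    also have "\<dots> = (\<integral>\<^sup>+s. indicator {t<..} s * ennreal (l * exp (- l * (s - t)) * H s) * \<phi> s \<partial>lborel)"
      using l H01 by (intro nn_integral_cong) (auto simp: ennreal_mult mult_ac)
    finally show "(\<integral>\<^sup>+\<kappa>. ennreal (h (t + fst \<kappa>) (snd \<kappa>)) * \<phi> (t + fst \<kappa>) \<partial>(exp_law l \<Otimes>\<^sub>M N))
      = (\<integral>\<^sup>+s. indicator {t<..} s * ennreal (l * exp (- l * (s - t)) * H s) * \<phi> s \<partial>lborel)" .
  qed simp_all
  then have eq: "(\<integral>\<^sup>+\<omega>. (\<Prod>n<k. ennreal (h (\<Sum>i\<le>n. fst (\<omega> i)) (snd (\<omega> n))))
      \<partial>PiM UNIV (\<lambda>_ :: nat. exp_law l \<Otimes>\<^sub>M N)) = picard l H k 0" for k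
    by simp
  show ?thesis
    unfolding eq H_def[symmetric] by (rule picard_tendsto[OF l H H01 HT])
qed

text \<open>With \<open>H\<close> the indicator of the complement of \<open>A\<close>, the product
  of the factors is the indicator that no point so far hits \<open>A\<close>. Boundedness of
  \<open>A\<close> from above makes \<open>H = 1\<close> eventually.\<close>

lemma void_probability:
  assumes l: "0 < l" and A[measurable]: "A \<in> sets borel" and AT: "A \<subseteq> {..T}"
  shows "measure (PiM UNIV (\<lambda>_ :: nat. exp_law l)) {r. \<forall>n. t + (\<Sum>i\<le>n. r i) \<notin> A}
    = exp (- l * measure lborel ({t<..} \<inter> A))"
proof -
  interpret E: prob_space "exp_law l" by (rule prob_space_exp_law[OF l])
  interpret sequence_space "exp_law l" ..
  define H :: "real \<Rightarrow> real" where "H = indicator (- A)"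
  have H[measurable]: "H \<in> borel_measurable borel" by (simp add: H_def)
  have sp[simp]: "space S = UNIV" by (simp add: space_PiM)
  have [measurable]: "(\<lambda>\<omega>. \<omega> i) \<in> measurable S borel" for i
    using measurable_component_singleton[of i UNIV "\<lambda>_. exp_law l"] by simp
  have "(\<integral>\<^sup>+\<omega>. (\<Prod>n<k. ennreal (H (t + (\<Sum>i\<le>n. id (\<omega> i))))) \<partial>S) = picard l H k t" for k
  proof (rule nn_integral_marked_points_eq_picard[where h = "\<lambda>s _. H s"])
    fix t and \<phi> :: "real \<Rightarrow> ennreal" assume [measurable]: "\<phi> \<in> borel_measurable borel"
    have "(\<integral>\<^sup>+\<kappa>. ennreal (H (t + id \<kappa>)) * \<phi> (t + id \<kappa>) \<partial>exp_law l)
      = (\<integral>\<^sup>+s. indicator {t<..} s * ennreal (l * exp (- l * (s - t))) * (ennreal (H s) * \<phi> s) \<partial>lborel)"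
      unfolding id_apply by (rule nn_integral_exp_law_shift[OF l]) simp
    also have "\<dots> = (\<integral>\<^sup>+s. indicator {t<..} s * ennreal (l * exp (- l * (s - t)) * H s) * \<phi> s \<partial>lborel)"
      using l by (intro nn_integral_cong) (auto simp: ennreal_mult mult_ac H_def)
    finally show "(\<integral>\<^sup>+\<kappa>. ennreal (H (t + id \<kappa>)) * \<phi> (t + id \<kappa>) \<partial>exp_law l)
      = (\<integral>\<^sup>+s. indicator {t<..} s * ennreal (l * exp (- l * (s - t)) * H s) * \<phi> s \<partial>lborel)" .
  qed (simp_all add: E.prob_space_axioms measurable_ident_sets)
  then have eq: "(\<integral>\<^sup>+\<omega>. (\<Prod>n<k. ennreal (H (t + (\<Sum>i\<le>n. \<omega> i)))) \<partial>S) = picard l H k t" for k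
    by simp
  have lim1: "(\<lambda>k. picard l H k t) \<longlonglongrightarrow> ennreal (survivor l H t)"
    by (rule picard_tendsto[OF l H, where T = T]) (use AT in \<open>auto simp: H_def indicator_def\<close>)
  let ?V = "{r. \<forall>n. t + (\<Sum>i\<le>n. r i) \<notin> A}"
  have [measurable]: "?V \<in> sets S"
  proof -
    have "{r \<in> space S. \<forall>n. t + (\<Sum>i\<le>n. r i) \<notin> A} \<in> sets S" by measurable
    then show ?thesis by simp
  qed
  have "(\<lambda>k. \<integral>\<^sup>+\<omega>. (\<Prod>n<k. ennreal (H (t + (\<Sum>i\<le>n. \<omega> i)))) \<partial>S) \<longlonglongrightarrow> (\<integral>\<^sup>+\<omega>. indicator ?V \<omega> \<partial>S)"
  proof (rule nn_integral_dominated_convergence[where w = "\<lambda>_. 1"])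
    show "(\<integral>\<^sup>+x. 1 \<partial>S) < \<infinity>" using emeasure_space_1 by (simp del: sp)
    have le1: "ennreal (H x) \<le> 1" for x by (simp add: H_def indicator_def)
    show "AE x in S. (\<Prod>n<j. ennreal (H (t + (\<Sum>i\<le>n. x i)))) \<le> 1" for j
      by (auto intro!: prod_le_1 le1)
    show "AE x in S. (\<lambda>k. \<Prod>n<k. ennreal (H (t + (\<Sum>i\<le>n. x i)))) \<longlonglongrightarrow> indicator ?V x"
    proof (intro AE_I2)
      fix x
      show "(\<lambda>k. \<Prod>n<k. ennreal (H (t + (\<Sum>i\<le>n. x i)))) \<longlonglongrightarrow> indicator ?V x"
      proof (cases "x \<in> ?V")
        case True
        then show ?thesis by (simp add: H_def)
      next
        case False
        then obtain n where n: "t + (\<Sum>i\<le>n. x i) \<in> A" by auto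
        have "\<forall>\<^sub>F k in sequentially. (\<Prod>n<k. ennreal (H (t + (\<Sum>i\<le>n. x i)))) = 0"
          using eventually_gt_at_top[of n]
          by eventually_elim (use n in \<open>auto simp: H_def intro!: bexI[of _ n]\<close>)
        then show ?thesis using False by (simp add: tendsto_eventually)
      qed
    qed
  qed measurable
  then have "ennreal (survivor l H t) = emeasure S ?V"
    using lim1 unfolding eq by (intro LIMSEQ_unique[OF lim1]) simp
  also have "emeasure S ?V = ennreal (measure S ?V)" by (simp add: emeasure_eq_measure)
  finally have "measure S ?V = survivor l H t" by (simp add: survivor_def)
  also have "(\<integral>s. indicator {t<..} s * (1 - H s) \<partial>lborel) = (\<integral>s. indicator ({t<..} \<inter> A) s \<partial>lborel)"
    by (intro Bochner_Integration.integral_cong) (auto simp: H_def indicator_def)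
  then have "survivor l H t = exp (- l * measure lborel ({t<..} \<inter> A))"
    by (simp add: survivor_def)
  finally show ?thesis .
qed

section \<open>Poisson thinning at given server epochs\<close>

text \<open>For one type of customers: \<open>t l\<close> is the start of the glue period \<open>l\<close>, of length \<open>g\<close>, which is used by
  this type iff \<open>own l\<close>.\<close>

locale glue_windows =
  fixes t :: "nat \<Rightarrow> real" and own :: "nat \<Rightarrow> bool" and g nu :: real
  assumes g_pos: "0 < g" and nu_pos: "0 < nu" and t_0: "0 \<le> t 0"
    and t_Suc: "t l + (if own l then g else 0) \<le> t (Suc l)"
begin

definition window :: "nat \<Rightarrow> real set" where
  "window l = {u. \<exists>l'<l. own l' \<and> t l' \<le> u \<and> u < t l' + g}"

text \<open>The empty sum at \<open>k = 0\<close> is the arrival itself, so a customer who arrives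
  during a glue period counts as caught.\<close>

definition missed :: "nat \<Rightarrow> real \<Rightarrow> (nat \<Rightarrow> real) \<Rightarrow> bool" where
  "missed l a r \<longleftrightarrow> (\<forall>k. a + (\<Sum>i<k. r i) \<notin> window l)"

definition miss_prob :: "nat \<Rightarrow> real \<Rightarrow> real" where
  "miss_prob l a = measure (PiM UNIV (\<lambda>_ :: nat. exp_law nu)) {r. missed l a r}"

lemma t_mono: "l \<le> l' \<Longrightarrow> t l \<le> t l'"
proof (induction l' rule: dec_induct)
  case (step n)
  then show ?case using t_Suc[of n] g_pos by (auto split: if_splits)
qed simp

lemma t_nonneg: "0 \<le> t l"
  using t_mono[of 0 l] t_0 by simp

lemma window_le: "window l \<subseteq> {..<t l}"
proof
  fix u assume "u \<in> window l"
  then obtain l' where "l' < l" "own l'" "u < t l' + g" by (auto simp: window_def)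
  then show "u \<in> {..<t l}"
    using t_Suc[of l'] t_mono[of "Suc l'" l] by auto
qed

lemma window_0[simp]: "window 0 = {}" by (simp add: window_def)

lemma window_Suc: "window (Suc l) = (if own l then window l \<union> {t l..<t l + g} else window l)"
  by (auto simp: window_def less_Suc_eq)

lemma window_meas[measurable]: "window l \<in> sets borel"
  by (induction l) (auto simp: window_Suc)

lemma missed_measurable[measurable]:
  "Measurable.pred (borel \<Otimes>\<^sub>M PiM UNIV (\<lambda>_ :: nat. borel)) (\<lambda>(a, r). missed l a r)"
  unfolding missed_def by measurable

text \<open>The attempt at \<open>a\<close> is deterministic; the retrials after it form a Poisson
  process of rate \<open>nu\<close>, which must avoid the part of the window beyond
  \<open>a\<close>.\<close>

lemma miss_prob_eq:
  "miss_prob l a = (if a \<in> window l then 0 else exp (- nu * measure lborel ({a<..} \<inter> window l)))"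
proof (cases "a \<in> window l")
  case True
  then have "\<not> missed l a r" for r
    unfolding missed_def by (auto intro!: exI[of _ "0::nat"])
  then show ?thesis using True by (simp add: miss_prob_def)
next
  case False
  have iff: "missed l a r \<longleftrightarrow> (\<forall>n. a + (\<Sum>i\<le>n. r i) \<notin> window l)" for r
  proof
    assume "missed l a r"
    then show "\<forall>n. a + (\<Sum>i\<le>n. r i) \<notin> window l"
      unfolding missed_def lessThan_Suc_atMost[symmetric] by blast
  next
    assume R: "\<forall>n. a + (\<Sum>i\<le>n. r i) \<notin> window l"
    show "missed l a r" unfolding missed_def
    proof
      fix k show "a + (\<Sum>i<k. r i) \<notin> window l"
        using R False by (cases k) (auto simp: lessThan_Suc_atMost)
    qed
  qed
  have "window l \<subseteq> {..t l}" using window_le[of l] by (auto dest: less_imp_le)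
  from void_probability[OF nu_pos window_meas this, of a] show ?thesis
    unfolding miss_prob_def iff using False by simp
qed

lemma miss_prob_measurable[measurable]: "miss_prob l \<in> borel_measurable borel"
proof -
  have "(\<lambda>a. enn2real (emeasure (density lborel (indicator (window l))) {a<..})) \<in> borel_measurable borel"
  proof (intro borel_measurable_enn2real measurable_emeasure_greaterThan(1))
    show "finite_measure (density lborel (indicator (window l)))"
    proof
      have "bounded (window l)"
      proof (rule bounded_subset)
        show "window l \<subseteq> {0..t l}"
          using window_le[of l] order_trans[OF t_nonneg] by (fastforce simp: window_def)
      qed simp
      then show "emeasure (density lborel (indicator (window l))) (space (density lborel (indicator (window l)))) \<noteq> \<infinity>"
        using emeasure_bounded_finite[of "window l"]
        by (subst emeasure_density) (auto simp: nn_integral_indicator[OF window_meas[unfolded sets_lborel[symmetric]]] less_top[symmetric])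
    qed
  qed simp
  moreover have "enn2real (emeasure (density lborel (indicator (window l))) {a<..}) = measure lborel ({a<..} \<inter> window l)" for a
    by (subst emeasure_density) (auto simp: measure_def indicator_inter_arith[symmetric] Int_commute nn_integral_indicator)
  ultimately have [measurable]: "(\<lambda>a. measure lborel ({a<..} \<inter> window l)) \<in> borel_measurable borel"
    by simp
  show ?thesis unfolding miss_prob_eq[abs_def] by measurable
qed

lemma miss_prob_0[simp]: "miss_prob 0 a = 1"
  by (simp add: miss_prob_eq)

lemma miss_prob_after: "t l \<le> a \<Longrightarrow> miss_prob l a = 1"
proof -
  assume "t l \<le> a"
  then have "a \<notin> window l" "{a<..} \<inter> window l = {}" using window_le[of l] by force+
  then show ?thesis by (simp add: miss_prob_eq)
qed

text \<open>Retrials in disjoint intervals are independent: one more window of length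
  \<open>g\<close> costs an earlier customer the factor \<open>exp (- nu * g)\<close>. Arrivals
  inside the window are caught, later ones do not meet it.\<close>

lemma miss_prob_Suc:
  "miss_prob (Suc l) a = (if \<not> own l then miss_prob l a
     else if a < t l then exp (- nu * g) * miss_prob l a else if a < t l + g then 0 else 1)"
proof (cases "own l")
  case own: True
  show ?thesis
  proof (cases "a < t l")
    case True
    have "{a<..} \<inter> window (Suc l) = ({a<..} \<inter> window l) \<union> {t l..<t l + g}"
      using own True by (auto simp: window_Suc)
    moreover have "measure lborel (({a<..} \<inter> window l) \<union> {t l..<t l + g})
      = measure lborel ({a<..} \<inter> window l) + measure lborel {t l..<t l + g}"
    proof (rule measure_Union)
      have "bounded ({a<..} \<inter> window l)"
        by (rule bounded_subset[of "{a..t l}"]) (use window_le[of l] in force)+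
      then show "emeasure lborel ({a<..} \<inter> window l) \<noteq> \<infinity>"
        using emeasure_bounded_finite[of "{a<..} \<inter> window l"] by (simp add: less_top)
      show "emeasure lborel {t l..<t l + g} \<noteq> \<infinity>" using g_pos by simp
      show "{a<..} \<inter> window l \<inter> {t l..<t l + g} = {}" using window_le[of l] by force
    qed simp_all
    ultimately show ?thesis using own True g_pos
      by (auto simp: miss_prob_eq window_Suc distrib_left exp_add[symmetric] algebra_simps)
  next
    case False
    show ?thesis
    proof (cases "a < t l + g")
      case True
      then show ?thesis using own False by (auto simp: miss_prob_eq window_Suc)
    next
      case F: False
      then have "t (Suc l) \<le> a \<or> ({a<..} \<inter> window (Suc l) = {} \<and> a \<notin> window (Suc l))"
        using own window_le[of l] False g_pos by (force simp: window_Suc)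
      then show ?thesis using miss_prob_after[of "Suc l" a] own False F
        by (auto simp: miss_prob_eq)
    qed
  qed
qed (simp add: miss_prob_eq window_Suc)

lemma miss_prob_bounds: "0 \<le> miss_prob l a" "miss_prob l a \<le> 1"
proof -
  have "0 \<le> miss_prob l a \<and> miss_prob l a \<le> 1"
  proof (induction l)
    case (Suc l)
    have "exp (- nu * g) * miss_prob l a \<le> 1 * 1"
      using Suc g_pos nu_pos by (intro mult_mono) auto
    then show ?case using Suc by (auto simp: miss_prob_Suc)
  qed simp
  then show "0 \<le> miss_prob l a" "miss_prob l a \<le> 1" by auto
qed

text \<open>Up to the factor \<open>lam\<close>, the mean number of customers arrived before \<open>T\<close> that no glue period before
  \<open>l\<close> has caught.\<close>

definition missed_mass :: "nat \<Rightarrow> real \<Rightarrow> real" where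
  "missed_mass l T = (\<integral>a. indicator {0<..T} a * miss_prob l a \<partial>lborel)"

lemma missed_mass_integrable: "integrable lborel (\<lambda>a. indicator {x<..T} a * miss_prob l a)"
  by (rule Bochner_Integration.integrable_bound[OF integrable_real_indicator[of "{x<..T}"]])
     (use miss_prob_bounds in \<open>auto simp: indicator_def intro!: emeasure_bounded_finite[unfolded infinity_ennreal_def]\<close>)

lemma missed_mass_0[simp]: "0 \<le> T \<Longrightarrow> missed_mass 0 T = T"
  by (simp add: missed_mass_def)

lemma missed_mass_split:
  assumes "0 \<le> s" "s \<le> T"
  shows "missed_mass l T = missed_mass l s + (\<integral>a. indicator {s<..T} a * miss_prob l a \<partial>lborel)"
proof -
  have "missed_mass l T = (\<integral>a. indicator {0<..s} a * miss_prob l a + indicator {s<..T} a * miss_prob l a \<partial>lborel)"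
    unfolding missed_mass_def
    by (intro Bochner_Integration.integral_cong) (use assms in \<open>auto simp: indicator_def\<close>)
  then show ?thesis
    by (simp add: missed_mass_def Bochner_Integration.integral_add[OF missed_mass_integrable missed_mass_integrable])
qed

lemma missed_mass_after:
  assumes "t l \<le> T"
  shows "missed_mass l T = missed_mass l (t l) + (T - t l)"
proof -
  have "(\<integral>a. indicator {t l<..T} a * miss_prob l a \<partial>lborel) = (\<integral>a. indicator {t l<..T} a \<partial>lborel)"
    by (intro Bochner_Integration.integral_cong) (auto simp: indicator_def miss_prob_after)
  then show ?thesis
    using missed_mass_split[OF t_nonneg assms, of l] assms by simp
qed

text \<open>The three ranges of \<open>miss_prob_Suc\<close> are integrated separately: the old mass
  is thinned, the window contributes nothing, and the arrivals after it accumulate at unit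
  rate.\<close>

lemma missed_mass_Suc:
  assumes "t l + (if own l then g else 0) \<le> T"
  shows "missed_mass (Suc l) T = (if own l then exp (- nu * g) * missed_mass l (t l) + (T - t l - g)
      else missed_mass l (t l) + (T - t l))"
proof (cases "own l")
  case True
  have tT: "t l \<le> T" using assms g_pos by (auto split: if_splits)
  have "missed_mass (Suc l) T = missed_mass (Suc l) (t l) + (\<integral>a. indicator {t l<..T} a * miss_prob (Suc l) a \<partial>lborel)"
    by (rule missed_mass_split[OF t_nonneg tT])
  also have "(\<integral>a. indicator {t l<..T} a * miss_prob (Suc l) a \<partial>lborel) = (\<integral>a. indicator {t l + g..T} a \<partial>lborel)"
    by (intro Bochner_Integration.integral_cong) (use True g_pos in \<open>auto simp: indicator_def miss_prob_Suc\<close>)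
  also have "\<dots> = T - t l - g" using assms True by simp
  also have "missed_mass (Suc l) (t l) = (\<integral>a. exp (- nu * g) * (indicator {0<..t l} a * miss_prob l a) \<partial>lborel)"
  proof -
    \<comment> \<open>The endpoint \<open>t l\<close> lies in the range of integration but already
      inside the new window; it is a null set.\<close>
    have "AE a in lborel. indicator {0<..t l} a * miss_prob (Suc l) a = exp (- nu * g) * (indicator {0<..t l} a * miss_prob l a)"
      using AE_lborel_singleton[of "t l"]
      by eventually_elim (use True in \<open>auto simp: miss_prob_Suc indicator_def\<close>)
    then show ?thesis unfolding missed_mass_def by (intro integral_cong_AE) auto
  qed
  also have "\<dots> = exp (- nu * g) * missed_mass l (t l)" by (simp add: missed_mass_def)
  finally show ?thesis using True by simp
next
  case False
  then have "missed_mass (Suc l) T = missed_mass l T" by (simp add: missed_mass_def miss_prob_Suc)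
  then show ?thesis using missed_mass_after[of l T] assms False by simp
qed

text \<open>The customers caught in window \<open>l\<close> are those missed before it minus those
  missed after it. The half-line can be cut at the end of the window, since both probabilities are 1
  beyond.\<close>

lemma glued_mass:
  "(\<integral>a. indicator {0<..} a * (miss_prob l a - miss_prob (Suc l) a) \<partial>lborel)
    = (if own l then (1 - exp (- nu * g)) * missed_mass l (t l) + g else 0)"
    (is "?I = _")
  and glued_mass_integrable:
  "integrable lborel (\<lambda>a. indicator {0<..} a * (miss_prob l a - miss_prob (Suc l) a))"
proof -
  define T where "T = t l + (if own l then g else 0)"
  have T: "t l \<le> T" using g_pos by (simp add: T_def)
  have eq: "indicator {0<..} a * (miss_prob l a - miss_prob (Suc l) a)
    = indicator {0<..T} a * miss_prob l a - indicator {0<..T} a * miss_prob (Suc l) a" for a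
  proof (cases "T < a")
    case True
    then have "miss_prob l a = 1" using T by (intro miss_prob_after) simp
    then show ?thesis using True T by (auto simp: indicator_def miss_prob_Suc T_def)
  qed (auto simp: indicator_def algebra_simps)
  show "integrable lborel (\<lambda>a. indicator {0<..} a * (miss_prob l a - miss_prob (Suc l) a))"
    unfolding eq by (intro Bochner_Integration.integrable_diff missed_mass_integrable)
  have "?I = missed_mass l T - missed_mass (Suc l) T"
    unfolding eq missed_mass_def by (rule Bochner_Integration.integral_diff[OF missed_mass_integrable missed_mass_integrable])
  also have "\<dots> = (if own l then (1 - exp (- nu * g)) * missed_mass l (t l) + g else 0)"
    by (subst missed_mass_Suc, simp add: T_def, subst missed_mass_after[OF T])
       (auto simp: T_def algebra_simps)
  finally show "?I = (if own l then (1 - exp (- nu * g)) * missed_mass l (t l) + g else 0)" .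
qed

text \<open>The factor of a customer with arrival time \<open>a\<close> and retrials \<open>r\<close> in the joint generating function:
  \<open>\<zeta> l\<close> if caught in glue period \<open>l\<close>, \<open>z\<close> if in orbit at time \<open>E\<close>, and \<open>1\<close> otherwise.\<close>

definition class_value :: "nat \<Rightarrow> (nat \<Rightarrow> real) \<Rightarrow> real \<Rightarrow> real \<Rightarrow> real \<Rightarrow> (nat \<Rightarrow> real) \<Rightarrow> real" where
  "class_value m \<zeta> z E a r = 1
     - (\<Sum>l<m. (1 - \<zeta> l) * (of_bool (missed l a r) - of_bool (missed (Suc l) a r)))
     - (1 - z) * of_bool (missed m a r \<and> a \<le> E)"

lemma missed_0[simp]: "missed 0 a r" by (simp add: missed_def)

lemma missed_antimono: "l \<le> l' \<Longrightarrow> missed l' a r \<Longrightarrow> missed l a r"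
  unfolding missed_def window_def by force

lemma class_value_missed:
  assumes "missed m a r"
  shows "class_value m \<zeta> z E a r = (if a \<le> E then z else 1)"
proof -
  have "missed l a r" if "l \<le> m" for l using missed_antimono[OF that assms] .
  then show ?thesis using assms by (simp add: class_value_def Suc_le_eq)
qed

text \<open>As \<open>missed\<close> decreases in the window index, its only jump is at
  \<open>l\<close>, and only this summand of the alternating sum survives.\<close>

lemma class_value_hit:
  assumes "l < m" "missed l a r" "\<not> missed (Suc l) a r"
  shows "class_value m \<zeta> z E a r = \<zeta> l"
proof -
  have "\<not> missed m a r" using missed_antimono[of "Suc l" m a r] assms by auto
  moreover have "(\<Sum>l<m. (1 - \<zeta> l) * (of_bool (missed l a r) - of_bool (missed (Suc l) a r)))
    = (\<Sum>l'<m. if l' = l then 1 - \<zeta> l else 0)"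
  proof (intro sum.cong refl)
    fix l' assume "l' \<in> {..<m}"
    consider "l' < l" | "l' = l" | "l < l'" by linarith
    then show "(1 - \<zeta> l') * (of_bool (missed l' a r) - of_bool (missed (Suc l') a r))
      = (if l' = l then 1 - \<zeta> l else 0)"
    proof cases
      case 1
      then show ?thesis using assms missed_antimono[of l' l a r] missed_antimono[of "Suc l'" l a r] by auto
    next
      case 3
      then show ?thesis using assms missed_antimono[of "Suc l" l' a r] missed_antimono[of "Suc l" "Suc l'" a r] by auto
    qed (use assms in auto)
  qed
  ultimately show ?thesis using assms by (simp add: class_value_def)
qed

lemma class_cases:
  obtains "missed m a r" | l where "l < m" "missed l a r" "\<not> missed (Suc l) a r"
proof (cases "missed m a r")
  case False
  have "\<exists>l<m. missed l a r \<and> \<not> missed (Suc l) a r"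
    using False
  proof (induction m)
    case (Suc m)
    then show ?case by (cases "missed m a r") (auto intro: less_SucI)
  qed simp
  then show ?thesis using that by auto
qed

lemma class_value_bounds:
  assumes "\<And>l. 0 \<le> \<zeta> l \<and> \<zeta> l \<le> 1" "0 \<le> z" "z \<le> 1"
  shows "0 \<le> class_value m \<zeta> z E a r" "class_value m \<zeta> z E a r \<le> 1"
  using assms by (cases m a r rule: class_cases; auto simp: class_value_missed class_value_hit)+

lemma class_value_measurable:
  "(\<lambda>(a, r). class_value m \<zeta> z E a r) \<in> borel_measurable (borel \<Otimes>\<^sub>M PiM UNIV (\<lambda>_ :: nat. borel))"
proof -
  have [measurable]: "Measurable.pred (borel \<Otimes>\<^sub>M PiM UNIV (\<lambda>_ :: nat. borel)) (\<lambda>x. missed l (fst x) (snd x))" for l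
    using missed_measurable[of l] by (simp add: split_beta')
  show ?thesis unfolding class_value_def split_beta' by measurable
qed

text \<open>The additive form of \<open>class_value\<close> pays off here: it is linear in the
  indicators of \<open>missed\<close>, so their expectations can be inserted term by term.\<close>

lemma integral_class_value:
  "(\<integral>r. class_value m \<zeta> z E a r \<partial>PiM UNIV (\<lambda>_ :: nat. exp_law nu)) = 1
     - (\<Sum>l<m. (1 - \<zeta> l) * (miss_prob l a - miss_prob (Suc l) a)) - (1 - z) * (miss_prob m a * indicator {..E} a)"
proof -
  interpret E: prob_space "exp_law nu" by (rule prob_space_exp_law[OF nu_pos])
  interpret sequence_space "exp_law nu" ..
  have ss: "sets S = sets (PiM UNIV (\<lambda>_ :: nat. borel))" by (rule sets_PiM_cong) auto
  have m[measurable]: "Measurable.pred S (\<lambda>r. missed l a r)" for l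
  proof -
    have "(\<lambda>r. (a, r)) \<in> measurable (PiM UNIV (\<lambda>_ :: nat. borel)) (borel \<Otimes>\<^sub>M PiM UNIV (\<lambda>_ :: nat. borel))"
      by simp
    from measurable_compose[OF this missed_measurable]
    have "Measurable.pred (PiM UNIV (\<lambda>_ :: nat. borel)) (\<lambda>r. missed l a r)" by simp
    then show ?thesis using measurable_cong_sets[OF ss refl] by blast
  qed
  have sp: "space S = UNIV" by (simp add: space_PiM)
  have int: "(\<lambda>r. of_bool (missed l a r) :: real) = indicator {r. missed l a r}" for l
    by (auto simp: fun_eq_iff indicator_def)
  have mset[measurable]: "{r. missed l a r} \<in> sets S" for l
    using m[of l, unfolded pred_def] by (simp add: sp)
  have I: "integrable S (\<lambda>r. of_bool (missed l a r) :: real)" for l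
    unfolding int by (simp add: integrable_real_indicator emeasure_eq_measure)
  have v: "(\<integral>r. of_bool (missed l a r) \<partial>S) = miss_prob l a" for l
    unfolding int miss_prob_def using sp by simp
  have e: "of_bool (missed m a r \<and> a \<le> E) = indicator {..E} a * (of_bool (missed m a r) :: real)" for r
    by auto
  have one: "(\<integral>r. 1 \<partial>S) = (1::real)" by (simp add: P.prob_space)
  show ?thesis
    unfolding class_value_def e
    by (subst Bochner_Integration.integral_diff Bochner_Integration.integral_sum integral_mult_right_zero
        | intro I Bochner_Integration.integrable_diff Bochner_Integration.integrable_sum
            integrable_mult_right integrable_const
        | simp only: v one)+ (simp add: mult_ac)
qed

text \<open>The exponent of the Laplace functional is additive over the disjoint fates of a
  customer, so the generating function is a product: the numbers with the various fates behave as
  independent Poisson variables.\<close>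

lemma class_value_survivor:
  assumes E: "t l + (if own l then g else 0) \<le> E" and m: "m = Suc l" and lam: "0 < lam"
  shows "survivor lam (\<lambda>a. \<integral>r. class_value m \<zeta> z E a r \<partial>PiM UNIV (\<lambda>_ :: nat. exp_law nu)) 0
    = exp (- (\<Sum>l<m. (1 - \<zeta> l) * (lam * (if own l then (1 - exp (- nu * g)) * missed_mass l (t l) + g else 0)))
        - (1 - z) * (lam * missed_mass m E))"
    and "\<And>a. E < a \<Longrightarrow> (\<integral>r. class_value m \<zeta> z E a r \<partial>PiM UNIV (\<lambda>_ :: nat. exp_law nu)) = 1"
proof -
  let ?H = "\<lambda>a. \<integral>r. class_value m \<zeta> z E a r \<partial>PiM UNIV (\<lambda>_ :: nat. exp_law nu)"
  have "indicator {0<..} a * (1 - ?H a)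
    = (\<Sum>l<m. (1 - \<zeta> l) * (indicator {0<..} a * (miss_prob l a - miss_prob (Suc l) a)))
      + (1 - z) * (indicator {0<..E} a * miss_prob m a)" for a
    unfolding integral_class_value by (auto simp: indicator_def)
  then have "(\<integral>a. indicator {0<..} a * (1 - ?H a) \<partial>lborel)
    = (\<integral>a. (\<Sum>l<m. (1 - \<zeta> l) * (indicator {0<..} a * (miss_prob l a - miss_prob (Suc l) a)))
      + (1 - z) * (indicator {0<..E} a * miss_prob m a) \<partial>lborel)"
    by simp
  also have "\<dots> = (\<Sum>l<m. (1 - \<zeta> l) * (if own l then (1 - exp (- nu * g)) * missed_mass l (t l) + g else 0))
      + (1 - z) * missed_mass m E"
    unfolding missed_mass_def[symmetric] glued_mass[symmetric]
    by (subst Bochner_Integration.integral_add Bochner_Integration.integral_sum integral_mult_right_zero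
        | intro glued_mass_integrable missed_mass_integrable Bochner_Integration.integrable_sum integrable_mult_right
        | simp only: missed_mass_def)+
  finally have e: "(\<integral>a. indicator {0<..} a * (1 - ?H a) \<partial>lborel)
    = (\<Sum>l<m. (1 - \<zeta> l) * (if own l then (1 - exp (- nu * g)) * missed_mass l (t l) + g else 0))
      + (1 - z) * missed_mass m E" .
  have "lam * (\<Sum>l<m. (1 - \<zeta> l) * (if own l then (1 - exp (- nu * g)) * missed_mass l (t l) + g else 0))
    = (\<Sum>l<m. (1 - \<zeta> l) * (lam * (if own l then (1 - exp (- nu * g)) * missed_mass l (t l) + g else 0)))"
    unfolding sum_distrib_left by (intro sum.cong refl) (simp only: mult_ac)
  then show "survivor lam ?H 0
    = exp (- (\<Sum>l<m. (1 - \<zeta> l) * (lam * (if own l then (1 - exp (- nu * g)) * missed_mass l (t l) + g else 0)))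
        - (1 - z) * (lam * missed_mass m E))"
    unfolding survivor_def e minus_mult_left[symmetric] distrib_left by (simp add: mult_ac)
  fix a assume a: "E < a"
  have "miss_prob l' a = 1" if "l' < m" for l'
  proof (rule miss_prob_after)
    have "t l' \<le> t l" using that m by (intro t_mono) simp
    then show "t l' \<le> a" using E a g_pos by (auto split: if_splits)
  qed
  moreover have "miss_prob m a = 1"
    using calculation[of l] E a m g_pos by (auto simp: miss_prob_Suc split: if_splits)
  ultimately have *: "miss_prob l' a = 1" if "l' \<le> m" for l' using that by (cases "l' = m") auto
  have "(\<Sum>l<m. (1 - \<zeta> l) * (miss_prob l a - miss_prob (Suc l) a)) = 0"
    by (rule sum.neutral) (use * in auto)
  then show "?H a = 1"
    using a unfolding integral_class_value by (simp add: *)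
qed

end

section \<open>Recovering Poisson probabilities from generating functions\<close>

lemma powser_unique_nonneg:
  fixes a b :: "nat \<Rightarrow> real"
  assumes "\<And>x. 0 \<le> x \<Longrightarrow> x < 1 \<Longrightarrow> (\<lambda>k. a k * x ^ k) sums f x"
    and "\<And>x. 0 \<le> x \<Longrightarrow> x < 1 \<Longrightarrow> (\<lambda>k. b k * x ^ k) sums f x"
  shows "a = b"
proof -
  define c where "c k = a k - b k" for k
  have c: "(\<lambda>k. c k * x ^ k) sums 0" if "0 \<le> x" "x < 1" for x
    using sums_diff[OF assms(1)[OF that] assms(2)[OF that]] by (simp add: c_def algebra_simps)
  have "c n = 0" for n
  proof (induction n rule: less_induct)
    \<comment> \<open>With all lower coefficients known to vanish, divide by \<open>x ^ n\<close>;
      the constant term of the shifted series is then \<open>c n\<close>.\<close>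
    case (less n)
    define g where "g x = (\<Sum>k. c (k + n) * x ^ k)" for x
    have shift: "(\<lambda>k. c (k + n) * x ^ (k + n)) sums 0" if "0 \<le> x" "x < 1" for x
      using c[OF that] less by (subst sums_iff_shift) simp
    have z: "(\<lambda>k. c (k + n) * x ^ k) sums 0" if "0 < x" "x < 1" for x
    proof -
      have "(\<lambda>k. c (k + n) * x ^ (k + n) * inverse (x ^ n)) sums (0 * inverse (x ^ n))"
        by (intro sums_mult2 shift) (use that in auto)
      then show ?thesis using that by (simp add: power_add field_simps)
    qed
    have "(\<lambda>k. c (k + n) * x ^ k) sums g x" if "norm x < 1/2" for x
    proof -
      have "summable (\<lambda>k. c (k + n) * x ^ k)"
        by (rule powser_inside[of _ "1/2"]) (use z[of "1/2"] that in \<open>auto simp: sums_iff\<close>)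
      then show ?thesis unfolding g_def by (rule summable_sums)
    qed
    \<comment> \<open>The series is continuous at 0 but is known to vanish only for positive
      arguments; the right-hand limit suffices.\<close>
    from powser_limit_0[of "1/2" "\<lambda>k. c (k + n)" g, OF _ this] have "(g \<longlongrightarrow> c n) (at 0)" by simp
    then have "(g \<longlongrightarrow> c n) (at_right 0)" by (rule filterlim_mono) (auto simp: at_within_le_at)
    moreover have "\<forall>\<^sub>F x in at_right (0::real). x < 1" by (rule eventually_at_rightI[of 0 1]) auto
    then have "\<forall>\<^sub>F x in at_right 0. g x = 0"
      using eventually_at_right_less[of 0]
      by eventually_elim (use z in \<open>auto simp: g_def sums_iff\<close>)
    then have "(g \<longlongrightarrow> 0) (at_right 0)" by (rule tendsto_eventually)
    ultimately show ?case using tendsto_unique[OF trivial_limit_at_right_real] by blast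
  qed
  then show ?thesis by (auto simp: c_def fun_eq_iff)
qed

definition poisson_weight :: "real \<Rightarrow> nat \<Rightarrow> real" where
  "poisson_weight \<mu> k = \<mu> ^ k / fact k * exp (- \<mu>)"

lemma poisson_weight_nonneg: "0 \<le> \<mu> \<Longrightarrow> 0 \<le> poisson_weight \<mu> k"
  by (simp add: poisson_weight_def)

lemma poisson_weight_sums: "(\<lambda>k. poisson_weight \<mu> k * x ^ k) sums exp (- (1 - x) * \<mu>)"
proof -
  have "(\<lambda>k. exp (- \<mu>) * ((\<mu> * x) ^ k /\<^sub>R fact k)) sums (exp (- \<mu>) * exp (\<mu> * x))"
    by (intro sums_mult exp_converges)
  then show ?thesis
    by (simp add: poisson_weight_def power_mult_distrib exp_add[symmetric] field_simps)
qed

lemma (in prob_space) expectation_power_nat_sums: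
  fixes Z :: "'a \<Rightarrow> real" and N :: "'a \<Rightarrow> nat"
  assumes Z[measurable]: "Z \<in> borel_measurable M" and Z01: "\<And>\<omega>. 0 \<le> Z \<omega>" "\<And>\<omega>. Z \<omega> \<le> 1"
    and N[measurable]: "N \<in> measurable M (count_space UNIV)" and x: "0 \<le> x" "x \<le> 1"
  shows "(\<lambda>k. expectation (\<lambda>\<omega>. Z \<omega> * of_bool (N \<omega> = k)) * x ^ k) sums expectation (\<lambda>\<omega>. Z \<omega> * x ^ N \<omega>)"
proof -
  have s: "(\<lambda>k. Z \<omega> * of_bool (N \<omega> = k) * x ^ k) sums (Z \<omega> * x ^ N \<omega>)" for \<omega>
  proof -
    have "(\<lambda>k. Z \<omega> * of_bool (N \<omega> = k) * x ^ k) = (\<lambda>k. if k = N \<omega> then Z \<omega> * x ^ k else 0)"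
      by auto
    then show ?thesis using sums_single[of "N \<omega>" "\<lambda>k. Z \<omega> * x ^ k"] by simp
  qed
  have "(\<lambda>n. expectation (\<lambda>\<omega>. \<Sum>k<n. Z \<omega> * of_bool (N \<omega> = k) * x ^ k)) \<longlonglongrightarrow> expectation (\<lambda>\<omega>. Z \<omega> * x ^ N \<omega>)"
  proof (rule integral_dominated_convergence[where w = "\<lambda>_. 1"])
    show "AE \<omega> in M. (\<lambda>n. \<Sum>k<n. Z \<omega> * of_bool (N \<omega> = k) * x ^ k) \<longlonglongrightarrow> Z \<omega> * x ^ N \<omega>"
      using s by (auto simp: sums_def)
    fix n show "AE \<omega> in M. norm (\<Sum>k<n. Z \<omega> * of_bool (N \<omega> = k) * x ^ k) \<le> 1"
    proof (intro AE_I2)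
      fix \<omega>
      have "(\<Sum>k<n. Z \<omega> * of_bool (N \<omega> = k) * x ^ k) \<le> Z \<omega> * x ^ N \<omega>"
        using s[of \<omega>] Z01 x sum_le_suminf[of "\<lambda>k. Z \<omega> * of_bool (N \<omega> = k) * x ^ k" "{..<n}"]
        by (auto simp: sums_iff)
      also have "\<dots> \<le> 1" using Z01[of \<omega>] x by (auto intro!: mult_le_one power_le_one)
      finally show "norm (\<Sum>k<n. Z \<omega> * of_bool (N \<omega> = k) * x ^ k) \<le> 1"
        using Z01 x by (simp add: sum_nonneg)
    qed
  qed (use x in auto)
  moreover have "integrable M (\<lambda>\<omega>. Z \<omega> * of_bool (N \<omega> = k))" for k
    by (rule integrable_const_bound[where B = 1]) (use Z01 in auto)
  ultimately show ?thesis by (simp add: sums_def)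
qed

text \<open>One count is extracted at a time by comparing power series coefficients in its variable,
  the other variables being fixed. The indicator obtained is absorbed into \<open>Z\<close> and its
  probability into \<open>K\<close>, which is why both are general.\<close>

lemma (in prob_space) poisson_coefficients:
  fixes N :: "'c \<Rightarrow> 'a \<Rightarrow> nat"
  assumes fin: "finite C" and N[measurable]: "\<And>c. N c \<in> measurable M (count_space UNIV)"
    and Z[measurable]: "Z \<in> borel_measurable M" and Z01: "\<And>\<omega>. 0 \<le> Z \<omega>" "\<And>\<omega>. Z \<omega> \<le> 1"
    and gf: "\<And>\<zeta>. (\<And>c. 0 \<le> \<zeta> c \<and> \<zeta> c \<le> 1) \<Longrightarrow>
      expectation (\<lambda>\<omega>. Z \<omega> * (\<Prod>c\<in>C. \<zeta> c ^ N c \<omega>)) = K * (\<Prod>c\<in>C. exp (- (1 - \<zeta> c) * \<mu> c))"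
  shows "expectation (\<lambda>\<omega>. Z \<omega> * (\<Prod>c\<in>C. of_bool (N c \<omega> = w c))) = K * (\<Prod>c\<in>C. poisson_weight (\<mu> c) (w c))"
  using fin Z Z01 gf
proof (induction C arbitrary: Z K rule: finite_induct)
  case (insert c C)
  note [measurable] = insert.prems(1)
  note Z01 = insert.prems(2,3)
  have step: "expectation (\<lambda>\<omega>. (Z \<omega> * of_bool (N c \<omega> = w c)) * (\<Prod>c\<in>C. \<zeta> c ^ N c \<omega>))
    = (K * poisson_weight (\<mu> c) (w c)) * (\<Prod>c\<in>C. exp (- (1 - \<zeta> c) * \<mu> c))"
    if \<zeta>: "\<And>c. 0 \<le> \<zeta> c \<and> \<zeta> c \<le> 1" for \<zeta>
  proof -
    let ?Z = "\<lambda>\<omega>. Z \<omega> * (\<Prod>c\<in>C. \<zeta> c ^ N c \<omega>)"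
    let ?K = "K * (\<Prod>c\<in>C. exp (- (1 - \<zeta> c) * \<mu> c))"
    have "(\<lambda>k. expectation (\<lambda>\<omega>. ?Z \<omega> * of_bool (N c \<omega> = k))) = (\<lambda>k. ?K * poisson_weight (\<mu> c) k)"
    proof (rule powser_unique_nonneg)
      fix x :: real assume x: "0 \<le> x" "x < 1"
      have p: "0 \<le> (\<Prod>c\<in>C. \<zeta> c ^ N c \<omega>)" "(\<Prod>c\<in>C. \<zeta> c ^ N c \<omega>) \<le> 1" for \<omega>
        using \<zeta> by (auto intro!: prod_nonneg prod_le_1 power_le_one)
      have s: "(\<lambda>k. expectation (\<lambda>\<omega>. ?Z \<omega> * of_bool (N c \<omega> = k)) * x ^ k) sums expectation (\<lambda>\<omega>. ?Z \<omega> * x ^ N c \<omega>)"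
        by (rule expectation_power_nat_sums) (use x Z01 p in \<open>auto intro!: mult_le_one\<close>)
      let ?\<zeta> = "\<zeta>(c := x)"
      have "expectation (\<lambda>\<omega>. Z \<omega> * (\<Prod>c\<in>insert c C. ?\<zeta> c ^ N c \<omega>)) = K * (\<Prod>c\<in>insert c C. exp (- (1 - ?\<zeta> c) * \<mu> c))"
        by (rule insert.prems(4)) (use \<zeta> x in auto)
      also have "(\<lambda>\<omega>. Z \<omega> * (\<Prod>c\<in>insert c C. ?\<zeta> c ^ N c \<omega>)) = (\<lambda>\<omega>. ?Z \<omega> * x ^ N c \<omega>)"
      proof
        fix \<omega>
        have "(\<Prod>d\<in>C. ?\<zeta> d ^ N d \<omega>) = (\<Prod>d\<in>C. \<zeta> d ^ N d \<omega>)"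
          using insert.hyps by (intro prod.cong) auto
        then show "Z \<omega> * (\<Prod>c\<in>insert c C. ?\<zeta> c ^ N c \<omega>) = ?Z \<omega> * x ^ N c \<omega>"
          using insert.hyps by simp
      qed
      also have "K * (\<Prod>d\<in>insert c C. exp (- (1 - ?\<zeta> d) * \<mu> d)) = ?K * exp (- (1 - x) * \<mu> c)"
      proof -
        have "(\<Prod>d\<in>C. exp (- (1 - ?\<zeta> d) * \<mu> d)) = (\<Prod>d\<in>C. exp (- (1 - \<zeta> d) * \<mu> d))"
          using insert.hyps by (intro prod.cong) auto
        then show ?thesis using insert.hyps by simp
      qed
      finally show "(\<lambda>k. expectation (\<lambda>\<omega>. ?Z \<omega> * of_bool (N c \<omega> = k)) * x ^ k) sums (?K * exp (- (1 - x) * \<mu> c))"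
        using s by simp
      show "(\<lambda>k. ?K * poisson_weight (\<mu> c) k * x ^ k) sums (?K * exp (- (1 - x) * \<mu> c))"
        unfolding mult.assoc[of ?K] by (intro sums_mult poisson_weight_sums)
    qed
    from fun_cong[OF this, of "w c"] show ?thesis by (simp add: mult_ac)
  qed
  have "expectation (\<lambda>\<omega>. (Z \<omega> * of_bool (N c \<omega> = w c)) * (\<Prod>c\<in>C. of_bool (N c \<omega> = w c)))
     = (K * poisson_weight (\<mu> c) (w c)) * (\<Prod>c\<in>C. poisson_weight (\<mu> c) (w c))"
    by (rule insert.IH[OF _ _ _ step]) (use Z01 in \<open>auto intro!: mult_le_one\<close>)
  then show ?case using insert.hyps by (simp add: mult_ac)
next
  case empty
  from empty.prems(4)[of "\<lambda>_. 0"] show ?case by simp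
qed

section \<open>Laws of independent blocks of random times\<close>

abbreviation seq_space :: "(nat \<Rightarrow> real) measure" where
  "seq_space \<equiv> PiM UNIV (\<lambda>_. borel)"

lemma (in prob_space) distr_iid:
  assumes I: "I \<noteq> {}" and ind: "indep_vars (\<lambda>_. N) Y I" and law: "\<And>n. n \<in> I \<Longrightarrow> distr M N (Y n) = D"
  shows "distr M (PiM I (\<lambda>_. N)) (\<lambda>\<omega>. \<lambda>n\<in>I. Y n \<omega>) = PiM I (\<lambda>_. D)"
proof -
  have rv: "random_variable N (Y i)" if "i \<in> I" for i
    using ind that unfolding indep_vars_def by auto
  have "distr M (PiM I (\<lambda>_. N)) (\<lambda>\<omega>. \<lambda>n\<in>I. Y n \<omega>) = PiM I (\<lambda>n. distr M N (Y n))"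
    using indep_vars_iff_distr_eq_PiM'[OF I, where M' = "\<lambda>_. N" and X = Y] rv ind by simp
  also have "\<dots> = PiM I (\<lambda>_. D)"
    by (rule PiM_cong) (auto simp: law)
  finally show ?thesis .
qed

lemma (in prob_space) indep_vars_inj:
  assumes ind: "indep_vars (\<lambda>_. N) X I" and f: "inj_on f L" "f ` L \<subseteq> I"
  shows "indep_vars (\<lambda>_. N) (\<lambda>l. X (f l)) L"
proof -
  have "indep_vars (\<lambda>l. PiM {f l} (\<lambda>_. N)) (\<lambda>l \<omega>. restrict (\<lambda>i. X i \<omega>) {f l}) L"
    by (rule indep_vars_restrict[OF ind]) (use f in \<open>auto simp: disjoint_family_on_def inj_on_def\<close>)
  then have "indep_vars (\<lambda>_. N) (\<lambda>l \<omega>. (\<lambda>u. u (f l)) (restrict (\<lambda>i. X i \<omega>) {f l})) L"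
    by (rule indep_vars_compose2) (auto intro!: measurable_component_singleton)
  then show ?thesis by simp
qed

lemma (in prob_space) distr_pair_blocks:
  assumes ind: "indep_vars (\<lambda>_. N) X UNIV" and AR: "A \<inter> R = {}"
    and f[measurable]: "f \<in> measurable (PiM A (\<lambda>_. N)) S" and g[measurable]: "g \<in> measurable (PiM R (\<lambda>_. N)) T"
  shows "distr M (S \<Otimes>\<^sub>M T) (\<lambda>\<omega>. (f (restrict (\<lambda>i. X i \<omega>) A), g (restrict (\<lambda>i. X i \<omega>) R)))
    = distr M S (\<lambda>\<omega>. f (restrict (\<lambda>i. X i \<omega>) A)) \<Otimes>\<^sub>M distr M T (\<lambda>\<omega>. g (restrict (\<lambda>i. X i \<omega>) R))"
proof -
  let ?a = "\<lambda>\<omega>. restrict (\<lambda>i. X i \<omega>) A" and ?r = "\<lambda>\<omega>. restrict (\<lambda>i. X i \<omega>) R"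
  let ?P = "PiM A (\<lambda>_. N)" and ?Q = "PiM R (\<lambda>_. N)"
  have "indep_var ?P ?a ?Q ?r"
    by (rule indep_var_restrict[OF ind AR]) auto
  then have a[measurable]: "?a \<in> measurable M ?P" and r[measurable]: "?r \<in> measurable M ?Q"
    and eq: "distr M ?P ?a \<Otimes>\<^sub>M distr M ?Q ?r = distr M (?P \<Otimes>\<^sub>M ?Q) (\<lambda>\<omega>. (?a \<omega>, ?r \<omega>))"
    unfolding indep_var_distribution_eq by auto
  have p: "prob_space (distr M T (\<lambda>\<omega>. g (?r \<omega>)))" by (rule prob_space_distr) measurable
  have "distr M S (\<lambda>\<omega>. f (?a \<omega>)) \<Otimes>\<^sub>M distr M T (\<lambda>\<omega>. g (?r \<omega>))
    = distr (distr M ?P ?a) S f \<Otimes>\<^sub>M distr (distr M ?Q ?r) T g"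
    by (simp add: distr_distr comp_def)
  also have "\<dots> = distr (distr M ?P ?a \<Otimes>\<^sub>M distr M ?Q ?r) (S \<Otimes>\<^sub>M T) (\<lambda>(x, y). (f x, g y))"
    using prob_space_imp_sigma_finite[OF p] by (intro pair_measure_distr) (auto simp: distr_distr comp_def)
  also have "\<dots> = distr M (S \<Otimes>\<^sub>M T) (\<lambda>\<omega>. (f (?a \<omega>), g (?r \<omega>)))"
    unfolding eq by (subst distr_distr) (auto simp: comp_def)
  finally show ?thesis ..
qed

section \<open>The law of the numbers in the system\<close>

locale driven_glue_system = glue_polling_system M X lam nu B S
  for M :: "'a measure" and X :: "'n::{finite,linorder} source \<Rightarrow> 'a \<Rightarrow> real" and lam nu and B S +
  fixes G :: "'n \<Rightarrow> real"
  assumes lam_pos: "0 < lam i" and nu_pos: "0 < nu i" and G_pos: "0 < G i"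
    and B_nonneg: "AE x in B i. 0 \<le> x" and S_nonneg: "AE x in S i. 0 \<le> x"
begin

lemma X_measurable[measurable]: "X s \<in> borel_measurable M"
  using indep by (auto simp: indep_vars_def)

text \<open>The interarrival time is the gap and the whole retrial sequence is the mark, in the form
  that \<open>marked_points_laplace\<close> expects.\<close>

definition customer :: "'n \<Rightarrow> nat \<Rightarrow> 'a \<Rightarrow> real \<times> (nat \<Rightarrow> real)" where
  "customer j n \<omega> = (X (Interarrival j n) \<omega>, \<lambda>k. X (Retrial j n k) \<omega>)"

abbreviation customer_space :: "(real \<times> (nat \<Rightarrow> real)) measure" where
  "customer_space \<equiv> borel \<Otimes>\<^sub>M seq_space"

definition customer_law :: "'n \<Rightarrow> (real \<times> (nat \<Rightarrow> real)) measure" where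
  "customer_law j = exp_law (lam j) \<Otimes>\<^sub>M PiM UNIV (\<lambda>_ :: nat. exp_law (nu j))"

lemma customer_measurable[measurable]: "customer j n \<in> measurable M customer_space"
  unfolding customer_def by (intro measurable_Pair measurable_PiM_single') auto

lemma distr_interarrival: "distr M borel (X (Interarrival j n)) = exp_law (lam j)"
  using distributed_distr_eq_density[OF interarrival[of j n]] unfolding exp_law_def
  by (metis distr_cong sets_lborel)

lemma distr_retrial: "distr M borel (X (Retrial j n k)) = exp_law (nu j)"
  using distributed_distr_eq_density[OF retrial[of j n k]] unfolding exp_law_def
  by (metis distr_cong sets_lborel)

lemma distr_customer: "distr M customer_space (customer j n) = customer_law j"
proof -
  define A where "A = {Interarrival j n}"
  define R where "R = range (Retrial j n)"
  have "indep_vars (\<lambda>_. borel) (\<lambda>k. X (Retrial j n k)) UNIV"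
    by (rule indep_vars_inj[OF indep]) (auto simp: inj_on_def)
  from distr_iid[OF _ this, of "exp_law (nu j)"] have R: "distr M seq_space (\<lambda>\<omega> k. X (Retrial j n k) \<omega>) = PiM UNIV (\<lambda>_ :: nat. exp_law (nu j))"
    by (simp add: distr_retrial restrict_UNIV)
  have AR: "A \<inter> R = {}" by (auto simp: A_def R_def)
  have mem[simp]: "Interarrival j n \<in> A" "Retrial j n k \<in> R" for k
    by (simp_all add: A_def R_def)
  have f: "(\<lambda>f. f (Interarrival j n)) \<in> measurable (PiM A (\<lambda>_. borel)) borel"
    by (rule measurable_component_singleton) simp
  have g: "(\<lambda>f k. f (Retrial j n k)) \<in> measurable (PiM R (\<lambda>_. borel)) seq_space"
    by (rule measurable_PiM_single') (auto intro!: measurable_component_singleton)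
  show ?thesis
    using distr_pair_blocks[OF indep AR f g]
    unfolding customer_def[abs_def] customer_law_def by (simp add: distr_interarrival R)
qed

lemma indep_customers: "indep_vars (\<lambda>_. customer_space) (\<lambda>(j, n). customer j n) UNIV"
proof -
  define K where "K = (\<lambda>(j :: 'n, n). insert (Interarrival j n) (range (Retrial j n)))"
  have "indep_vars (\<lambda>p. PiM (K p) (\<lambda>_. borel)) (\<lambda>p \<omega>. restrict (\<lambda>i. X i \<omega>) (K p)) UNIV"
    by (rule indep_vars_restrict[OF indep]) (auto simp: K_def disjoint_family_on_def)
  then have "indep_vars (\<lambda>_. customer_space)
      (\<lambda>p \<omega>. (\<lambda>f. (f (Interarrival (fst p) (snd p)), \<lambda>k. f (Retrial (fst p) (snd p) k))) (restrict (\<lambda>i. X i \<omega>) (K p))) UNIV"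
    by (rule indep_vars_compose2)
       (auto simp: K_def split_beta' intro!: measurable_Pair measurable_component_singleton measurable_PiM_single')
  then show ?thesis
    by (simp add: K_def split_beta' customer_def[abs_def] cong: indep_vars_cong)
qed

definition customers :: "'n \<Rightarrow> 'a \<Rightarrow> nat \<Rightarrow> real \<times> (nat \<Rightarrow> real)" where
  "customers j \<omega> n = customer j n \<omega>"

lemma customers_measurable[measurable]: "customers j \<in> measurable M (PiM UNIV (\<lambda>_. customer_space))"
  unfolding customers_def[abs_def]
  by (intro measurable_PiM_single') (auto simp: space_pair_measure space_PiM)

lemma distr_customers: "distr M (PiM UNIV (\<lambda>_. customer_space)) (customers j) = PiM UNIV (\<lambda>_. customer_law j)"
proof -
  have "indep_vars (\<lambda>_. customer_space) (\<lambda>n. (case (j, n) of (j, n) \<Rightarrow> customer j n)) UNIV"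
    by (rule indep_vars_inj[OF indep_customers]) (auto simp: inj_on_def)
  then have "indep_vars (\<lambda>_. customer_space) (\<lambda>n. customer j n) UNIV" by simp
  from distr_iid[OF _ this, of "customer_law j"] show ?thesis
    by (simp add: distr_customer customers_def[abs_def] restrict_UNIV)
qed

lemma indep_customers_types: "indep_vars (\<lambda>_. PiM UNIV (\<lambda>_. customer_space)) customers UNIV"
proof -
  have "indep_vars (\<lambda>j. PiM ({j} \<times> UNIV) (\<lambda>_. customer_space))
      (\<lambda>j \<omega>. restrict (\<lambda>p. (case p of (j, n) \<Rightarrow> customer j n) \<omega>) ({j} \<times> UNIV)) (UNIV :: 'n set)"
    by (rule indep_vars_restrict[OF indep_customers]) (auto simp: disjoint_family_on_def)
  then have "indep_vars (\<lambda>_. PiM UNIV (\<lambda>_. customer_space))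
      (\<lambda>j \<omega>. (\<lambda>f n. f (j, n)) (restrict (\<lambda>p. (case p of (j, n) \<Rightarrow> customer j n) \<omega>) ({j} \<times> UNIV))) (UNIV :: 'n set)"
    by (rule indep_vars_compose2)
       (auto intro!: measurable_component_singleton measurable_PiM_single' simp: space_pair_measure space_PiM)
  then show ?thesis by (simp add: customers_def[abs_def])
qed

lemma nn_integral_customers_prod:
  assumes [measurable]: "\<And>j. F j \<in> borel_measurable (PiM UNIV (\<lambda>_. customer_space))"
  shows "(\<integral>\<^sup>+\<omega>. (\<Prod>j\<in>UNIV. F j (customers j \<omega>)) \<partial>M) = (\<Prod>j\<in>UNIV. \<integral>\<^sup>+u. F j u \<partial>PiM UNIV (\<lambda>_. customer_law j))"
proof -
  have "indep_vars (\<lambda>_. borel) (\<lambda>j \<omega>. F j (customers j \<omega>)) UNIV"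
    by (rule indep_vars_compose2[OF indep_customers_types]) simp
  then have "(\<integral>\<^sup>+\<omega>. (\<Prod>j\<in>UNIV. F j (customers j \<omega>)) \<partial>M) = (\<Prod>j\<in>UNIV. \<integral>\<^sup>+\<omega>. F j (customers j \<omega>) \<partial>M)"
    by (intro indep_vars_nn_integral) auto
  also have "\<dots> = (\<Prod>j\<in>UNIV. \<integral>\<^sup>+u. F j u \<partial>PiM UNIV (\<lambda>_. customer_law j))"
    unfolding distr_customers[symmetric] by (intro prod.cong refl nn_integral_distr[symmetric]) auto
  finally show ?thesis .
qed

lemma AE_X_nonneg: "AE \<omega> in M. \<forall>s. 0 \<le> X s \<omega>"
proof -
  have e: "AE x in exp_law l. 0 \<le> x" if "0 < l" for l
    unfolding exp_law_def by (subst AE_density) (auto simp: exponential_density_def)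
  have "AE \<omega> in M. 0 \<le> X s \<omega>" for s
  proof -
    have "AE x in distr M borel (X s). 0 \<le> x"
      using e[OF lam_pos] e[OF nu_pos] B_nonneg S_nonneg
      by (cases s) (simp_all only: distr_interarrival distr_retrial service switch)
    then show ?thesis by (subst (asm) AE_distr_iff) auto
  qed
  moreover have "countable (UNIV :: 'n source set)"
  proof -
    have "UNIV = (\<Union>i. range (Interarrival i)) \<union> (\<Union>i. \<Union>n. range (Retrial i n)) \<union> (\<Union>m. range (Service m)) \<union> range (Switch :: nat \<Rightarrow> 'n source)"
    proof (intro set_eqI iffI UNIV_I)
      fix s :: "'n source"
      show "s \<in> (\<Union>i. range (Interarrival i)) \<union> (\<Union>i. \<Union>n. range (Retrial i n)) \<union> (\<Union>m. range (Service m)) \<union> range Switch"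
      proof (cases s)
        case (Interarrival i n)
        then have "s \<in> (\<Union>i. range (Interarrival i))" by (intro UN_I[of i] range_eqI[of _ _ n]) simp_all
        then show ?thesis by (intro UnI1)
      next
        case (Retrial i n k)
        then have "s \<in> (\<Union>i. \<Union>n. range (Retrial i n))"
          by (intro UN_I[of i] UN_I[of n] range_eqI[of _ _ k]) simp_all
        then show ?thesis by (intro UnI1[OF UnI1] UnI2)
      next
        case (Service m k)
        then have "s \<in> (\<Union>m. range (Service m))" by (intro UN_I[of m] range_eqI[of _ _ k]) simp_all
        then show ?thesis by (intro UnI1[OF UnI2])
      next
        case (Switch m)
        then have "s \<in> range Switch" by (intro range_eqI[of _ _ m])
        then show ?thesis by (intro UnI2)
      qed
    qed
    also have "countable \<dots>" by (intro countable_Un countable_UN countable_image) (auto intro: countable_finite)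
    finally show ?thesis .
  qed
  ultimately show ?thesis
    using AE_ball_countable[of "UNIV :: 'n source set" "\<lambda>\<omega> s. 0 \<le> X s \<omega>" M] by simp
qed

text \<open>The expectation of \<open>exp (- x)\<close> at the arrival time with index
  \<open>n\<close> is \<open>r ^ Suc n\<close>, which is summable. Hence these exponentials are
  almost surely summable and tend to 0. This makes the number of arrivals before any fixed time
  finite.\<close>

lemma AE_arrivals_unbounded: "AE \<omega> in M. \<forall>j. filterlim (\<lambda>n. \<Sum>l\<le>n. X (Interarrival j l) \<omega>) at_top sequentially"
proof -
  have "AE \<omega> in M. filterlim (\<lambda>n. \<Sum>l\<le>n. X (Interarrival j l) \<omega>) at_top sequentially" for j
  proof -
    define r where "r = lam j / (lam j + 1)"
    have r: "0 \<le> r" "r < 1" using lam_pos[of j] by (auto simp: r_def)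
    have one: "(\<integral>\<^sup>+\<omega>. ennreal (exp (- X (Interarrival j l) \<omega>)) \<partial>M) = ennreal r" for l
    proof -
      have "(\<integral>\<^sup>+\<omega>. ennreal (exp (- X (Interarrival j l) \<omega>)) \<partial>M) = (\<integral>\<^sup>+x. ennreal (exp (- (0 + x))) \<partial>exp_law (lam j))"
        unfolding distr_interarrival[of j l, symmetric] by (subst nn_integral_distr) auto
      also have "\<dots> = (\<integral>\<^sup>+s. indicator {0<..} s * ennreal (lam j * exp (- lam j * (s - 0))) * ennreal (exp (- s)) \<partial>lborel)"
        by (rule nn_integral_exp_law_shift[OF lam_pos]) simp
      also have "\<dots> = (\<integral>\<^sup>+s. ennreal r * (indicator {0<..} s * ennreal ((lam j + 1) * exp (- (lam j + 1) * (s - 0)))) \<partial>lborel)"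
      proof (intro nn_integral_cong)
        fix s
        have "lam j * exp (- lam j * (s - 0)) * exp (- s) = r * ((lam j + 1) * exp (- (lam j + 1) * (s - 0)))"
        proof -
          have "r * ((lam j + 1) * x) = lam j * x" for x using lam_pos[of j] by (simp add: r_def)
          moreover have "exp (- lam j * (s - 0)) * exp (- s) = exp (- (lam j + 1) * (s - 0))"
            by (simp add: exp_add[symmetric] algebra_simps)
          ultimately show ?thesis by (simp only: mult.assoc)
        qed
        then show "indicator {0<..} s * ennreal (lam j * exp (- lam j * (s - 0))) * ennreal (exp (- s))
          = ennreal r * (indicator {0<..} s * ennreal ((lam j + 1) * exp (- (lam j + 1) * (s - 0))))"
          using lam_pos[of j] r by (simp add: indicator_def ennreal_mult[symmetric])
      qed
      also have "\<dots> = ennreal r"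
        using lam_pos[of j] by (subst nn_integral_cmult, simp, subst nn_integral_exp_cutoff) auto
      finally show ?thesis .
    qed
    have E: "(\<integral>\<^sup>+\<omega>. ennreal (exp (- (\<Sum>l\<le>n. X (Interarrival j l) \<omega>))) \<partial>M) = ennreal (r ^ Suc n)" for n
    proof -
      have "indep_vars (\<lambda>_. borel) (\<lambda>l. X (Interarrival j l)) {..n}"
        by (rule indep_vars_inj[OF indep]) (auto simp: inj_on_def)
      then have "indep_vars (\<lambda>_. borel) (\<lambda>l \<omega>. ennreal (exp (- X (Interarrival j l) \<omega>))) {..n}"
        by (rule indep_vars_compose2) simp
      then have "(\<integral>\<^sup>+\<omega>. (\<Prod>l\<le>n. ennreal (exp (- X (Interarrival j l) \<omega>))) \<partial>M) = (\<Prod>l\<le>n. ennreal r)"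
        by (subst indep_vars_nn_integral) (auto simp: one)
      also have "(\<lambda>\<omega>. \<Prod>l\<le>n. ennreal (exp (- X (Interarrival j l) \<omega>))) = (\<lambda>\<omega>. ennreal (exp (- (\<Sum>l\<le>n. X (Interarrival j l) \<omega>))))"
        by (simp add: prod_ennreal exp_sum[symmetric] sum_negf)
      finally show ?thesis using r by (simp add: ennreal_power ennreal_mult)
    qed
    have "(\<integral>\<^sup>+\<omega>. (\<Sum>n. ennreal (exp (- (\<Sum>l\<le>n. X (Interarrival j l) \<omega>)))) \<partial>M) = (\<Sum>n. ennreal (r ^ Suc n))"
      by (subst nn_integral_suminf) (simp_all only: E, measurable)
    also have "\<dots> < \<infinity>"
    proof -
      have "summable (\<lambda>n. r ^ Suc n)" using r by (simp add: summable_mult)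
      then show ?thesis using r by (subst suminf_ennreal2) auto
    qed
    finally have "AE \<omega> in M. (\<Sum>n. ennreal (exp (- (\<Sum>l\<le>n. X (Interarrival j l) \<omega>)))) \<noteq> \<infinity>"
      by (intro nn_integral_PInf_AE) auto
    then show ?thesis
    proof eventually_elim
      fix \<omega> assume "(\<Sum>n. ennreal (exp (- (\<Sum>l\<le>n. X (Interarrival j l) \<omega>)))) \<noteq> \<infinity>"
      then have "summable (\<lambda>n. exp (- (\<Sum>l\<le>n. X (Interarrival j l) \<omega>)))"
        by (intro summable_suminf_not_top) auto
      then have "(\<lambda>n. exp (- (\<Sum>l\<le>n. X (Interarrival j l) \<omega>))) \<longlonglongrightarrow> 0"
        by (rule summable_LIMSEQ_zero)
      then have "\<forall>\<^sub>F n in sequentially. exp (- (\<Sum>l\<le>n. X (Interarrival j l) \<omega>)) < exp (- c)" for c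
        by (rule order_tendstoD) simp
      then show "filterlim (\<lambda>n. \<Sum>l\<le>n. X (Interarrival j l) \<omega>) at_top sequentially"
        unfolding filterlim_at_top_dense by simp
    qed
  qed
  then show ?thesis by (simp add: AE_all_countable)
qed

end

text \<open>The epochs of the server depend on the arrivals only through the numbers \<open>w l\<close> of customers served in
  the visits. Summing over all possible \<open>w\<close> (\<open>path_sum\<close>), with the epochs computed from \<open>w\<close>, decouples them
  from the arrival and retrial times; only the actual \<open>w\<close> contributes.\<close>

primrec path_sum :: "nat \<Rightarrow> ((nat \<Rightarrow> nat) \<Rightarrow> ennreal) \<Rightarrow> ennreal" where
  "path_sum 0 \<phi> = \<phi> (\<lambda>_. 0)"
| "path_sum (Suc m) \<phi> = path_sum m (\<lambda>w. \<Sum>k. \<phi> (w(m := k)))"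

lemma path_sum_nn_integral:
  assumes "\<And>w. (\<lambda>x. \<phi> w x) \<in> borel_measurable M"
  shows "(\<integral>\<^sup>+x. path_sum m (\<lambda>w. \<phi> w x) \<partial>M) = path_sum m (\<lambda>w. \<integral>\<^sup>+x. \<phi> w x \<partial>M)"
  using assms
proof (induction m arbitrary: \<phi>)
  case (Suc m)
  note [measurable] = Suc.prems
  have "(\<integral>\<^sup>+x. path_sum (Suc m) (\<lambda>w. \<phi> w x) \<partial>M) = path_sum m (\<lambda>w. \<integral>\<^sup>+x. (\<Sum>k. \<phi> (w(m := k)) x) \<partial>M)"
    unfolding path_sum.simps by (rule Suc.IH) measurable
  also have "\<dots> = path_sum (Suc m) (\<lambda>w. \<integral>\<^sup>+x. \<phi> w x \<partial>M)"
    by (simp add: nn_integral_suminf)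
  finally show ?case .
qed simp

lemma path_sum_cmult: "path_sum m (\<lambda>w. c * \<phi> w) = c * path_sum m \<phi>"
  by (induction m arbitrary: \<phi>) simp_all

section \<open>Server epochs along a prescribed path of batch sizes\<close>

definition path_time :: "('n::{finite,linorder} \<Rightarrow> real) \<Rightarrow> ('n source \<Rightarrow> real) \<Rightarrow> (nat \<Rightarrow> nat) \<Rightarrow> nat \<Rightarrow> real" where
  "path_time G x w m = (\<Sum>l<m. G (station l) + (\<Sum>k<w l. x (Service l k)) + x (Switch l))"

definition path_end :: "('n::{finite,linorder} \<Rightarrow> real) \<Rightarrow> ('n source \<Rightarrow> real) \<Rightarrow> (nat \<Rightarrow> nat) \<Rightarrow> nat \<Rightarrow> real" where
  "path_end G x w m = path_time G x w m + G (station m) + (\<Sum>k<w m. x (Service m k))"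

text \<open>No recursion on served sets: a customer counts as served once some attempt falls into an
  earlier glue period of its station. Along the actual path this agrees with the sample path
  recursion.\<close>

definition path_served :: "('n::{finite,linorder} \<Rightarrow> real) \<Rightarrow> ('n source \<Rightarrow> real) \<Rightarrow> (nat \<Rightarrow> nat) \<Rightarrow> nat \<Rightarrow> 'n \<Rightarrow> nat set" where
  "path_served G x w m j = {n. \<exists>l<m. station l = j \<and>
     (\<exists>k. attempt_time x j n k \<in> {path_time G x w l..<path_time G x w l + G j})}"

definition path_joined :: "('n::{finite,linorder} \<Rightarrow> real) \<Rightarrow> ('n source \<Rightarrow> real) \<Rightarrow> (nat \<Rightarrow> nat) \<Rightarrow> nat \<Rightarrow> nat set" where
  "path_joined G x w l = path_served G x w (Suc l) (station l) - path_served G x w l (station l)"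

lemma path_time_0[simp]: "path_time G x w 0 = 0"
  by (simp add: path_time_def)

lemma path_time_Suc: "path_time G x w (Suc m) = path_end G x w m + x (Switch m)"
  by (simp add: path_time_def path_end_def)

lemma path_time_cong:
  "(\<And>l. l < m \<Longrightarrow> w l = w' l) \<Longrightarrow> path_time G x w m = path_time G x w' m"
  by (simp add: path_time_def)

text \<open>Window \<open>l\<close> starts at \<open>path_time G x w l\<close>, which only sees the
  batch sizes of visits before \<open>l\<close>; the last window counted is
  \<open>m - 1\<close>.\<close>

lemma path_served_cong:
  assumes "\<And>l. Suc l < m \<Longrightarrow> w l = w' l"
  shows "path_served G x w m j = path_served G x w' m j"
proof -
  have "path_time G x w l = path_time G x w' l" if "l < m" for l
    by (rule path_time_cong) (use assms that in auto)
  then show ?thesis unfolding path_served_def by (metis (no_types, lifting))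
qed

text \<open>The batch found at visit \<open>m\<close> does not depend on the prescribed value
  \<open>w m\<close>. This makes the consistency equations
  \<open>card (path_joined G x w l) = w l\<close> solvable one visit at a time.\<close>

lemma path_joined_cong:
  assumes "\<And>l. l < m \<Longrightarrow> w l = w' l"
  shows "path_joined G x w m = path_joined G x w' m"
  unfolding path_joined_def using assms
  by (simp add: path_served_cong[of "Suc m" w w'] path_served_cong[of m w w'])

text \<open>As long as \<open>w\<close> predicts every batch size correctly, the total service time
  of each visit is right, and the explicit epochs follow the recursion of the server.\<close>

lemma glue_start_eq:
  assumes "\<And>l. l < m \<Longrightarrow> card (path_joined G x w l) = w l"
  shows "glue_start G x m = (path_time G x w m, path_served G x w m)"
  using assms
proof (induction m)
  case 0
  then show ?case by (simp add: path_time_def path_served_def[abs_def])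
next
  case (Suc m)
  let ?i = "station m :: 'a" and ?t = "path_time G x w m"
  have IH: "glue_start G x m = (?t, path_served G x w m)" using Suc by simp
  have W: "glued G x ?i ?t (path_served G x w m ?i) = path_joined G x w m"
    by (auto simp: glued_def path_joined_def path_served_def less_Suc_eq)
  have D: "(path_served G x w m)(?i := path_served G x w m ?i \<union> path_joined G x w m) = path_served G x w (Suc m)"
    by (rule ext) (auto simp: path_joined_def path_served_def less_Suc_eq)
  have "card (path_joined G x w m) = w m" using Suc.prems by simp
  then show ?case
    by (simp add: IH visit_end_from_def Let_def W D path_time_Suc path_end_def)
qed

lemma visit_end_eq:
  assumes "\<And>l. l < Suc m \<Longrightarrow> card (path_joined G x w l) = w l"
  shows "visit_end G x m = (path_end G x w m, path_served G x w (Suc m))"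
proof -
  let ?i = "station m :: 'a" and ?t = "path_time G x w m"
  have IH: "glue_start G x m = (?t, path_served G x w m)" using assms by (intro glue_start_eq) simp
  have W: "glued G x ?i ?t (path_served G x w m ?i) = path_joined G x w m"
    by (auto simp: glued_def path_joined_def path_served_def less_Suc_eq)
  have D: "(path_served G x w m)(?i := path_served G x w m ?i \<union> path_joined G x w m) = path_served G x w (Suc m)"
    by (rule ext) (auto simp: path_joined_def path_served_def less_Suc_eq)
  have "card (path_joined G x w m) = w m" using assms by simp
  then show ?thesis
    by (simp add: visit_end_def IH visit_end_from_def Let_def W D path_end_def)
qed

definition path_orbit :: "('n::{finite,linorder} \<Rightarrow> real) \<Rightarrow> ('n source \<Rightarrow> real) \<Rightarrow> (nat \<Rightarrow> nat) \<Rightarrow> nat \<Rightarrow> 'n \<Rightarrow> nat" where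
  "path_orbit G x w m j = card {n. arrival_time x j n \<le> path_end G x w m \<and> n \<notin> path_served G x w (Suc m) j}"

primrec actual_path :: "('n::{finite,linorder} \<Rightarrow> real) \<Rightarrow> ('n source \<Rightarrow> real) \<Rightarrow> nat \<Rightarrow> nat \<Rightarrow> nat" where
  "actual_path G x 0 = (\<lambda>_. 0)"
| "actual_path G x (Suc m) = (actual_path G x m)(m := card (path_joined G x (actual_path G x m) m))"

lemma actual_path_consistent: "l < m \<Longrightarrow> card (path_joined G x (actual_path G x m) l) = actual_path G x m l"
proof (induction m)
  case (Suc m)
  have "path_joined G x (actual_path G x (Suc m)) l = path_joined G x (actual_path G x m) l"
    by (rule path_joined_cong) (use Suc.prems in auto)
  note eq = this
  show ?case
  proof (cases "l = m")
    case True
    show ?thesis unfolding eq using True by simp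
  next
    case False
    then show ?thesis unfolding eq using Suc by simp
  qed
qed simp

text \<open>In the innermost sum over \<open>k\<close> exactly one term survives, the one with
  \<open>k\<close> equal to the batch size that the earlier entries of \<open>w\<close> determine;
  absorbing it into \<open>\<xi>\<close> leaves the statement for one visit fewer.\<close>

lemma path_sum_actual:
  "path_sum m (\<lambda>w. (\<Prod>l<m. of_bool (card (path_joined G x w l) = w l)) * \<xi> w) = \<xi> (actual_path G x m)"
proof (induction m arbitrary: \<xi>)
  case (Suc m)
  have j: "path_joined G x (w(m := k)) l = path_joined G x w l" if "l \<le> m" for w k l
    by (rule path_joined_cong) (use that in auto)
  have "(\<Sum>k. (\<Prod>l<Suc m. of_bool (card (path_joined G x (w(m := k)) l) = (w(m := k)) l)) * \<xi> (w(m := k)))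
    = (\<Prod>l<m. of_bool (card (path_joined G x w l) = w l)) * \<xi> (w(m := card (path_joined G x w m)))" for w
  proof -
    have "(\<Prod>l<Suc m. of_bool (card (path_joined G x (w(m := k)) l) = (w(m := k)) l)) * \<xi> (w(m := k))
      = (if k = card (path_joined G x w m) then (\<Prod>l<m. of_bool (card (path_joined G x w l) = w l)) * \<xi> (w(m := k)) else 0)" for k
    proof -
      have "(\<Prod>l<m. of_bool (card (path_joined G x (w(m := k)) l) = (w(m := k)) l)) = (\<Prod>l<m. of_bool (card (path_joined G x w l) = w l) :: ennreal)"
        by (intro prod.cong) (auto simp: j)
      then show ?thesis by (simp add: j)
    qed
    then show ?thesis
      using sums_single[of "card (path_joined G x w m)" "\<lambda>k. (\<Prod>l<m. of_bool (card (path_joined G x w l) = w l)) * \<xi> (w(m := k))"]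
      by (simp add: sums_iff)
  qed
  then show ?case using Suc.IH[of "\<lambda>w. \<xi> (w(m := card (path_joined G x w m)))"] by (simp add: fun_upd_def)
qed simp

lemma path_sum_in_system:
  "path_sum (Suc m) (\<lambda>w. (\<Prod>l<Suc m. of_bool (card (path_joined G x w l) = w l)) * h (path_orbit G x w m)) = h (in_system G x m)"
proof -
  have "visit_end G x m = (path_end G x (actual_path G x (Suc m)) m, path_served G x (actual_path G x (Suc m)) (Suc m))"
    by (rule visit_end_eq) (rule actual_path_consistent)
  then have "in_system G x m = path_orbit G x (actual_path G x (Suc m)) m"
    by (simp add: in_system_def path_orbit_def fun_eq_iff del: actual_path.simps)
  then show ?thesis
    using path_sum_actual[of "Suc m" G x "\<lambda>w. h (path_orbit G x w m)"] by simp
qed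

text \<open>Conditioning without conditional expectations: the sources in \<open>J\<close> may be
  read from an independent copy \<open>\<omega>'\<close> of the sample point, and the inner integral
  then treats them as constants.\<close>

lemma (in prob_space) nn_integral_split_sources:
  fixes X :: "'s \<Rightarrow> 'a \<Rightarrow> real"
  assumes ind: "indep_vars (\<lambda>_. borel) X UNIV" and F[measurable]: "F \<in> borel_measurable (PiM UNIV (\<lambda>_. borel))"
  shows "(\<integral>\<^sup>+\<omega>. F (\<lambda>s. X s \<omega>) \<partial>M) = (\<integral>\<^sup>+\<omega>'. \<integral>\<^sup>+\<omega>. F (\<lambda>s. if s \<in> J then X s \<omega>' else X s \<omega>) \<partial>M \<partial>M)"
proof -
  let ?P = "PiM J (\<lambda>_. borel) :: ('s \<Rightarrow> real) measure" and ?Q = "PiM (- J) (\<lambda>_. borel) :: ('s \<Rightarrow> real) measure"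
  let ?a = "\<lambda>\<omega>. restrict (\<lambda>i. X i \<omega>) J" and ?r = "\<lambda>\<omega>. restrict (\<lambda>i. X i \<omega>) (- J)"
  have X[measurable]: "X s \<in> borel_measurable M" for s using ind by (auto simp: indep_vars_def)
  have a[measurable]: "?a \<in> measurable M ?P" by (rule measurable_restrict) simp
  have r[measurable]: "?r \<in> measurable M ?Q" by (rule measurable_restrict) simp
  define H where "H p = F (\<lambda>s. if s \<in> J then fst p s else snd p s)" for p
  have H[measurable]: "H \<in> borel_measurable (?P \<Otimes>\<^sub>M ?Q)"
  proof -
    have "(\<lambda>p s. if s \<in> J then fst p s else snd p s) \<in> measurable (?P \<Otimes>\<^sub>M ?Q) (PiM UNIV (\<lambda>_. borel))"
    proof (rule measurable_PiM_single')
      fix s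
      show "(\<lambda>p. if s \<in> J then fst p s else snd p s) \<in> borel_measurable (?P \<Otimes>\<^sub>M ?Q)"
        by (cases "s \<in> J") (auto intro!: measurable_compose[OF measurable_fst measurable_component_singleton]
            measurable_compose[OF measurable_snd measurable_component_singleton])
    qed auto
    from measurable_compose[OF this F] show ?thesis by (simp add: H_def[abs_def])
  qed
  interpret Q: prob_space "distr M ?Q ?r" by (rule prob_space_distr) measurable
  have "(\<integral>\<^sup>+\<omega>. F (\<lambda>s. X s \<omega>) \<partial>M) = (\<integral>\<^sup>+\<omega>. H (?a \<omega>, ?r \<omega>) \<partial>M)"
    unfolding H_def by (intro nn_integral_cong arg_cong[where f = F]) auto
  also have "\<dots> = (\<integral>\<^sup>+p. H p \<partial>distr M (?P \<Otimes>\<^sub>M ?Q) (\<lambda>\<omega>. (?a \<omega>, ?r \<omega>)))"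
    by (subst nn_integral_distr) auto
  also have "distr M (?P \<Otimes>\<^sub>M ?Q) (\<lambda>\<omega>. (?a \<omega>, ?r \<omega>)) = distr M ?P ?a \<Otimes>\<^sub>M distr M ?Q ?r"
    using distr_pair_blocks[OF ind, of J "- J" "\<lambda>x. x" ?P "\<lambda>x. x" ?Q] by simp
  also have "(\<integral>\<^sup>+p. H p \<partial>(distr M ?P ?a \<Otimes>\<^sub>M distr M ?Q ?r)) = (\<integral>\<^sup>+a. \<integral>\<^sup>+r. H (a, r) \<partial>distr M ?Q ?r \<partial>distr M ?P ?a)"
    by (rule Q.nn_integral_fst[symmetric]) (simp cong: measurable_cong_sets sets_pair_measure_cong)
  also have "\<dots> = (\<integral>\<^sup>+\<omega>'. \<integral>\<^sup>+r. H (?a \<omega>', r) \<partial>distr M ?Q ?r \<partial>M)"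
    by (rule nn_integral_distr[OF a]) (rule Q.borel_measurable_nn_integral_fst, simp)
  also have "\<dots> = (\<integral>\<^sup>+\<omega>'. \<integral>\<^sup>+\<omega>. H (?a \<omega>', ?r \<omega>) \<partial>M \<partial>M)"
  proof (intro nn_integral_cong)
    fix \<omega>' assume "\<omega>' \<in> space M"
    then have "?a \<omega>' \<in> space ?P" using measurable_space[OF a] by blast
    then have "(\<lambda>r. H (?a \<omega>', r)) \<in> borel_measurable ?Q"
      by (intro measurable_compose[OF measurable_Pair1' H])
    then show "(\<integral>\<^sup>+r. H (?a \<omega>', r) \<partial>distr M ?Q ?r) = (\<integral>\<^sup>+\<omega>. H (?a \<omega>', ?r \<omega>) \<partial>M)"
      by (subst nn_integral_distr[OF r]) auto
  qed
  also have "\<dots> = (\<integral>\<^sup>+\<omega>'. \<integral>\<^sup>+\<omega>. F (\<lambda>s. if s \<in> J then X s \<omega>' else X s \<omega>) \<partial>M \<partial>M)"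
    unfolding H_def by (intro nn_integral_cong arg_cong[where f = F]) auto
  finally show ?thesis .
qed

section \<open>Joint generating function of the thinned counts\<close>

lemma prod_if_eq_power_card:
  "finite A \<Longrightarrow> (\<Prod>n\<in>A. if P n then c else 1) = c ^ card {n \<in> A. P n}"
  for c :: "'a::comm_monoid_mult"
  by (simp add: prod.inter_filter[symmetric])

lemma tendsto_prod_ennreal:
  assumes "\<And>i. i \<in> A \<Longrightarrow> (f i \<longlongrightarrow> ennreal (c i)) F"
  shows "((\<lambda>x. \<Prod>i\<in>A. f i x) \<longlongrightarrow> (\<Prod>i\<in>A. ennreal (c i))) F"
  using assms
proof (induction A rule: infinite_finite_induct)
  case (insert i A)
  have "(\<Prod>i\<in>A. ennreal (c i)) < \<top>" by (simp add: less_top[symmetric] ennreal_prod_eq_top)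
  then show ?case
    using insert by (auto intro!: tendsto_mult_ennreal)
qed simp_all

context glue_windows
begin

text \<open>The multiplicative counterpart of the additive definition: in this form the product over
  all customers collects each \<open>\<zeta> l\<close> to the power of a count.\<close>

lemma class_value_eq_prod:
  "class_value m \<zeta> z E a r = (\<Prod>l<m. if missed l a r \<and> \<not> missed (Suc l) a r then \<zeta> l else 1)
     * (if missed m a r \<and> a \<le> E then z else 1)"
proof (cases m a r rule: class_cases)
  case 1
  have "missed l a r" if "l \<le> m" for l using missed_antimono[OF that 1] .
  then have "(\<Prod>l<m. if missed l a r \<and> \<not> missed (Suc l) a r then \<zeta> l else 1) = 1"
    by (intro prod.neutral) (auto simp: Suc_le_eq)
  then show ?thesis using 1 by (simp add: class_value_missed)
next
  case (2 l)
  have nm: "\<not> missed m a r" using missed_antimono[of "Suc l" m a r] 2 by auto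
  have "(\<Prod>l<m. if missed l a r \<and> \<not> missed (Suc l) a r then \<zeta> l else 1) = (\<Prod>l'<m. if l' = l then \<zeta> l else 1)"
  proof (intro prod.cong refl)
    fix l' assume "l' \<in> {..<m}"
    consider "l' < l" | "l' = l" | "l < l'" by linarith
    then show "(if missed l' a r \<and> \<not> missed (Suc l') a r then \<zeta> l' else 1) = (if l' = l then \<zeta> l else 1)"
    proof cases
      case 1
      then show ?thesis using 2 missed_antimono[of "Suc l'" l a r] by auto
    next
      case 3
      then show ?thesis using 2 missed_antimono[of "Suc l" l' a r] by auto
    qed (use 2 in auto)
  qed
  then show ?thesis using 2 nm by (simp add: class_value_hit)
qed

text \<open>Attempts never precede the arrival, and all windows before \<open>m\<close> are over at
  \<open>E\<close>; so customers arriving after \<open>E\<close> contribute the factor 1.\<close>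

lemma class_value_late:
  assumes a: "E < a" and E: "\<And>l. l < m \<Longrightarrow> t l + (if own l then g else 0) \<le> E" and r: "\<And>k. 0 \<le> r k"
  shows "missed l a r \<or> m < l" "class_value m \<zeta> z E a r = 1"
proof -
  have *: "missed l a r" if "l \<le> m" for l
    unfolding missed_def
  proof
    fix k
    have "0 \<le> (\<Sum>i<k. r i)" by (intro sum_nonneg r)
    then have "E < a + (\<Sum>i<k. r i)" using a by linarith
    show "a + (\<Sum>i<k. r i) \<notin> window l"
    proof
      assume "a + (\<Sum>i<k. r i) \<in> window l"
      then obtain l' where "l' < l" "own l'" "a + (\<Sum>i<k. r i) < t l' + g" by (auto simp: window_def)
      then show False using E[of l'] that \<open>E < a + (\<Sum>i<k. r i)\<close> by simp
    qed
  qed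
  then show "missed l a r \<or> m < l" by (cases "l \<le> m") auto
  show "class_value m \<zeta> z E a r = 1" using *[of m] a by (simp add: class_value_missed)
qed

end

context driven_glue_system
begin

definition arr :: "'n \<Rightarrow> nat \<Rightarrow> 'a \<Rightarrow> real" where
  "arr j n \<omega> = (\<Sum>i\<le>n. fst (customers j \<omega> i))"

definition ret :: "'n \<Rightarrow> nat \<Rightarrow> 'a \<Rightarrow> nat \<Rightarrow> real" where
  "ret j n \<omega> = snd (customers j \<omega> n)"

text \<open>The value for each type is a Laplace functional by \<open>marked_points_laplace\<close>;
  the types are independent. The epochs \<open>t\<close> and \<open>E\<close> are constants here, so
  nothing couples them to the arrivals.\<close>

lemma class_counts_gf:
  fixes t :: "nat \<Rightarrow> real" and m l0 :: nat and E :: real and \<zeta> :: "nat \<Rightarrow> real" and z :: "'n \<Rightarrow> real"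
  assumes win: "\<And>j. glue_windows t (\<lambda>l. station l = j) (G j) (nu j)"
    and m: "m = Suc l0" and E: "t l0 + G (station l0) \<le> E"
    and \<zeta>: "\<And>l. 0 \<le> \<zeta> l \<and> \<zeta> l \<le> 1" and z: "\<And>j. 0 \<le> z j \<and> z j \<le> 1"
  defines "missed \<equiv> \<lambda>j. glue_windows.missed t (\<lambda>l. station l = j) (G j)"
  defines "mass \<equiv> \<lambda>j. glue_windows.missed_mass t (\<lambda>l. station l = j) (G j) (nu j)"
  defines "cnt \<equiv> \<lambda>l \<omega>. card {n. missed (station l) l (arr (station l) n \<omega>) (ret (station l) n \<omega>)
      \<and> \<not> missed (station l) (Suc l) (arr (station l) n \<omega>) (ret (station l) n \<omega>)}"
  defines "orb \<equiv> \<lambda>j \<omega>. card {n. missed j m (arr j n \<omega>) (ret j n \<omega>) \<and> arr j n \<omega> \<le> E}"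
  shows "(\<integral>\<omega>. (\<Prod>j\<in>UNIV. z j ^ orb j \<omega>) * (\<Prod>l<m. \<zeta> l ^ cnt l \<omega>) \<partial>M)
    = (\<Prod>j\<in>UNIV. exp (- (1 - z j) * (lam j * mass j m E)))
      * (\<Prod>l<m. exp (- (1 - \<zeta> l) * (lam (station l) * ((1 - exp (- nu (station l) * G (station l)))
          * mass (station l) l (t l) + G (station l)))))"
    and "\<And>l. cnt l \<in> measurable M (count_space UNIV)"
    and "\<And>j. orb j \<in> measurable M (count_space UNIV)"
proof -
  interpret W: glue_windows t "\<lambda>l. station l = j" "G j" "nu j" for j by (rule win)
  have missed[simp]: "W.missed j = missed j" for j by (simp add: missed_def)
  have mass[simp]: "W.missed_mass j = mass j" for j by (simp add: mass_def)
  let ?N = "\<lambda>j. PiM UNIV (\<lambda>_ :: nat. exp_law (nu j))"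
  let ?v = "\<lambda>j. W.class_value j m \<zeta> (z j) E"
  have ss: "sets (?N j) = sets seq_space" for j by (rule sets_PiM_cong) auto
  have vm0: "case_prod (?v j) \<in> borel_measurable (borel \<Otimes>\<^sub>M seq_space)" for j
    using W.class_value_measurable by simp
  have v01: "0 \<le> ?v j s r" "?v j s r \<le> 1" for j s r
    using W.class_value_bounds[of \<zeta> "z j"] \<zeta> z by auto
  have E': "t l0 + (if station l0 = j then G j else 0) \<le> E" for j
    using E G_pos[of "station l0"] by auto
  have El: "t l + (if station l = j then G j else 0) \<le> E" if "l < m" for l j
  proof (cases "l = l0")
    case False
    then have "t (Suc l) \<le> t l0" using that m by (intro W.t_mono) auto
    then show ?thesis using W.t_Suc[of l j] E G_pos[of "station l0"] by linarith
  qed (use E' in auto)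
  define F where "F k j u = (\<Prod>n<k. ennreal (?v j (\<Sum>i\<le>n. fst (u i)) (snd (u n))))"
    for k j and u :: "nat \<Rightarrow> real \<times> (nat \<Rightarrow> real)"
  have Fm[measurable]: "F k j \<in> borel_measurable (PiM UNIV (\<lambda>_. customer_space))" for k j
  proof -
    note [measurable] = vm0
    have "(\<lambda>u. ?v j (\<Sum>i\<le>n. fst (u i)) (snd (u n))) \<in> borel_measurable (PiM UNIV (\<lambda>_. customer_space))" for n
      by measurable
    then show ?thesis unfolding F_def[abs_def] by measurable
  qed
  let ?R = "\<lambda>j. exp (- (\<Sum>l<m. (1 - \<zeta> l) * (lam j * (if station l = j then (1 - exp (- nu j * G j)) * mass j l (t l) + G j else 0)))
        - (1 - z j) * (lam j * mass j m E))"
  have lim1: "(\<lambda>k. \<integral>\<^sup>+u. F k j u \<partial>PiM UNIV (\<lambda>_. customer_law j)) \<longlonglongrightarrow> ennreal (?R j)" for j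
  proof -
    interpret P: prob_space "exp_law (nu j)" by (rule prob_space_exp_law[OF nu_pos])
    have N: "prob_space (?N j)" by (rule prob_space_PiM) (rule prob_space_exp_law[OF nu_pos])
    have "case_prod (?v j) \<in> borel_measurable (borel \<Otimes>\<^sub>M ?N j)"
      using vm0[of j] by (subst measurable_cong_sets[OF sets_pair_measure_cong[OF refl ss] refl])
    from marked_points_laplace[OF N lam_pos[of j] this v01 W.class_value_survivor(2)[OF E' m lam_pos]]
    show ?thesis
      unfolding F_def customer_law_def W.class_value_survivor(1)[OF E' m lam_pos] mass by blast
  qed
  have "(\<lambda>k. \<Prod>j\<in>UNIV. \<integral>\<^sup>+u. F k j u \<partial>PiM UNIV (\<lambda>_. customer_law j)) \<longlonglongrightarrow> (\<Prod>j\<in>UNIV. ennreal (?R j))"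
    by (intro tendsto_prod_ennreal lim1)
  then have lim: "(\<lambda>k. \<integral>\<^sup>+\<omega>. (\<Prod>j\<in>UNIV. F k j (customers j \<omega>)) \<partial>M) \<longlonglongrightarrow> (\<Prod>j\<in>UNIV. ennreal (?R j))"
    by (simp add: nn_integral_customers_prod)
  have am[measurable]: "arr j n \<in> borel_measurable M" for j n
    unfolding arr_def[abs_def] by measurable
  have rm[measurable]: "ret j n \<in> measurable M seq_space" for j n
    unfolding ret_def[abs_def] by measurable
  have mm[measurable]: "Measurable.pred M (\<lambda>\<omega>. missed j l (arr j n \<omega>) (ret j n \<omega>))" for j l n
    using measurable_compose[OF measurable_Pair[OF am rm] W.missed_measurable[of j l]] by simp
  show cm[measurable]: "cnt l \<in> measurable M (count_space UNIV)" for l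
    unfolding cnt_def by measurable
  show om[measurable]: "orb j \<in> measurable M (count_space UNIV)" for j
    unfolding orb_def by measurable
  let ?I = "\<lambda>\<omega>. (\<Prod>j\<in>UNIV. z j ^ orb j \<omega>) * (\<Prod>l<m. \<zeta> l ^ cnt l \<omega>)"
  have I01: "0 \<le> ?I \<omega>" "?I \<omega> \<le> 1" for \<omega>
    using \<zeta> z by (auto intro!: mult_nonneg_nonneg prod_nonneg mult_le_one prod_le_1 power_le_one)
  have "(\<lambda>k. \<integral>\<^sup>+\<omega>. (\<Prod>j\<in>UNIV. F k j (customers j \<omega>)) \<partial>M) \<longlonglongrightarrow> (\<integral>\<^sup>+\<omega>. ennreal (?I \<omega>) \<partial>M)"
  proof (rule nn_integral_dominated_convergence[where w = "\<lambda>_. 1"])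
    show "(\<integral>\<^sup>+\<omega>. 1 \<partial>M) < \<infinity>" by (simp add: emeasure_space_1)
    show "AE \<omega> in M. (\<Prod>j\<in>UNIV. F k j (customers j \<omega>)) \<le> 1" for k
      unfolding F_def using v01 by (auto intro!: prod_le_1 simp: ennreal_le_1)
    show "AE \<omega> in M. (\<lambda>k. \<Prod>j\<in>UNIV. F k j (customers j \<omega>)) \<longlonglongrightarrow> ennreal (?I \<omega>)"
      using AE_X_nonneg AE_arrivals_unbounded
    proof eventually_elim
      case (elim \<omega>)
      have r: "0 \<le> ret j n \<omega> k" for j n k
        using elim(1) by (simp add: ret_def customers_def customer_def)
      have "\<forall>\<^sub>F n in sequentially. \<forall>j. E < arr j n \<omega>"
      proof (rule eventually_all_finite)
        fix j
        show "\<forall>\<^sub>F n in sequentially. E < arr j n \<omega>"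
          using elim(2) by (simp add: filterlim_at_top_dense arr_def customers_def customer_def)
      qed
      \<comment> \<open>Almost surely only customers with index below \<open>K\<close> arrive by
        time \<open>E\<close>. All other factors are 1, so the products are eventually constant in
        \<open>k\<close> and converge trivially.\<close>
      then obtain K where K: "\<And>n j. K \<le> n \<Longrightarrow> E < arr j n \<omega>"
        unfolding eventually_sequentially by blast
      have late: "?v j (arr j n \<omega>) (ret j n \<omega>) = 1" if "K \<le> n" for j n
        by (rule W.class_value_late(2)[OF K[OF that] El r])
      have late': "missed j l (arr j n \<omega>) (ret j n \<omega>)" if "K \<le> n" "l \<le> m" for j l n
        using W.class_value_late(1)[OF K[OF that(1)] El r, of m j l] that by auto
      have val: "F k j (customers j \<omega>) = ennreal (\<Prod>n<K. ?v j (arr j n \<omega>) (ret j n \<omega>))" if "K \<le> k" for k j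
      proof -
        have "F k j (customers j \<omega>) = ennreal (\<Prod>n<k. ?v j (arr j n \<omega>) (ret j n \<omega>))"
          unfolding F_def arr_def ret_def by (rule prod_ennreal) (use v01 in auto)
        also have "(\<Prod>n<k. ?v j (arr j n \<omega>) (ret j n \<omega>)) = (\<Prod>n<K. ?v j (arr j n \<omega>) (ret j n \<omega>))"
          by (rule prod.mono_neutral_right) (use that late in auto)
        finally show ?thesis .
      qed
      let ?c = "\<lambda>j l n. missed j l (arr j n \<omega>) (ret j n \<omega>) \<and> \<not> missed j (Suc l) (arr j n \<omega>) (ret j n \<omega>)"
      let ?o = "\<lambda>j n. missed j m (arr j n \<omega>) (ret j n \<omega>) \<and> arr j n \<omega> \<le> E"
      have P: "(\<Prod>n<K. ?v j (arr j n \<omega>) (ret j n \<omega>))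
        = (\<Prod>l<m. if station l = j then \<zeta> l ^ cnt l \<omega> else 1) * z j ^ orb j \<omega>" for j
      proof -
        have "n < K" if "l < m" "?c j l n" for l n
          using late'[of n "Suc l" j] that by (cases "K \<le> n") auto
        then have c: "{n \<in> {..<K}. ?c j l n} = {n. ?c j l n}" if "l < m" for l
          using that by blast
        have "n < K" if "?o j n" for n
          using K[of n j] that by (cases "K \<le> n") auto
        then have o: "{n \<in> {..<K}. ?o j n} = {n. ?o j n}"
          by blast
        \<comment> \<open>A window of another station leaves type \<open>j\<close> untouched, so
          each \<open>\<zeta> l\<close> is collected from the type of its own station only.\<close>
        have e: "{n. ?c j l n} = {}" if "station l \<noteq> j" for l
        proof -
          have "W.missed j (Suc l) a r = W.missed j l a r" for a r
            by (simp only: W.missed_def W.window_Suc that if_False)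
          then show ?thesis by auto
        qed
        have "(\<Prod>n<K. ?v j (arr j n \<omega>) (ret j n \<omega>))
          = (\<Prod>n<K. \<Prod>l<m. if ?c j l n then \<zeta> l else 1) * (\<Prod>n<K. if ?o j n then z j else 1)"
          unfolding W.class_value_eq_prod missed prod.distrib ..
        also have "(\<Prod>n<K. \<Prod>l<m. if ?c j l n then \<zeta> l else 1) = (\<Prod>l<m. \<Prod>n<K. if ?c j l n then \<zeta> l else 1)"
          by (rule prod.swap)
        also have "\<dots> = (\<Prod>l<m. if station l = j then \<zeta> l ^ cnt l \<omega> else 1)"
        proof (intro prod.cong refl)
          fix l assume l: "l \<in> {..<m}"
          have "(\<Prod>n<K. if ?c j l n then \<zeta> l else 1) = \<zeta> l ^ card {n. ?c j l n}"
            using l c[of l] by (simp add: prod_if_eq_power_card)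
          then show "(\<Prod>n<K. if ?c j l n then \<zeta> l else 1) = (if station l = j then \<zeta> l ^ cnt l \<omega> else 1)"
            using e[of l] by (cases "station l = j") (auto simp: cnt_def)
        qed
        also have "(\<Prod>n<K. if ?o j n then z j else 1) = z j ^ orb j \<omega>"
          unfolding orb_def by (subst prod_if_eq_power_card) (simp_all add: o[simplified])
        finally show ?thesis .
      qed
      have "(\<Prod>j\<in>UNIV. F k j (customers j \<omega>)) = ennreal (?I \<omega>)" if k: "K \<le> k" for k
      proof -
        have "(\<Prod>j\<in>UNIV. F k j (customers j \<omega>)) = ennreal (\<Prod>j\<in>UNIV. \<Prod>n<K. ?v j (arr j n \<omega>) (ret j n \<omega>))"
          unfolding val[OF k] by (rule prod_ennreal) (use v01 in \<open>auto intro!: prod_nonneg\<close>)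
        also have "(\<Prod>j\<in>UNIV. \<Prod>n<K. ?v j (arr j n \<omega>) (ret j n \<omega>))
           = (\<Prod>j\<in>(UNIV :: 'n set). \<Prod>l<m. if station l = j then \<zeta> l ^ cnt l \<omega> else 1) * (\<Prod>j\<in>UNIV. z j ^ orb j \<omega>)"
          by (simp only: P prod.distrib)
        also have "(\<Prod>j\<in>(UNIV :: 'n set). \<Prod>l<m. if station l = j then \<zeta> l ^ cnt l \<omega> else 1)
           = (\<Prod>l<m. \<Prod>j\<in>(UNIV :: 'n set). if station l = j then \<zeta> l ^ cnt l \<omega> else 1)"
          by (rule prod.swap)
        also have "\<dots> = (\<Prod>l<m. \<zeta> l ^ cnt l \<omega>)" by simp
        finally show ?thesis by (simp add: mult.commute)
      qed
      then show ?case
        by (intro tendsto_eventually eventually_sequentiallyI)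
    qed
  qed measurable
  then have "(\<integral>\<^sup>+\<omega>. ennreal (?I \<omega>) \<partial>M) = (\<Prod>j\<in>UNIV. ennreal (?R j))"
    using lim by (rule LIMSEQ_unique)
  also have "\<dots> = ennreal (\<Prod>j\<in>UNIV. ?R j)" by (rule prod_ennreal) simp
  finally have nn: "(\<integral>\<^sup>+\<omega>. ennreal (?I \<omega>) \<partial>M) = ennreal (\<Prod>j\<in>UNIV. ?R j)" .
  have "(\<integral>\<omega>. ?I \<omega> \<partial>M) = enn2real (\<integral>\<^sup>+\<omega>. ennreal (?I \<omega>) \<partial>M)"
    by (rule integral_eq_nn_integral) (use I01 in auto)
  also have "\<dots> = (\<Prod>j\<in>UNIV. ?R j)"
    unfolding nn by (rule enn2real_ennreal) (intro prod_nonneg ballI exp_ge_zero)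
  also have "(\<Prod>j\<in>UNIV. ?R j) = (\<Prod>j\<in>UNIV. exp (- (1 - z j) * (lam j * mass j m E)))
      * (\<Prod>l<m. exp (- (1 - \<zeta> l) * (lam (station l) * ((1 - exp (- nu (station l) * G (station l)))
          * mass (station l) l (t l) + G (station l)))))"
  proof -
    have "?R j = exp (- (1 - z j) * (lam j * mass j m E)) * (\<Prod>l<m. if station l = j then
        exp (- (1 - \<zeta> l) * (lam j * ((1 - exp (- nu j * G j)) * mass j l (t l) + G j))) else 1)" for j
    proof -
      have "(\<Prod>l<m. if station l = j then
        exp (- (1 - \<zeta> l) * (lam j * ((1 - exp (- nu j * G j)) * mass j l (t l) + G j))) else 1)
        = (\<Prod>l<m. exp (- ((1 - \<zeta> l) * (lam j * (if station l = j then (1 - exp (- nu j * G j)) * mass j l (t l) + G j else 0)))))"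
      proof (intro prod.cong refl)
        fix l
        show "(if station l = j then
            exp (- (1 - \<zeta> l) * (lam j * ((1 - exp (- nu j * G j)) * mass j l (t l) + G j))) else 1)
          = exp (- ((1 - \<zeta> l) * (lam j * (if station l = j then (1 - exp (- nu j * G j)) * mass j l (t l) + G j else 0))))"
          by (cases "station l = j")
             (simp_all only: mult_minus_left if_True if_False mult_zero_right minus_zero exp_zero simp_thms)
      qed
      also have "\<dots> = exp (- (\<Sum>l<m. (1 - \<zeta> l) * (lam j * (if station l = j then (1 - exp (- nu j * G j)) * mass j l (t l) + G j else 0))))"
        by (simp only: exp_sum[OF finite_lessThan, symmetric] sum_negf)
      finally show ?thesis
        by (simp only: exp_add[symmetric] mult_minus_left diff_conv_add_uminus add.commute)
    qed
    then have "(\<Prod>j\<in>UNIV. ?R j) = (\<Prod>j\<in>UNIV. exp (- (1 - z j) * (lam j * mass j m E)))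
      * (\<Prod>j\<in>UNIV. \<Prod>l<m. if station l = j then
        exp (- (1 - \<zeta> l) * (lam j * ((1 - exp (- nu j * G j)) * mass j l (t l) + G j))) else 1)"
      by (simp only: prod.distrib)
    also have "(\<Prod>j\<in>UNIV. \<Prod>l<m. if station l = j then
        exp (- (1 - \<zeta> l) * (lam j * ((1 - exp (- nu j * G j)) * mass j l (t l) + G j))) else 1)
      = (\<Prod>l<m. \<Prod>j\<in>UNIV. if station l = j then
        exp (- (1 - \<zeta> l) * (lam j * ((1 - exp (- nu j * G j)) * mass j l (t l) + G j))) else 1)"
      by (rule prod.swap)
    finally show ?thesis by (simp only: prod.delta finite_class.finite_UNIV UNIV_I if_True prod.delta')
  qed
  finally show "(\<integral>\<omega>. ?I \<omega> \<partial>M)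
    = (\<Prod>j\<in>UNIV. exp (- (1 - z j) * (lam j * mass j m E)))
      * (\<Prod>l<m. exp (- (1 - \<zeta> l) * (lam (station l) * ((1 - exp (- nu (station l) * G (station l)))
          * mass (station l) l (t l) + G (station l)))))" .
qed

end

text \<open>\<open>offspring\<close> and \<open>gate\<close> describe one visit backwards in time: with \<open>y = 1 - z\<close>, a customer present
  at the start of a glue period of \<open>i\<close> is replaced by its descendants, and the arrivals during the glue
  period give the factor \<open>gate\<close>.\<close>

definition lst :: "real measure \<Rightarrow> real \<Rightarrow> real" where
  "lst D c = (\<integral>x. exp (- c * x) \<partial>D)"

definition offspring :: "('n::finite \<Rightarrow> real) \<Rightarrow> ('n \<Rightarrow> real) \<Rightarrow> ('n \<Rightarrow> real) \<Rightarrow> ('n \<Rightarrow> real measure) \<Rightarrow>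
    'n \<Rightarrow> ('n \<Rightarrow> real) \<Rightarrow> 'n \<Rightarrow> real" where
  "offspring lam nu G B i y = y(i := exp (- nu i * G i) * y i
     + (1 - exp (- nu i * G i)) * (1 - lst (B i) (\<Sum>j\<in>UNIV. lam j * y j)))"

definition gate :: "('n::finite \<Rightarrow> real) \<Rightarrow> ('n \<Rightarrow> real) \<Rightarrow> ('n \<Rightarrow> real measure) \<Rightarrow> 'n \<Rightarrow> ('n \<Rightarrow> real) \<Rightarrow> real" where
  "gate lam G B i y = exp (- (G i * ((\<Sum>j\<in>UNIV. lam j * y j) - lam i * y i)
     + lam i * G i * (1 - lst (B i) (\<Sum>j\<in>UNIV. lam j * y j))))"

text \<open>The last of the \<open>m\<close> visits, together with the switch-over after it, is
  peeled off first. The value belongs to the start of the glue period of visit \<open>m\<close>; the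
  initial 1 is the empty system at time 0.\<close>

primrec back_prod :: "('n::{finite,linorder} \<Rightarrow> real) \<Rightarrow> ('n \<Rightarrow> real) \<Rightarrow> ('n \<Rightarrow> real) \<Rightarrow> ('n \<Rightarrow> real measure) \<Rightarrow>
    ('n \<Rightarrow> real measure) \<Rightarrow> nat \<Rightarrow> ('n \<Rightarrow> real) \<Rightarrow> real" where
  "back_prod lam nu G B S 0 y = 1"
| "back_prod lam nu G B S (Suc m) y = gate lam G B (station m) y
     * lst (S (station m)) (\<Sum>j\<in>UNIV. lam j * y j)
     * back_prod lam nu G B S m (offspring lam nu G B (station m) y)"

section \<open>Poisson means along a prescribed path\<close>

context driven_glue_system
begin

text \<open>The effect on the mean numbers of a glue period of \<open>i\<close> followed by service
  of total length \<open>s\<close>: arrivals of type \<open>i\<close> during the glue period stick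
  and are served, so type \<open>i\<close> only gains arrivals during the service.\<close>

definition serve :: "('n \<Rightarrow> real) \<Rightarrow> 'n \<Rightarrow> real \<Rightarrow> 'n \<Rightarrow> real" where
  "serve v i s j = (if j = i then exp (- nu j * G j) * v j + lam j * s else v j + lam j * (G i + s))"

text \<open>Given the service and switch-over times and the path \<open>w\<close>, the number of type \<open>j\<close> customers in orbit is
  Poisson with mean \<open>path_mass x w m j\<close>, and the number caught in glue period \<open>l\<close> with mean \<open>path_mean x w l\<close>;
  all these numbers are independent.\<close>

primrec path_mass :: "('n source \<Rightarrow> real) \<Rightarrow> (nat \<Rightarrow> nat) \<Rightarrow> nat \<Rightarrow> 'n \<Rightarrow> real" where
  "path_mass x w 0 = (\<lambda>_. 0)"
| "path_mass x w (Suc m) = (\<lambda>j. serve (path_mass x w m) (station m) (\<Sum>k<w m. x (Service m k)) j + lam j * x (Switch m))"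

definition path_mean :: "('n source \<Rightarrow> real) \<Rightarrow> (nat \<Rightarrow> nat) \<Rightarrow> nat \<Rightarrow> real" where
  "path_mean x w l = (1 - exp (- nu (station l) * G (station l))) * path_mass x w l (station l)
     + lam (station l) * G (station l)"

text \<open>The probability that the batch sizes follow \<open>w\<close> when the service and
  switch-over times are frozen. It is a product although later epochs depend on earlier batches,
  because \<open>w\<close> is prescribed.\<close>

definition path_weight :: "('n source \<Rightarrow> real) \<Rightarrow> (nat \<Rightarrow> nat) \<Rightarrow> nat \<Rightarrow> ennreal" where
  "path_weight x w m = (\<Prod>l<m. ennreal (poisson_weight (path_mean x w l) (w l)))"

lemma path_mass_measurable[measurable]: "(\<lambda>x. path_mass x w m j) \<in> borel_measurable (PiM UNIV (\<lambda>_. borel))"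
proof (induction m arbitrary: j)
  case (Suc m)
  note [measurable] = Suc
  show ?case unfolding path_mass.simps serve_def by (cases "j = station m") simp_all
qed simp

lemma path_weight_measurable[measurable]: "(\<lambda>x. path_weight x w m) \<in> borel_measurable (PiM UNIV (\<lambda>_. borel))"
  unfolding path_weight_def poisson_weight_def path_mean_def by measurable

lemma path_mass_nonneg:
  assumes "\<And>s. 0 \<le> x s"
  shows "0 \<le> path_mass x w m j"
  using lam_pos G_pos by (induction m arbitrary: j)
    (auto simp: serve_def assms less_imp_le intro!: add_nonneg_nonneg mult_nonneg_nonneg sum_nonneg)

lemma p_nonneg: "0 \<le> 1 - exp (- nu j * G j)"
  using nu_pos[of j] G_pos[of j] by simp

lemma path_mean_nonneg:
  assumes "\<And>s. 0 \<le> x s"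
  shows "0 \<le> path_mean x w l"
  unfolding path_mean_def using lam_pos G_pos
  by (intro add_nonneg_nonneg mult_nonneg_nonneg path_mass_nonneg p_nonneg assms) (auto simp: less_imp_le)

lemma path_time_Suc_ge:
  assumes "\<And>s. 0 \<le> x s"
  shows "path_time G x w l + G (station l) \<le> path_end G x w l" "path_end G x w l \<le> path_time G x w (Suc l)"
  using assms by (auto simp: path_time_Suc path_end_def intro!: sum_nonneg)

lemma path_windows:
  assumes x: "\<And>s. 0 \<le> x s"
  shows "glue_windows (path_time G x w) (\<lambda>l. station l = j) (G j) (nu j)"
proof
  show "path_time G x w l + (if station l = j then G j else 0) \<le> path_time G x w (Suc l)" for l
    using path_time_Suc_ge[of x w l, OF x] G_pos[of "station l"] by auto
qed (use G_pos nu_pos in auto)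

text \<open>\<open>missed_mass_Suc\<close> is evaluated at the two relevant times, the start of the
  next glue period and the end of the visit; multiplied by the arrival rate it becomes the recursion
  of \<open>path_mass\<close>.\<close>

lemma path_mass_eq:
  fixes x :: "'n source \<Rightarrow> real" and w :: "nat \<Rightarrow> nat"
  assumes x: "\<And>s. 0 \<le> x s"
  defines "mass \<equiv> \<lambda>j. glue_windows.missed_mass (path_time G x w) (\<lambda>l. station l = j) (G j) (nu j)"
  shows "lam j * mass j m (path_time G x w m) = path_mass x w m j"
    and "lam j * mass j (Suc m) (path_end G x w m) = serve (path_mass x w m) (station m) (\<Sum>k<w m. x (Service m k)) j"
proof -
  interpret W: glue_windows "path_time G x w" "\<lambda>l. station l = j" "G j" "nu j" for j by (rule path_windows[OF x])
  have mass: "mass j = W.missed_mass j" for j by (simp add: mass_def)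
  have le: "path_time G x w m + (if station m = j then G j else 0) \<le> path_end G x w m" for m j
    using path_time_Suc_ge(1)[of x w m, OF x] G_pos[of "station m"] by auto
  have le': "path_time G x w m + (if station m = j then G j else 0) \<le> path_time G x w (Suc m)" for m j
    using le[of m j] path_time_Suc_ge(2)[of x w m, OF x] by linarith
  have 1: "lam j * mass j m (path_time G x w m) = path_mass x w m j" for m j
  proof (induction m)
    case 0
    then show ?case by (simp add: mass)
  next
    case (Suc m)
    then show ?case
      unfolding mass W.missed_mass_Suc[OF le']
      by (auto simp: mass path_time_Suc path_end_def serve_def algebra_simps)
  qed
  then show "lam j * mass j m (path_time G x w m) = path_mass x w m j" .
  show "lam j * mass j (Suc m) (path_end G x w m) = serve (path_mass x w m) (station m) (\<Sum>k<w m. x (Service m k)) j"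
    using 1[of j m] unfolding mass W.missed_mass_Suc[OF le]
    by (auto simp: path_end_def serve_def algebra_simps)
qed

lemma path_time_measurable[measurable]: "(\<lambda>x. path_time G x w m) \<in> borel_measurable (PiM UNIV (\<lambda>_. borel))"
  unfolding path_time_def by measurable

lemma path_end_measurable[measurable]: "(\<lambda>x. path_end G x w m) \<in> borel_measurable (PiM UNIV (\<lambda>_. borel))"
  unfolding path_end_def by measurable

lemma attempt_time_measurable[measurable]:
  "(\<lambda>x. attempt_time x j n k) \<in> borel_measurable (PiM UNIV (\<lambda>_. borel))" for j :: 'n
  unfolding attempt_time_def arrival_time_def by measurable

lemma arrival_time_measurable[measurable]:
  "(\<lambda>x. arrival_time x j n) \<in> borel_measurable (PiM UNIV (\<lambda>_. borel))" for j :: 'n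
  unfolding arrival_time_def by measurable

lemma path_served_measurable[measurable]:
  "Measurable.pred (PiM UNIV (\<lambda>_. borel)) (\<lambda>x. n \<in> path_served G x w m j)"
proof (induction m)
  case 0
  show ?case by (simp add: path_served_def)
next
  case (Suc m)
  note [measurable] = Suc
  have a: "Measurable.pred (PiM UNIV (\<lambda>_. borel)) (\<lambda>x. path_time G x w m \<le> attempt_time x j n k)" for k
    unfolding pred_def by (rule borel_measurable_le[OF path_time_measurable attempt_time_measurable])
  have b: "Measurable.pred (PiM UNIV (\<lambda>_. borel)) (\<lambda>x. attempt_time x j n k < path_time G x w m + G j)" for k
    by (rule borel_measurable_pred_less[OF attempt_time_measurable
          borel_measurable_add[OF path_time_measurable borel_measurable_const]])
  have [measurable]: "Measurable.pred (PiM UNIV (\<lambda>_. borel))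
      (\<lambda>x. \<exists>k. path_time G x w m \<le> attempt_time x j n k \<and> attempt_time x j n k < path_time G x w m + G j)"
    by (intro pred_intros_countable pred_intros_logic a b)
  have "(\<lambda>x. n \<in> path_served G x w (Suc m) j) = (\<lambda>x. n \<in> path_served G x w m j \<or> (station m = j \<and>
      (\<exists>k. path_time G x w m \<le> attempt_time x j n k \<and> attempt_time x j n k < path_time G x w m + G j)))"
    by (auto simp: path_served_def less_Suc_eq fun_eq_iff)
  also have "Measurable.pred (PiM UNIV (\<lambda>_. borel)) \<dots>"
    by (cases "station m = j") simp_all
  finally show ?case .
qed

lemma path_counts_measurable[measurable]:
  "(\<lambda>x. card (path_joined G x w l)) \<in> measurable (PiM UNIV (\<lambda>_. borel)) (count_space UNIV)"
  "(\<lambda>x. path_orbit G x w m j) \<in> measurable (PiM UNIV (\<lambda>_. borel)) (count_space UNIV)"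
proof -
  have [measurable]: "Measurable.pred (PiM UNIV (\<lambda>_. borel)) (\<lambda>x. n \<in> path_joined G x w l)" for n
    unfolding path_joined_def Diff_iff by measurable
  show "(\<lambda>x. card (path_joined G x w l)) \<in> measurable (PiM UNIV (\<lambda>_. borel)) (count_space UNIV)"
    by measurable
  have [measurable]: "Measurable.pred (PiM UNIV (\<lambda>_. borel)) (\<lambda>x. n \<in> {n. arrival_time x j n \<le> path_end G x w m \<and> n \<notin> path_served G x w (Suc m) j})" for n
  proof -
    have a: "Measurable.pred (PiM UNIV (\<lambda>_. borel)) (\<lambda>x. arrival_time x j n \<le> path_end G x w m)"
      unfolding pred_def by (rule borel_measurable_le[OF arrival_time_measurable path_end_measurable])
    show ?thesis
      unfolding mem_Collect_eq by (intro pred_intros_logic a path_served_measurable)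
  qed
  show "(\<lambda>x. path_orbit G x w m j) \<in> measurable (PiM UNIV (\<lambda>_. borel)) (count_space UNIV)"
    unfolding path_orbit_def by measurable
qed

lemma X_all_measurable[measurable]: "(\<lambda>\<omega> s. X s \<omega>) \<in> measurable M (PiM UNIV (\<lambda>_. borel))"
proof (rule measurable_PiM_single')
  show "(\<lambda>\<omega> s. X s \<omega>) \<in> space M \<rightarrow> (\<Pi>\<^sub>E i\<in>UNIV. space borel)" by simp
qed (rule X_measurable)

text \<open>Freeze the service and switch-over times. The epochs along \<open>w\<close> become
  constants, the batch counts become Poisson counts independent of the orbit numbers, and the
  consistency indicators turn into Poisson weights.\<close>

lemma path_law:
  assumes z: "\<And>j. 0 \<le> z j \<and> z j \<le> 1"
  shows "(\<integral>\<^sup>+\<omega>. (\<Prod>l<Suc m. of_bool (card (path_joined G (\<lambda>s. X s \<omega>) w l) = w l))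
        * ennreal (\<Prod>j\<in>UNIV. z j ^ path_orbit G (\<lambda>s. X s \<omega>) w m j) \<partial>M)
    = (\<integral>\<^sup>+\<omega>. path_weight (\<lambda>s. X s \<omega>) w (Suc m) * ennreal (exp (- (\<Sum>j\<in>UNIV. (1 - z j)
        * serve (path_mass (\<lambda>s. X s \<omega>) w m) (station m) (\<Sum>k<w m. X (Service m k) \<omega>) j))) \<partial>M)"
proof -
  \<comment> \<open>The sources that determine the epochs of a prescribed path; arrivals and
    retrials stay outside and are integrated in the inner integral.\<close>
  define J :: "'n source set" where "J = {s. case s of Service _ _ \<Rightarrow> True | Switch _ \<Rightarrow> True | _ \<Rightarrow> False}"
  have J[simp]: "Service m k \<in> J" "Switch m \<in> J" "Interarrival j m \<notin> J" "Retrial j m k \<notin> J" for m k and j :: 'n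
    by (simp_all add: J_def)
  let ?F = "\<lambda>x. (\<Prod>l<Suc m. of_bool (card (path_joined G x w l) = w l)) * ennreal (\<Prod>j\<in>UNIV. z j ^ path_orbit G x w m j)"
  have F: "?F \<in> borel_measurable (PiM UNIV (\<lambda>_. borel))"
    by measurable
  have "(\<integral>\<^sup>+\<omega>. ?F (\<lambda>s. X s \<omega>) \<partial>M) = (\<integral>\<^sup>+\<omega>'. \<integral>\<^sup>+\<omega>. ?F (\<lambda>s. if s \<in> J then X s \<omega>' else X s \<omega>) \<partial>M \<partial>M)"
    by (rule nn_integral_split_sources[OF indep F])
  also have "\<dots> = (\<integral>\<^sup>+\<omega>'. path_weight (\<lambda>s. X s \<omega>') w (Suc m) * ennreal (exp (- (\<Sum>j\<in>UNIV. (1 - z j)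
        * serve (path_mass (\<lambda>s. X s \<omega>') w m) (station m) (\<Sum>k<w m. X (Service m k) \<omega>') j))) \<partial>M)"
  proof (rule nn_integral_cong_AE)
    show "AE \<omega>' in M. (\<integral>\<^sup>+\<omega>. ?F (\<lambda>s. if s \<in> J then X s \<omega>' else X s \<omega>) \<partial>M)
      = path_weight (\<lambda>s. X s \<omega>') w (Suc m) * ennreal (exp (- (\<Sum>j\<in>UNIV. (1 - z j)
        * serve (path_mass (\<lambda>s. X s \<omega>') w m) (station m) (\<Sum>k<w m. X (Service m k) \<omega>') j)))"
      using AE_X_nonneg
    proof eventually_elim
      case (elim \<omega>')
      define x where "x s = X s \<omega>'" for s
      have x: "0 \<le> x s" for s using elim by (simp add: x_def)
      let ?t = "path_time G x w" and ?E = "path_end G x w m"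
      define y where "y \<omega> = (\<lambda>s. if s \<in> J then x s else X s \<omega>)" for \<omega>
      interpret W: glue_windows ?t "\<lambda>l. station l = j" "G j" "nu j" for j by (rule path_windows[OF x])
      have tE: "?t m + G (station m) \<le> ?E" by (rule path_time_Suc_ge(1)[of x w m, OF x])
      have t: "path_time G (y \<omega>) w l = ?t l" "path_end G (y \<omega>) w m = ?E" for \<omega> l
        by (simp_all add: path_time_def path_end_def y_def)
      have arr: "arrival_time (y \<omega>) j n = arr j n \<omega>" for \<omega> j n
        by (simp add: arrival_time_def y_def arr_def customers_def customer_def)
      have att: "attempt_time (y \<omega>) j n k = arr j n \<omega> + (\<Sum>i<k. ret j n \<omega> i)" for \<omega> j n k
        unfolding attempt_time_def arr by (simp add: y_def ret_def customers_def customer_def)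
      have served: "path_served G (y \<omega>) w l j = {n. \<not> W.missed j l (arr j n \<omega>) (ret j n \<omega>)}" for \<omega> l j
        unfolding path_served_def W.missed_def W.window_def t att by auto
      let ?cnt = "\<lambda>l \<omega>. card {n. W.missed (station l) l (arr (station l) n \<omega>) (ret (station l) n \<omega>)
          \<and> \<not> W.missed (station l) (Suc l) (arr (station l) n \<omega>) (ret (station l) n \<omega>)}"
      let ?orb = "\<lambda>j \<omega>. card {n. W.missed j (Suc m) (arr j n \<omega>) (ret j n \<omega>) \<and> arr j n \<omega> \<le> ?E}"
      have joined: "card (path_joined G (y \<omega>) w l) = ?cnt l \<omega>" for \<omega> l
        unfolding path_joined_def served by (intro arg_cong[where f = card]) auto
      have orbit: "path_orbit G (y \<omega>) w m j = ?orb j \<omega>" for \<omega> j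
        unfolding path_orbit_def served arr t by (intro arg_cong[where f = card]) auto
      let ?K = "\<Prod>j\<in>UNIV. exp (- (1 - z j) * (lam j * W.missed_mass j (Suc m) ?E))"
      let ?\<mu> = "\<lambda>l. lam (station l) * ((1 - exp (- nu (station l) * G (station l)))
          * W.missed_mass (station l) l (?t l) + G (station l))"
      have m1: "?cnt l \<in> measurable M (count_space UNIV)" for l
        using class_counts_gf(2)[OF path_windows[OF x] refl tE, of "\<lambda>_. 0" "\<lambda>_. 0"] by simp
      have m2[measurable]: "?orb j \<in> measurable M (count_space UNIV)" for j
        using class_counts_gf(3)[OF path_windows[OF x] refl tE, of "\<lambda>_. 0" "\<lambda>_. 0"] by simp
      note m1[measurable]
      have Z01: "0 \<le> (\<Prod>j\<in>UNIV. z j ^ ?orb j \<omega>)" "(\<Prod>j\<in>UNIV. z j ^ ?orb j \<omega>) \<le> 1" for \<omega>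
        using z by (auto intro!: prod_nonneg prod_le_1 power_le_one)
      have "expectation (\<lambda>\<omega>. (\<Prod>j\<in>UNIV. z j ^ ?orb j \<omega>) * (\<Prod>l<Suc m. of_bool (?cnt l \<omega> = w l)))
        = ?K * (\<Prod>l<Suc m. poisson_weight (?\<mu> l) (w l))"
      \<comment> \<open>The orbit factor plays the role of \<open>Z\<close>: only the batch counts
        are to be fixed, while the orbit numbers remain in the generating function.\<close>
      proof (rule poisson_coefficients)
        fix \<zeta> :: "nat \<Rightarrow> real" assume \<zeta>: "\<And>c. 0 \<le> \<zeta> c \<and> \<zeta> c \<le> 1"
        show "expectation (\<lambda>\<omega>. (\<Prod>j\<in>UNIV. z j ^ ?orb j \<omega>) * (\<Prod>l<Suc m. \<zeta> l ^ ?cnt l \<omega>))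
          = ?K * (\<Prod>l<Suc m. exp (- (1 - \<zeta> l) * ?\<mu> l))"
          by (rule class_counts_gf(1)[OF path_windows[OF x] refl tE \<zeta> z])
      qed (use Z01 in \<open>auto intro: m1\<close>)
      then have e: "expectation (\<lambda>\<omega>. (\<Prod>j\<in>UNIV. z j ^ ?orb j \<omega>) * (\<Prod>l<Suc m. of_bool (?cnt l \<omega> = w l)))
        = ?K * (\<Prod>l<Suc m. poisson_weight (path_mean x w l) (w l))"
      proof -
        have "?\<mu> l = path_mean x w l" for l
          unfolding path_mean_def path_mass_eq(1)[OF x, symmetric] by (simp add: algebra_simps)
        then show ?thesis using \<open>expectation _ = _\<close> by simp
      qed
      have K: "?K = exp (- (\<Sum>j\<in>UNIV. (1 - z j) * serve (path_mass x w m) (station m) (\<Sum>k<w m. x (Service m k)) j))"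
        unfolding path_mass_eq(2)[OF x] exp_sum[OF finite_class.finite_UNIV, symmetric] sum_negf[symmetric] mult_minus_left ..
      have "(\<integral>\<^sup>+\<omega>. ?F (y \<omega>) \<partial>M)
        = (\<integral>\<^sup>+\<omega>. ennreal ((\<Prod>j\<in>UNIV. z j ^ ?orb j \<omega>) * (\<Prod>l<Suc m. of_bool (?cnt l \<omega> = w l))) \<partial>M)"
      proof (intro nn_integral_cong)
        fix \<omega>
        have "(\<Prod>l<Suc m. of_bool (?cnt l \<omega> = w l) :: ennreal) = ennreal (\<Prod>l<Suc m. of_bool (?cnt l \<omega> = w l))"
          by (subst prod_ennreal[symmetric]) (auto intro!: prod.cong)
        then show "?F (y \<omega>) = ennreal ((\<Prod>j\<in>UNIV. z j ^ ?orb j \<omega>) * (\<Prod>l<Suc m. of_bool (?cnt l \<omega> = w l)))"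
          unfolding joined orbit using Z01[of \<omega>] by (simp only: ennreal_mult' mult.commute)
      qed
      also have "\<dots> = ennreal (expectation (\<lambda>\<omega>. (\<Prod>j\<in>UNIV. z j ^ ?orb j \<omega>) * (\<Prod>l<Suc m. of_bool (?cnt l \<omega> = w l))))"
      proof (rule nn_integral_eq_integral)
        have le: "(\<Prod>j\<in>UNIV. z j ^ ?orb j \<omega>) * (\<Prod>l<Suc m. of_bool (?cnt l \<omega> = w l)) \<le> 1" for \<omega>
          using Z01[of \<omega>] by (intro mult_le_one) (auto intro!: prod_nonneg prod_le_1 simp del: prod.lessThan_Suc)
        have ge: "0 \<le> (\<Prod>j\<in>UNIV. z j ^ ?orb j \<omega>) * (\<Prod>l<Suc m. of_bool (?cnt l \<omega> = w l))" for \<omega>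
          using Z01[of \<omega>] by (intro mult_nonneg_nonneg) (auto intro!: prod_nonneg simp del: prod.lessThan_Suc)
        show "integrable M (\<lambda>\<omega>. (\<Prod>j\<in>UNIV. z j ^ ?orb j \<omega>) * (\<Prod>l<Suc m. of_bool (?cnt l \<omega> = w l)))"
          by (rule integrable_const_bound[where B = 1])
             (use le ge in \<open>auto simp del: prod.lessThan_Suc simp: abs_of_nonneg\<close>)
        show "AE \<omega> in M. 0 \<le> (\<Prod>j\<in>UNIV. z j ^ ?orb j \<omega>) * (\<Prod>l<Suc m. of_bool (?cnt l \<omega> = w l))"
          using ge by blast
      qed
      also have "\<dots> = path_weight x w (Suc m) * ennreal ?K"
      proof -
        have "path_weight x w (Suc m) = ennreal (\<Prod>l<Suc m. poisson_weight (path_mean x w l) (w l))"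
          unfolding path_weight_def
          by (rule prod_ennreal) (intro poisson_weight_nonneg path_mean_nonneg x)
        moreover have "0 \<le> ?K" by (intro prod_nonneg) simp
        ultimately show ?thesis unfolding e by (simp only: ennreal_mult'' mult.commute)
      qed
      also note K
      finally show ?case unfolding y_def x_def by simp
    qed
  qed
  finally show ?thesis .
qed

end

lemma suminf_poisson_weight:
  assumes "0 \<le> \<mu>" "0 \<le> x"
  shows "(\<Sum>k. ennreal (poisson_weight \<mu> k) * ennreal x ^ k) = ennreal (exp (- (1 - x) * \<mu>))"
proof -
  have "(\<Sum>k. ennreal (poisson_weight \<mu> k) * ennreal x ^ k) = (\<Sum>k. ennreal (poisson_weight \<mu> k * x ^ k))"
    using assms by (simp add: ennreal_mult poisson_weight_nonneg ennreal_power)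
  also have "\<dots> = ennreal (exp (- (1 - x) * \<mu>))"
    using assms poisson_weight_sums[of \<mu> x]
    by (subst suminf_ennreal2) (auto simp: sums_iff intro!: mult_nonneg_nonneg poisson_weight_nonneg)
  finally show ?thesis .
qed

section \<open>Summation over the batch sizes, visit by visit\<close>

context driven_glue_system
begin

lemma path_mass_cong:
  "(\<And>l. l < m \<Longrightarrow> w l = w' l) \<Longrightarrow> path_mass x w m = path_mass x w' m"
  by (induction m) simp_all

lemma path_weight_Suc_upd:
  "path_weight x (w(m := k)) (Suc m) = path_weight x w m * ennreal (poisson_weight (path_mean x w m) k)"
proof -
  have "path_mass x (w(m := k)) l = path_mass x w l" if "l \<le> m" for l
    by (rule path_mass_cong) (use that in auto)
  then show ?thesis
    unfolding path_weight_def path_mean_def by (auto intro!: arg_cong2[where f = "(*)"] prod.cong)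
qed

lemma nn_integral_exp_source:
  assumes c: "0 \<le> c"
  shows "(\<integral>\<^sup>+\<omega>. ennreal (exp (- c * X (Service m k) \<omega>)) \<partial>M) = ennreal (lst (B (station m)) c)"
    and "(\<integral>\<^sup>+\<omega>. ennreal (exp (- c * X (Switch m) \<omega>)) \<partial>M) = ennreal (lst (S (station m)) c)"
proof -
  have *: "(\<integral>\<^sup>+\<omega>. ennreal (exp (- c * X s \<omega>)) \<partial>M) = ennreal (lst (distr M borel (X s)) c)" for s
  proof -
    have "AE \<omega> in M. norm (exp (- c * X s \<omega>)) \<le> 1"
      using AE_X_nonneg by eventually_elim (use c in auto)
    then have "integrable M (\<lambda>\<omega>. exp (- c * X s \<omega>))"
      by (intro integrable_const_bound[where B = 1]) auto
    then show ?thesis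
      unfolding lst_def by (subst integral_distr) (auto intro!: nn_integral_eq_integral)
  qed
  show "(\<integral>\<^sup>+\<omega>. ennreal (exp (- c * X (Service m k) \<omega>)) \<partial>M) = ennreal (lst (B (station m)) c)"
    using *[of "Service m k"] unfolding service .
  show "(\<integral>\<^sup>+\<omega>. ennreal (exp (- c * X (Switch m) \<omega>)) \<partial>M) = ennreal (lst (S (station m)) c)"
    using *[of "Switch m"] unfolding switch .
qed

lemma lst_bounds:
  assumes "0 \<le> c"
  shows "0 \<le> lst (B (station m)) c" "lst (B (station m)) c \<le> 1" "0 \<le> lst (S (station m)) c" "lst (S (station m)) c \<le> 1"
proof -
  have le: "(\<integral>\<^sup>+\<omega>. ennreal (exp (- c * X s \<omega>)) \<partial>M) \<le> 1" for s
  proof -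
    have "(\<integral>\<^sup>+\<omega>. ennreal (exp (- c * X s \<omega>)) \<partial>M) \<le> (\<integral>\<^sup>+\<omega>. 1 \<partial>M)"
      using AE_X_nonneg by (intro nn_integral_mono_AE) (auto elim!: eventually_mono simp: ennreal_le_1 assms)
    then show ?thesis by (simp add: emeasure_space_1)
  qed
  show "0 \<le> lst (B (station m)) c" "0 \<le> lst (S (station m)) c"
    unfolding lst_def by (auto intro!: integral_nonneg_AE)
  show "lst (B (station m)) c \<le> 1" "lst (S (station m)) c \<le> 1"
    using le[of "Service m 0"] le[of "Switch m"] nn_integral_exp_source[OF assms, of m] by (auto simp: ennreal_le_1)
qed

lemma serve_split: "serve v i s j = serve v i 0 j + lam j * s"
  by (simp add: serve_def algebra_simps)

text \<open>Pure bookkeeping of exponents. Each customer of a batch yields the factor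
  \<open>lst (B i) \<Lambda>\<close> through the arrivals during its service, so the batch has
  exponent \<open>1 - lst (B i) \<Lambda>\<close> times its mean. The coefficients of
  \<open>v\<close> form \<open>offspring\<close>; the remainder is the exponent of
  \<open>gate\<close>.\<close>

lemma gate_offspring:
  fixes y v :: "'n \<Rightarrow> real" and i :: 'n
  defines "\<Lambda> \<equiv> \<Sum>j\<in>UNIV. lam j * y j"
  shows "(\<Sum>j\<in>UNIV. y j * serve v i 0 j) + (1 - lst (B i) \<Lambda>) * ((1 - exp (- nu i * G i)) * v i + lam i * G i)
    = (\<Sum>j\<in>UNIV. offspring lam nu G B i y j * v j)
      + (G i * (\<Lambda> - lam i * y i) + lam i * G i * (1 - lst (B i) \<Lambda>))"
proof -
  have 1: "(\<Sum>j\<in>UNIV. y j * serve v i 0 j) = y i * (exp (- nu i * G i) * v i) + (\<Sum>j\<in>UNIV - {i}. y j * v j + G i * (lam j * y j))"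
    by (subst sum.remove[of UNIV i]) (auto simp: serve_def algebra_simps intro!: sum.cong)
  have 2: "\<Lambda> - lam i * y i = (\<Sum>j\<in>UNIV - {i}. lam j * y j)"
    unfolding \<Lambda>_def by (subst sum.remove[of UNIV i]) auto
  have 3: "(\<Sum>j\<in>UNIV. offspring lam nu G B i y j * v j)
    = (exp (- nu i * G i) * y i + (1 - exp (- nu i * G i)) * (1 - lst (B i) \<Lambda>)) * v i + (\<Sum>j\<in>UNIV - {i}. y j * v j)"
    unfolding offspring_def \<Lambda>_def by (subst sum.remove[of UNIV i]) (auto intro!: sum.cong)
  show ?thesis
    unfolding 1 2 3 sum.distrib sum_distrib_left[symmetric] by (simp add: algebra_simps)
qed

text \<open>The service times of visit \<open>m\<close> and the switch-over after it are independent
  of everything that determines the path up to \<open>m\<close>, so their transforms factor out and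
  the sum over \<open>k\<close> is a Poisson generating function. The separate \<open>c\<close>
  allows an observation after the switch-over, with \<open>c = \<Lambda>\<close>, or before it, with
  \<open>c = 0\<close>.\<close>

lemma visit_factorization:
  fixes y :: "'n \<Rightarrow> real"
  assumes y: "\<And>j. 0 \<le> y j" and c: "0 \<le> c"
  defines "\<Lambda> \<equiv> \<Sum>j\<in>UNIV. lam j * y j"
  shows "(\<Sum>k. \<integral>\<^sup>+\<omega>. path_weight (\<lambda>s. X s \<omega>) (w(m := k)) (Suc m)
        * ennreal (exp (- (\<Sum>j\<in>UNIV. y j * serve (path_mass (\<lambda>s. X s \<omega>) (w(m := k)) m) (station m) (\<Sum>l<k. X (Service m l) \<omega>) j)
            - c * X (Switch m) \<omega>)) \<partial>M)
    = ennreal (gate lam G B (station m) y * lst (S (station m)) c)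
      * (\<integral>\<^sup>+\<omega>. path_weight (\<lambda>s. X s \<omega>) w m
        * ennreal (exp (- (\<Sum>j\<in>UNIV. offspring lam nu G B (station m) y j * path_mass (\<lambda>s. X s \<omega>) w m j))) \<partial>M)"
proof -
  let ?i = "station m :: 'n"
  have \<Lambda>: "0 \<le> \<Lambda>" unfolding \<Lambda>_def using y lam_pos by (auto intro!: sum_nonneg simp: less_imp_le)
  define \<beta> where "\<beta> = lst (B ?i) \<Lambda>"
  define \<sigma> where "\<sigma> = lst (S ?i) c"
  have \<beta>: "0 \<le> \<beta>" "\<beta> \<le> 1" and \<sigma>: "0 \<le> \<sigma>" using lst_bounds[OF \<Lambda>, of m] lst_bounds[OF c, of m] by (auto simp: \<beta>_def \<sigma>_def)
  \<comment> \<open>The exponent is split by source: \<open>R\<close> and \<open>A\<close> see only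
    times before visit \<open>m\<close>, \<open>D\<close> only the service times of visit
    \<open>m\<close> and its switch-over.\<close>
  define R where "R x = (\<Sum>j\<in>UNIV. y j * serve (path_mass x w m) ?i 0 j)" for x
  define A where "A k x = path_weight x w m * ennreal (exp (- R x)) * ennreal (poisson_weight (path_mean x w m) k)" for k x
  define D where "D k x = (\<Prod>l<k. ennreal (exp (- \<Lambda> * x (Service m l)))) * ennreal (exp (- c * x (Switch m)))" for k :: nat and x :: "'n source \<Rightarrow> real"
  have Rm[measurable]: "R \<in> borel_measurable (PiM UNIV (\<lambda>_. borel))"
    unfolding R_def[abs_def] serve_def by measurable
  have Am[measurable]: "A k \<in> borel_measurable (PiM UNIV (\<lambda>_. borel))" for k
    unfolding A_def[abs_def] poisson_weight_def path_mean_def by measurable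
  have Dm[measurable]: "D k \<in> borel_measurable (PiM UNIV (\<lambda>_. borel))" for k
    unfolding D_def[abs_def] by measurable
  have eq: "path_weight x (w(m := k)) (Suc m)
        * ennreal (exp (- (\<Sum>j\<in>UNIV. y j * serve (path_mass x (w(m := k)) m) ?i (\<Sum>l<k. x (Service m l)) j) - c * x (Switch m)))
      = A k x * D k x" for x k
  proof -
    have pm: "path_mass x (w(m := k)) m = path_mass x w m" by (rule path_mass_cong) auto
    have "(\<Sum>j\<in>UNIV. y j * serve (path_mass x w m) ?i (\<Sum>l<k. x (Service m l)) j)
      = R x + \<Lambda> * (\<Sum>l<k. x (Service m l))"
      unfolding R_def \<Lambda>_def
      by (subst serve_split) (simp add: distrib_left sum.distrib sum_distrib_right mult_ac)
    then have "exp (- (\<Sum>j\<in>UNIV. y j * serve (path_mass x w m) ?i (\<Sum>l<k. x (Service m l)) j) - c * x (Switch m))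
      = exp (- R x) * ((\<Prod>l<k. exp (- \<Lambda> * x (Service m l))) * exp (- c * x (Switch m)))"
      by (simp add: exp_add[symmetric] exp_sum[symmetric] sum_distrib_left sum_negf)
    moreover have "ennreal (\<dots>) = ennreal (exp (- R x)) * D k x"
      unfolding D_def by (simp add: ennreal_mult prod_nonneg prod_ennreal[symmetric])
    ultimately show ?thesis
      unfolding path_weight_Suc_upd pm A_def by (simp add: mult_ac)
  qed
  have D: "(\<integral>\<^sup>+\<omega>. D k (\<lambda>s. X s \<omega>) \<partial>M) = ennreal \<beta> ^ k * ennreal \<sigma>" for k
  proof -
    define I where "I = insert (Switch m) (Service m ` {..<k} :: 'n source set)"
    define h where "h s x = (case s of Switch _ \<Rightarrow> ennreal (exp (- c * x)) | _ \<Rightarrow> ennreal (exp (- \<Lambda> * x)))" for s :: "'n source" and x :: real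
    have hm: "h s \<in> borel_measurable borel" for s
      unfolding h_def by (cases s) simp_all
    have "indep_vars (\<lambda>_. borel) X I" by (rule indep_vars_subset[OF indep]) auto
    then have ih: "indep_vars (\<lambda>_. borel) (\<lambda>s \<omega>. h s (X s \<omega>)) I"
      by (rule indep_vars_compose2) (rule hm)
    have nin: "Switch m \<notin> Service m ` {..<k}" by auto
    have inj: "inj_on (Service m) {..<k}" by (auto simp: inj_on_def)
    have P: "(\<Prod>s\<in>I. F s) = (\<Prod>l<k. F (Service m l)) * F (Switch m)" for F :: "'n source \<Rightarrow> ennreal"
      unfolding I_def by (subst prod.insert) (use nin in \<open>auto simp: prod.reindex[OF inj] mult.commute\<close>)
    have "(\<integral>\<^sup>+\<omega>. D k (\<lambda>s. X s \<omega>) \<partial>M) = (\<integral>\<^sup>+\<omega>. (\<Prod>s\<in>I. h s (X s \<omega>)) \<partial>M)"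
      unfolding P by (simp add: D_def h_def)
    also have "\<dots> = (\<Prod>s\<in>I. \<integral>\<^sup>+\<omega>. h s (X s \<omega>) \<partial>M)"
      by (rule indep_vars_nn_integral) (use ih in \<open>auto simp: I_def\<close>)
    also have "\<dots> = ennreal \<beta> ^ k * ennreal \<sigma>"
      unfolding P by (simp add: h_def nn_integral_exp_source[OF \<Lambda>, simplified] nn_integral_exp_source[OF c, simplified] \<beta>_def \<sigma>_def)
    finally show ?thesis .
  qed
  have fact: "(\<integral>\<^sup>+\<omega>. A k (\<lambda>s. X s \<omega>) * D k (\<lambda>s. X s \<omega>) \<partial>M) = (\<integral>\<^sup>+\<omega>. A k (\<lambda>s. X s \<omega>) \<partial>M) * (ennreal \<beta> ^ k * ennreal \<sigma>)" for k
  proof -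
    \<comment> \<open>All service and switch-over times of the visits before \<open>m\<close>, the
      only sources on which \<open>A\<close> depends.\<close>
    define J :: "'n source set" where "J = {s. case s of Service l _ \<Rightarrow> l < m | Switch l \<Rightarrow> l < m | _ \<Rightarrow> False}"
    let ?y = "\<lambda>\<omega>' \<omega> s. if s \<in> J then X s \<omega>' else X s \<omega>"
    have pm: "path_mass (?y \<omega>' \<omega>) w l = path_mass (\<lambda>s. X s \<omega>') w l" if "l \<le> m" for l \<omega> \<omega>'
      using that by (induction l) (simp_all add: J_def)
    have A: "A k (?y \<omega>' \<omega>) = A k (\<lambda>s. X s \<omega>')" for \<omega>' \<omega>
    proof -
      have "path_weight (?y \<omega>' \<omega>) w m = path_weight (\<lambda>s. X s \<omega>') w m"
        unfolding path_weight_def path_mean_def by (intro prod.cong refl) (simp add: pm)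
      then show ?thesis unfolding A_def R_def path_mean_def by (simp add: pm)
    qed
    have Dy: "D k (?y \<omega>' \<omega>) = D k (\<lambda>s. X s \<omega>)" for \<omega>' \<omega>
      by (simp add: D_def J_def)
    have "(\<lambda>x. A k x * D k x) \<in> borel_measurable (PiM UNIV (\<lambda>_. borel))" by measurable
    from nn_integral_split_sources[OF indep this, of J]
    have "(\<integral>\<^sup>+\<omega>. A k (\<lambda>s. X s \<omega>) * D k (\<lambda>s. X s \<omega>) \<partial>M) = (\<integral>\<^sup>+\<omega>'. \<integral>\<^sup>+\<omega>. A k (\<lambda>s. X s \<omega>') * D k (\<lambda>s. X s \<omega>) \<partial>M \<partial>M)"
      unfolding A Dy .
    also have "\<dots> = (\<integral>\<^sup>+\<omega>'. A k (\<lambda>s. X s \<omega>') * (ennreal \<beta> ^ k * ennreal \<sigma>) \<partial>M)"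
      by (subst nn_integral_cmult) (simp_all add: D)
    also have "\<dots> = (\<integral>\<^sup>+\<omega>. A k (\<lambda>s. X s \<omega>) \<partial>M) * (ennreal \<beta> ^ k * ennreal \<sigma>)"
      by (subst nn_integral_multc) simp_all
    finally show ?thesis .
  qed
  have "(\<Sum>k. \<integral>\<^sup>+\<omega>. A k (\<lambda>s. X s \<omega>) * D k (\<lambda>s. X s \<omega>) \<partial>M)
    = (\<Sum>k. ennreal \<sigma> * (\<integral>\<^sup>+\<omega>. A k (\<lambda>s. X s \<omega>) * ennreal \<beta> ^ k \<partial>M))"
    unfolding fact by (subst nn_integral_multc) (simp_all add: mult_ac)
  also have "\<dots> = ennreal \<sigma> * (\<integral>\<^sup>+\<omega>. (\<Sum>k. A k (\<lambda>s. X s \<omega>) * ennreal \<beta> ^ k) \<partial>M)"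
    by (subst nn_integral_suminf) simp_all
  also have "(\<integral>\<^sup>+\<omega>. (\<Sum>k. A k (\<lambda>s. X s \<omega>) * ennreal \<beta> ^ k) \<partial>M)
    = (\<integral>\<^sup>+\<omega>. ennreal (gate lam G B ?i y) * (path_weight (\<lambda>s. X s \<omega>) w m
        * ennreal (exp (- (\<Sum>j\<in>UNIV. offspring lam nu G B ?i y j * path_mass (\<lambda>s. X s \<omega>) w m j)))) \<partial>M)"
  proof (rule nn_integral_cong_AE)
    show "AE \<omega> in M. (\<Sum>k. A k (\<lambda>s. X s \<omega>) * ennreal \<beta> ^ k) = ennreal (gate lam G B ?i y) * (path_weight (\<lambda>s. X s \<omega>) w m
        * ennreal (exp (- (\<Sum>j\<in>UNIV. offspring lam nu G B ?i y j * path_mass (\<lambda>s. X s \<omega>) w m j))))"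
      using AE_X_nonneg
    proof eventually_elim
      case (elim \<omega>)
      let ?x = "\<lambda>s. X s \<omega>"
      have mean: "0 \<le> path_mean ?x w m" by (rule path_mean_nonneg) (use elim in simp)
      have "(\<Sum>k. A k ?x * ennreal \<beta> ^ k) = path_weight ?x w m * ennreal (exp (- R ?x))
          * (\<Sum>k. ennreal (poisson_weight (path_mean ?x w m) k) * ennreal \<beta> ^ k)"
        unfolding A_def mult.assoc by simp
      also have "\<dots> = path_weight ?x w m * (ennreal (exp (- R ?x)) * ennreal (exp (- (1 - \<beta>) * path_mean ?x w m)))"
        unfolding suminf_poisson_weight[OF mean \<beta>(1)] by (simp add: mult.assoc)
      also have "ennreal (exp (- R ?x)) * ennreal (exp (- (1 - \<beta>) * path_mean ?x w m))
        = ennreal (exp (- (R ?x + (1 - \<beta>) * path_mean ?x w m)))"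
        by (simp add: ennreal_mult[symmetric] exp_add[symmetric] algebra_simps)
      also have "R ?x + (1 - \<beta>) * path_mean ?x w m = (\<Sum>j\<in>UNIV. offspring lam nu G B ?i y j * path_mass ?x w m j)
        + (G ?i * (\<Lambda> - lam ?i * y ?i) + lam ?i * G ?i * (1 - \<beta>))"
        unfolding R_def path_mean_def \<beta>_def \<Lambda>_def by (rule gate_offspring)
      also have "ennreal (exp (- ((\<Sum>j\<in>UNIV. offspring lam nu G B ?i y j * path_mass ?x w m j)
        + (G ?i * (\<Lambda> - lam ?i * y ?i) + lam ?i * G ?i * (1 - \<beta>)))))
        = ennreal (gate lam G B ?i y) * ennreal (exp (- (\<Sum>j\<in>UNIV. offspring lam nu G B ?i y j * path_mass ?x w m j)))"
        unfolding gate_def \<beta>_def \<Lambda>_def by (simp add: ennreal_mult[symmetric] exp_add[symmetric])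
      finally show ?case by (simp only: mult_ac)
    qed
  qed
  also have "\<dots> = ennreal (gate lam G B ?i y) * (\<integral>\<^sup>+\<omega>. path_weight (\<lambda>s. X s \<omega>) w m
        * ennreal (exp (- (\<Sum>j\<in>UNIV. offspring lam nu G B ?i y j * path_mass (\<lambda>s. X s \<omega>) w m j))) \<partial>M)"
    by (rule nn_integral_cmult) measurable
  finally have fin: "(\<Sum>k. \<integral>\<^sup>+\<omega>. A k (\<lambda>s. X s \<omega>) * D k (\<lambda>s. X s \<omega>) \<partial>M) = ennreal \<sigma> * (ennreal (gate lam G B ?i y)
      * (\<integral>\<^sup>+\<omega>. path_weight (\<lambda>s. X s \<omega>) w m
        * ennreal (exp (- (\<Sum>j\<in>UNIV. offspring lam nu G B ?i y j * path_mass (\<lambda>s. X s \<omega>) w m j))) \<partial>M))" .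
  have eqX: "path_weight (\<lambda>s. X s \<omega>) (w(m := k)) (Suc m)
        * ennreal (exp (- (\<Sum>j\<in>UNIV. y j * serve (path_mass (\<lambda>s. X s \<omega>) (w(m := k)) m) ?i (\<Sum>l<k. X (Service m l) \<omega>) j)
            - c * X (Switch m) \<omega>))
      = A k (\<lambda>s. X s \<omega>) * D k (\<lambda>s. X s \<omega>)" for k \<omega>
    using eq[of "\<lambda>s. X s \<omega>" k] .
  have "ennreal (gate lam G B ?i y * \<sigma>) = ennreal (gate lam G B ?i y) * ennreal \<sigma>"
    using \<sigma> by (intro ennreal_mult) (simp_all add: gate_def)
  then show ?thesis
    unfolding eqX fin \<sigma>_def[symmetric] by (simp only: mult_ac)
qed

lemma offspring_nonneg:
  assumes y: "\<And>j. 0 \<le> y j"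
  shows "0 \<le> offspring lam nu G B (station m) y j"
proof -
  have "0 \<le> (\<Sum>j\<in>UNIV. lam j * y j)" using y lam_pos by (auto intro!: sum_nonneg simp: less_imp_le)
  from lst_bounds(2)[OF this, of m] show ?thesis
    using y p_nonneg[of "station m"] by (auto simp: offspring_def intro!: add_nonneg_nonneg mult_nonneg_nonneg)
qed

lemma back_prod_nonneg:
  assumes "\<And>j. 0 \<le> y j"
  shows "0 \<le> back_prod lam nu G B S m y"
  using assms
proof (induction m arbitrary: y)
  case (Suc m)
  have "0 \<le> (\<Sum>j\<in>UNIV. lam j * y j)" using Suc.prems lam_pos by (auto intro!: sum_nonneg simp: less_imp_le)
  from lst_bounds(3)[OF this, of m] show ?case
    using Suc.IH[OF offspring_nonneg[OF Suc.prems]] by (simp add: gate_def)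
qed simp

text \<open>Summing over the last batch size leaves the same expression for one visit fewer with
  \<open>y\<close> replaced by its offspring; hence the induction for all nonnegative
  \<open>y\<close>.\<close>

lemma path_sum_back_prod:
  assumes "\<And>j. 0 \<le> y j"
  shows "path_sum m (\<lambda>w. \<integral>\<^sup>+\<omega>. path_weight (\<lambda>s. X s \<omega>) w m
        * ennreal (exp (- (\<Sum>j\<in>UNIV. y j * path_mass (\<lambda>s. X s \<omega>) w m j))) \<partial>M)
    = ennreal (back_prod lam nu G B S m y)"
  using assms
proof (induction m arbitrary: y)
  case 0
  then show ?case by (simp add: path_weight_def emeasure_space_1)
next
  case (Suc m)
  let ?\<Lambda> = "\<Sum>j\<in>UNIV. lam j * y j" and ?i = "station m :: 'n"
  have \<Lambda>: "0 \<le> ?\<Lambda>" using Suc.prems lam_pos by (auto intro!: sum_nonneg simp: less_imp_le)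
  have e: "- (\<Sum>j\<in>UNIV. y j * path_mass x w (Suc m) j)
    = - (\<Sum>j\<in>UNIV. y j * serve (path_mass x w m) ?i (\<Sum>k<w m. x (Service m k)) j) - ?\<Lambda> * x (Switch m)" for x w
    by (simp add: distrib_left sum.distrib sum_distrib_left sum_distrib_right mult_ac)
  have "path_sum (Suc m) (\<lambda>w. \<integral>\<^sup>+\<omega>. path_weight (\<lambda>s. X s \<omega>) w (Suc m)
        * ennreal (exp (- (\<Sum>j\<in>UNIV. y j * path_mass (\<lambda>s. X s \<omega>) w (Suc m) j))) \<partial>M)
    = path_sum m (\<lambda>w. ennreal (gate lam G B ?i y * lst (S ?i) ?\<Lambda>)
      * (\<integral>\<^sup>+\<omega>. path_weight (\<lambda>s. X s \<omega>) w m
        * ennreal (exp (- (\<Sum>j\<in>UNIV. offspring lam nu G B ?i y j * path_mass (\<lambda>s. X s \<omega>) w m j))) \<partial>M))"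
    unfolding path_sum.simps e visit_factorization[OF Suc.prems \<Lambda>, symmetric]
    by (simp only: fun_upd_same)
  also have "\<dots> = ennreal (gate lam G B ?i y * lst (S ?i) ?\<Lambda>) * ennreal (back_prod lam nu G B S m (offspring lam nu G B ?i y))"
    unfolding path_sum_cmult by (subst Suc.IH[OF offspring_nonneg[OF Suc.prems]]) simp
  also have "\<dots> = ennreal (back_prod lam nu G B S (Suc m) y)"
    using back_prod_nonneg[OF offspring_nonneg[OF Suc.prems]] lst_bounds(3)[OF \<Lambda>, of m]
    by (simp add: ennreal_mult[symmetric] gate_def)
  finally show ?case .
qed

text \<open>The system is observed before the last switch-over begins, so the last visit enters with
  \<open>c = 0\<close> and contributes \<open>gate\<close> but no switch-over factor.\<close>

theorem in_system_gf:
  assumes z: "\<And>j. 0 \<le> z j \<and> z j \<le> 1"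
  shows "(\<integral>\<^sup>+\<omega>. ennreal (\<Prod>j\<in>UNIV. z j ^ in_system G (\<lambda>s. X s \<omega>) m j) \<partial>M)
    = ennreal (gate lam G B (station m) (\<lambda>j. 1 - z j)
        * back_prod lam nu G B S m (offspring lam nu G B (station m) (\<lambda>j. 1 - z j)))"
proof -
  let ?i = "station m :: 'n" and ?y = "\<lambda>j. 1 - z j"
  have y: "0 \<le> ?y j" for j using z[of j] by simp
  have "(\<integral>\<^sup>+\<omega>. ennreal (\<Prod>j\<in>UNIV. z j ^ in_system G (\<lambda>s. X s \<omega>) m j) \<partial>M)
    = (\<integral>\<^sup>+\<omega>. path_sum (Suc m) (\<lambda>w. (\<Prod>l<Suc m. of_bool (card (path_joined G (\<lambda>s. X s \<omega>) w l) = w l))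
        * ennreal (\<Prod>j\<in>UNIV. z j ^ path_orbit G (\<lambda>s. X s \<omega>) w m j)) \<partial>M)"
    by (simp only: path_sum_in_system[where h = "\<lambda>n. ennreal (\<Prod>j\<in>UNIV. z j ^ n j)"])
  also have "\<dots> = path_sum (Suc m) (\<lambda>w. \<integral>\<^sup>+\<omega>. (\<Prod>l<Suc m. of_bool (card (path_joined G (\<lambda>s. X s \<omega>) w l) = w l))
        * ennreal (\<Prod>j\<in>UNIV. z j ^ path_orbit G (\<lambda>s. X s \<omega>) w m j) \<partial>M)"
  proof (rule path_sum_nn_integral)
    fix w
    have "(\<lambda>x. (\<Prod>l<Suc m. of_bool (card (path_joined G x w l) = w l))
        * ennreal (\<Prod>j\<in>UNIV. z j ^ path_orbit G x w m j)) \<in> borel_measurable (PiM UNIV (\<lambda>_. borel))"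
      by measurable
    from measurable_compose[OF X_all_measurable this]
    show "(\<lambda>\<omega>. (\<Prod>l<Suc m. of_bool (card (path_joined G (\<lambda>s. X s \<omega>) w l) = w l))
        * ennreal (\<Prod>j\<in>UNIV. z j ^ path_orbit G (\<lambda>s. X s \<omega>) w m j)) \<in> borel_measurable M"
      by simp
  qed
  also have "\<dots> = path_sum m (\<lambda>w. ennreal (gate lam G B ?i ?y * lst (S ?i) 0)
      * (\<integral>\<^sup>+\<omega>. path_weight (\<lambda>s. X s \<omega>) w m
        * ennreal (exp (- (\<Sum>j\<in>UNIV. offspring lam nu G B ?i ?y j * path_mass (\<lambda>s. X s \<omega>) w m j))) \<partial>M))"
    unfolding path_law[OF z] path_sum.simps visit_factorization[OF y order_refl, symmetric]
    by (simp only: fun_upd_same mult_zero_left diff_zero)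
  also have "\<dots> = ennreal (gate lam G B ?i ?y * lst (S ?i) 0) * ennreal (back_prod lam nu G B S m (offspring lam nu G B ?i ?y))"
    unfolding path_sum_cmult by (subst path_sum_back_prod[OF offspring_nonneg[OF y]]) simp
  also have "lst (S ?i) 0 = 1"
  proof -
    have "prob_space (S ?i)" using prob_space_distr[of "X (Switch m)" borel] switch[of m] by simp
    then show ?thesis by (simp add: lst_def prob_space.prob_space)
  qed
  finally show ?thesis
    using back_prod_nonneg[OF offspring_nonneg[OF y]] by (simp add: ennreal_mult gate_def)
qed

end

section \<open>Convergence in distribution from Laplace transforms\<close>

text \<open>In the coordinates \<open>exp (- x j)\<close> the Laplace transforms at integer points are moments on the cube, and
  the Stone--Weierstrass theorem applies.\<close>

definition exp_coords :: "real ^ 'n \<Rightarrow> real ^ 'n" where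
  "exp_coords x = (\<chi> j. exp (- \<bar>x $ j\<bar>))"

lemma exp_coords_measurable[measurable]: "exp_coords \<in> borel_measurable borel"
proof (rule borel_measurable_continuous_onI)
  show "continuous_on UNIV exp_coords"
    unfolding exp_coords_def[abs_def] by (intro continuous_on_vec_lambda continuous_intros)
qed

lemma exp_coords_cube: "exp_coords x \<in> {w. \<forall>j. 0 \<le> w $ j \<and> w $ j \<le> 1}"
  by (simp add: exp_coords_def)

lemma compact_cube: "compact {w :: real ^ 'n. \<forall>j. 0 \<le> w $ j \<and> w $ j \<le> 1}"
proof -
  have "{w :: real ^ 'n. \<forall>j. 0 \<le> w $ j \<and> w $ j \<le> 1} = cbox 0 1"
    by (auto simp: mem_box_cart)
  then show ?thesis by simp
qed

lemma bounded_linear_vec_eq_sum: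
  fixes f :: "real ^ 'n \<Rightarrow> real"
  assumes "bounded_linear f"
  shows "f w = (\<Sum>j\<in>UNIV. f (axis j 1) * w $ j)"
proof -
  interpret bounded_linear f by fact
  have "f w = f (\<Sum>j\<in>UNIV. (w $ j) *\<^sub>R axis j 1)"
    by (simp add: basis_expansion scalar_mult_eq_scaleR[symmetric])
  also have "\<dots> = (\<Sum>j\<in>UNIV. f (axis j 1) * w $ j)"
    by (simp add: sum scaleR mult.commute)
  finally show ?thesis .
qed

text \<open>The absolute values keep all exponentials bounded by 1, so the transforms exist on the
  whole space; they change nothing for laws on the nonnegative orthant.\<close>

locale laplace_convergence =
  fixes \<mu> :: "'b \<Rightarrow> (real ^ 'n) measure" and \<nu> :: "(real ^ 'n) measure" and F :: "'b filter"
  assumes prob: "\<And>t. prob_space (\<mu> t)" "prob_space \<nu>"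
    and sets[measurable_cong, simp]: "\<And>t. sets (\<mu> t) = sets borel" "sets \<nu> = sets borel"
    and nonneg: "\<forall>\<^sub>F t in F. AE x in \<mu> t. \<forall>j. 0 \<le> x $ j" "AE x in \<nu>. \<forall>j. 0 \<le> x $ j"
    and lim: "\<And>s :: 'n \<Rightarrow> nat. ((\<lambda>t. \<integral>x. exp (- (\<Sum>j\<in>UNIV. real (s j) * \<bar>x $ j\<bar>)) \<partial>\<mu> t)
      \<longlongrightarrow> (\<integral>x. exp (- (\<Sum>j\<in>UNIV. real (s j) * \<bar>x $ j\<bar>)) \<partial>\<nu>)) F"
begin

definition conv :: "(real ^ 'n \<Rightarrow> real) \<Rightarrow> bool" where
  "conv h \<longleftrightarrow> (\<forall>t. integrable (\<mu> t) (\<lambda>x. h (exp_coords x))) \<and> integrable \<nu> (\<lambda>x. h (exp_coords x))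
    \<and> ((\<lambda>t. \<integral>x. h (exp_coords x) \<partial>\<mu> t) \<longlongrightarrow> (\<integral>x. h (exp_coords x) \<partial>\<nu>)) F"

lemma conv_add: "conv f \<Longrightarrow> conv g \<Longrightarrow> conv (\<lambda>w. f w + g w)"
  unfolding conv_def by (auto intro!: tendsto_intros)

lemma conv_cmult: "conv f \<Longrightarrow> conv (\<lambda>w. c * f w)"
  unfolding conv_def by (auto intro!: tendsto_intros)

lemma conv_sum: "finite A \<Longrightarrow> (\<And>i. i \<in> A \<Longrightarrow> conv (f i)) \<Longrightarrow> conv (\<lambda>w. \<Sum>i\<in>A. f i w)"
proof (induction A rule: finite_induct)
  case (insert i A)
  then show ?case using conv_add[of "f i" "\<lambda>w. \<Sum>i\<in>A. f i w"] by simp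
qed (simp add: conv_def)

lemma conv_monomial: "conv (\<lambda>w. \<Prod>j\<in>UNIV. w $ j ^ s j)"
proof -
  have eq: "(\<Prod>j\<in>UNIV. exp_coords x $ j ^ s j) = exp (- (\<Sum>j\<in>UNIV. real (s j) * \<bar>x $ j\<bar>))" for x
    by (simp add: exp_coords_def exp_of_nat_mult[symmetric] exp_sum sum_negf[symmetric])
  have le: "exp (- (\<Sum>j\<in>UNIV. real (s j) * \<bar>x $ j\<bar>)) \<le> 1" for x :: "real ^ 'n"
    by (simp add: sum_nonneg)
  have i: "integrable N (\<lambda>x. exp (- (\<Sum>j\<in>UNIV. real (s j) * \<bar>x $ j\<bar>)))"
    if "prob_space N" and [measurable_cong]: "sets N = sets borel" for N :: "(real ^ 'n) measure"
  proof -
    interpret prob_space N by fact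
    show ?thesis by (rule integrable_const_bound[where B = 1]) (use le in auto)
  qed
  show ?thesis unfolding conv_def eq using i[OF prob(1) sets(1)] i[OF prob(2) sets(2)] lim by auto
qed

text \<open>Multiplication by a polynomial preserves convergence against all monomials; the statement is
  made for all \<open>\<phi>\<close> so that it composes under products.\<close>

lemma conv_polynomial_mult:
  assumes "real_polynomial_function p" and "\<And>s. conv (\<lambda>w. (\<Prod>j\<in>UNIV. w $ j ^ s j) * \<phi> w)"
  shows "conv (\<lambda>w. (\<Prod>j\<in>UNIV. w $ j ^ s j) * (\<phi> w * p w))"
  using assms
proof (induction p arbitrary: \<phi> s rule: real_polynomial_function.induct)
  case (linear f)
  have "(\<Prod>j\<in>UNIV. w $ j ^ s j) * (\<phi> w * f w)
    = (\<Sum>i\<in>UNIV. f (axis i 1) * ((\<Prod>j\<in>UNIV. w $ j ^ (s(i := Suc (s i))) j) * \<phi> w))" for w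
  proof -
    have "(\<Prod>j\<in>UNIV. w $ j ^ (s(i := Suc (s i))) j) = w $ i * (\<Prod>j\<in>UNIV. w $ j ^ s j)" for i
      by (subst (1 2) prod.remove[of UNIV i]) (auto intro!: prod.cong)
    then show ?thesis
      unfolding bounded_linear_vec_eq_sum[OF linear(1), of w] by (simp add: sum_distrib_left mult_ac)
  qed
  then show ?case using linear(2) by (auto intro!: conv_sum conv_cmult)
next
  case (const c)
  then show ?case using conv_cmult[OF const(1), of c s] by (simp add: mult_ac)
next
  case (add f g)
  show ?case using conv_add[OF add.IH(1)[OF add.prems] add.IH(2)[OF add.prems], of s s]
    by (simp add: algebra_simps)
next
  case (mult f g)
  have "conv (\<lambda>w. (\<Prod>j\<in>UNIV. w $ j ^ s j) * ((\<phi> w * f w) * g w))"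
    by (rule mult.IH(2)) (rule mult.IH(1)[OF mult.prems])
  then show ?case by (simp add: mult_ac)
qed

lemma conv_polynomial: "real_polynomial_function p \<Longrightarrow> conv p"
  using conv_polynomial_mult[of p "\<lambda>_. 1" "\<lambda>_. 0"] conv_monomial by simp

lemma integrable_bounded_coords:
  fixes h :: "real ^ 'n \<Rightarrow> real"
  assumes h[measurable]: "h \<in> borel_measurable borel" and b: "\<And>x. \<bar>h x\<bar> \<le> K"
  shows "integrable (\<mu> t) h" "integrable \<nu> h"
proof -
  interpret A: prob_space "\<mu> t" by (rule prob)
  interpret B: prob_space \<nu> by (rule prob)
  show "integrable (\<mu> t) h" by (rule A.integrable_const_bound[where B = K]) (use b in auto)
  show "integrable \<nu> h" by (rule B.integrable_const_bound[where B = K]) (use b in auto)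
qed

lemma integral_diff_le:
  fixes f g :: "real ^ 'n \<Rightarrow> real"
  assumes "prob_space N" "integrable N f" "integrable N g" "\<And>x. \<bar>f x - g x\<bar> \<le> e"
  shows "\<bar>(\<integral>x. f x \<partial>N) - (\<integral>x. g x \<partial>N)\<bar> \<le> e"
proof -
  interpret prob_space N by fact
  have "\<bar>(\<integral>x. f x \<partial>N) - (\<integral>x. g x \<partial>N)\<bar> = \<bar>\<integral>x. f x - g x \<partial>N\<bar>"
    using assms by simp
  also have "\<dots> \<le> (\<integral>x. \<bar>f x - g x\<bar> \<partial>N)" by (rule integral_abs_bound)
  also have "\<dots> \<le> e" by (rule integral_le_const) (use assms in auto)
  finally show ?thesis .
qed

text \<open>\<open>exp_coords\<close> takes its values in the compact cube, where polynomials
  approximate \<open>h\<close> uniformly; the approximation error is then uniform in all the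
  laws.\<close>

lemma conv_continuous:
  assumes c: "continuous_on UNIV h"
  shows "conv h"
proof -
  let ?C = "{w :: real ^ 'n. \<forall>j. 0 \<le> w $ j \<and> w $ j \<le> 1}"
  have hC: "continuous_on ?C h" using c continuous_on_subset by blast
  have hm[measurable]: "h \<in> borel_measurable borel" by (rule borel_measurable_continuous_onI[OF c])
  have "bounded (h ` ?C)" by (rule compact_imp_bounded[OF compact_continuous_image[OF hC compact_cube]])
  then obtain K where "\<And>w. w \<in> ?C \<Longrightarrow> \<bar>h w\<bar> \<le> K" unfolding bounded_iff by auto
  then have K: "\<bar>h (exp_coords x)\<bar> \<le> K" for x using exp_coords_cube by blast
  have int: "integrable (\<mu> t) (\<lambda>x. h (exp_coords x))" "integrable \<nu> (\<lambda>x. h (exp_coords x))" for t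
    by (rule integrable_bounded_coords[OF _ K]; measurable)+
  have "((\<lambda>t. \<integral>x. h (exp_coords x) \<partial>\<mu> t) \<longlongrightarrow> (\<integral>x. h (exp_coords x) \<partial>\<nu>)) F"
  proof (rule tendstoI)
    fix e :: real assume "0 < e"
    then have e: "0 < e / 3" by simp
    obtain g where g: "real_polynomial_function g" "\<And>w. w \<in> ?C \<Longrightarrow> \<bar>h w - g w\<bar> < e / 3"
      using Stone_Weierstrass_real_polynomial_function[OF compact_cube hC e] by blast
    have cg: "conv g" by (rule conv_polynomial[OF g(1)])
    have gb: "\<bar>h (exp_coords x) - g (exp_coords x)\<bar> \<le> e / 3" for x
      using g(2)[OF exp_coords_cube[of x]] by simp
    have 1: "\<bar>(\<integral>x. h (exp_coords x) \<partial>\<mu> t) - (\<integral>x. g (exp_coords x) \<partial>\<mu> t)\<bar> \<le> e / 3" for t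
      using cg unfolding conv_def by (intro integral_diff_le prob int gb) auto
    have 2: "\<bar>(\<integral>x. h (exp_coords x) \<partial>\<nu>) - (\<integral>x. g (exp_coords x) \<partial>\<nu>)\<bar> \<le> e / 3"
      using cg unfolding conv_def by (intro integral_diff_le prob int gb) auto
    have "\<forall>\<^sub>F t in F. dist (\<integral>x. g (exp_coords x) \<partial>\<mu> t) (\<integral>x. g (exp_coords x) \<partial>\<nu>) < e / 3"
      using cg unfolding conv_def by (intro tendstoD[OF _ e]) auto
    then show "\<forall>\<^sub>F t in F. dist (\<integral>x. h (exp_coords x) \<partial>\<mu> t) (\<integral>x. h (exp_coords x) \<partial>\<nu>) < e"
    proof eventually_elim
      case (elim t)
      then show ?case using 1[of t] 2 unfolding dist_real_def by linarith
    qed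
  qed
  then show ?thesis using int by (simp add: conv_def)
qed

text \<open>A continuous weight that vanishes as soon as some coordinate is at most \<open>d\<close>
  and equals 1 when all are at least \<open>2 * d\<close>. Small coordinates
  \<open>exp (- x)\<close> are large \<open>x\<close>, where a bounded continuous test function need
  not extend to the closed cube.\<close>

definition cutoff :: "real \<Rightarrow> real ^ 'n \<Rightarrow> real" where
  "cutoff d w = (\<Prod>j\<in>UNIV. min 1 (max 0 (inverse d * w $ j - 1)))"

lemma cutoff_bounds: "0 \<le> cutoff d w" "cutoff d w \<le> 1"
  unfolding cutoff_def by (auto intro!: prod_nonneg prod_le_1)

lemma cutoff_continuous: "continuous_on UNIV (cutoff d)"
  unfolding cutoff_def[abs_def]
  by (intro continuous_on_prod continuous_on_min continuous_on_max continuous_on_diff continuous_on_mult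
      continuous_on_const bounded_linear.continuous_on[OF bounded_linear_vec_nth continuous_on_id])

lemma cutoff_nonzero: "0 < d \<Longrightarrow> cutoff d w \<noteq> 0 \<Longrightarrow> d < w $ j"
proof (rule ccontr)
  assume d: "0 < d" "cutoff d w \<noteq> 0" "\<not> d < w $ j"
  then have "inverse d * w $ j \<le> inverse d * d" by (intro mult_left_mono) auto
  then have "min 1 (max 0 (inverse d * w $ j - 1)) = 0" using d by simp
  then have "cutoff d w = 0" unfolding cutoff_def by (intro prod_zero) (auto intro!: bexI[of _ j])
  then show False using d by simp
qed

lemma cutoff_limit: "(\<lambda>n. \<integral>x. 1 - cutoff (1 / real (Suc n)) (exp_coords x) \<partial>\<nu>) \<longlonglongrightarrow> 0"
proof -
  interpret N: prob_space \<nu> by (rule prob)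
  have "(\<lambda>n. \<integral>x. 1 - cutoff (1 / real (Suc n)) (exp_coords x) \<partial>\<nu>) \<longlonglongrightarrow> (\<integral>x. 0 \<partial>\<nu>)"
  proof (rule integral_dominated_convergence[where w = "\<lambda>_. 1"])
    fix n
    have [measurable]: "cutoff d \<in> borel_measurable borel" for d
      by (rule borel_measurable_continuous_onI[OF cutoff_continuous])
    show "(\<lambda>x. 1 - cutoff (1 / real (Suc n)) (exp_coords x)) \<in> borel_measurable \<nu>" by measurable
    show "AE x in \<nu>. norm (1 - cutoff (1 / real (Suc n)) (exp_coords x)) \<le> 1"
      using cutoff_bounds by (auto simp: abs_of_nonneg)
  next
    show "AE x in \<nu>. (\<lambda>n. 1 - cutoff (1 / real (Suc n)) (exp_coords x)) \<longlonglongrightarrow> 0"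
    proof (intro AE_I2 tendsto_eventually)
      fix x :: "real ^ 'n"
      have "\<forall>\<^sub>F n in sequentially. \<forall>j. 2 / exp_coords x $ j \<le> real n"
        by (rule eventually_all_finite) (rule eventually_nat_real, simp add: eventually_ge_at_top)
      then show "\<forall>\<^sub>F n in sequentially. 1 - cutoff (1 / real (Suc n)) (exp_coords x) = 0"
      proof eventually_elim
        case (elim n)
        have "min 1 (max 0 (inverse (1 / real (Suc n)) * exp_coords x $ j - 1)) = 1" for j
        proof -
          have p: "0 < exp_coords x $ j" by (simp add: exp_coords_def)
          have "2 / exp_coords x $ j \<le> real (Suc n)" using elim[rule_format, of j] by simp
          then have "2 \<le> exp_coords x $ j * real (Suc n)" using p by (simp add: pos_divide_le_eq mult.commute)
          then show ?thesis by (simp add: mult.commute del: of_nat_Suc)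
        qed
        then show ?case by (simp add: cutoff_def del: of_nat_Suc)
      qed
    qed
  qed simp_all
  then show ?thesis by simp
qed

text \<open>Tightness is obtained for free: the mass removed by the cutoff is the integral of a
  function continuous on the cube, so its limit is the value under \<open>\<nu>\<close>, which is
  small for small \<open>d\<close>.\<close>

theorem converges: "converges_in_distribution \<mu> \<nu> F"
  unfolding converges_in_distribution_def
proof (intro allI impI)
  fix f :: "real ^ 'n \<Rightarrow> real" assume f: "continuous_on UNIV f \<and> bounded (range f)"
  then obtain K where "\<forall>y\<in>range f. norm y \<le> K" using bounded_iff[of "range f"] by blast
  then have K: "\<bar>f x\<bar> \<le> K" for x by simp
  have K0: "0 \<le> K" using K[of 0] by linarith
  have fc: "continuous_on UNIV f" using f by blast
  have fm[measurable]: "f \<in> borel_measurable borel" by (rule borel_measurable_continuous_onI[OF fc])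
  \<comment> \<open>\<open>exp_coords\<close> forgets signs, so the test function is first made even
    in each coordinate; this changes it only on a null set of the laws concerned.\<close>
  define fa where "fa x = f (\<chi> j. \<bar>x $ j\<bar>)" for x
  have "continuous_on UNIV fa"
    unfolding fa_def[abs_def]
    by (rule continuous_on_compose2[OF fc])
       (auto intro!: continuous_on_vec_lambda continuous_on_rabs
         bounded_linear.continuous_on[OF bounded_linear_vec_nth continuous_on_id])
  then have fam[measurable]: "fa \<in> borel_measurable borel" by (rule borel_measurable_continuous_onI)
  have fe: "(\<integral>x. f x \<partial>N) = (\<integral>x. fa x \<partial>N)" if "AE x in N. \<forall>j. 0 \<le> x $ j" and [measurable_cong]: "sets N = sets borel" for N
  proof (rule integral_cong_AE)
    show "AE x in N. f x = fa x" using that(1)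
    proof eventually_elim
      case (elim x)
      then have "(\<chi> j. \<bar>x $ j\<bar>) = x" by (simp add: vec_eq_iff)
      then show ?case by (simp add: fa_def)
    qed
  qed measurable
  \<comment> \<open>\<open>- ln\<close> undoes \<open>exp_coords\<close>. The maximum with
    \<open>d\<close> keeps the logarithm continuous and is inactive wherever the cutoff is
    nonzero.\<close>
  define h where "h d w = f (\<chi> j. - ln (max (w $ j) d)) * cutoff d w" for d w
  have hc: "continuous_on UNIV (h d)" if "0 < d" for d
    unfolding h_def[abs_def]
  proof (intro continuous_on_mult cutoff_continuous continuous_on_compose2[OF fc]
      continuous_on_vec_lambda continuous_on_minus continuous_on_ln continuous_on_max continuous_on_const
      bounded_linear.continuous_on[OF bounded_linear_vec_nth continuous_on_id] ballI)
    show "max (w $ j) d \<noteq> 0" for w :: "real ^ 'n" and j using that by (auto simp: max_def)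
  qed simp
  have cm[measurable]: "cutoff d \<in> borel_measurable borel" for d
    by (rule borel_measurable_continuous_onI[OF cutoff_continuous])
  have close: "\<bar>fa x - h d (exp_coords x)\<bar> \<le> K * (1 - cutoff d (exp_coords x))" if d: "0 < d" for x d
  proof (cases "cutoff d (exp_coords x) = 0")
    case True
    then show ?thesis using K by (simp add: h_def fa_def)
  next
    case False
    have "max (exp_coords x $ j) d = exp_coords x $ j" for j
      using cutoff_nonzero[OF d False, of j] by simp
    then have "h d (exp_coords x) = fa x * cutoff d (exp_coords x)"
      by (simp add: h_def fa_def exp_coords_def)
    then have "\<bar>fa x - h d (exp_coords x)\<bar> = \<bar>fa x\<bar> * (1 - cutoff d (exp_coords x))"
      using cutoff_bounds[of d "exp_coords x"]
      by (simp add: abs_mult[symmetric] right_diff_distrib[symmetric] abs_of_nonneg)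
         (metis abs_mult abs_of_nonneg diff_ge_0_iff_ge mult.right_neutral right_diff_distrib)
    also have "\<dots> \<le> K * (1 - cutoff d (exp_coords x))"
      using K cutoff_bounds[of d "exp_coords x"] by (intro mult_right_mono) (auto simp: fa_def)
    finally show ?thesis .
  qed
  have ifa: "integrable (\<mu> t) fa" "integrable \<nu> fa" for t
    by (rule integrable_bounded_coords[OF fam, of K]; simp add: fa_def K)+
  have diff: "\<bar>(\<integral>x. fa x \<partial>N) - (\<integral>x. h d (exp_coords x) \<partial>N)\<bar> \<le> K * (\<integral>x. 1 - cutoff d (exp_coords x) \<partial>N)"
    if d: "0 < d" and i: "integrable N fa" "integrable N (\<lambda>x. h d (exp_coords x))" "integrable N (\<lambda>x. 1 - cutoff d (exp_coords x))" for d N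
  proof -
    have "\<bar>(\<integral>x. fa x \<partial>N) - (\<integral>x. h d (exp_coords x) \<partial>N)\<bar> = \<bar>\<integral>x. fa x - h d (exp_coords x) \<partial>N\<bar>"
      using i by simp
    also have "\<dots> \<le> (\<integral>x. \<bar>fa x - h d (exp_coords x)\<bar> \<partial>N)" by (rule integral_abs_bound)
    also have "\<dots> \<le> (\<integral>x. K * (1 - cutoff d (exp_coords x)) \<partial>N)"
      by (rule integral_mono) (use i close[OF d] in auto)
    finally show ?thesis by simp
  qed
  show "((\<lambda>t. \<integral>x. f x \<partial>\<mu> t) \<longlongrightarrow> (\<integral>x. f x \<partial>\<nu>)) F"
  proof (rule tendstoI)
    fix e :: real assume e: "0 < e"
    \<comment> \<open>Chosen so that each of the two cutoff errors is at most \<open>e / 4\<close>;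
      the \<open>+ 1\<close> covers \<open>K = 0\<close>.\<close>
    define e' where "e' = e / (4 * (K + 1))"
    have e': "0 < e'" using e K0 by (simp add: e'_def)
    have Ke: "K * e' \<le> e / 4"
    proof -
      have "K * e' \<le> (K + 1) * e'" using e' by (intro mult_right_mono) auto
      also have "\<dots> = e / 4" using K0 by (simp add: e'_def field_simps)
      finally show ?thesis .
    qed
    obtain n where n: "(\<integral>x. 1 - cutoff (1 / real (Suc n)) (exp_coords x) \<partial>\<nu>) < e' / 2"
      using order_tendstoD(2)[OF cutoff_limit, of "e' / 2"] e' by (auto simp: eventually_sequentially)
    define d where "d = 1 / real (Suc n)"
    have d: "0 < d" by (simp add: d_def)
    have c1: "conv (h d)" by (rule conv_continuous[OF hc[OF d]])
    have c2: "conv (\<lambda>w. 1 - cutoff d w)" by (rule conv_continuous) (intro continuous_intros cutoff_continuous)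
    have "\<forall>\<^sub>F t in F. dist (\<integral>x. h d (exp_coords x) \<partial>\<mu> t) (\<integral>x. h d (exp_coords x) \<partial>\<nu>) < e / 4"
      using c1 e unfolding conv_def by (intro tendstoD[where e = "e / 4"]) auto
    moreover have "\<forall>\<^sub>F t in F. (\<integral>x. 1 - cutoff d (exp_coords x) \<partial>\<mu> t) < e'"
    proof (rule order_tendstoD(2))
      show "((\<lambda>t. \<integral>x. 1 - cutoff d (exp_coords x) \<partial>\<mu> t) \<longlongrightarrow> (\<integral>x. 1 - cutoff d (exp_coords x) \<partial>\<nu>)) F"
        using c2 unfolding conv_def by blast
      show "(\<integral>x. 1 - cutoff d (exp_coords x) \<partial>\<nu>) < e'" using n e' unfolding d_def by linarith
    qed
    ultimately show "\<forall>\<^sub>F t in F. dist (\<integral>x. f x \<partial>\<mu> t) (\<integral>x. f x \<partial>\<nu>) < e"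
      using nonneg(1)
    proof eventually_elim
      case (elim t)
      have 1: "\<bar>(\<integral>x. fa x \<partial>\<mu> t) - (\<integral>x. h d (exp_coords x) \<partial>\<mu> t)\<bar> \<le> K * (\<integral>x. 1 - cutoff d (exp_coords x) \<partial>\<mu> t)"
        using c1 c2 unfolding conv_def by (intro diff d ifa) auto
      have 2: "\<bar>(\<integral>x. fa x \<partial>\<nu>) - (\<integral>x. h d (exp_coords x) \<partial>\<nu>)\<bar> \<le> K * (\<integral>x. 1 - cutoff d (exp_coords x) \<partial>\<nu>)"
        using c1 c2 unfolding conv_def by (intro diff d ifa) auto
      have 3: "K * (\<integral>x. 1 - cutoff d (exp_coords x) \<partial>\<mu> t) \<le> K * e'"
        using elim(2) K0 by (intro mult_left_mono) auto
      have 4: "K * (\<integral>x. 1 - cutoff d (exp_coords x) \<partial>\<nu>) \<le> K * e'"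
        using n e' K0 by (intro mult_left_mono) (auto simp: d_def)
      show ?case
        unfolding fe[OF elim(3) sets(1)] fe[OF nonneg(2) sets(2)]
        using 1 2 3 4 elim(1) Ke e unfolding dist_real_def by linarith
    qed
  qed
qed

end

section \<open>The gamma law and its Laplace transform\<close>

lemma nn_integral_gamma_law_exp:
  assumes a: "0 < a" and \<theta>: "0 \<le> \<theta>"
  shows "(\<integral>\<^sup>+y. ennreal (exp (- \<theta> * y)) \<partial>gamma_law a 1) = ennreal ((1 + \<theta>) powr (- a))"
proof -
  let ?c = "1 + \<theta>"
  have c: "0 < ?c" using \<theta> by simp
  have G: "0 < Gamma a" using a by (rule Gamma_real_pos)
  define I where "I = (\<integral>\<^sup>+y. ennreal (indicator {0..} y * y powr (a - 1) / exp (?c * y)) \<partial>lborel)"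
  have "ennreal (Gamma a) = (\<integral>\<^sup>+t. ennreal (indicator {0..} t * t powr (a - 1) / exp t) \<partial>lborel)"
    by (rule Gamma_conv_nn_integral_real[OF a])
  \<comment> \<open>The substitution \<open>t = (1 + \<theta>) * y\<close> in Euler's integral turns
    \<open>exp (- t)\<close> into the gamma weight times the factor to be integrated.\<close>
  also have "\<dots> = ennreal \<bar>?c\<bar> * (\<integral>\<^sup>+y. ennreal (indicator {0..} (0 + ?c * y) * (0 + ?c * y) powr (a - 1) / exp (0 + ?c * y)) \<partial>lborel)"
    by (rule nn_integral_real_affine) (use c in auto)
  also have "(\<integral>\<^sup>+y. ennreal (indicator {0..} (0 + ?c * y) * (0 + ?c * y) powr (a - 1) / exp (0 + ?c * y)) \<partial>lborel)
    = (\<integral>\<^sup>+y. ennreal (?c powr (a - 1)) * ennreal (indicator {0..} y * y powr (a - 1) / exp (?c * y)) \<partial>lborel)"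
    using c by (intro nn_integral_cong)
      (auto simp: indicator_def ennreal_mult[symmetric] powr_mult zero_le_mult_iff)
  also have "\<dots> = ennreal (?c powr (a - 1)) * I"
    unfolding I_def by (rule nn_integral_cmult) measurable
  finally have "ennreal (Gamma a) = ennreal (?c * ?c powr (a - 1)) * I"
    using c by (simp add: ennreal_mult mult.assoc)
  also have "?c * ?c powr (a - 1) = ?c powr a" using c by (simp add: powr_diff)
  finally have I: "ennreal (Gamma a) = ennreal (?c powr a) * I" .
  have "(\<integral>\<^sup>+y. ennreal (exp (- \<theta> * y)) \<partial>gamma_law a 1)
    = (\<integral>\<^sup>+y. ennreal (1 / Gamma a) * ennreal (indicator {0..} y * y powr (a - 1) / exp (?c * y)) \<partial>lborel)"
    unfolding gamma_law_def using AE_lborel_singleton[of 0] G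
    by (subst nn_integral_density)
       (auto intro!: nn_integral_cong_AE elim!: eventually_mono
         simp: indicator_def ennreal_mult[symmetric] exp_minus field_simps exp_add)
  also have "\<dots> = ennreal (1 / Gamma a) * I"
    unfolding I_def by (rule nn_integral_cmult) measurable
  also have "I = ennreal (?c powr (- a)) * ennreal (Gamma a)"
    unfolding I mult.assoc[symmetric] using c by (simp add: ennreal_mult[symmetric] powr_minus)
  also have "ennreal (1 / Gamma a) * (ennreal (?c powr (- a)) * ennreal (Gamma a)) = ennreal (?c powr (- a))"
    using G by (simp add: ennreal_mult[symmetric])
  finally show ?thesis .
qed

lemma prob_space_gamma_law: "0 < a \<Longrightarrow> prob_space (gamma_law a 1)"
  using nn_integral_gamma_law_exp[of a 0] by (intro prob_spaceI) simp

lemma AE_gamma_law: "AE y in gamma_law a 1. 0 < y"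
  unfolding gamma_law_def by (subst AE_density) auto

lemma sets_gamma_law[simp, measurable_cong]: "sets (gamma_law a b) = sets borel"
  by (simp add: gamma_law_def)

section \<open>Averaging with small losses\<close>

lemma weighted_average_bounds:
  fixes r x :: "'n::finite \<Rightarrow> real"
  assumes "\<And>j. 0 \<le> r j" "(\<Sum>j\<in>UNIV. r j) = 1" "\<And>j. lo \<le> x j" "\<And>j. x j \<le> hi"
  shows "lo \<le> (\<Sum>j\<in>UNIV. r j * x j)" "(\<Sum>j\<in>UNIV. r j * x j) \<le> hi"
proof -
  have "lo = (\<Sum>j\<in>UNIV. r j * lo)" "hi = (\<Sum>j\<in>UNIV. r j * hi)"
    using assms(2) by (simp_all add: sum_distrib_right[symmetric])
  moreover have "(\<Sum>j\<in>UNIV. r j * lo) \<le> (\<Sum>j\<in>UNIV. r j * x j)" "(\<Sum>j\<in>UNIV. r j * x j) \<le> (\<Sum>j\<in>UNIV. r j * hi)"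
    using assms by (auto intro!: sum_mono mult_left_mono)
  ultimately show "lo \<le> (\<Sum>j\<in>UNIV. r j * x j)" "(\<Sum>j\<in>UNIV. r j * x j) \<le> hi" by auto
qed

text \<open>Knowing one coordinate exactly improves the bounds of an average by its weight times the
  distance of that coordinate from the bound; this gain drives the contraction.\<close>

lemma weighted_average_pinned:
  fixes r x :: "'n::finite \<Rightarrow> real"
  assumes "\<And>j. 0 \<le> r j" "(\<Sum>j\<in>UNIV. r j) = 1" "\<And>j. lo \<le> x j" "\<And>j. x j \<le> hi"
  shows "lo + r i * (x i - lo) \<le> (\<Sum>j\<in>UNIV. r j * x j)" "(\<Sum>j\<in>UNIV. r j * x j) \<le> hi - r i * (hi - x i)"
proof -
  have s: "(\<Sum>j\<in>UNIV. r j * x j) = r i * x i + (\<Sum>j\<in>UNIV - {i}. r j * x j)" by (subst sum.remove[of UNIV i]) auto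
  have t: "(\<Sum>j\<in>UNIV - {i}. r j) = 1 - r i" using assms(2) by (subst (asm) sum.remove[of UNIV i]) auto
  have "(\<Sum>j\<in>UNIV - {i}. r j * lo) \<le> (\<Sum>j\<in>UNIV - {i}. r j * x j)" "(\<Sum>j\<in>UNIV - {i}. r j * x j) \<le> (\<Sum>j\<in>UNIV - {i}. r j * hi)"
    using assms by (auto intro!: sum_mono mult_left_mono)
  then show "lo + r i * (x i - lo) \<le> (\<Sum>j\<in>UNIV. r j * x j)" "(\<Sum>j\<in>UNIV. r j * x j) \<le> hi - r i * (hi - x i)"
    unfolding s sum_distrib_right[symmetric] t by (auto simp: algebra_simps)
qed

text \<open>The equation \<open>cycle\<close> for all \<open>\<phi>\<close> says that any
  \<open>N\<close> consecutive indices visit every coordinate exactly once; indicator functions as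
  \<open>\<phi>\<close> recover this. The constant \<open>\<theta>\<close> bounds the pull of any
  coordinate on any other in a single update.\<close>

locale cyclic_averaging =
  fixes N :: nat and \<tau> :: "nat \<Rightarrow> 'n::finite" and r p :: "'n \<Rightarrow> real" and \<theta> :: real
  assumes N_pos: "0 < N"
    and cycle: "\<And>l (\<phi> :: 'n \<Rightarrow> real). (\<Sum>k<N. \<phi> (\<tau> (l + k))) = (\<Sum>i\<in>UNIV. \<phi> i)"
    and r_nonneg: "\<And>i. 0 \<le> r i" and r_sum: "(\<Sum>i\<in>UNIV. r i) = 1"
    and p_bounds: "\<And>i. 0 \<le> p i" "\<And>i. p i \<le> 1"
    and \<theta>_pos: "0 < \<theta>" and \<theta>_le: "\<And>i j. \<theta> \<le> p i * r j"
begin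

lemma visited: "\<exists>k<N. \<tau> (l + k) = j"
proof (rule ccontr)
  assume "\<not> ?thesis"
  then have "(\<Sum>k<N. (if \<tau> (l + k) = j then 1 else 0 :: real)) = 0" by (intro sum.neutral) auto
  then show False using cycle[of "\<lambda>i. if i = j then 1 else 0" l] by simp
qed

lemma not_revisited: "0 < k \<Longrightarrow> k < N \<Longrightarrow> \<tau> (l + k) \<noteq> \<tau> l"
proof
  assume k: "0 < k" "k < N" "\<tau> (l + k) = \<tau> l"
  have "(\<Sum>k\<in>{0, k}. (if \<tau> (l + k) = \<tau> l then 1 else 0 :: real)) \<le> (\<Sum>k<N. (if \<tau> (l + k) = \<tau> l then 1 else 0))"
    using k by (intro sum_mono2) auto
  then show False using k cycle[of "\<lambda>i. if i = \<tau> l then 1 else 0" l] by simp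
qed

lemma \<theta>_le_1: "\<theta> \<le> 1"
proof -
  obtain i :: 'n where True by blast
  have "r i \<le> (\<Sum>i\<in>UNIV. r i)" by (rule member_le_sum) (use r_nonneg in auto)
  then have "p i * r i \<le> 1 * 1" using p_bounds r_nonneg r_sum by (intro mult_mono) auto
  then show ?thesis using \<theta>_le[of i i] by linarith
qed

definition avg :: "('n \<Rightarrow> real) \<Rightarrow> real" where
  "avg x = (\<Sum>j\<in>UNIV. r j * x j)"

text \<open>The coordinate updated first in a cycle keeps its value during the rest of the cycle, so all
  later updates are pulled towards this common value.\<close>

lemma cycle_contraction:
  fixes x :: "nat \<Rightarrow> 'n \<Rightarrow> real" and D :: real
  assumes upd: "\<And>k. l \<le> k \<Longrightarrow> x (Suc k) = (x k)(\<tau> k := (1 - p (\<tau> k)) * x k (\<tau> k) + p (\<tau> k) * (avg (x k) - e k))"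
    and e: "\<And>k. l \<le> k \<Longrightarrow> 0 \<le> e k \<and> e k \<le> D" and D: "0 \<le> D"
    and x: "\<And>j. lo \<le> x l j" "\<And>j. x l j \<le> hi"
  shows "\<exists>lo' hi'. (\<forall>j. lo' \<le> x (l + N) j \<and> x (l + N) j \<le> hi') \<and> hi' \<le> hi \<and> hi' - lo' \<le> (1 - \<theta>) * (hi - lo) + N * D"
proof -
  \<comment> \<open>The anchor of the cycle. The invariant below has three parts: all coordinates
    stay within the old bounds up to the losses, the anchor keeps its value, and every coordinate
    already updated has gained the margins \<open>\<theta> * (hi - a)\<close> and
    \<open>\<theta> * (a - lo)\<close>.\<close>
  define a where "a = x (Suc l) (\<tau> l)"
  have step: "(\<forall>j. lo - Suc k * D \<le> x (l + Suc k) j \<and> x (l + Suc k) j \<le> hi) \<and> x (l + Suc k) (\<tau> l) = a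
     \<and> (\<forall>j\<in>\<tau> ` {l..l + k}. lo + \<theta> * (a - lo) - Suc k * D \<le> x (l + Suc k) j \<and> x (l + Suc k) j \<le> hi - \<theta> * (hi - a))"
    if "k < N" for k
    using that
  proof (induction k)
    case 0
    let ?i = "\<tau> l"
    have L: "lo \<le> avg (x l)" "avg (x l) \<le> hi"
      unfolding avg_def using weighted_average_bounds[OF r_nonneg r_sum x] by auto
    have a: "a = (1 - p ?i) * x l ?i + p ?i * (avg (x l) - e l)" unfolding a_def by (simp add: upd)
    have up: "a \<le> hi"
    proof -
      have "a \<le> (1 - p ?i) * hi + p ?i * hi"
        unfolding a using p_bounds[of ?i] x(2)[of ?i] L e[of l] by (intro add_mono mult_left_mono) auto
      then show ?thesis by (simp add: algebra_simps)
    qed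
    have dn: "lo - D \<le> a"
    proof -
      have "(1 - p ?i) * lo + p ?i * (lo - D) \<le> a"
        unfolding a using p_bounds[of ?i] x(1)[of ?i] L e[of l] by (intro add_mono mult_left_mono) auto
      moreover have "p ?i * D \<le> 1 * D" using p_bounds D by (intro mult_right_mono) auto
      ultimately show ?thesis by (simp add: algebra_simps)
    qed
    have t1: "a \<le> hi - \<theta> * (hi - a)"
    proof -
      have "\<theta> * (hi - a) \<le> 1 * (hi - a)" using \<theta>_le_1 up by (intro mult_right_mono) auto
      then show ?thesis by simp
    qed
    have t2: "lo + \<theta> * (a - lo) - D \<le> a"
    proof (cases "lo \<le> a")
      case True
      then have "\<theta> * (a - lo) \<le> 1 * (a - lo)" using \<theta>_le_1 by (intro mult_right_mono) auto
      then show ?thesis using D by simp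
    next
      case False
      then have "\<theta> * (a - lo) \<le> 0" using \<theta>_pos by (intro mult_nonneg_nonpos) auto
      then show ?thesis using dn by simp
    qed
    have "lo - D \<le> x (Suc l) j \<and> x (Suc l) j \<le> hi" for j
    proof (cases "j = ?i")
      case False
      then show ?thesis using x[of j] D by (simp add: upd)
    qed (use up dn a_def in auto)
    then show ?case using t1 t2 by (simp add: a_def)
  next
    case (Suc k)
    then have k: "k < N" by simp
    note IH = Suc.IH[OF k]
    let ?m = "l + Suc k" and ?i = "\<tau> (l + Suc k)"
    have ne: "?i \<noteq> \<tau> l" by (rule not_revisited) (use Suc.prems in auto)
    define lo1 where "lo1 = lo - Suc k * D"
    have b: "lo1 \<le> x ?m j" "x ?m j \<le> hi" for j using IH by (auto simp: lo1_def)
    have am: "x ?m (\<tau> l) = a" using IH by blast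
    have up: "a \<le> hi" "lo1 \<le> a" using b[of "\<tau> l"] am by auto
    have L: "lo1 + r (\<tau> l) * (a - lo1) \<le> avg (x ?m)" "avg (x ?m) \<le> hi - r (\<tau> l) * (hi - a)"
      unfolding avg_def using weighted_average_pinned[where i = "\<tau> l" and r = r and x = "x ?m", OF r_nonneg r_sum b] am by auto
    define v where "v = (1 - p ?i) * x ?m ?i + p ?i * (avg (x ?m) - e ?m)"
    have xm: "x (Suc ?m) = (x ?m)(?i := v)" unfolding v_def by (rule upd) simp
    have em: "0 \<le> e ?m" "e ?m \<le> D" using e[of ?m] by auto
    have vu: "v \<le> hi - \<theta> * (hi - a)"
    proof -
      have "v \<le> (1 - p ?i) * hi + p ?i * (hi - r (\<tau> l) * (hi - a))"
        unfolding v_def using p_bounds[of ?i] b[of ?i] L em by (intro add_mono mult_left_mono) auto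
      also have "\<dots> = hi - (p ?i * r (\<tau> l)) * (hi - a)" by (simp add: algebra_simps)
      also have "\<dots> \<le> hi - \<theta> * (hi - a)" using \<theta>_le[of ?i "\<tau> l"] up by (simp add: mult_right_mono)
      finally show ?thesis .
    qed
    have pD: "p ?i * D \<le> D" using mult_right_mono[OF p_bounds(2)[of ?i] D] by simp
    have vl': "lo1 + \<theta> * (a - lo1) - D \<le> v"
    proof -
      have "lo1 + \<theta> * (a - lo1) \<le> lo1 + (p ?i * r (\<tau> l)) * (a - lo1)"
        using \<theta>_le[of ?i "\<tau> l"] up by (simp add: mult_right_mono)
      also have "\<dots> - p ?i * D = (1 - p ?i) * lo1 + p ?i * (lo1 + r (\<tau> l) * (a - lo1) - D)"
        by (simp add: algebra_simps)
      also have "\<dots> \<le> v"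
        unfolding v_def using p_bounds[of ?i] b[of ?i] L em by (intro add_mono mult_left_mono) auto
      finally show ?thesis using pD by linarith
    qed
    have th: "\<theta> * (a - lo) \<le> \<theta> * (a - lo1)" using \<theta>_pos D by (intro mult_left_mono) (auto simp: lo1_def)
    have th0: "0 \<le> \<theta> * (a - lo1)" using \<theta>_pos up by simp
    have th1: "0 \<le> \<theta> * (hi - a)" using \<theta>_pos up by simp
    have lo2: "lo - Suc (Suc k) * D = lo1 - D" by (simp add: lo1_def algebra_simps)
    have lo3: "lo + \<theta> * (a - lo) - Suc (Suc k) * D = lo1 + \<theta> * (a - lo) - D" by (simp add: lo1_def algebra_simps)
    have lo4: "lo + \<theta> * (a - lo) - Suc k * D = lo1 + \<theta> * (a - lo)" by (simp add: lo1_def)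
    have img: "\<tau> ` {l..l + Suc k} = insert ?i (\<tau> ` {l..l + k})"
      by (simp add: atLeastAtMostSuc_conv)
    have A: "lo - Suc (Suc k) * D \<le> x (Suc ?m) j \<and> x (Suc ?m) j \<le> hi" for j
      unfolding lo2 xm using b[of j] vl' th0 vu th1 D by auto
    have B: "lo + \<theta> * (a - lo) - Suc (Suc k) * D \<le> x (Suc ?m) j \<and> x (Suc ?m) j \<le> hi - \<theta> * (hi - a)"
      if "j \<in> \<tau> ` {l..l + Suc k}" for j
    proof (cases "j = ?i")
      case True
      then show ?thesis unfolding lo3 xm using vl' th vu by auto
    next
      case False
      then have "j \<in> \<tau> ` {l..l + k}" using that img by auto
      then have "lo1 + \<theta> * (a - lo) \<le> x ?m j \<and> x ?m j \<le> hi - \<theta> * (hi - a)" using IH unfolding lo4 by blast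
      then show ?thesis unfolding lo3 xm using False D by auto
    qed
    have C: "x (Suc ?m) (\<tau> l) = a" unfolding xm using ne am by simp
    show ?case using A B C by simp
  qed
  obtain k where k: "N = Suc k" using N_pos by (cases N) auto
  have all: "j \<in> \<tau> ` {l..l + k}" for j
    using visited[of l j] k by (force simp: less_Suc_eq_le)
  have up: "a \<le> hi"
  proof -
    have "x (l + Suc k) (\<tau> l) \<le> hi" "x (l + Suc k) (\<tau> l) = a" using step[of k] k by auto
    then show ?thesis by simp
  qed
  have kN: "k < N" using k by simp
  have "\<forall>j. lo + \<theta> * (a - lo) - N * D \<le> x (l + N) j \<and> x (l + N) j \<le> hi - \<theta> * (hi - a)"
    using step[OF kN] all unfolding k by blast
  moreover have "hi - \<theta> * (hi - a) \<le> hi" using \<theta>_pos up by simp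
  \<comment> \<open>The position of \<open>a\<close> cancels: the two margins always add up to
    \<open>\<theta> * (hi - lo)\<close>.\<close>
  moreover have "hi - \<theta> * (hi - a) - (lo + \<theta> * (a - lo) - N * D) \<le> (1 - \<theta>) * (hi - lo) + N * D"
    by (simp add: algebra_simps)
  ultimately show ?thesis by blast
qed

text \<open>Iteration of the one-cycle bound; \<open>N * D / \<theta>\<close> is the fixed point of
  the map \<open>s \<mapsto> (1 - \<theta>) * s + N * D\<close> for the spread.\<close>

lemma collapse:
  fixes x :: "nat \<Rightarrow> 'n \<Rightarrow> real" and D :: real
  assumes upd: "\<And>k. l \<le> k \<Longrightarrow> x (Suc k) = (x k)(\<tau> k := (1 - p (\<tau> k)) * x k (\<tau> k) + p (\<tau> k) * (avg (x k) - e k))"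
    and e: "\<And>k. l \<le> k \<Longrightarrow> 0 \<le> e k \<and> e k \<le> D" and D: "0 \<le> D"
    and x: "\<And>j. 0 \<le> x l j" "\<And>j. x l j \<le> hi"
  shows "\<exists>lo' hi'. (\<forall>j. lo' \<le> x (l + K * N) j \<and> x (l + K * N) j \<le> hi') \<and> hi' \<le> hi \<and> hi' - lo' \<le> (1 - \<theta>) ^ K * hi + N * D / \<theta>"
proof (induction K)
  case 0
  have "0 \<le> N * D / \<theta>" using D \<theta>_pos by simp
  then show ?case using x by (intro exI[of _ 0] exI[of _ hi]) auto
next
  case (Suc K)
  then obtain lo1 hi1 where IH: "\<And>j. lo1 \<le> x (l + K * N) j" "\<And>j. x (l + K * N) j \<le> hi1" "hi1 \<le> hi"
    "hi1 - lo1 \<le> (1 - \<theta>) ^ K * hi + N * D / \<theta>" by blast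
  from cycle_contraction[of "l + K * N" x e D lo1 hi1] upd e D IH(1,2)
  obtain lo2 hi2 where 2: "\<forall>j. lo2 \<le> x (l + K * N + N) j \<and> x (l + K * N + N) j \<le> hi2" "hi2 \<le> hi1"
    "hi2 - lo2 \<le> (1 - \<theta>) * (hi1 - lo1) + N * D" by (auto simp: trans_le_add1)
  have "hi2 - lo2 \<le> (1 - \<theta>) * ((1 - \<theta>) ^ K * hi + N * D / \<theta>) + N * D"
    using 2(3) mult_left_mono[OF IH(4), of "1 - \<theta>"] \<theta>_le_1 by simp
  also have "\<dots> = (1 - \<theta>) ^ Suc K * hi + N * D / \<theta>"
    using \<theta>_pos by (simp add: field_simps)
  finally show ?case using 2 IH(3) by (intro exI[of _ lo2] exI[of _ hi2]) (auto simp: add_ac)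
qed

end

section \<open>Averaging with losses that vanish with the parameter\<close>

lemma eventually_mult_le_at_right: "0 < c \<Longrightarrow> \<forall>\<^sub>F \<epsilon> in at_right 0. C * \<epsilon> \<le> c" for c C :: real
proof -
  assume c: "0 < c"
  have "((\<lambda>\<epsilon>. C * \<epsilon>) \<longlongrightarrow> C * 0) (at_right 0)" by (intro tendsto_intros)
  then have "\<forall>\<^sub>F \<epsilon> in at_right 0. C * \<epsilon> < c" using c by (intro order_tendstoD) auto
  then show ?thesis by eventually_elim simp
qed

text \<open>\<open>x \<epsilon> l\<close> is a positive vector of order \<open>\<epsilon>\<close>. In step \<open>l\<close> the coordinate \<open>\<tau> l\<close> moves towards the average, up to a
  loss \<open>\<epsilon> * L + \<kappa> * L ^ 2\<close> of smaller order, so \<open>x \<epsilon> l\<close> soon becomes nearly constant, equal to the weighted mean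
  \<open>H \<epsilon> l\<close>, which decreases slowly.\<close>

locale averaging_family = cyclic_averaging N \<tau> r p \<theta>
  for N and \<tau> :: "nat \<Rightarrow> 'n::finite" and r p and \<theta> +
  fixes w :: "nat \<Rightarrow> 'n \<Rightarrow> real" and \<kappa> \<gamma> :: "'n \<Rightarrow> real" and \<delta> C1 C4 wmin h0 :: real
    and x :: "real \<Rightarrow> nat \<Rightarrow> 'n \<Rightarrow> real" and loss :: "real \<Rightarrow> 'n \<Rightarrow> real \<Rightarrow> real"
    and imm :: "real \<Rightarrow> 'n \<Rightarrow> ('n \<Rightarrow> real) \<Rightarrow> real" and T :: "real \<Rightarrow> real"
  assumes w_sum: "\<And>l. (\<Sum>j\<in>UNIV. w l j) = 1" and w_min: "\<And>l j. wmin \<le> w l j" and wmin_pos: "0 < wmin"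
    and \<delta>_pos: "0 < \<delta>" and C1_pos: "0 < C1" and \<kappa>_nonneg: "\<And>i. 0 \<le> \<kappa> i"
    and \<kappa>_pos: "0 < (\<Sum>i\<in>UNIV. r i * \<kappa> i)" and \<gamma>_nonneg: "\<And>i. 0 \<le> \<gamma> i"
    and x_Suc: "\<And>\<epsilon> l. x \<epsilon> (Suc l) = (x \<epsilon> l)(\<tau> l := (1 - p (\<tau> l)) * x \<epsilon> l (\<tau> l)
        + p (\<tau> l) * (avg (x \<epsilon> l) - loss \<epsilon> (\<tau> l) (avg (x \<epsilon> l))))"
    and drop: "\<And>\<epsilon> l. (\<Sum>j\<in>UNIV. w l j * x \<epsilon> l j) - (\<Sum>j\<in>UNIV. w (Suc l) j * x \<epsilon> (Suc l) j)
        = r (\<tau> l) / \<delta> * loss \<epsilon> (\<tau> l) (avg (x \<epsilon> l))"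
    and x_0: "\<forall>\<^sub>F \<epsilon> in at_right 0. \<forall>j. 0 \<le> x \<epsilon> 0 j \<and> x \<epsilon> 0 j \<le> C1 * \<epsilon>"
    and loss: "\<And>\<eta>. 0 < \<eta> \<Longrightarrow> \<forall>\<^sub>F \<epsilon> in at_right 0. \<forall>i L. 0 \<le> L \<and> L \<le> C1 * \<epsilon> \<longrightarrow>
        (1 - \<eta>) * (\<epsilon> * L + \<kappa> i * L ^ 2) \<le> loss \<epsilon> i L \<and> loss \<epsilon> i L \<le> (1 + \<eta>) * (\<epsilon> * L + \<kappa> i * L ^ 2)"
    and imm_near: "\<And>\<eta>. 0 < \<eta> \<Longrightarrow> \<eta> < 1 \<Longrightarrow> \<forall>\<^sub>F \<epsilon> in at_right 0. \<forall>i y h. 0 \<le> h \<and>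
        (\<forall>j. (1 - \<eta>) * h \<le> y j \<and> y j \<le> (1 + \<eta>) * h \<and> y j \<le> C1 * \<epsilon>) \<longrightarrow>
        (1 - \<eta>) ^ 3 * (\<gamma> i * h) \<le> imm \<epsilon> i y \<and> imm \<epsilon> i y \<le> (1 + \<eta>) ^ 3 * (\<gamma> i * h)"
    and imm_crude: "\<forall>\<^sub>F \<epsilon> in at_right 0. \<forall>i y. (\<forall>j. 0 \<le> y j \<and> y j \<le> C1 * \<epsilon>) \<longrightarrow> 0 \<le> imm \<epsilon> i y \<and> imm \<epsilon> i y \<le> C4 * \<epsilon>"
    and H_0: "((\<lambda>\<epsilon>. (\<Sum>j\<in>UNIV. w 0 j * x \<epsilon> 0 j) / \<epsilon>) \<longlongrightarrow> h0) (at_right 0)"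
    and T_lim: "\<forall>\<^sub>F \<epsilon> in at_right 0. (\<lambda>C. \<Sum>l<C * N. imm \<epsilon> (\<tau> l) (x \<epsilon> l)) \<longlonglongrightarrow> T \<epsilon>"
begin

definition H :: "real \<Rightarrow> nat \<Rightarrow> real" where
  "H \<epsilon> l = (\<Sum>j\<in>UNIV. w l j * x \<epsilon> l j)"

text \<open>For \<open>L \<le> C1 * \<epsilon>\<close> the hypothesis on the loss with
  \<open>\<eta> = 1\<close> gives at most \<open>2 * (\<epsilon> + \<kappa> i * L) * L\<close>,
  hence at most \<open>C2 * \<epsilon> * L\<close>.\<close>

definition C2 :: real where "C2 = 2 * (1 + (\<Sum>i\<in>UNIV. \<kappa> i) * C1)"

text \<open>Bounds the relative drop of \<open>H\<close> in a single step by
  \<open>C3 * \<epsilon>\<close>; \<open>1 / wmin\<close> converts a bound on the average into one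
  by \<open>H\<close>.\<close>

definition C3 :: real where "C3 = C2 / (\<delta> * wmin)"

text \<open>The smallness conditions that keep the recursion in the box of side
  \<open>C1 * \<epsilon>\<close>; \<open>C2 * \<epsilon> \<le> 1\<close> keeps the loss below the
  average, so coordinates stay nonnegative.\<close>

definition good :: "real \<Rightarrow> bool" where
  "good \<epsilon> \<longleftrightarrow> 0 < \<epsilon> \<and> C2 * \<epsilon> \<le> 1 \<and> (\<forall>j. 0 \<le> x \<epsilon> 0 j \<and> x \<epsilon> 0 j \<le> C1 * \<epsilon>) \<and>
     (\<forall>i L. 0 \<le> L \<and> L \<le> C1 * \<epsilon> \<longrightarrow> 0 \<le> loss \<epsilon> i L \<and> loss \<epsilon> i L \<le> C2 * \<epsilon> * L)"

lemma w_nonneg: "0 \<le> w l j"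
  using w_min[of l j] wmin_pos by linarith

lemma C2_pos: "0 < C2"
  unfolding C2_def using C1_pos \<kappa>_nonneg by (intro mult_pos_pos add_pos_nonneg mult_nonneg_nonneg sum_nonneg) auto

lemma C3_pos: "0 < C3"
  unfolding C3_def using C2_pos \<delta>_pos wmin_pos by simp

lemma eventually_good: "\<forall>\<^sub>F \<epsilon> in at_right 0. good \<epsilon>"
  using eventually_at_right_less[of 0] eventually_mult_le_at_right[of 1 C2, simplified] x_0 loss[of 1, simplified]
proof eventually_elim
  case (elim \<epsilon>)
  have "0 \<le> loss \<epsilon> i L \<and> loss \<epsilon> i L \<le> C2 * \<epsilon> * L" if L: "0 \<le> L" "L \<le> C1 * \<epsilon>" for i L
  proof -
    have "\<kappa> i \<le> (\<Sum>i\<in>UNIV. \<kappa> i)" by (rule member_le_sum) (use \<kappa>_nonneg in auto)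
    then have "\<kappa> i * L \<le> (\<Sum>i\<in>UNIV. \<kappa> i) * (C1 * \<epsilon>)" using L \<kappa>_nonneg by (intro mult_mono sum_nonneg) auto
    then have "(\<epsilon> + \<kappa> i * L) * L \<le> (\<epsilon> + (\<Sum>i\<in>UNIV. \<kappa> i) * (C1 * \<epsilon>)) * L" using L by (intro mult_right_mono) auto
    moreover have "loss \<epsilon> i L \<le> 2 * ((\<epsilon> + \<kappa> i * L) * L)"
      using elim(4) L by (auto simp: algebra_simps power2_eq_square)
    ultimately show ?thesis using elim(4) L by (auto simp: C2_def algebra_simps)
  qed
  then show ?case using elim by (simp add: good_def)
qed

context
  fixes \<epsilon> assumes good: "good \<epsilon>"
begin

lemma \<epsilon>_pos: "0 < \<epsilon>" using good by (simp add: good_def)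

lemma update_bounds:
  assumes "\<And>j. 0 \<le> x \<epsilon> l j" "\<And>j. x \<epsilon> l j \<le> m" "m \<le> C1 * \<epsilon>"
  shows "0 \<le> x \<epsilon> (Suc l) j \<and> x \<epsilon> (Suc l) j \<le> m"
    and "0 \<le> loss \<epsilon> (\<tau> l) (avg (x \<epsilon> l))" "loss \<epsilon> (\<tau> l) (avg (x \<epsilon> l)) \<le> C2 * \<epsilon> * m"
proof -
  let ?i = "\<tau> l" and ?L = "avg (x \<epsilon> l)"
  have L: "0 \<le> ?L" "?L \<le> m" unfolding avg_def using weighted_average_bounds[OF r_nonneg r_sum assms(1,2)] by auto
  then have ls: "0 \<le> loss \<epsilon> ?i ?L" "loss \<epsilon> ?i ?L \<le> C2 * \<epsilon> * ?L" using good assms(3) by (auto simp: good_def)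
  have "C2 * \<epsilon> * ?L \<le> 1 * ?L" using good L by (intro mult_right_mono) (auto simp: good_def)
  then have le: "loss \<epsilon> ?i ?L \<le> ?L" using ls by simp
  show "0 \<le> loss \<epsilon> (\<tau> l) (avg (x \<epsilon> l))" by (rule ls)
  show "loss \<epsilon> (\<tau> l) (avg (x \<epsilon> l)) \<le> C2 * \<epsilon> * m"
  proof -
    have "0 \<le> C2 * \<epsilon>" using C2_pos \<epsilon>_pos by simp
    from order_trans[OF ls(2) mult_left_mono[OF L(2) this]] show ?thesis .
  qed
  have "0 \<le> (1 - p ?i) * x \<epsilon> l ?i + p ?i * (?L - loss \<epsilon> ?i ?L)"
    using p_bounds[of ?i] assms le by (intro add_nonneg_nonneg mult_nonneg_nonneg) auto
  moreover have "(1 - p ?i) * x \<epsilon> l ?i + p ?i * (?L - loss \<epsilon> ?i ?L) \<le> (1 - p ?i) * m + p ?i * m"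
    using p_bounds[of ?i] assms(2)[of ?i] L ls by (intro add_mono mult_left_mono) auto
  ultimately show "0 \<le> x \<epsilon> (Suc l) j \<and> x \<epsilon> (Suc l) j \<le> m"
    using assms by (simp add: x_Suc algebra_simps)
qed

lemma x_bounds: "0 \<le> x \<epsilon> l j" "x \<epsilon> l j \<le> C1 * \<epsilon>"
proof -
  have "\<forall>j. 0 \<le> x \<epsilon> l j \<and> x \<epsilon> l j \<le> C1 * \<epsilon>"
  proof (induction l)
    case (Suc l)
    then show ?case using update_bounds(1)[of l "C1 * \<epsilon>"] by blast
  qed (use good in \<open>simp add: good_def\<close>)
  then show "0 \<le> x \<epsilon> l j" "x \<epsilon> l j \<le> C1 * \<epsilon>" by auto
qed

text \<open>All weights are bounded below, so each coordinate is controlled by \<open>H\<close>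
  itself. This is what makes later errors relative to \<open>H\<close> instead of to the
  parameter.\<close>

lemma x_le_H: "x \<epsilon> l j \<le> H \<epsilon> l / wmin"
proof -
  have "wmin * x \<epsilon> l j \<le> w l j * x \<epsilon> l j" by (intro mult_right_mono w_min x_bounds)
  also have "\<dots> \<le> H \<epsilon> l" unfolding H_def by (rule member_le_sum) (auto intro!: mult_nonneg_nonneg w_nonneg x_bounds)
  finally show ?thesis using wmin_pos by (simp add: field_simps)
qed

lemma H_nonneg: "0 \<le> H \<epsilon> l"
  unfolding H_def by (intro sum_nonneg mult_nonneg_nonneg w_nonneg x_bounds)

lemma avg_bounds: "0 \<le> avg (x \<epsilon> l)" "avg (x \<epsilon> l) \<le> H \<epsilon> l / wmin" "avg (x \<epsilon> l) \<le> C1 * \<epsilon>"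
  unfolding avg_def
  using weighted_average_bounds[OF r_nonneg r_sum x_bounds(1) x_le_H] weighted_average_bounds[OF r_nonneg r_sum x_bounds] by auto

lemma loss_bounds: "0 \<le> loss \<epsilon> (\<tau> l) (avg (x \<epsilon> l))" "loss \<epsilon> (\<tau> l) (avg (x \<epsilon> l)) \<le> C2 * \<epsilon> * (H \<epsilon> l / wmin)"
proof -
  show "0 \<le> loss \<epsilon> (\<tau> l) (avg (x \<epsilon> l))" by (rule update_bounds(2)[OF x_bounds order_refl])
  have "loss \<epsilon> (\<tau> l) (avg (x \<epsilon> l)) \<le> C2 * \<epsilon> * avg (x \<epsilon> l)" using good avg_bounds by (simp add: good_def)
  also have "\<dots> \<le> C2 * \<epsilon> * (H \<epsilon> l / wmin)" using avg_bounds C2_pos \<epsilon>_pos by (intro mult_left_mono) auto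
  finally show "loss \<epsilon> (\<tau> l) (avg (x \<epsilon> l)) \<le> C2 * \<epsilon> * (H \<epsilon> l / wmin)" .
qed

lemma r_le_1: "r i \<le> 1"
  using member_le_sum[of i UNIV r] r_nonneg r_sum by simp

lemma H_Suc: "H \<epsilon> (Suc l) \<le> H \<epsilon> l" "H \<epsilon> l - H \<epsilon> (Suc l) \<le> C3 * \<epsilon> * H \<epsilon> l"
proof -
  have d: "H \<epsilon> l - H \<epsilon> (Suc l) = r (\<tau> l) / \<delta> * loss \<epsilon> (\<tau> l) (avg (x \<epsilon> l))"
    unfolding H_def by (rule drop)
  have "0 \<le> r (\<tau> l) / \<delta> * loss \<epsilon> (\<tau> l) (avg (x \<epsilon> l))"
    using r_nonneg \<delta>_pos loss_bounds(1) by (intro mult_nonneg_nonneg divide_nonneg_pos) auto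
  then show "H \<epsilon> (Suc l) \<le> H \<epsilon> l" using d by simp
  have "r (\<tau> l) / \<delta> * loss \<epsilon> (\<tau> l) (avg (x \<epsilon> l)) \<le> 1 / \<delta> * (C2 * \<epsilon> * (H \<epsilon> l / wmin))"
    using r_le_1 r_nonneg \<delta>_pos loss_bounds by (intro mult_mono divide_right_mono) auto
  also have "\<dots> = C3 * \<epsilon> * H \<epsilon> l" by (simp add: C3_def)
  finally show "H \<epsilon> l - H \<epsilon> (Suc l) \<le> C3 * \<epsilon> * H \<epsilon> l" using d by simp
qed

text \<open>Bernoulli's inequality for the per-step factor \<open>1 - C3 * \<epsilon>\<close>: over
  boundedly many steps \<open>H\<close> is constant up to a relative error of order
  \<epsilon>.\<close>

lemma H_add: "H \<epsilon> (l + k) \<le> H \<epsilon> l" "(1 - k * (C3 * \<epsilon>)) * H \<epsilon> l \<le> H \<epsilon> (l + k)"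
proof -
  have "H \<epsilon> (l + k) \<le> H \<epsilon> l \<and> (1 - k * (C3 * \<epsilon>)) * H \<epsilon> l \<le> H \<epsilon> (l + k)"
  proof (induction k)
    case (Suc k)
    have "C3 * \<epsilon> * H \<epsilon> (l + k) \<le> C3 * \<epsilon> * H \<epsilon> l" using Suc C3_pos \<epsilon>_pos by (intro mult_left_mono) auto
    then show ?case using Suc H_Suc[of "l + k"] by (simp add: algebra_simps)
  qed simp
  then show "H \<epsilon> (l + k) \<le> H \<epsilon> l" "(1 - k * (C3 * \<epsilon>)) * H \<epsilon> l \<le> H \<epsilon> (l + k)" by auto
qed

text \<open>Restart the recursion \<open>K\<close> cycles earlier. There the spread is at most
  \<open>H / wmin\<close> and every loss at most \<open>C2 * \<epsilon>\<close> times that;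
  contraction and small losses leave a small multiple of the earlier \<open>H\<close>, and
  \<open>H\<close> has at most halved since.\<close>

lemma near_direction:
  assumes K: "(1 - \<theta>) ^ K * (2 / wmin) \<le> \<eta> / 2" and \<epsilon>1: "real (K * N) * (C3 * \<epsilon>) \<le> 1 / 2"
    and \<epsilon>2: "real N * C2 / \<theta> * (2 / wmin) * \<epsilon> \<le> \<eta> / 2" and l: "K * N \<le> l"
  shows "\<bar>x \<epsilon> l j - H \<epsilon> l\<bar> \<le> \<eta> * H \<epsilon> l"
proof -
  obtain l' where l': "l = l' + K * N" using l by (metis le_add_diff_inverse2)
  define hi where "hi = H \<epsilon> l' / wmin"
  have hi: "0 \<le> hi" using H_nonneg wmin_pos by (simp add: hi_def)
  have e: "0 \<le> loss \<epsilon> (\<tau> k) (avg (x \<epsilon> k)) \<and> loss \<epsilon> (\<tau> k) (avg (x \<epsilon> k)) \<le> C2 * \<epsilon> * hi" if "l' \<le> k" for k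
  proof -
    have "H \<epsilon> k \<le> H \<epsilon> l'" using H_add(1)[of l' "k - l'"] that by simp
    then have "C2 * \<epsilon> * (H \<epsilon> k / wmin) \<le> C2 * \<epsilon> * hi"
      unfolding hi_def using C2_pos \<epsilon>_pos wmin_pos by (intro mult_left_mono divide_right_mono) auto
    then show ?thesis using loss_bounds[of k] by simp
  qed
  have D: "0 \<le> C2 * \<epsilon> * hi" using C2_pos \<epsilon>_pos hi by simp
  from collapse[of l' "x \<epsilon>" "\<lambda>k. loss \<epsilon> (\<tau> k) (avg (x \<epsilon> k))" "C2 * \<epsilon> * hi" hi K, OF x_Suc e D x_bounds(1) x_le_H[of l', folded hi_def]]
  obtain lo1 hi1 where b: "\<And>j. lo1 \<le> x \<epsilon> l j" "\<And>j. x \<epsilon> l j \<le> hi1"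
    and s: "hi1 - lo1 \<le> (1 - \<theta>) ^ K * hi + N * (C2 * \<epsilon> * hi) / \<theta>" unfolding l' by blast
  have "lo1 \<le> H \<epsilon> l" "H \<epsilon> l \<le> hi1"
    unfolding H_def using weighted_average_bounds[OF w_nonneg w_sum b] by auto
  then have 1: "\<bar>x \<epsilon> l j - H \<epsilon> l\<bar> \<le> hi1 - lo1" using b[of j] by linarith
  have "(1 - real (K * N) * (C3 * \<epsilon>)) * H \<epsilon> l' \<le> H \<epsilon> l" unfolding l' by (rule H_add)
  moreover have "1 / 2 * H \<epsilon> l' \<le> (1 - real (K * N) * (C3 * \<epsilon>)) * H \<epsilon> l'"
    using \<epsilon>1 H_nonneg by (intro mult_right_mono) auto
  ultimately have "H \<epsilon> l' \<le> 2 * H \<epsilon> l" by linarith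
  then have "hi \<le> 2 * H \<epsilon> l / wmin" unfolding hi_def using wmin_pos by (intro divide_right_mono) auto
  then have hi2: "hi \<le> 2 / wmin * H \<epsilon> l" by simp
  have "hi1 - lo1 \<le> ((1 - \<theta>) ^ K + N * C2 / \<theta> * \<epsilon>) * hi"
    using s by (simp add: algebra_simps)
  also have "\<dots> \<le> ((1 - \<theta>) ^ K + N * C2 / \<theta> * \<epsilon>) * (2 / wmin * H \<epsilon> l)"
    using hi2 \<theta>_le_1 \<theta>_pos C2_pos \<epsilon>_pos by (intro mult_left_mono add_nonneg_nonneg) auto
  also have "\<dots> = ((1 - \<theta>) ^ K * (2 / wmin) + real N * C2 / \<theta> * (2 / wmin) * \<epsilon>) * H \<epsilon> l"
    by (simp add: algebra_simps)
  also have "\<dots> \<le> (\<eta> / 2 + \<eta> / 2) * H \<epsilon> l"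
    using K \<epsilon>2 H_nonneg by (intro mult_right_mono add_mono) auto
  finally show ?thesis using 1 by simp
qed

lemma summed_drop: "H \<epsilon> l - H \<epsilon> (l + n) = (\<Sum>k<n. r (\<tau> (l + k)) / \<delta> * loss \<epsilon> (\<tau> (l + k)) (avg (x \<epsilon> (l + k))))"
proof (induction n)
  case (Suc n)
  have "H \<epsilon> (l + n) - H \<epsilon> (Suc (l + n)) = r (\<tau> (l + n)) / \<delta> * loss \<epsilon> (\<tau> (l + n)) (avg (x \<epsilon> (l + n)))"
    unfolding H_def by (rule drop)
  then show ?case using Suc by simp
qed simp

end

definition \<kappa>0 :: real where "\<kappa>0 = (\<Sum>i\<in>UNIV. r i * \<kappa> i)"

definition \<gamma>0 :: real where "\<gamma>0 = (\<Sum>i\<in>UNIV. \<gamma> i)"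

text \<open>The exponent 5 counts factors. For the lower bounds, the average costs two, one for the
  direction and one for the drift of \<open>H\<close> in the cycle; squaring makes four, and the
  asymptotics of the loss adds one. The other bounds need fewer and are rounded to 5.\<close>

lemma one_cycle:
  assumes g: "good \<epsilon>" and \<eta>: "0 < \<eta>" "\<eta> < 1"
    and near: "\<And>k j. l \<le> k \<Longrightarrow> \<bar>x \<epsilon> k j - H \<epsilon> k\<bar> \<le> \<eta> * H \<epsilon> k"
    and small: "real N * (C3 * \<epsilon>) \<le> \<eta>"
    and ls: "\<forall>i L. 0 \<le> L \<and> L \<le> C1 * \<epsilon> \<longrightarrow>
        (1 - \<eta>) * (\<epsilon> * L + \<kappa> i * L ^ 2) \<le> loss \<epsilon> i L \<and> loss \<epsilon> i L \<le> (1 + \<eta>) * (\<epsilon> * L + \<kappa> i * L ^ 2)"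
    and im: "\<forall>i y h. 0 \<le> h \<and> (\<forall>j. (1 - \<eta>) * h \<le> y j \<and> y j \<le> (1 + \<eta>) * h \<and> y j \<le> C1 * \<epsilon>) \<longrightarrow>
        (1 - \<eta>) ^ 3 * (\<gamma> i * h) \<le> imm \<epsilon> i y \<and> imm \<epsilon> i y \<le> (1 + \<eta>) ^ 3 * (\<gamma> i * h)"
  shows "(1 - \<eta>) * H \<epsilon> l \<le> H \<epsilon> (l + N)"
    and "(1 - \<eta>) ^ 5 * ((\<epsilon> * H \<epsilon> l + \<kappa>0 * H \<epsilon> l ^ 2) / \<delta>) \<le> H \<epsilon> l - H \<epsilon> (l + N)"
    and "H \<epsilon> l - H \<epsilon> (l + N) \<le> (1 + \<eta>) ^ 5 * ((\<epsilon> * H \<epsilon> l + \<kappa>0 * H \<epsilon> l ^ 2) / \<delta>)"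
    and "(1 - \<eta>) ^ 5 * (\<gamma>0 * H \<epsilon> l) \<le> (\<Sum>k<N. imm \<epsilon> (\<tau> (l + k)) (x \<epsilon> (l + k)))"
    and "(\<Sum>k<N. imm \<epsilon> (\<tau> (l + k)) (x \<epsilon> (l + k))) \<le> (1 + \<eta>) ^ 5 * (\<gamma>0 * H \<epsilon> l)"
proof -
  let ?h = "H \<epsilon> l"
  have \<epsilon>: "0 < \<epsilon>" by (rule \<epsilon>_pos[OF g])
  have h: "0 \<le> ?h" by (rule H_nonneg[OF g])
  have Hk: "(1 - \<eta>) * ?h \<le> H \<epsilon> (l + k)" "H \<epsilon> (l + k) \<le> ?h" if "k \<le> N" for k
  proof -
    have "real k * (C3 * \<epsilon>) \<le> real N * (C3 * \<epsilon>)" using that C3_pos \<epsilon> by (intro mult_right_mono) auto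
    then have "(1 - \<eta>) * ?h \<le> (1 - k * (C3 * \<epsilon>)) * ?h" using small h by (intro mult_right_mono) auto
    then show "(1 - \<eta>) * ?h \<le> H \<epsilon> (l + k)" using H_add(2)[OF g, of k l] by simp
    show "H \<epsilon> (l + k) \<le> ?h" by (rule H_add(1)[OF g])
  qed
  show "(1 - \<eta>) * H \<epsilon> l \<le> H \<epsilon> (l + N)" by (rule Hk) simp
  have xk: "(1 - \<eta>) * H \<epsilon> (l + k) \<le> x \<epsilon> (l + k) j" "x \<epsilon> (l + k) j \<le> (1 + \<eta>) * H \<epsilon> (l + k)" for k j
    using near[of "l + k" j] by (auto simp: abs_le_iff algebra_simps)
  have Lk: "(1 - \<eta>) ^ 2 * ?h \<le> avg (x \<epsilon> (l + k))" "avg (x \<epsilon> (l + k)) \<le> (1 + \<eta>) * ?h" if "k \<le> N" for k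
  proof -
    have "(1 - \<eta>) * ((1 - \<eta>) * ?h) \<le> (1 - \<eta>) * H \<epsilon> (l + k)" using Hk[OF that] \<eta> by (intro mult_left_mono) auto
    also have "\<dots> \<le> avg (x \<epsilon> (l + k))"
      unfolding avg_def by (rule weighted_average_bounds(1)[OF r_nonneg r_sum xk])
    finally show "(1 - \<eta>) ^ 2 * ?h \<le> avg (x \<epsilon> (l + k))" by (simp add: power2_eq_square mult.assoc)
    have "avg (x \<epsilon> (l + k)) \<le> (1 + \<eta>) * H \<epsilon> (l + k)"
      unfolding avg_def by (rule weighted_average_bounds(2)[OF r_nonneg r_sum xk])
    also have "\<dots> \<le> (1 + \<eta>) * ?h" using Hk[OF that] \<eta> by (intro mult_left_mono) auto
    finally show "avg (x \<epsilon> (l + k)) \<le> (1 + \<eta>) * ?h" .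
  qed
  have pw: "(1 - \<eta>) ^ 5 \<le> (1 - \<eta>) ^ n" "(1 + \<eta>) ^ n \<le> (1 + \<eta>) ^ 5" if "n \<le> 5" for n
    using that \<eta> by (auto intro!: power_decreasing power_increasing)
  have lsk: "(1 - \<eta>) ^ 5 * (\<epsilon> * ?h + \<kappa> i * ?h ^ 2) \<le> loss \<epsilon> i (avg (x \<epsilon> (l + k)))"
    "loss \<epsilon> i (avg (x \<epsilon> (l + k))) \<le> (1 + \<eta>) ^ 5 * (\<epsilon> * ?h + \<kappa> i * ?h ^ 2)" if "k \<le> N" for k i
  proof -
    let ?L = "avg (x \<epsilon> (l + k))"
    have L0: "0 \<le> ?L" "?L \<le> C1 * \<epsilon>" using avg_bounds[OF g] by auto
    have L2: "((1 - \<eta>) ^ 2 * ?h) ^ 2 \<le> ?L ^ 2" "?L ^ 2 \<le> ((1 + \<eta>) * ?h) ^ 2"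
      using Lk[OF that] L0 h by (auto intro!: power_mono)
    have "(1 - \<eta>) ^ 4 * (\<epsilon> * ?h + \<kappa> i * ?h ^ 2) \<le> \<epsilon> * ((1 - \<eta>) ^ 2 * ?h) + \<kappa> i * ((1 - \<eta>) ^ 2 * ?h) ^ 2"
    proof -
      have "(1 - \<eta>) ^ 4 * (\<epsilon> * ?h) \<le> (1 - \<eta>) ^ 2 * (\<epsilon> * ?h)"
        using \<eta> \<epsilon> h by (intro mult_right_mono power_decreasing) auto
      then show ?thesis by (simp add: power_mult_distrib algebra_simps flip: power_mult)
    qed
    also have "\<dots> \<le> \<epsilon> * ?L + \<kappa> i * ?L ^ 2"
      using Lk(1)[OF that] L2(1) \<epsilon> \<kappa>_nonneg by (intro add_mono mult_left_mono) auto
    finally have "(1 - \<eta>) * ((1 - \<eta>) ^ 4 * (\<epsilon> * ?h + \<kappa> i * ?h ^ 2)) \<le> (1 - \<eta>) * (\<epsilon> * ?L + \<kappa> i * ?L ^ 2)"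
      using \<eta> by (intro mult_left_mono) auto
    also have "\<dots> \<le> loss \<epsilon> i ?L" using ls L0 by blast
    finally show "(1 - \<eta>) ^ 5 * (\<epsilon> * ?h + \<kappa> i * ?h ^ 2) \<le> loss \<epsilon> i ?L"
      by (simp add: eval_nat_numeral mult.assoc)
    have "\<epsilon> * ?L + \<kappa> i * ?L ^ 2 \<le> \<epsilon> * ((1 + \<eta>) * ?h) + \<kappa> i * ((1 + \<eta>) * ?h) ^ 2"
      using Lk(2)[OF that] L2(2) \<epsilon> \<kappa>_nonneg by (intro add_mono mult_left_mono) auto
    also have "\<dots> \<le> (1 + \<eta>) ^ 2 * (\<epsilon> * ?h + \<kappa> i * ?h ^ 2)"
    proof -
      have "(1 + \<eta>) ^ 1 * (\<epsilon> * ?h) \<le> (1 + \<eta>) ^ 2 * (\<epsilon> * ?h)"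
        using \<eta> \<epsilon> h by (intro mult_right_mono power_increasing) auto
      moreover have "\<epsilon> * ((1 + \<eta>) * ?h) = (1 + \<eta>) ^ 1 * (\<epsilon> * ?h)" by simp
      moreover have "\<kappa> i * ((1 + \<eta>) * ?h) ^ 2 = (1 + \<eta>) ^ 2 * (\<kappa> i * ?h ^ 2)"
        by (simp add: power_mult_distrib)
      ultimately show ?thesis unfolding distrib_left by linarith
    qed
    finally have "(1 + \<eta>) * (\<epsilon> * ?L + \<kappa> i * ?L ^ 2) \<le> (1 + \<eta>) * ((1 + \<eta>) ^ 2 * (\<epsilon> * ?h + \<kappa> i * ?h ^ 2))"
      using \<eta> by (intro mult_left_mono) auto
    also have "\<dots> = (1 + \<eta>) ^ 3 * (\<epsilon> * ?h + \<kappa> i * ?h ^ 2)" by (simp add: eval_nat_numeral mult.assoc)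
    also have "\<dots> \<le> (1 + \<eta>) ^ 5 * (\<epsilon> * ?h + \<kappa> i * ?h ^ 2)"
      using pw(2)[of 3] \<epsilon> h \<kappa>_nonneg by (intro mult_right_mono) auto
    finally show "loss \<epsilon> i ?L \<le> (1 + \<eta>) ^ 5 * (\<epsilon> * ?h + \<kappa> i * ?h ^ 2)"
      using ls L0 by (meson order_trans)
  qed
  have sumd: "(\<Sum>k<N. r (\<tau> (l + k)) / \<delta> * (c * (\<epsilon> * ?h + \<kappa> (\<tau> (l + k)) * ?h ^ 2))) = c * ((\<epsilon> * ?h + \<kappa>0 * ?h ^ 2) / \<delta>)" for c
  proof -
    have "(\<Sum>k<N. r (\<tau> (l + k)) / \<delta> * (c * (\<epsilon> * ?h + \<kappa> (\<tau> (l + k)) * ?h ^ 2)))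
      = (\<Sum>i\<in>UNIV. r i / \<delta> * (c * (\<epsilon> * ?h + \<kappa> i * ?h ^ 2)))"
      by (rule cycle[of "\<lambda>i. r i / \<delta> * (c * (\<epsilon> * ?h + \<kappa> i * ?h ^ 2))"])
    also have "\<dots> = (\<Sum>i\<in>UNIV. c / \<delta> * (\<epsilon> * ?h) * r i + c / \<delta> * ?h ^ 2 * (r i * \<kappa> i))"
      by (intro sum.cong refl) (simp add: algebra_simps)
    also have "\<dots> = c / \<delta> * (\<epsilon> * ?h) + c / \<delta> * ?h ^ 2 * \<kappa>0"
      by (simp only: sum.distrib sum_distrib_left[symmetric] r_sum \<kappa>0_def mult_1_right)
    finally show ?thesis using \<delta>_pos by (simp add: field_simps)
  qed
  show "(1 - \<eta>) ^ 5 * ((\<epsilon> * ?h + \<kappa>0 * ?h ^ 2) / \<delta>) \<le> ?h - H \<epsilon> (l + N)"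
    unfolding summed_drop[OF g] sumd[symmetric] using lsk(1) r_nonneg \<delta>_pos
    by (intro sum_mono mult_left_mono) auto
  show "?h - H \<epsilon> (l + N) \<le> (1 + \<eta>) ^ 5 * ((\<epsilon> * ?h + \<kappa>0 * ?h ^ 2) / \<delta>)"
    unfolding summed_drop[OF g] sumd[symmetric] using lsk(2) r_nonneg \<delta>_pos
    by (intro sum_mono mult_left_mono) auto
  have imk: "(1 - \<eta>) ^ 5 * (\<gamma> i * ?h) \<le> imm \<epsilon> i (x \<epsilon> (l + k))" "imm \<epsilon> i (x \<epsilon> (l + k)) \<le> (1 + \<eta>) ^ 5 * (\<gamma> i * ?h)" if "k \<le> N" for k i
  proof -
    let ?H = "H \<epsilon> (l + k)"
    have b: "(1 - \<eta>) ^ 3 * (\<gamma> i * ?H) \<le> imm \<epsilon> i (x \<epsilon> (l + k))" "imm \<epsilon> i (x \<epsilon> (l + k)) \<le> (1 + \<eta>) ^ 3 * (\<gamma> i * ?H)"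
      using im H_nonneg[OF g] xk x_bounds(2)[OF g] by blast+
    have "(1 - \<eta>) ^ 5 * (\<gamma> i * ?h) \<le> (1 - \<eta>) ^ 4 * (\<gamma> i * ?h)"
      using \<eta> h \<gamma>_nonneg by (intro mult_right_mono power_decreasing) auto
    also have "\<dots> = (1 - \<eta>) ^ 3 * (\<gamma> i * ((1 - \<eta>) * ?h))" by (simp add: eval_nat_numeral algebra_simps)
    also have "\<dots> \<le> (1 - \<eta>) ^ 3 * (\<gamma> i * ?H)" using Hk[OF that] \<eta> \<gamma>_nonneg by (intro mult_left_mono) auto
    finally show "(1 - \<eta>) ^ 5 * (\<gamma> i * ?h) \<le> imm \<epsilon> i (x \<epsilon> (l + k))" using b by simp
    have "(1 + \<eta>) ^ 3 * (\<gamma> i * ?H) \<le> (1 + \<eta>) ^ 5 * (\<gamma> i * ?h)"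
      using pw(2)[of 3] Hk[OF that] H_nonneg[OF g] \<eta> \<gamma>_nonneg by (intro mult_mono mult_nonneg_nonneg) auto
    then show "imm \<epsilon> i (x \<epsilon> (l + k)) \<le> (1 + \<eta>) ^ 5 * (\<gamma> i * ?h)" using b by simp
  qed
  have sumg: "(\<Sum>k<N. c * (\<gamma> (\<tau> (l + k)) * ?h)) = c * (\<gamma>0 * ?h)" for c
    using cycle[of "\<lambda>i. c * (\<gamma> i * ?h)" l] by (simp add: \<gamma>0_def sum_distrib_left sum_distrib_right)
  show "(1 - \<eta>) ^ 5 * (\<gamma>0 * ?h) \<le> (\<Sum>k<N. imm \<epsilon> (\<tau> (l + k)) (x \<epsilon> (l + k)))"
    unfolding sumg[symmetric] by (intro sum_mono imk(1)) simp
  show "(\<Sum>k<N. imm \<epsilon> (\<tau> (l + k)) (x \<epsilon> (l + k))) \<le> (1 + \<eta>) ^ 5 * (\<gamma>0 * ?h)"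
    unfolding sumg[symmetric] by (intro sum_mono imk(2)) simp
qed

end

section \<open>Telescoping logarithms\<close>

lemma ln_diff_bounds:
  fixes u v :: real
  assumes "0 \<le> v" "v \<le> u"
  shows "(u - v) / (1 + u) \<le> ln (1 + u) - ln (1 + v)" "ln (1 + u) - ln (1 + v) \<le> (u - v) / (1 + v)"
proof -
  have p: "0 < 1 + u" "0 < 1 + v" using assms by auto
  have "ln ((1 + v) / (1 + u)) \<le> (1 + v) / (1 + u) - 1" by (rule ln_le_minus_one) (use p in simp)
  moreover have "(1 + v) / (1 + u) - 1 = - ((u - v) / (1 + u))" using p by (simp add: field_simps)
  moreover have "ln ((1 + v) / (1 + u)) = ln (1 + v) - ln (1 + u)" using p by (simp add: ln_div)
  ultimately show "(u - v) / (1 + u) \<le> ln (1 + u) - ln (1 + v)" by linarith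
  have "ln ((1 + u) / (1 + v)) \<le> (1 + u) / (1 + v) - 1" by (rule ln_le_minus_one) (use p in simp)
  moreover have "(1 + u) / (1 + v) - 1 = (u - v) / (1 + v)" using p by (simp add: field_simps)
  moreover have "ln ((1 + u) / (1 + v)) = ln (1 + u) - ln (1 + v)" using p by (simp add: ln_div)
  ultimately show "ln (1 + u) - ln (1 + v) \<le> (u - v) / (1 + v)" by linarith
qed

context averaging_family
begin

definition \<alpha>0 :: real where "\<alpha>0 = \<gamma>0 * \<delta> / \<kappa>0"

lemma \<kappa>0_pos: "0 < \<kappa>0" unfolding \<kappa>0_def by (rule \<kappa>_pos)

lemma \<gamma>0_nonneg: "0 \<le> \<gamma>0" unfolding \<gamma>0_def by (intro sum_nonneg \<gamma>_nonneg)

lemma \<alpha>0_nonneg: "0 \<le> \<alpha>0" unfolding \<alpha>0_def using \<kappa>0_pos \<gamma>0_nonneg \<delta>_pos by simp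

text \<open>With \<open>\<Theta> = \<kappa>0 * H / \<epsilon>\<close> the drop of \<open>H\<close> over a cycle reads
  \<open>\<Delta> \<Theta> \<approx> \<epsilon> / \<delta> * \<Theta> * (1 + \<Theta>)\<close>, so \<open>ln (1 + \<Theta>)\<close> drops by \<open>\<epsilon> / \<delta> * \<Theta>\<close>, which is proportional to the
  immigration term of the cycle: the sum of the immigration terms telescopes.\<close>

lemma telescope_step:
  assumes g: "good \<epsilon>" and \<eta>: "0 < \<eta>" "\<eta> < 1"
    and c1: "(1 - \<eta>) * H \<epsilon> l \<le> H \<epsilon> (l + N)"
    and c2: "(1 - \<eta>) ^ 5 * ((\<epsilon> * H \<epsilon> l + \<kappa>0 * H \<epsilon> l ^ 2) / \<delta>) \<le> H \<epsilon> l - H \<epsilon> (l + N)"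
    and c3: "H \<epsilon> l - H \<epsilon> (l + N) \<le> (1 + \<eta>) ^ 5 * ((\<epsilon> * H \<epsilon> l + \<kappa>0 * H \<epsilon> l ^ 2) / \<delta>)"
    and c4: "(1 - \<eta>) ^ 5 * (\<gamma>0 * H \<epsilon> l) \<le> S"
    and c5: "S \<le> (1 + \<eta>) ^ 5 * (\<gamma>0 * H \<epsilon> l)"
  defines "\<Theta> \<equiv> \<lambda>l. \<kappa>0 * H \<epsilon> l / \<epsilon>"
  shows "(1 - \<eta>) ^ 5 * (\<epsilon> / \<delta>) * \<Theta> l \<le> ln (1 + \<Theta> l) - ln (1 + \<Theta> (l + N))"
    and "S \<le> (1 + \<eta>) ^ 5 / (1 - \<eta>) ^ 5 * \<alpha>0 * (ln (1 + \<Theta> l) - ln (1 + \<Theta> (l + N)))"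
    and "(1 - \<eta>) ^ 5 * (1 - \<eta>) / (1 + \<eta>) ^ 5 * \<alpha>0 * (ln (1 + \<Theta> l) - ln (1 + \<Theta> (l + N))) \<le> S"
proof -
  let ?a = "(1 - \<eta>) ^ 5" and ?A = "(1 + \<eta>) ^ 5"
  let ?u = "\<Theta> l" and ?v = "\<Theta> (l + N)"
  have \<epsilon>: "0 < \<epsilon>" by (rule \<epsilon>_pos[OF g])
  have pos: "0 < ?a" "0 < ?A" using \<eta> by auto
  have u0: "0 \<le> ?u" "0 \<le> ?v" unfolding \<Theta>_def using H_nonneg[OF g] \<kappa>0_pos \<epsilon> by auto
  have mono: "?v \<le> ?u" unfolding \<Theta>_def using H_add(1)[OF g] \<kappa>0_pos \<epsilon> by (intro divide_right_mono mult_left_mono) auto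
  have e: "\<kappa>0 / \<epsilon> * ((\<epsilon> * H \<epsilon> l + \<kappa>0 * H \<epsilon> l ^ 2) / \<delta>) = \<epsilon> / \<delta> * (?u * (1 + ?u))"
    unfolding \<Theta>_def using \<epsilon> \<delta>_pos by (simp add: field_simps power2_eq_square)
  have d: "\<kappa>0 / \<epsilon> * (H \<epsilon> l - H \<epsilon> (l + N)) = ?u - ?v"
    unfolding \<Theta>_def by (simp add: algebra_simps diff_divide_distrib)
  have k: "0 \<le> \<kappa>0 / \<epsilon>" using \<kappa>0_pos \<epsilon> by simp
  have lo: "?a * (\<epsilon> / \<delta> * (?u * (1 + ?u))) \<le> ?u - ?v"
    using mult_left_mono[OF c2 k] unfolding d e[symmetric] by (simp add: mult_ac)
  have hi: "?u - ?v \<le> ?A * (\<epsilon> / \<delta> * (?u * (1 + ?u)))"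
    using mult_left_mono[OF c3 k] unfolding d e[symmetric] by (simp add: mult_ac)
  \<comment> \<open>The mean value bound for the logarithm has \<open>1 + ?v\<close> in the
    denominator; over one cycle it differs from \<open>1 + ?u\<close> by a factor at least
    \<open>1 - \<eta>\<close> only.\<close>
  have v: "(1 - \<eta>) * (1 + ?u) \<le> 1 + ?v"
  proof -
    have "(1 - \<eta>) * ?u \<le> ?v"
      using mult_left_mono[OF c1 k] unfolding \<Theta>_def by (simp add: mult_ac)
    then show ?thesis using \<eta> by (simp add: algebra_simps)
  qed
  let ?D = "ln (1 + ?u) - ln (1 + ?v)"
  have Dlo: "?a * (\<epsilon> / \<delta> * ?u) \<le> ?D"
  proof -
    have "?a * (\<epsilon> / \<delta> * ?u) = (?a * (\<epsilon> / \<delta> * (?u * (1 + ?u)))) / (1 + ?u)" using u0 by simp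
    also have "\<dots> \<le> (?u - ?v) / (1 + ?u)" using lo u0 by (intro divide_right_mono) auto
    also have "\<dots> \<le> ?D" by (rule ln_diff_bounds(1)[OF u0(2) mono])
    finally show ?thesis .
  qed
  then show "?a * (\<epsilon> / \<delta>) * ?u \<le> ?D" by (simp add: mult.assoc)
  have Dhi: "(1 - \<eta>) * ?D \<le> ?A * (\<epsilon> / \<delta> * ?u)"
  proof -
    have "?D \<le> (?u - ?v) / (1 + ?v)" by (rule ln_diff_bounds(2)[OF u0(2) mono])
    also have "\<dots> \<le> (?A * (\<epsilon> / \<delta> * (?u * (1 + ?u)))) / ((1 - \<eta>) * (1 + ?u))"
    proof (rule frac_le)
      show "0 \<le> ?A * (\<epsilon> / \<delta> * (?u * (1 + ?u)))" using pos \<epsilon> \<delta>_pos u0 by simp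
      show "0 < (1 - \<eta>) * (1 + ?u)" using \<eta> u0 by simp
    qed (rule hi, rule v)
    also have "\<dots> = ?A * (\<epsilon> / \<delta> * ?u) / (1 - \<eta>)"
    proof -
      have "(?A * (\<epsilon> / \<delta> * (?u * (1 + ?u)))) = (?A * (\<epsilon> / \<delta> * ?u)) * (1 + ?u)" by (simp only: mult.assoc)
      moreover have "1 + ?u \<noteq> 0" using u0 by simp
      ultimately show ?thesis by (metis mult_divide_mult_cancel_right)
    qed
    finally have "(1 - \<eta>) * ?D \<le> (1 - \<eta>) * (?A * (\<epsilon> / \<delta> * ?u) / (1 - \<eta>))"
      using \<eta> by (intro mult_left_mono) auto
    also have "\<dots> = ?A * (\<epsilon> / \<delta> * ?u)" using \<eta> by (simp only: times_divide_eq_right) simp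
    finally show ?thesis .
  qed
  have \<gamma>H: "\<gamma>0 * H \<epsilon> l = \<alpha>0 * (\<epsilon> / \<delta> * ?u)"
    unfolding \<alpha>0_def \<Theta>_def using \<kappa>0_pos \<delta>_pos \<epsilon> by simp
  have "S \<le> ?A * (\<alpha>0 * (\<epsilon> / \<delta> * ?u))" using c5 unfolding \<gamma>H .
  also have "\<dots> = ?A / ?a * \<alpha>0 * (?a * (\<epsilon> / \<delta> * ?u))" using pos by (simp add: mult_ac)
  also have "\<dots> \<le> ?A / ?a * \<alpha>0 * ?D" using pos \<alpha>0_nonneg Dlo by (intro mult_left_mono) auto
  finally show "S \<le> ?A / ?a * \<alpha>0 * ?D" .
  have "?a * (1 - \<eta>) / ?A * \<alpha>0 * ?D = ?a / ?A * \<alpha>0 * ((1 - \<eta>) * ?D)" by simp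
  also have "\<dots> \<le> ?a / ?A * \<alpha>0 * (?A * (\<epsilon> / \<delta> * ?u))" using pos \<alpha>0_nonneg Dhi by (intro mult_left_mono) auto
  also have "\<dots> = ?a * (\<gamma>0 * H \<epsilon> l)" unfolding \<gamma>H using pos by (simp add: mult_ac)
  also have "\<dots> \<le> S" by (rule c4)
  finally show "?a * (1 - \<eta>) / ?A * \<alpha>0 * ?D \<le> S" .
qed

text \<open>The first \<open>K\<close> cycles, before the vector is nearly constant, contribute at
  most a multiple of \<epsilon>; they also change \<open>H\<close> by at most the factor
  \<open>1 - \<eta>\<close>. From then on every cycle telescopes.\<close>

lemma T_bounds:
  assumes \<eta>: "0 < \<eta>" "\<eta> < 1"
  obtains K where "\<forall>\<^sub>F \<epsilon> in at_right 0.
      (1 - \<eta>) ^ 5 * (1 - \<eta>) / (1 + \<eta>) ^ 5 * \<alpha>0 * ln (1 + (1 - \<eta>) * (\<kappa>0 * (H \<epsilon> 0 / \<epsilon>))) \<le> T \<epsilon> \<and>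
      T \<epsilon> \<le> real (K * N) * (C4 * \<epsilon>) + (1 + \<eta>) ^ 5 / (1 - \<eta>) ^ 5 * \<alpha>0 * ln (1 + \<kappa>0 * (H \<epsilon> 0 / \<epsilon>))"
proof -
  have "(\<lambda>K. (1 - \<theta>) ^ K * (2 / wmin)) \<longlonglongrightarrow> 0 * (2 / wmin)"
    using \<theta>_pos \<theta>_le_1 by (intro tendsto_intros LIMSEQ_realpow_zero) auto
  then have "\<forall>\<^sub>F K in sequentially. (1 - \<theta>) ^ K * (2 / wmin) < \<eta> / 2"
    using \<eta> by (intro order_tendstoD) auto
  then obtain K where "(1 - \<theta>) ^ K * (2 / wmin) < \<eta> / 2"
    using eventually_happens'[OF sequentially_bot] by blast
  then have K: "(1 - \<theta>) ^ K * (2 / wmin) \<le> \<eta> / 2" by (rule less_imp_le)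
  have "\<forall>\<^sub>F \<epsilon> in at_right 0. real N * C3 * \<epsilon> \<le> \<eta>" "\<forall>\<^sub>F \<epsilon> in at_right 0. real (K * N) * C3 * \<epsilon> \<le> \<eta>"
    "\<forall>\<^sub>F \<epsilon> in at_right 0. real (K * N) * C3 * \<epsilon> \<le> 1 / 2"
    "\<forall>\<^sub>F \<epsilon> in at_right 0. real N * C2 / \<theta> * (2 / wmin) * \<epsilon> \<le> \<eta> / 2"
    using \<eta> by (intro eventually_mult_le_at_right; simp)+
  then have "\<forall>\<^sub>F \<epsilon> in at_right 0.
      (1 - \<eta>) ^ 5 * (1 - \<eta>) / (1 + \<eta>) ^ 5 * \<alpha>0 * ln (1 + (1 - \<eta>) * (\<kappa>0 * (H \<epsilon> 0 / \<epsilon>))) \<le> T \<epsilon> \<and>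
      T \<epsilon> \<le> real (K * N) * (C4 * \<epsilon>) + (1 + \<eta>) ^ 5 / (1 - \<eta>) ^ 5 * \<alpha>0 * ln (1 + \<kappa>0 * (H \<epsilon> 0 / \<epsilon>))"
    using eventually_good loss[OF \<eta>(1)] imm_near[OF \<eta>] imm_crude T_lim
  proof eventually_elim
    case (elim \<epsilon>)
    note g = elim(5)
    have \<epsilon>: "0 < \<epsilon>" by (rule \<epsilon>_pos[OF g])
    have s1: "real (K * N) * (C3 * \<epsilon>) \<le> 1 / 2" "real N * (C3 * \<epsilon>) \<le> \<eta>" "real (K * N) * (C3 * \<epsilon>) \<le> \<eta>"
      using elim(1-3) by (simp_all add: mult.assoc)
    let ?l = "\<lambda>c. K * N + c * N"
    define \<Theta> where "\<Theta> c = \<kappa>0 * H \<epsilon> (?l c) / \<epsilon>" for c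
    define S where "S c = (\<Sum>k<N. imm \<epsilon> (\<tau> (?l c + k)) (x \<epsilon> (?l c + k)))" for c
    let ?D = "\<lambda>c. ln (1 + \<Theta> c) - ln (1 + \<Theta> (Suc c))"
    have near: "\<bar>x \<epsilon> k j - H \<epsilon> k\<bar> \<le> \<eta> * H \<epsilon> k" if "?l c \<le> k" for c k j
      by (rule near_direction[OF g K s1(1) elim(4)]) (use that in simp)
    have nx: "?l c + N = ?l (Suc c)" for c by simp
    have step: "(1 - \<eta>) ^ 5 * (\<epsilon> / \<delta>) * \<Theta> c \<le> ?D c"
      "S c \<le> (1 + \<eta>) ^ 5 / (1 - \<eta>) ^ 5 * \<alpha>0 * ?D c"
      "(1 - \<eta>) ^ 5 * (1 - \<eta>) / (1 + \<eta>) ^ 5 * \<alpha>0 * ?D c \<le> S c" for c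
    proof -
      have nr: "\<And>k j. ?l c \<le> k \<Longrightarrow> \<bar>x \<epsilon> k j - H \<epsilon> k\<bar> \<le> \<eta> * H \<epsilon> k" by (rule near)
      note ts = telescope_step[where l = "?l c" and S = "S c", OF g \<eta>
          one_cycle[where l = "?l c", OF g \<eta> nr s1(2) elim(6,7), folded S_def]]
      show "(1 - \<eta>) ^ 5 * (\<epsilon> / \<delta>) * \<Theta> c \<le> ?D c"
        unfolding \<Theta>_def nx[symmetric] by (rule ts(1))
      show "S c \<le> (1 + \<eta>) ^ 5 / (1 - \<eta>) ^ 5 * \<alpha>0 * ?D c"
        unfolding \<Theta>_def nx[symmetric] by (rule ts(2))
      show "(1 - \<eta>) ^ 5 * (1 - \<eta>) / (1 + \<eta>) ^ 5 * \<alpha>0 * ?D c \<le> S c"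
        unfolding \<Theta>_def nx[symmetric] by (rule ts(3))
    qed
    have \<Theta>0: "0 \<le> \<Theta> c" for c unfolding \<Theta>_def using H_nonneg[OF g] \<kappa>0_pos \<epsilon> by simp
    have tel: "(\<Sum>c<C. ?D c) = ln (1 + \<Theta> 0) - ln (1 + \<Theta> C)" for C
      by (induction C) auto
    \<comment> \<open>The total drop of the logarithm bounds the sum of the
      \<open>\<Theta> c\<close>, so \<open>\<Theta>\<close> tends to 0. Thus the telescoping sum
      exhausts the whole logarithm, as the lower bound requires.\<close>
    have "(\<Sum>c<C. (1 - \<eta>) ^ 5 * (\<epsilon> / \<delta>) * \<Theta> c) \<le> ln (1 + \<Theta> 0)" for C
    proof -
      have "(\<Sum>c<C. (1 - \<eta>) ^ 5 * (\<epsilon> / \<delta>) * \<Theta> c) \<le> (\<Sum>c<C. ?D c)" by (intro sum_mono step)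
      also have "\<dots> \<le> ln (1 + \<Theta> 0)" unfolding tel using \<Theta>0[of C] by simp
      finally show ?thesis .
    qed
    moreover have cpos: "0 < (1 - \<eta>) ^ 5 * (\<epsilon> / \<delta>)" using \<eta> \<epsilon> \<delta>_pos by simp
    moreover have "0 \<le> (1 - \<eta>) ^ 5 * (\<epsilon> / \<delta>) * \<Theta> c" for c
      by (rule mult_nonneg_nonneg[OF less_imp_le[OF cpos] \<Theta>0])
    ultimately have "summable (\<lambda>c. (1 - \<eta>) ^ 5 * (\<epsilon> / \<delta>) * \<Theta> c)"
      by (intro summableI_nonneg_bounded[where x = "ln (1 + \<Theta> 0)"])
    then have "(\<lambda>c. (1 - \<eta>) ^ 5 * (\<epsilon> / \<delta>) * \<Theta> c) \<longlonglongrightarrow> 0" by (rule summable_LIMSEQ_zero)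
    then have "(\<lambda>c. inverse ((1 - \<eta>) ^ 5 * (\<epsilon> / \<delta>)) * ((1 - \<eta>) ^ 5 * (\<epsilon> / \<delta>) * \<Theta> c)) \<longlonglongrightarrow> inverse ((1 - \<eta>) ^ 5 * (\<epsilon> / \<delta>)) * 0"
      by (intro tendsto_intros)
    moreover have "inverse ((1 - \<eta>) ^ 5 * (\<epsilon> / \<delta>)) * ((1 - \<eta>) ^ 5 * (\<epsilon> / \<delta>) * \<Theta> c) = \<Theta> c" for c
    proof -
      have inv: "inverse b * (b * y) = y" if "0 < b" for b y :: real using that by simp
      show ?thesis by (rule inv[OF cpos])
    qed
    ultimately have \<Theta>lim: "\<Theta> \<longlonglongrightarrow> 0" by simp
    define P0 where "P0 = (\<Sum>l<K * N. imm \<epsilon> (\<tau> l) (x \<epsilon> l))"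
    have P0: "0 \<le> P0" "P0 \<le> real (K * N) * (C4 * \<epsilon>)"
    proof -
      have b: "0 \<le> imm \<epsilon> (\<tau> l) (x \<epsilon> l) \<and> imm \<epsilon> (\<tau> l) (x \<epsilon> l) \<le> C4 * \<epsilon>" for l
        using elim(8) x_bounds[OF g] by blast
      show "0 \<le> P0" unfolding P0_def using b by (intro sum_nonneg) auto
      have "P0 \<le> (\<Sum>l<K * N. C4 * \<epsilon>)" unfolding P0_def using b by (intro sum_mono) auto
      then show "P0 \<le> real (K * N) * (C4 * \<epsilon>)" by simp
    qed
    have split: "(\<Sum>l<(C + K) * N. imm \<epsilon> (\<tau> l) (x \<epsilon> l)) = P0 + (\<Sum>c<C. S c)" for C
    proof (induction C)
      case 0
      then show ?case by (simp add: P0_def)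
    next
      case (Suc C)
      have "(\<Sum>l<(Suc C + K) * N. imm \<epsilon> (\<tau> l) (x \<epsilon> l))
        = (\<Sum>l<(C + K) * N. imm \<epsilon> (\<tau> l) (x \<epsilon> l)) + (\<Sum>l\<in>{(C + K) * N..<(C + K) * N + N}. imm \<epsilon> (\<tau> l) (x \<epsilon> l))"
      proof -
        have "{..<(Suc C + K) * N} = {..<(C + K) * N} \<union> {(C + K) * N..<(C + K) * N + N}" by auto
        then show ?thesis by (simp add: sum.union_disjoint ivl_disj_int)
      qed
      also have "(\<Sum>l\<in>{(C + K) * N..<(C + K) * N + N}. imm \<epsilon> (\<tau> l) (x \<epsilon> l)) = S C"
        using sum.shift_bounds_nat_ivl[of "\<lambda>l. imm \<epsilon> (\<tau> l) (x \<epsilon> l)" 0 "(C + K) * N" N]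
        by (simp add: S_def atLeast0LessThan add.commute add.left_commute distrib_right)
      finally show ?case using Suc by simp
    qed
    have T: "(\<lambda>C. P0 + (\<Sum>c<C. S c)) \<longlonglongrightarrow> T \<epsilon>"
      using LIMSEQ_ignore_initial_segment[OF elim(9), of K] unfolding split .
    let ?hi = "(1 + \<eta>) ^ 5 / (1 - \<eta>) ^ 5 * \<alpha>0" and ?lo = "(1 - \<eta>) ^ 5 * (1 - \<eta>) / (1 + \<eta>) ^ 5 * \<alpha>0"
    have coef: "0 \<le> ?hi" "0 \<le> ?lo" using \<eta> \<alpha>0_nonneg by auto
    have "T \<epsilon> \<le> real (K * N) * (C4 * \<epsilon>) + ?hi * ln (1 + \<Theta> 0)"
    proof (rule LIMSEQ_le_const2[OF T], intro exI allI impI)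
      fix C
      have "(\<Sum>c<C. S c) \<le> (\<Sum>c<C. ?hi * ?D c)" by (intro sum_mono step)
      also have "\<dots> = ?hi * (ln (1 + \<Theta> 0) - ln (1 + \<Theta> C))" by (simp only: sum_distrib_left[symmetric] tel)
      also have "\<dots> \<le> ?hi * ln (1 + \<Theta> 0)" using coef \<Theta>0[of C] by (intro mult_left_mono) auto
      finally show "P0 + (\<Sum>c<C. S c) \<le> real (K * N) * (C4 * \<epsilon>) + ?hi * ln (1 + \<Theta> 0)" using P0 by simp
    qed
    moreover have "?lo * ln (1 + \<Theta> 0) \<le> T \<epsilon>"
    proof (rule LIMSEQ_le[OF _ T])
      have "(\<lambda>C. ?lo * (ln (1 + \<Theta> 0) - ln (1 + \<Theta> C))) \<longlonglongrightarrow> ?lo * (ln (1 + \<Theta> 0) - ln (1 + 0))"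
        by (intro tendsto_intros \<Theta>lim) auto
      then show "(\<lambda>C. ?lo * (ln (1 + \<Theta> 0) - ln (1 + \<Theta> C))) \<longlonglongrightarrow> ?lo * ln (1 + \<Theta> 0)" by simp
      show "\<exists>C0. \<forall>C\<ge>C0. ?lo * (ln (1 + \<Theta> 0) - ln (1 + \<Theta> C)) \<le> P0 + (\<Sum>c<C. S c)"
      proof (intro exI allI impI)
        fix C
        have "?lo * (ln (1 + \<Theta> 0) - ln (1 + \<Theta> C)) = (\<Sum>c<C. ?lo * ?D c)" by (simp only: sum_distrib_left[symmetric] tel)
        also have "\<dots> \<le> (\<Sum>c<C. S c)" by (intro sum_mono step)
        finally show "?lo * (ln (1 + \<Theta> 0) - ln (1 + \<Theta> C)) \<le> P0 + (\<Sum>c<C. S c)" using P0 by simp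
      qed
    qed
    moreover have "\<Theta> 0 \<le> \<kappa>0 * (H \<epsilon> 0 / \<epsilon>)"
      unfolding \<Theta>_def using H_add(1)[OF g, of 0 "K * N"] \<kappa>0_pos \<epsilon> by (simp add: divide_right_mono)
    moreover have "(1 - \<eta>) * (\<kappa>0 * (H \<epsilon> 0 / \<epsilon>)) \<le> \<Theta> 0"
    proof -
      have "(1 - \<eta>) * H \<epsilon> 0 \<le> (1 - real (K * N) * (C3 * \<epsilon>)) * H \<epsilon> 0"
        using s1(3) H_nonneg[OF g] by (intro mult_right_mono) auto
      also have "\<dots> \<le> H \<epsilon> (K * N)" using H_add(2)[OF g, of "K * N" 0] by simp
      finally have "\<kappa>0 / \<epsilon> * ((1 - \<eta>) * H \<epsilon> 0) \<le> \<kappa>0 / \<epsilon> * H \<epsilon> (K * N)"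
        using \<kappa>0_pos \<epsilon> by (intro mult_left_mono) auto
      then show ?thesis by (simp add: \<Theta>_def mult_ac)
    qed
    moreover have "0 \<le> (1 - \<eta>) * (\<kappa>0 * (H \<epsilon> 0 / \<epsilon>))"
      using \<eta> \<kappa>0_pos \<epsilon> H_nonneg[OF g] by simp
    ultimately have l1: "ln (1 + (1 - \<eta>) * (\<kappa>0 * (H \<epsilon> 0 / \<epsilon>))) \<le> ln (1 + \<Theta> 0)"
      and l2: "ln (1 + \<Theta> 0) \<le> ln (1 + \<kappa>0 * (H \<epsilon> 0 / \<epsilon>))"
      using \<Theta>0[of 0] by (auto intro!: ln_mono)
    show ?case
      using mult_left_mono[OF l1 coef(2)] mult_left_mono[OF l2 coef(1)] \<open>T \<epsilon> \<le> _\<close> \<open>?lo * ln (1 + \<Theta> 0) \<le> T \<epsilon>\<close> by linarith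
  qed
  then show ?thesis by (rule that)
qed

text \<open>For fixed \<open>\<eta>\<close> the bounds converge as \<epsilon> tends to 0, and their
  limits come arbitrarily close to the claimed value as \<open>\<eta>\<close> tends to 0. The
  burn-in length \<open>K\<close> depends on \<open>\<eta>\<close> alone, which fixes this order of
  limits.\<close>

theorem T_tendsto: "(T \<longlongrightarrow> \<alpha>0 * ln (1 + \<kappa>0 * h0)) (at_right 0)"
proof -
  have H0: "((\<lambda>\<epsilon>. H \<epsilon> 0 / \<epsilon>) \<longlongrightarrow> h0) (at_right 0)" unfolding H_def by (rule H_0)
  have "\<forall>\<^sub>F \<epsilon> in at_right 0. 0 \<le> H \<epsilon> 0 / \<epsilon>"
    using eventually_good by eventually_elim (auto intro!: divide_nonneg_pos H_nonneg \<epsilon>_pos)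
  then have h0: "0 \<le> h0" by (rule tendsto_lowerbound[OF H0]) simp
  have kh: "0 \<le> \<kappa>0 * h0" using h0 \<kappa>0_pos by simp
  have ev1: "\<forall>\<^sub>F \<eta> in at_right 0. \<eta> < (1 :: real)" by (rule eventually_at_rightI[of 0 1]) auto
  show ?thesis
  proof (rule order_tendstoI)
    fix a assume a: "a < \<alpha>0 * ln (1 + \<kappa>0 * h0)"
    have "((\<lambda>\<eta>. (1 - \<eta>) ^ 5 * (1 - \<eta>) / (1 + \<eta>) ^ 5 * \<alpha>0 * ln (1 + (1 - \<eta>) * (\<kappa>0 * h0)))
      \<longlongrightarrow> (1 - 0) ^ 5 * (1 - 0) / (1 + 0) ^ 5 * \<alpha>0 * ln (1 + (1 - 0) * (\<kappa>0 * h0))) (at_right 0)"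
      using kh by (intro tendsto_intros) auto
    then have "\<forall>\<^sub>F \<eta> in at_right 0. a < (1 - \<eta>) ^ 5 * (1 - \<eta>) / (1 + \<eta>) ^ 5 * \<alpha>0 * ln (1 + (1 - \<eta>) * (\<kappa>0 * h0))"
      using a by (intro order_tendstoD) auto
    then have "\<forall>\<^sub>F \<eta> in at_right 0. 0 < \<eta> \<and> \<eta> < 1 \<and> a < (1 - \<eta>) ^ 5 * (1 - \<eta>) / (1 + \<eta>) ^ 5 * \<alpha>0 * ln (1 + (1 - \<eta>) * (\<kappa>0 * h0))"
      using ev1 eventually_at_right_less[of 0] by eventually_elim auto
    then obtain \<eta> where \<eta>: "0 < \<eta>" "\<eta> < 1" and ae: "a < (1 - \<eta>) ^ 5 * (1 - \<eta>) / (1 + \<eta>) ^ 5 * \<alpha>0 * ln (1 + (1 - \<eta>) * (\<kappa>0 * h0))"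
      using eventually_happens'[OF trivial_limit_at_right_real] by blast
    obtain K where K: "\<forall>\<^sub>F \<epsilon> in at_right 0.
      (1 - \<eta>) ^ 5 * (1 - \<eta>) / (1 + \<eta>) ^ 5 * \<alpha>0 * ln (1 + (1 - \<eta>) * (\<kappa>0 * (H \<epsilon> 0 / \<epsilon>))) \<le> T \<epsilon> \<and>
      T \<epsilon> \<le> real (K * N) * (C4 * \<epsilon>) + (1 + \<eta>) ^ 5 / (1 - \<eta>) ^ 5 * \<alpha>0 * ln (1 + \<kappa>0 * (H \<epsilon> 0 / \<epsilon>))"
      using T_bounds[OF \<eta>] by blast
    have p1: "0 < 1 + (1 - \<eta>) * (\<kappa>0 * h0)" using \<eta> kh by (simp add: add_pos_nonneg)
    have "((\<lambda>\<epsilon>. (1 - \<eta>) ^ 5 * (1 - \<eta>) / (1 + \<eta>) ^ 5 * \<alpha>0 * ln (1 + (1 - \<eta>) * (\<kappa>0 * (H \<epsilon> 0 / \<epsilon>))))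
      \<longlongrightarrow> (1 - \<eta>) ^ 5 * (1 - \<eta>) / (1 + \<eta>) ^ 5 * \<alpha>0 * ln (1 + (1 - \<eta>) * (\<kappa>0 * h0))) (at_right 0)"
      by (intro tendsto_mult tendsto_const tendsto_ln tendsto_add H0) (use p1 in auto)
    from order_tendstoD(1)[OF this ae] K
    show "\<forall>\<^sub>F \<epsilon> in at_right 0. a < T \<epsilon>" by eventually_elim linarith
  next
    fix a assume a: "\<alpha>0 * ln (1 + \<kappa>0 * h0) < a"
    have "((\<lambda>\<eta>. (1 + \<eta>) ^ 5 / (1 - \<eta>) ^ 5 * \<alpha>0 * ln (1 + \<kappa>0 * h0))
      \<longlongrightarrow> (1 + 0) ^ 5 / (1 - 0) ^ 5 * \<alpha>0 * ln (1 + \<kappa>0 * h0)) (at_right 0)"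
      by (intro tendsto_intros) auto
    then have "\<forall>\<^sub>F \<eta> in at_right 0. (1 + \<eta>) ^ 5 / (1 - \<eta>) ^ 5 * \<alpha>0 * ln (1 + \<kappa>0 * h0) < a"
      using a by (intro order_tendstoD) auto
    then have "\<forall>\<^sub>F \<eta> in at_right 0. 0 < \<eta> \<and> \<eta> < 1 \<and> (1 + \<eta>) ^ 5 / (1 - \<eta>) ^ 5 * \<alpha>0 * ln (1 + \<kappa>0 * h0) < a"
      using ev1 eventually_at_right_less[of 0] by eventually_elim auto
    then obtain \<eta> where \<eta>: "0 < \<eta>" "\<eta> < 1" and ae: "(1 + \<eta>) ^ 5 / (1 - \<eta>) ^ 5 * \<alpha>0 * ln (1 + \<kappa>0 * h0) < a"
      using eventually_happens'[OF trivial_limit_at_right_real] by blast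
    obtain K where K: "\<forall>\<^sub>F \<epsilon> in at_right 0.
      (1 - \<eta>) ^ 5 * (1 - \<eta>) / (1 + \<eta>) ^ 5 * \<alpha>0 * ln (1 + (1 - \<eta>) * (\<kappa>0 * (H \<epsilon> 0 / \<epsilon>))) \<le> T \<epsilon> \<and>
      T \<epsilon> \<le> real (K * N) * (C4 * \<epsilon>) + (1 + \<eta>) ^ 5 / (1 - \<eta>) ^ 5 * \<alpha>0 * ln (1 + \<kappa>0 * (H \<epsilon> 0 / \<epsilon>))"
      using T_bounds[OF \<eta>] by blast
    have p1: "0 < 1 + \<kappa>0 * h0" using kh by simp
    have "((\<lambda>\<epsilon>. real (K * N) * (C4 * \<epsilon>) + (1 + \<eta>) ^ 5 / (1 - \<eta>) ^ 5 * \<alpha>0 * ln (1 + \<kappa>0 * (H \<epsilon> 0 / \<epsilon>)))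
      \<longlongrightarrow> real (K * N) * (C4 * 0) + (1 + \<eta>) ^ 5 / (1 - \<eta>) ^ 5 * \<alpha>0 * ln (1 + \<kappa>0 * h0)) (at_right 0)"
      by (intro tendsto_mult tendsto_const tendsto_ln tendsto_add H0 tendsto_ident_at) (use p1 in auto)
    from order_tendstoD(2)[OF this, of a] ae
    have "\<forall>\<^sub>F \<epsilon> in at_right 0. real (K * N) * (C4 * \<epsilon>) + (1 + \<eta>) ^ 5 / (1 - \<eta>) ^ 5 * \<alpha>0 * ln (1 + \<kappa>0 * (H \<epsilon> 0 / \<epsilon>)) < a"
      by simp
    with K show "\<forall>\<^sub>F \<epsilon> in at_right 0. T \<epsilon> < a" by eventually_elim linarith
  qed
qed

end

section \<open>Laplace transforms of nonnegative laws near 0\<close>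

text \<open>Alternating Taylor bounds, each obtained by integrating the previous one. The cubic one
  serves only pointwise limits.\<close>

lemma exp_minus_taylor:
  fixes u :: real
  assumes u: "0 \<le> u"
  shows "1 - u \<le> exp (- u)" "exp (- u) \<le> 1 - u + u ^ 2 / 2" "1 - u + u ^ 2 / 2 - u ^ 3 / 6 \<le> exp (- u)"
proof -
  show 1: "1 - v \<le> exp (- v)" for v :: real using exp_ge_add_one_self[of "- v"] by simp
  have 2: "exp (- v) \<le> 1 - v + v ^ 2 / 2" if "0 \<le> v" for v :: real
  proof -
    have "(\<lambda>x. 1 - x + x ^ 2 / 2 - exp (- x)) 0 \<le> (\<lambda>x. 1 - x + x ^ 2 / 2 - exp (- x)) v"
    proof (rule DERIV_nonneg_imp_nondecreasing[OF that])
      fix x :: real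
      show "\<exists>y. ((\<lambda>x. 1 - x + x ^ 2 / 2 - exp (- x)) has_real_derivative y) (at x) \<and> 0 \<le> y"
        using 1[of x] by (intro exI[of _ "- 1 + x + exp (- x)"]) (auto intro!: derivative_eq_intros)
    qed
    then show ?thesis by simp
  qed
  show "exp (- u) \<le> 1 - u + u ^ 2 / 2" by (rule 2[OF u])
  have "(\<lambda>x. exp (- x) - 1 + x - x ^ 2 / 2 + x ^ 3 / 6) 0 \<le> (\<lambda>x. exp (- x) - 1 + x - x ^ 2 / 2 + x ^ 3 / 6) u"
  proof (rule DERIV_nonneg_imp_nondecreasing[OF u])
    fix x :: real assume "0 \<le> x"
    then show "\<exists>y. ((\<lambda>x. exp (- x) - 1 + x - x ^ 2 / 2 + x ^ 3 / 6) has_real_derivative y) (at x) \<and> 0 \<le> y"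
      using 2[of x] by (intro exI[of _ "- exp (- x) + 1 - x + x ^ 2 / 2"])
        (auto intro!: derivative_eq_intros simp: power2_eq_square)
  qed
  then show "1 - u + u ^ 2 / 2 - u ^ 3 / 6 \<le> exp (- u)" by simp
qed

locale nonneg_law = real_distribution D for D +
  assumes nonneg: "AE x in D. 0 \<le> x" and int1: "integrable D (\<lambda>x. x)"
begin

lemma mean_eq: "mean D = (\<integral>x. x \<partial>D)" by (simp add: moment_def)

lemma moment_Suc_0: "moment (Suc 0) D = (\<integral>x. x \<partial>D)" by (simp add: moment_def)

lemma prob_UNIV: "prob UNIV = 1" using prob_space by simp

lemma mean_nonneg: "0 \<le> mean D"
  unfolding mean_eq using nonneg by (rule integral_nonneg_AE)

lemma integrable_exp: "0 \<le> t \<Longrightarrow> integrable D (\<lambda>x. exp (- t * x))"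
  by (rule integrable_const_bound[where B = 1]) (use nonneg in \<open>auto elim!: eventually_mono\<close>)

lemma one_minus_lst: "0 \<le> t \<Longrightarrow> 1 - lst D t = (\<integral>x. 1 - exp (- t * x) \<partial>D)"
  unfolding lst_def using integrable_exp by (subst Bochner_Integration.integral_diff) (auto simp: prob_UNIV)

lemma lst_le_1: "0 \<le> t \<Longrightarrow> lst D t \<le> 1"
proof -
  assume t: "0 \<le> t"
  have "0 \<le> (\<integral>x. 1 - exp (- t * x) \<partial>D)"
    using nonneg by (intro integral_nonneg_AE) (auto elim!: eventually_mono simp: t)
  then show ?thesis using one_minus_lst[OF t] by simp
qed

lemma lst_upper: "0 \<le> t \<Longrightarrow> 1 - lst D t \<le> t * mean D"
proof -
  assume t: "0 \<le> t"
  have "(\<integral>x. 1 - exp (- t * x) \<partial>D) \<le> (\<integral>x. t * x \<partial>D)"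
  proof (rule integral_mono_AE)
    show "AE x in D. 1 - exp (- t * x) \<le> t * x"
      using nonneg by eventually_elim (use exp_minus_taylor(1) t in \<open>auto simp: algebra_simps\<close>)
  qed (use t integrable_exp int1 in auto)
  then show ?thesis using t by (simp add: one_minus_lst moment_Suc_0)
qed

lemma lst_pos: "0 \<le> t \<Longrightarrow> 0 < lst D t"
proof -
  assume t: "0 \<le> t"
  have "lst D t \<noteq> 0"
  proof
    assume "lst D t = 0"
    then have "AE x in D. exp (- t * x) = 0"
      unfolding lst_def using integrable_exp[OF t] by (subst (asm) integral_nonneg_eq_0_iff_AE) auto
    then have "AE x in D. False" by eventually_elim simp
    then show False by simp
  qed
  moreover have "0 \<le> lst D t" unfolding lst_def by simp
  ultimately show ?thesis by simp
qed

text \<open>Dominated convergence with majorant \<open>x\<close>: the difference quotient of the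
  exponential increases to \<open>x\<close> as its argument shrinks.\<close>

lemma lst_first_order: "((\<lambda>t. (1 - lst D t) / t) \<longlongrightarrow> mean D) (at_right 0)"
  unfolding tendsto_at_iff_sequentially
proof (intro allI impI)
  fix X :: "nat \<Rightarrow> real" assume X: "\<forall>i. X i \<in> {0<..} - {0}" "X \<longlonglongrightarrow> 0"
  then have Xp: "0 < X i" for i by auto
  have "(\<lambda>i. \<integral>x. (1 - exp (- X i * x)) / X i \<partial>D) \<longlonglongrightarrow> (\<integral>x. x \<partial>D)"
  proof (rule integral_dominated_convergence[where w = "\<lambda>x. x"])
    show "AE x in D. (\<lambda>i. (1 - exp (- X i * x)) / X i) \<longlonglongrightarrow> x"
      using nonneg
    proof eventually_elim
      case (elim x)
      show ?case
      proof (rule tendsto_sandwich[where f = "\<lambda>i. x - X i * x ^ 2 / 2" and h = "\<lambda>_. x"])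
        have "(\<lambda>i. x - X i * x ^ 2 / 2) \<longlonglongrightarrow> x - 0 * x ^ 2 / 2" by (intro tendsto_intros X) auto
        then show "(\<lambda>i. x - X i * x ^ 2 / 2) \<longlonglongrightarrow> x" by simp
        show "\<forall>\<^sub>F i in sequentially. x - X i * x ^ 2 / 2 \<le> (1 - exp (- X i * x)) / X i"
        proof (intro always_eventually allI)
          fix i
          have "exp (- (X i * x)) \<le> 1 - X i * x + (X i * x) ^ 2 / 2"
            by (rule exp_minus_taylor(2)) (use Xp[of i] elim in simp)
          then have "(x - X i * x ^ 2 / 2) * X i \<le> 1 - exp (- X i * x)"
            by (simp add: algebra_simps power2_eq_square)
          then show "x - X i * x ^ 2 / 2 \<le> (1 - exp (- X i * x)) / X i"
            by (simp only: pos_le_divide_eq[OF Xp[of i]])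
        qed
        show "\<forall>\<^sub>F i in sequentially. (1 - exp (- X i * x)) / X i \<le> x"
        proof (intro always_eventually allI)
          fix i
          show "(1 - exp (- X i * x)) / X i \<le> x"
            using exp_minus_taylor(1)[of "X i * x"] Xp[of i] elim by (simp add: pos_divide_le_eq algebra_simps)
        qed
      qed simp
    qed
    fix i show "AE x in D. norm ((1 - exp (- X i * x)) / X i) \<le> x"
      using nonneg
    proof eventually_elim
      case (elim x)
      have "0 \<le> 1 - exp (- X i * x)" using Xp[of i] elim by simp
      moreover have "1 - exp (- X i * x) \<le> x * X i"
        using exp_minus_taylor(1)[of "X i * x"] Xp[of i] elim by (simp add: algebra_simps)
      ultimately show ?case using Xp[of i] by (simp add: pos_divide_le_eq)
    qed
  next
    show "integrable D (\<lambda>x. x)" by (rule int1)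
    show "(\<lambda>x. x) \<in> borel_measurable D" by simp
    fix i show "(\<lambda>x. (1 - exp (- X i * x)) / X i) \<in> borel_measurable D" by measurable
  qed
  moreover have "(\<lambda>i. \<integral>x. (1 - exp (- X i * x)) / X i \<partial>D) = (\<lambda>t. (1 - lst D t) / t) \<circ> X"
    unfolding comp_def one_minus_lst[OF less_imp_le[OF Xp]] by (intro ext integral_divide_zero)
  ultimately show "((\<lambda>t. (1 - lst D t) / t) \<circ> X) \<longlonglongrightarrow> mean D" by (simp only: mean_eq)
qed

text \<open>A relative bound, uniform near 0. The limit yields it only for a positive mean; for the
  point mass at 0 both sides vanish or are nonnegative.\<close>

lemma lst_first_order_lower:
  assumes "0 < \<eta>"
  obtains t0 where "0 < t0" "\<And>t. 0 \<le> t \<Longrightarrow> t \<le> t0 \<Longrightarrow> (1 - \<eta>) * (t * mean D) \<le> 1 - lst D t"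
proof (cases "mean D = 0")
  case True
  show ?thesis by (rule that[of 1]) (use True lst_le_1 in auto)
next
  case False
  then have "(1 - \<eta>) * mean D < mean D" using mean_nonneg assms by simp
  from order_tendstoD(1)[OF lst_first_order this]
  obtain t0 where t0: "0 < t0" "\<And>t. 0 < t \<Longrightarrow> t < t0 \<Longrightarrow> (1 - \<eta>) * mean D < (1 - lst D t) / t"
    unfolding eventually_at_right_field by blast
  show ?thesis
  proof (rule that[of "t0 / 2"])
    fix t assume t: "0 \<le> t" "t \<le> t0 / 2"
    show "(1 - \<eta>) * (t * mean D) \<le> 1 - lst D t"
    proof (cases "t = 0")
      case False
      then have "(1 - \<eta>) * mean D < (1 - lst D t) / t" using t0 t by simp
      then show ?thesis using t False by (simp add: pos_less_divide_eq mult_ac less_imp_le)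
    qed (use lst_le_1[of 0] in simp)
  qed (use t0 in simp)
qed

text \<open>The second remainder of the exponential lies between 0 and
  \<open>(t * x) ^ 2 / 2\<close>. This bound is both the inequality and the majorant for the limit,
  so that two finite moments suffice.\<close>

lemma lst_second_order:
  assumes int2: "integrable D (\<lambda>x. x ^ 2)"
  shows "0 \<le> t \<Longrightarrow> mean D * t - (1 - lst D t) \<le> moment 2 D / 2 * t ^ 2"
    and "((\<lambda>t. (mean D * t - (1 - lst D t)) / t ^ 2) \<longlongrightarrow> moment 2 D / 2) (at_right 0)"
proof -
  have e: "mean D * t - (1 - lst D t) = (\<integral>x. exp (- t * x) - 1 + t * x \<partial>D)" if "0 \<le> t" for t
    unfolding one_minus_lst[OF that] using integrable_exp[OF that] int1 by (simp add: mean_eq moment_Suc_0 prob_UNIV)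
  have i: "integrable D (\<lambda>x. exp (- t * x) - 1 + t * x)" if "0 \<le> t" for t
    using integrable_exp[OF that] int1 by auto
  have b: "AE x in D. 0 \<le> exp (- t * x) - 1 + t * x \<and> exp (- t * x) - 1 + t * x \<le> t ^ 2 * (x ^ 2 / 2)" if "0 \<le> t" for t
    using nonneg
  proof eventually_elim
    case (elim x)
    then show ?case using exp_minus_taylor(1,2)[of "t * x"] that by (simp add: power_mult_distrib algebra_simps)
  qed
  show "mean D * t - (1 - lst D t) \<le> moment 2 D / 2 * t ^ 2" if t: "0 \<le> t"
  proof -
    have "(\<integral>x. exp (- t * x) - 1 + t * x \<partial>D) \<le> (\<integral>x. t ^ 2 * (x ^ 2 / 2) \<partial>D)"
      by (rule integral_mono_AE) (use i[OF t] int2 b[OF t] in auto)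
    then show ?thesis unfolding e[OF t] by (simp add: moment_def mult.commute)
  qed
  show "((\<lambda>t. (mean D * t - (1 - lst D t)) / t ^ 2) \<longlongrightarrow> moment 2 D / 2) (at_right 0)"
    unfolding tendsto_at_iff_sequentially
  proof (intro allI impI)
    fix X :: "nat \<Rightarrow> real" assume X: "\<forall>i. X i \<in> {0<..} - {0}" "X \<longlonglongrightarrow> 0"
    then have Xp: "0 < X i" for i by auto
    have "(\<lambda>i. \<integral>x. (exp (- X i * x) - 1 + X i * x) / X i ^ 2 \<partial>D) \<longlonglongrightarrow> (\<integral>x. x ^ 2 / 2 \<partial>D)"
    proof (rule integral_dominated_convergence[where w = "\<lambda>x. x ^ 2 / 2"])
      show "AE x in D. (\<lambda>i. (exp (- X i * x) - 1 + X i * x) / X i ^ 2) \<longlonglongrightarrow> x ^ 2 / 2"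
        using nonneg
      proof eventually_elim
        case (elim x)
        show ?case
        proof (rule tendsto_sandwich[where f = "\<lambda>i. x ^ 2 / 2 - X i * x ^ 3 / 6" and h = "\<lambda>_. x ^ 2 / 2"])
          have "(\<lambda>i. x ^ 2 / 2 - X i * x ^ 3 / 6) \<longlonglongrightarrow> x ^ 2 / 2 - 0 * x ^ 3 / 6" by (intro tendsto_intros X) auto
          then show "(\<lambda>i. x ^ 2 / 2 - X i * x ^ 3 / 6) \<longlonglongrightarrow> x ^ 2 / 2" by simp
          show "\<forall>\<^sub>F i in sequentially. x ^ 2 / 2 - X i * x ^ 3 / 6 \<le> (exp (- X i * x) - 1 + X i * x) / X i ^ 2"
          proof (intro always_eventually allI)
            fix i
            have "1 - X i * x + (X i * x) ^ 2 / 2 - (X i * x) ^ 3 / 6 \<le> exp (- (X i * x))"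
              by (rule exp_minus_taylor(3)) (use Xp[of i] elim in simp)
            then have "(x ^ 2 / 2 - X i * x ^ 3 / 6) * X i ^ 2 \<le> exp (- X i * x) - 1 + X i * x"
              by (simp add: power_mult_distrib algebra_simps power2_eq_square power3_eq_cube)
            then show "x ^ 2 / 2 - X i * x ^ 3 / 6 \<le> (exp (- X i * x) - 1 + X i * x) / X i ^ 2"
              using Xp[of i] by (simp add: pos_le_divide_eq)
          qed
          show "\<forall>\<^sub>F i in sequentially. (exp (- X i * x) - 1 + X i * x) / X i ^ 2 \<le> x ^ 2 / 2"
          proof (intro always_eventually allI)
            fix i
            have "exp (- (X i * x)) \<le> 1 - X i * x + (X i * x) ^ 2 / 2"
              by (rule exp_minus_taylor(2)) (use Xp[of i] elim in simp)
            then have "exp (- X i * x) - 1 + X i * x \<le> x ^ 2 / 2 * X i ^ 2"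
              by (simp add: power_mult_distrib algebra_simps)
            then show "(exp (- X i * x) - 1 + X i * x) / X i ^ 2 \<le> x ^ 2 / 2"
              using Xp[of i] by (simp add: pos_divide_le_eq)
          qed
        qed simp
      qed
      fix i show "AE x in D. norm ((exp (- X i * x) - 1 + X i * x) / X i ^ 2) \<le> x ^ 2 / 2"
        using b[OF less_imp_le[OF Xp[of i]]]
      proof eventually_elim
        case (elim x)
        then show ?case using Xp[of i] by (simp add: pos_divide_le_eq mult.commute)
      qed
    qed (use int2 in auto)
    moreover have "(\<integral>x. x ^ 2 / 2 \<partial>D) = moment 2 D / 2" by (simp add: moment_def)
    moreover have "(\<lambda>i. \<integral>x. (exp (- X i * x) - 1 + X i * x) / X i ^ 2 \<partial>D)
      = (\<lambda>t. (mean D * t - (1 - lst D t)) / t ^ 2) \<circ> X"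
      unfolding comp_def e[OF less_imp_le[OF Xp]] by (intro ext integral_divide_zero)
    ultimately show "((\<lambda>t. (mean D * t - (1 - lst D t)) / t ^ 2) \<circ> X) \<longlonglongrightarrow> moment 2 D / 2"
      by (simp only:)
  qed
qed

text \<open>A vanishing second moment would concentrate the law at 0 and make the mean
  vanish.\<close>

lemma moment2_pos:
  assumes int2: "integrable D (\<lambda>x. x ^ 2)" and m: "0 < mean D"
  shows "0 < moment 2 D"
proof -
  have "moment 2 D \<noteq> 0"
  proof
    assume "moment 2 D = 0"
    then have "AE x in D. x ^ 2 = 0"
      unfolding moment_def using int2 by (subst (asm) integral_nonneg_eq_0_iff_AE) auto
    then have "(\<integral>x. x \<partial>D) = (\<integral>x. 0 \<partial>D)" by (intro integral_cong_AE) auto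
    then show False using m by (simp add: moment_Suc_0)
  qed
  moreover have "0 \<le> moment 2 D" unfolding moment_def by simp
  ultimately show ?thesis by simp
qed

lemma lst_second_order_lower:
  assumes int2: "integrable D (\<lambda>x. x ^ 2)" and m: "0 < mean D" and \<eta>: "0 < \<eta>"
  obtains t0 where "0 < t0" "\<And>t. 0 \<le> t \<Longrightarrow> t \<le> t0 \<Longrightarrow> (1 - \<eta>) * (moment 2 D / 2 * t ^ 2) \<le> mean D * t - (1 - lst D t)"
proof -
  have "(1 - \<eta>) * (moment 2 D / 2) < moment 2 D / 2" using moment2_pos[OF int2 m] \<eta> by simp
  from order_tendstoD(1)[OF lst_second_order(2)[OF int2] this]
  obtain t0 where t0: "0 < t0" "\<And>t. 0 < t \<Longrightarrow> t < t0 \<Longrightarrow> (1 - \<eta>) * (moment 2 D / 2) < (mean D * t - (1 - lst D t)) / t ^ 2"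
    unfolding eventually_at_right_field by blast
  show ?thesis
  proof (rule that[of "t0 / 2"])
    fix t assume t: "0 \<le> t" "t \<le> t0 / 2"
    show "(1 - \<eta>) * (moment 2 D / 2 * t ^ 2) \<le> mean D * t - (1 - lst D t)"
    proof (cases "t = 0")
      case False
      then have "(1 - \<eta>) * (moment 2 D / 2) < (mean D * t - (1 - lst D t)) / t ^ 2" using t0 t by simp
      then show ?thesis using t False by (simp add: pos_less_divide_eq mult_ac less_imp_le)
    qed (use lst_le_1[of 0] lst_upper[of 0] in simp)
  qed (use t0 in simp)
qed

text \<open>Both bounds are \<open>ln v \<le> v - 1\<close>, applied to the transform and to its
  reciprocal.\<close>

lemma minus_ln_lst:
  assumes t: "0 \<le> t"
  shows "1 - lst D t \<le> - ln (lst D t)" "- ln (lst D t) \<le> t * mean D / lst D t"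
proof -
  have p: "0 < lst D t" by (rule lst_pos[OF t])
  show "1 - lst D t \<le> - ln (lst D t)" using ln_le_minus_one[OF p] by simp
  have "ln (1 / lst D t) \<le> 1 / lst D t - 1" by (rule ln_le_minus_one) (use p in simp)
  moreover have "ln (1 / lst D t) = - ln (lst D t)" using p by (simp add: ln_div)
  moreover have "1 / lst D t - 1 = (1 - lst D t) / lst D t" using p by (simp add: field_simps)
  moreover have "(1 - lst D t) / lst D t \<le> t * mean D / lst D t" using p lst_upper[OF t] by (intro divide_right_mono) auto
  ultimately show "- ln (lst D t) \<le> t * mean D / lst D t" by linarith
qed

end

section \<open>The backward recursion in heavy traffic\<close>

lemma station_eq_nth: "m < CARD('n::{finite,linorder}) \<Longrightarrow> station m = sorted_list_of_set (UNIV :: 'n set) ! m"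
  by (simp add: station_def)

lemma station_mod: "station (m mod CARD('n)) = (station m :: 'n::{finite,linorder})"
  by (simp add: station_def)

lemma station_inj: "inj_on (station :: nat \<Rightarrow> 'n::{finite,linorder}) {..<CARD('n)}"
proof (rule inj_onI)
  fix m m' assume "m \<in> {..<CARD('n)}" "m' \<in> {..<CARD('n)}" "(station m :: 'n) = station m'"
  then show "m = m'"
    using nth_eq_iff_index_eq[of "sorted_list_of_set (UNIV :: 'n set)" m m'] by (simp add: station_eq_nth)
qed

lemma station_bij: "bij_betw (station :: nat \<Rightarrow> 'n::{finite,linorder}) {..<CARD('n)} UNIV"
proof -
  have "card (station ` {..<CARD('n)} :: 'n set) = CARD('n)"
    using card_image[OF station_inj[where 'n = 'n]] by simp
  then have "station ` {..<CARD('n)} = (UNIV :: 'n set)" by (intro card_subset_eq) auto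
  then show ?thesis using station_inj by (simp add: bij_betw_def)
qed

lemma station_le_iff:
  assumes "m < CARD('n)" "m' < CARD('n)"
  shows "(station m :: 'n::{finite,linorder}) \<le> station m' \<longleftrightarrow> m \<le> m'"
proof -
  have mono: "(station a :: 'n) \<le> station c" if "a \<le> c" "c < CARD('n)" for a c
    using that sorted_nth_mono[of "sorted_list_of_set (UNIV :: 'n set)" a c] by (simp add: station_eq_nth)
  show ?thesis
    using mono[of m m'] mono[of m' m] assms inj_onD[OF station_inj[where 'n = 'n], of m m'] by (cases "m \<le> m'") (auto simp: not_le)
qed

text \<open>The station of visit \<open>c * CARD('n) - l\<close>; this does not depend on \<open>c\<close>.\<close>

definition back_station :: "nat \<Rightarrow> 'n::{finite,linorder}" where
  "back_station l = station (nat ((- int l) mod int CARD('n)))"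

lemma back_station_0: "back_station 0 = station 0"
  by (simp add: back_station_def)

lemma back_station_cycle:
  assumes "l \<le> c * CARD('n)"
  shows "(back_station l :: 'n::{finite,linorder}) = station (c * CARD('n) - l)"
proof -
  have "int ((c * CARD('n) - l) mod CARD('n)) = (int c * int CARD('n) - int l) mod int CARD('n)"
    using assms by (simp add: zmod_int of_nat_diff)
  also have "\<dots> = (- int l) mod int CARD('n)"
    by (metis add.commute diff_conv_add_uminus mod_mult_self1)
  finally have "nat ((- int l) mod int CARD('n)) = (c * CARD('n) - l) mod CARD('n)" by (metis nat_int)
  then show ?thesis unfolding back_station_def by (simp add: station_mod)
qed

lemma back_station_bij: "bij_betw (\<lambda>k. back_station (l + k) :: 'n::{finite,linorder}) {..<CARD('n)} UNIV"
proof -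
  have inj: "inj_on (\<lambda>k. back_station (l + k) :: 'n) {..<CARD('n)}"
  proof (rule inj_onI)
    fix k k' assume k: "k \<in> {..<CARD('n)}" "k' \<in> {..<CARD('n)}" "(back_station (l + k) :: 'n) = back_station (l + k')"
    let ?i = "\<lambda>k. nat ((- int (l + k)) mod int CARD('n))"
    have lt: "?i k < CARD('n)" for k
      using pos_mod_bound[of "int CARD('n)" "- int (l + k)"] by (simp add: nat_less_iff)
    have "?i k = ?i k'"
      using inj_onD[OF station_inj[where 'n = 'n], of "?i k" "?i k'"] k lt unfolding back_station_def by simp
    then have "(- int (l + k)) mod int CARD('n) = (- int (l + k')) mod int CARD('n)"
      by (simp add: nat_eq_iff)
    then have "int CARD('n) dvd (- int (l + k)) - (- int (l + k'))" by (simp only: mod_eq_dvd_iff)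
    then have "int CARD('n) dvd int k' - int k" by simp
    moreover have "\<bar>int k' - int k\<bar> < int CARD('n)" using k by auto
    ultimately show "k = k'" using zdvd_not_zless[of "\<bar>int k' - int k\<bar>" "int CARD('n)"] by auto
  qed
  have "card ((\<lambda>k. back_station (l + k) :: 'n) ` {..<CARD('n)}) = CARD('n)"
    using card_image[OF inj] by simp
  then have "(\<lambda>k. back_station (l + k)) ` {..<CARD('n)} = (UNIV :: 'n set)" by (intro card_subset_eq) auto
  then show ?thesis using inj by (simp add: bij_betw_def)
qed

lemma back_station_sum:
  "(\<Sum>k<CARD('n). \<phi> (back_station (l + k))) = (\<Sum>i\<in>UNIV. \<phi> i)" for \<phi> :: "'n::{finite,linorder} \<Rightarrow> real"
  by (rule sum.reindex_bij_betw[OF back_station_bij])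

lemma back_station_periodic: "back_station (l + CARD('n)) = (back_station l :: 'n::{finite,linorder})"
proof -
  have "(- int (l + CARD('n))) mod int CARD('n) = (- int l - int CARD('n)) mod int CARD('n)" by simp
  also have "\<dots> = (- int l) mod int CARD('n)" by (rule minus_mod_self2)
  finally show ?thesis by (simp add: back_station_def)
qed

section \<open>Fluid weights conserved by the critical recursion\<close>

locale polling_data =
  fixes lam nu G :: "'n::{finite,linorder} \<Rightarrow> real" and B S :: "'n \<Rightarrow> real measure"
  assumes lam_pos: "\<And>i. 0 < lam i" and nu_pos: "\<And>i. 0 < nu i" and G_pos: "\<And>i. 0 < G i"
    and B_law: "\<And>i. nonneg_law (B i)" and S_law: "\<And>i. nonneg_law (S i)"
    and B_mean: "\<And>i. 0 < mean (B i)" and B_second: "\<And>i. integrable (B i) (\<lambda>x. x ^ 2)"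
    and critical: "(\<Sum>i\<in>UNIV. lam i * mean (B i)) = 1"
begin

definition r :: "'n \<Rightarrow> real" where "r i = lam i * mean (B i)"
definition q :: "'n \<Rightarrow> real" where "q i = exp (- nu i * G i)"
definition p :: "'n \<Rightarrow> real" where "p i = 1 - q i"

lemma r_pos: "0 < r i" using lam_pos B_mean by (simp add: r_def)
lemma r_sum: "(\<Sum>i\<in>UNIV. r i) = 1" using critical by (simp add: r_def)
lemma q_bounds: "0 < q i" "q i < 1" using nu_pos[of i] G_pos[of i] by (auto simp: q_def)
lemma p_bounds: "0 < p i" "p i < 1" using q_bounds[of i] by (auto simp: p_def)

text \<open>At the fluid limit, \<open>fluid l j\<close> is proportional to the number of type \<open>j\<close> customers \<open>l\<close> visits before the end;
  it is a conserved weight for the backward recursion when \<open>\<rho> = 1\<close>.\<close>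

definition age :: "nat \<Rightarrow> 'n \<Rightarrow> real" where
  "age l j = (\<Sum>k\<le>(LEAST k. back_station (l + k) = j). r (back_station (l + k)))"

definition fluid :: "nat \<Rightarrow> 'n \<Rightarrow> real" where
  "fluid l j = lam j * (q j / p j + age l j)"

lemma back_station_ex: "\<exists>k. back_station (l + k) = (j :: 'n)"
proof -
  have "j \<in> (\<lambda>k. back_station (l + k)) ` {..<CARD('n)}"
    using back_station_bij[of l, where 'n = 'n] by (simp add: bij_betw_def)
  then show ?thesis by auto
qed

lemma age_here: "age l (back_station l) = r (back_station l)"
proof -
  have "(LEAST k. back_station (l + k) = (back_station l :: 'n)) = 0" by (rule Least_eq_0) simp
  then show ?thesis by (simp add: age_def)
qed

lemma age_Suc: "j \<noteq> back_station l \<Longrightarrow> age l j = r (back_station l) + age (Suc l) j"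
proof -
  assume j: "j \<noteq> back_station l"
  obtain k where k: "back_station (l + k) = j" using back_station_ex by blast
  have "(LEAST k. back_station (l + k) = j) = Suc (LEAST m. back_station (l + Suc m) = j)"
    by (rule Least_Suc[of "\<lambda>k. back_station (l + k) = j" k]) (use j k in auto)
  then show ?thesis unfolding age_def by (simp add: sum.atMost_Suc_shift del: sum.atMost_Suc)
qed

text \<open>Just before a station is visited again a full cycle has passed since its last visit, and
  the loads of a cycle add up to 1.\<close>

lemma age_full: "age (Suc l) (back_station l) = 1"
proof -
  let ?N = "CARD('n)"
  have N: "0 < ?N" by simp
  have "(LEAST k. back_station (Suc l + k) = (back_station l :: 'n)) = ?N - 1"
  proof (rule Least_equality)
    show e: "back_station (Suc l + (?N - 1)) = (back_station l :: 'n)"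
      using back_station_periodic[of l, where 'n = 'n] N by simp
    fix k assume k: "back_station (Suc l + k) = (back_station l :: 'n)"
    show "?N - 1 \<le> k"
    proof (rule ccontr)
      assume "\<not> ?N - 1 \<le> k"
      then have "k \<in> {..<?N}" "?N - 1 \<in> {..<?N}" using N by auto
      have "k = ?N - 1"
        using \<open>k \<in> {..<?N}\<close> \<open>?N - 1 \<in> {..<?N}\<close> inj_onD[OF bij_betw_imp_inj_on[OF back_station_bij[of "Suc l", where 'n = 'n]], of k "?N - 1"] k e by simp
      then show False using \<open>\<not> ?N - 1 \<le> k\<close> by simp
    qed
  qed
  moreover have "{..?N - 1} = {..<?N}" using lessThan_Suc_atMost[of "?N - 1"] N by simp
  ultimately show ?thesis
    unfolding age_def using back_station_sum[of r "Suc l"] r_sum by simp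
qed

text \<open>Balance at criticality, with the cycle as unit of time: a glue period catches as many
  customers as arrive per cycle. The term \<open>q / p\<close> in \<open>fluid\<close> is the
  geometric sum over customers that failed in earlier glue periods, \<open>q\<close> being the
  chance of failing once.\<close>

lemma fluid_Suc_here: "p (back_station l) * fluid (Suc l) (back_station l) = lam (back_station l)"
  unfolding fluid_def age_full using p_bounds[of "back_station l"] by (simp add: field_simps p_def)

lemma fluid_here: "fluid l (back_station l)
    = q (back_station l) * fluid (Suc l) (back_station l) + r (back_station l) * lam (back_station l)"
  unfolding fluid_def age_full age_here using p_bounds[of "back_station l"] by (simp add: field_simps p_def)

lemma fluid_other: "j \<noteq> back_station l \<Longrightarrow> fluid l j = fluid (Suc l) j + r (back_station l) * lam j"
  unfolding fluid_def by (simp add: age_Suc algebra_simps)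

text \<open>Going back from the end of a visit to the first station, the stations appear in
  decreasing order from the last one down. The age of \<open>j\<close> therefore sums exactly the
  loads of the stations from \<open>j\<close> on.\<close>

lemma fluid_1: "fluid 1 j = u_hat lam nu G B j"
proof -
  let ?N = "CARD('n)"
  obtain m where m: "m < ?N" "j = station m"
    using station_bij[where 'n = 'n] unfolding bij_betw_def by (metis UNIV_I imageE lessThan_iff)
  have bs: "(back_station (1 + k) :: 'n) = station (?N - 1 - k)" if "k < ?N" for k
    using back_station_cycle[of "1 + k" 1, where 'n = 'n] that by simp
  have least: "(LEAST k. back_station (1 + k) = j) = ?N - 1 - m"
  proof (rule Least_equality)
    show "back_station (1 + (?N - 1 - m)) = j" using bs[of "?N - 1 - m"] m by simp
    fix k assume k: "back_station (1 + k) = j"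
    show "?N - 1 - m \<le> k"
    proof (rule ccontr)
      assume "\<not> ?N - 1 - m \<le> k"
      then have "k < ?N" "?N - 1 - k < ?N" "?N - 1 - k \<noteq> m" by auto
      then show False
        using bs[of k] k m inj_onD[OF station_inj[where 'n = 'n], of "?N - 1 - k" m] by simp
    qed
  qed
  have "age 1 j = (\<Sum>k\<le>?N - 1 - m. r (station (?N - 1 - k)))"
    unfolding age_def least by (intro sum.cong refl arg_cong[where f = r] bs) (use m in auto)
  also have "\<dots> = (\<Sum>m'\<in>{m..<?N}. r (station m'))"
    by (rule sum.reindex_bij_witness[of _ "\<lambda>m'. ?N - 1 - m'" "\<lambda>k. ?N - 1 - k"]) (use m in auto)
  also have "\<dots> = (\<Sum>i\<in>{j..}. r i)"
  proof (rule sum.reindex_bij_betw)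
    have "station ` {m..<?N} = {j..}"
    proof (intro set_eqI iffI)
      fix i :: 'n assume "i \<in> station ` {m..<?N}"
      then show "i \<in> {j..}" using m station_le_iff[of m, where 'n = 'n] by auto
    next
      fix i :: 'n assume i: "i \<in> {j..}"
      obtain m' where m': "m' < ?N" "i = station m'"
        using station_bij[where 'n = 'n] unfolding bij_betw_def by (metis UNIV_I imageE lessThan_iff)
      then have "m \<le> m'" using i m station_le_iff[of m m', where 'n = 'n] by auto
      then show "i \<in> station ` {m..<?N}" using m' by auto
    qed
    then show "bij_betw station {m..<?N} {j..}"
      using inj_on_subset[OF station_inj[where 'n = 'n], of "{m..<?N}"] by (simp add: bij_betw_def subset_eq)
  qed
  finally show ?thesis by (simp add: fluid_def u_hat_def p_def q_def r_def)
qed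

lemma age_nonneg: "0 \<le> age l j"
  unfolding age_def by (intro sum_nonneg less_imp_le r_pos)

lemma fluid_lower: "lam j * (q j / p j) \<le> fluid l j"
  unfolding fluid_def using lam_pos[of j] age_nonneg[of l j] by (intro mult_left_mono) auto

lemma fluid_pos: "0 < fluid l j"
  using fluid_lower[of j l] lam_pos[of j] q_bounds[of j] p_bounds[of j] by (smt (verit) divide_pos_pos mult_pos_pos)

definition work :: real where "work = delta lam nu G B"

text \<open>For the linear update \<open>v = mean (B i) * (\<Sum>j. lam j * y j)\<close> the
  right-hand side vanishes. So the weighted sum changes only by the amount by which the actual
  update stays below its linearization.\<close>

lemma fluid_drop:
  fixes y :: "'n \<Rightarrow> real" and l :: nat and v :: real
  defines "i \<equiv> back_station l"
  shows "(\<Sum>j\<in>UNIV. fluid l j * y j) - (\<Sum>j\<in>UNIV. fluid (Suc l) j * (y(i := q i * y i + p i * v)) j)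
    = r i * (\<Sum>j\<in>UNIV. lam j * y j) - lam i * v"
proof -
  have 1: "(\<Sum>j\<in>UNIV. fluid l j * y j) = fluid l i * y i + (\<Sum>j\<in>UNIV - {i}. fluid (Suc l) j * y j + r i * (lam j * y j))"
    by (subst sum.remove[of UNIV i]) (auto simp: i_def fluid_other algebra_simps intro!: sum.cong)
  have 2: "(\<Sum>j\<in>UNIV. fluid (Suc l) j * (y(i := q i * y i + p i * v)) j)
    = fluid (Suc l) i * (q i * y i + p i * v) + (\<Sum>j\<in>UNIV - {i}. fluid (Suc l) j * y j)"
    by (subst sum.remove[of UNIV i]) (auto intro!: sum.cong)
  have 3: "(\<Sum>j\<in>UNIV. lam j * y j) = lam i * y i + (\<Sum>j\<in>UNIV - {i}. lam j * y j)"
    by (subst sum.remove[of UNIV i]) auto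
  have 4: "fluid (Suc l) i * (q i * y i + p i * v) = q i * fluid (Suc l) i * y i + lam i * v"
    using fluid_Suc_here[of l] by (simp add: i_def algebra_simps)
  have 5: "fluid l i = q i * fluid (Suc l) i + r i * lam i" unfolding i_def by (rule fluid_here)
  show ?thesis
    unfolding 1 2 3 4 5 sum.distrib sum_distrib_left[symmetric] by (simp add: algebra_simps)
qed

text \<open>The vector of mean service times is fixed by the linear critical update, so its weighted
  sum is the same at every step; at step 1 the weights are \<open>u_hat\<close>, and the sum is
  \<open>delta\<close>.\<close>

lemma fluid_work: "(\<Sum>j\<in>UNIV. fluid l j * mean (B j)) = work"
proof -
  have step: "(\<Sum>j\<in>UNIV. fluid l j * mean (B j)) = (\<Sum>j\<in>UNIV. fluid (Suc l) j * mean (B j))" for l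
  proof -
    let ?i = "back_station l :: 'n"
    have "(\<lambda>j. mean (B j))(?i := q ?i * mean (B ?i) + p ?i * mean (B ?i)) = (\<lambda>j. mean (B j))"
      by (auto simp: p_def algebra_simps)
    then show ?thesis
      using fluid_drop[of l "\<lambda>j. mean (B j)" "mean (B ?i)"] critical by (simp add: r_def)
  qed
  have "(\<Sum>j\<in>UNIV. fluid 1 j * mean (B j)) = work" by (simp only: fluid_1 work_def delta_def)
  moreover have "(\<Sum>j\<in>UNIV. fluid l j * mean (B j)) = (\<Sum>j\<in>UNIV. fluid 0 j * mean (B j))" for l
    by (induction l) (simp_all only: step[symmetric])
  ultimately show ?thesis by metis
qed

lemma work_pos: "0 < work"
  unfolding fluid_work[of 0, symmetric] by (intro sum_pos mult_pos_pos fluid_pos B_mean) auto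

text \<open>One visit to the first station carries the weights at the start of its glue period,
  \<open>u_hat\<close>, to those at the end of the visit, which are the coordinates of the limiting
  vector.\<close>

lemma fluid_0: "fluid 0 j = (if j = station 0 then exp (- nu (station 0) * G (station 0)) * u_hat lam nu G B (station 0)
      else u_hat lam nu G B j)
    + (1 - exp (- nu (station 0) * G (station 0))) * u_hat lam nu G B (station 0) * lam j * mean (B (station 0))"
proof -
  have h: "(1 - exp (- nu (station 0) * G (station 0))) * u_hat lam nu G B (station 0) = lam (station 0)"
    using fluid_Suc_here[of 0] by (simp add: fluid_1[unfolded One_nat_def] back_station_0 p_def q_def)
  show ?thesis
  proof (cases "j = station 0")
    case True
    then show ?thesis
      using fluid_here[of 0] unfolding h by (simp add: fluid_1[unfolded One_nat_def] back_station_0 q_def r_def mult_ac)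
  next
    case False
    then show ?thesis
      using fluid_other[of j 0] unfolding h by (simp add: fluid_1[unfolded One_nat_def] back_station_0 r_def mult_ac)
  qed
qed

end

section \<open>The queueing recursion as an averaging family\<close>

locale heavy_traffic = polling_data lam nu G B S
  for lam nu G :: "'n::{finite,linorder} \<Rightarrow> real" and B S :: "'n \<Rightarrow> real measure" +
  fixes s :: "'n \<Rightarrow> real" and P :: "real \<Rightarrow> real"
  assumes s_nonneg: "\<And>j. 0 \<le> s j"
    and P_pos: "\<forall>\<^sub>F \<epsilon> in at_right 0. 0 < P \<epsilon>"
    and P_lim: "\<forall>\<^sub>F \<epsilon> in at_right 0.
      (\<lambda>c. gate (\<lambda>j. (1 - \<epsilon>) * lam j) G B (station 0) (\<lambda>j. 1 - exp (- \<epsilon> * s j))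
        * back_prod (\<lambda>j. (1 - \<epsilon>) * lam j) nu G B S (c * CARD('n))
            (offspring (\<lambda>j. (1 - \<epsilon>) * lam j) nu G B (station 0) (\<lambda>j. 1 - exp (- \<epsilon> * s j))))
      \<longlonglongrightarrow> P \<epsilon>"
begin

abbreviation b :: "'n \<Rightarrow> real" where "b i \<equiv> mean (B i)"

definition th :: real where "th = Min ((\<lambda>(i, j). p i * r j) ` UNIV)"

sublocale cyc: cyclic_averaging "CARD('n)" back_station r p th
proof
  show "0 < CARD('n)" by simp
  show "(\<Sum>k<CARD('n). \<phi> (back_station (l + k))) = (\<Sum>i\<in>UNIV. \<phi> i)" for l and \<phi> :: "'n \<Rightarrow> real"
    by (rule back_station_sum)
  show "0 \<le> r i" for i using r_pos[of i] by simp
  show "(\<Sum>i\<in>UNIV. r i) = 1" by (rule r_sum)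
  show "0 \<le> p i" "p i \<le> 1" for i using p_bounds[of i] by auto
  show "0 < th" unfolding th_def using p_bounds(1) r_pos by (subst Min_gr_iff) auto
  show "th \<le> p i * r j" for i j unfolding th_def by (rule Min_le) (auto intro!: image_eqI[of _ _ "(i, j)"])
qed

definition rate :: "real \<Rightarrow> 'n \<Rightarrow> real" where "rate \<epsilon> j = (1 - \<epsilon>) * lam j"

primrec state :: "real \<Rightarrow> nat \<Rightarrow> 'n \<Rightarrow> real" where
  "state \<epsilon> 0 = (\<lambda>j. 1 - exp (- \<epsilon> * s j))"
| "state \<epsilon> (Suc l) = offspring (rate \<epsilon>) nu G B (back_station l) (state \<epsilon> l)"

text \<open>Dividing by the mean service time turns the fixed direction of the linear critical
  update into the constant vectors, and that update into an average with weights
  \<open>r\<close>.\<close>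

definition x :: "real \<Rightarrow> nat \<Rightarrow> 'n \<Rightarrow> real" where "x \<epsilon> l j = state \<epsilon> l j / b j"

text \<open>The shortfall of the new value against the average. The reduced rate contributes
  \<open>\<epsilon> * L\<close>, the curvature of the transform the quadratic term with coefficient
  \<open>kap i\<close>.\<close>

definition loss :: "real \<Rightarrow> 'n \<Rightarrow> real \<Rightarrow> real" where
  "loss \<epsilon> i L = L - (1 - lst (B i) ((1 - \<epsilon>) * L)) / b i"

definition imm :: "real \<Rightarrow> 'n \<Rightarrow> ('n \<Rightarrow> real) \<Rightarrow> real" where
  "imm \<epsilon> i y = - ln (gate (rate \<epsilon>) G B i (\<lambda>j. b j * y j)) - ln (lst (S i) ((1 - \<epsilon>) * cyc.avg y))"

definition w :: "nat \<Rightarrow> 'n \<Rightarrow> real" where "w l j = fluid l j * b j / work"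

text \<open>A lower bound of the weights uniform in \<open>l\<close>, obtained by dropping the
  nonnegative age from \<open>fluid\<close>.\<close>

definition wlow :: real where "wlow = Min (range (\<lambda>j. lam j * (q j / p j) * b j / work))"

definition kap :: "'n \<Rightarrow> real" where "kap i = moment 2 (B i) / (2 * b i)"

definition gam :: "'n \<Rightarrow> real" where "gam i = G i + mean (S i)"

definition c1 :: real where "c1 = 1 + (\<Sum>j\<in>UNIV. s j / b j)"

definition c4 :: real where "c4 = (\<Sum>i\<in>UNIV. 2 * G i + 2 * mean (S i)) * c1"

text \<open>\<open>P\<close> belongs to the start of a switch-over and lacks the switch-over factor
  of the last visit. The second term adds it, so that all visits enter \<open>T\<close> alike; it
  vanishes in the limit.\<close>

definition T :: "real \<Rightarrow> real" where
  "T \<epsilon> = - ln (P \<epsilon>) - ln (lst (S (station 0)) ((1 - \<epsilon>) * cyc.avg (x \<epsilon> 0)))"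

lemma b_pos: "0 < b i" by (rule B_mean)

lemma state_x: "state \<epsilon> l j = b j * x \<epsilon> l j"
  using b_pos[of j] by (simp add: x_def del: One_nat_def)

lemma rate_sum: "(\<Sum>j\<in>UNIV. rate \<epsilon> j * (b j * y j)) = (1 - \<epsilon>) * cyc.avg y"
  by (simp add: rate_def cyc.avg_def r_def sum_distrib_left mult_ac)

lemma state_sum: "(\<Sum>j\<in>UNIV. rate \<epsilon> j * state \<epsilon> l j) = (1 - \<epsilon>) * cyc.avg (x \<epsilon> l)"
  unfolding state_x by (rule rate_sum)

lemma state_Suc: "state \<epsilon> (Suc l) = (state \<epsilon> l)(back_station l := q (back_station l) * state \<epsilon> l (back_station l)
    + p (back_station l) * (1 - lst (B (back_station l)) ((1 - \<epsilon>) * cyc.avg (x \<epsilon> l))))"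
  by (simp add: offspring_def state_sum q_def p_def)

lemma lst_loss: "1 - lst (B i) ((1 - \<epsilon>) * L) = b i * (L - loss \<epsilon> i L)"
  using b_pos[of i] by (simp add: loss_def del: One_nat_def)

lemma x_Suc: "x \<epsilon> (Suc l) = (x \<epsilon> l)(back_station l := (1 - p (back_station l)) * x \<epsilon> l (back_station l)
    + p (back_station l) * (cyc.avg (x \<epsilon> l) - loss \<epsilon> (back_station l) (cyc.avg (x \<epsilon> l))))"
proof
  fix j
  show "x \<epsilon> (Suc l) j = ((x \<epsilon> l)(back_station l := (1 - p (back_station l)) * x \<epsilon> l (back_station l)
    + p (back_station l) * (cyc.avg (x \<epsilon> l) - loss \<epsilon> (back_station l) (cyc.avg (x \<epsilon> l))))) j"
    unfolding x_def[of \<epsilon> "Suc l"] state_Suc lst_loss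
    using b_pos[of j] by (auto simp: x_def p_def add_divide_distrib simp del: One_nat_def)
qed

text \<open>\<open>fluid_drop\<close> at the critical rates: the linear part of the new value
  cancels because \<open>r i = lam i * b i\<close>, and \<open>r i\<close> times the loss
  remains.\<close>

lemma drop: "(\<Sum>j\<in>UNIV. w l j * x \<epsilon> l j) - (\<Sum>j\<in>UNIV. w (Suc l) j * x \<epsilon> (Suc l) j)
    = r (back_station l) / work * loss \<epsilon> (back_station l) (cyc.avg (x \<epsilon> l))"
proof -
  have s: "(\<Sum>j\<in>UNIV. w l j * x \<epsilon> l j) = (\<Sum>j\<in>UNIV. fluid l j * state \<epsilon> l j) / work" for l
    unfolding sum_divide_distrib by (intro sum.cong refl) (simp add: w_def state_x mult_ac)
  have a: "(\<Sum>j\<in>UNIV. lam j * state \<epsilon> l j) = cyc.avg (x \<epsilon> l)"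
    unfolding cyc.avg_def by (intro sum.cong refl) (simp add: state_x r_def)
  show ?thesis
    unfolding s diff_divide_distrib[symmetric] state_Suc fluid_drop a lst_loss
    by (simp add: r_def algebra_simps)
qed

lemma w_sum: "(\<Sum>j\<in>UNIV. w l j) = 1"
  using work_pos by (simp add: w_def sum_divide_distrib[symmetric] fluid_work del: One_nat_def)

lemma w_min: "wlow \<le> w l j"
proof -
  have "wlow \<le> lam j * (q j / p j) * b j / work" unfolding wlow_def by (rule Min_le) auto
  also have "\<dots> \<le> w l j"
    unfolding w_def using fluid_lower[of j l] b_pos[of j] work_pos by (intro divide_right_mono mult_right_mono) auto
  finally show ?thesis .
qed

lemma wlow_pos: "0 < wlow"
  unfolding wlow_def using lam_pos q_bounds(1) p_bounds(1) b_pos work_pos by (subst Min_gr_iff) auto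

lemma c1_pos: "1 \<le> c1"
  unfolding c1_def using s_nonneg b_pos by (auto intro!: sum_nonneg divide_nonneg_pos simp del: One_nat_def)

lemma x_0: "\<forall>\<^sub>F \<epsilon> in at_right 0. \<forall>j. 0 \<le> x \<epsilon> 0 j \<and> x \<epsilon> 0 j \<le> c1 * \<epsilon>"
  using eventually_at_right_less[of 0]
proof eventually_elim
  case (elim \<epsilon>)
  show ?case
  proof
    fix j
    have y: "0 \<le> state \<epsilon> 0 j" "state \<epsilon> 0 j \<le> \<epsilon> * s j"
      using elim s_nonneg[of j] exp_minus_taylor(1)[of "\<epsilon> * s j"] by auto
    have "s j / b j \<le> (\<Sum>j\<in>UNIV. s j / b j)"
      by (rule member_le_sum) (auto intro!: divide_nonneg_pos s_nonneg b_pos simp del: One_nat_def)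
    then have "\<epsilon> * (s j / b j) \<le> \<epsilon> * c1" unfolding c1_def using elim by (intro mult_left_mono) auto
    moreover have "x \<epsilon> 0 j \<le> \<epsilon> * s j / b j" unfolding x_def using y b_pos[of j] by (intro divide_right_mono) auto
    moreover have "0 \<le> x \<epsilon> 0 j" unfolding x_def using y b_pos[of j] by (intro divide_nonneg_pos) auto
    ultimately show "0 \<le> x \<epsilon> 0 j \<and> x \<epsilon> 0 j \<le> c1 * \<epsilon>" by (simp add: mult.commute)
  qed
qed

lemma loss_asymp:
  assumes \<eta>: "0 < \<eta>"
  shows "\<forall>\<^sub>F \<epsilon> in at_right 0. \<forall>i L. 0 \<le> L \<and> L \<le> c1 * \<epsilon> \<longrightarrow>
    (1 - \<eta>) * (\<epsilon> * L + kap i * L ^ 2) \<le> loss \<epsilon> i L \<and> loss \<epsilon> i L \<le> (1 + \<eta>) * (\<epsilon> * L + kap i * L ^ 2)"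
proof (rule eventually_all_finite)
  fix i
  interpret B: nonneg_law "B i" by (rule B_law)
  \<comment> \<open>The budget for the quadratic term: \<open>e\<close> for the second-order
    expansion and at most another \<open>e\<close> for \<open>(1 - \<epsilon>) ^ 2\<close>, together
    at most \<open>\<eta>\<close>.\<close>
  define e where "e = min (\<eta> / 2) (1 / 2)"
  have e: "0 < e" "e \<le> 1 / 2" "e \<le> \<eta> / 2" using \<eta> by (auto simp: e_def)
  obtain t0 where t0: "0 < t0" "\<And>t. 0 \<le> t \<Longrightarrow> t \<le> t0 \<Longrightarrow>
      (1 - e) * (moment 2 (B i) / 2 * t ^ 2) \<le> b i * t - (1 - lst (B i) t)"
    by (rule B.lst_second_order_lower[OF B_second B_mean e(1)]) (rule that; blast)
  have m2: "0 < moment 2 (B i)" by (rule B.moment2_pos[OF B_second B_mean])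
  have kap0: "0 \<le> kap i" using m2 b_pos[of i] by (simp add: kap_def del: One_nat_def)
  show "\<forall>\<^sub>F \<epsilon> in at_right 0. \<forall>L. 0 \<le> L \<and> L \<le> c1 * \<epsilon> \<longrightarrow>
    (1 - \<eta>) * (\<epsilon> * L + kap i * L ^ 2) \<le> loss \<epsilon> i L \<and> loss \<epsilon> i L \<le> (1 + \<eta>) * (\<epsilon> * L + kap i * L ^ 2)"
    using eventually_at_right_less[of 0] eventually_mult_le_at_right[OF t0(1), of c1] eventually_mult_le_at_right[OF e(1), of 2]
  proof eventually_elim
    case (elim \<epsilon>)
    show ?case
    proof (intro allI impI)
      fix L assume L: "0 \<le> L \<and> L \<le> c1 * \<epsilon>"
      define t where "t = (1 - \<epsilon>) * L"
      have \<epsilon>1: "0 \<le> 1 - \<epsilon>" "1 - \<epsilon> \<le> 1" using elim e by auto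
      have t: "0 \<le> t" "t \<le> L" using \<epsilon>1 L mult_right_mono[of "1 - \<epsilon>" 1 L] by (auto simp: t_def)
      have split: "loss \<epsilon> i L = \<epsilon> * L + (b i * t - (1 - lst (B i) t)) / b i"
        using b_pos[of i] by (simp add: loss_def t_def[symmetric] diff_divide_distrib del: One_nat_def) (simp add: t_def algebra_simps)
      have k: "moment 2 (B i) / 2 * u / b i = kap i * u" for u by (simp add: kap_def)
      have "(b i * t - (1 - lst (B i) t)) / b i \<le> moment 2 (B i) / 2 * t ^ 2 / b i"
        using B.lst_second_order(1)[OF B_second t(1)] b_pos[of i] by (intro divide_right_mono) auto
      also have "\<dots> = kap i * t ^ 2" by (rule k)
      also have "\<dots> \<le> kap i * L ^ 2" using t kap0 by (intro mult_left_mono power_mono) auto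
      finally have up: "loss \<epsilon> i L \<le> \<epsilon> * L + kap i * L ^ 2" unfolding split by simp
      have nn: "0 \<le> \<epsilon> * L + kap i * L ^ 2" using elim L kap0 by auto
      have "(1 - e) * (kap i * t ^ 2) = (1 - e) * (moment 2 (B i) / 2 * t ^ 2) / b i"
        unfolding k[symmetric] by simp
      also have "\<dots> \<le> (b i * t - (1 - lst (B i) t)) / b i"
        using t0(2)[OF t(1)] t L elim b_pos[of i] by (intro divide_right_mono) auto
      finally have "\<epsilon> * L + (1 - e) * (kap i * t ^ 2) \<le> loss \<epsilon> i L" unfolding split by simp
      moreover have "(1 - \<eta>) * (kap i * L ^ 2) \<le> (1 - e) * (kap i * t ^ 2)"
      proof -
        have "1 - \<eta> \<le> 1 - e - 2 * \<epsilon>" using e elim by simp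
        also have "\<dots> \<le> (1 - e) * (1 - 2 * \<epsilon>)" using e elim by (simp add: algebra_simps)
        also have "\<dots> \<le> (1 - e) * (1 - \<epsilon>) ^ 2"
          using e by (intro mult_left_mono) (auto simp: power2_eq_square algebra_simps)
        finally have "(1 - \<eta>) * (kap i * L ^ 2) \<le> (1 - e) * (1 - \<epsilon>) ^ 2 * (kap i * L ^ 2)"
          using kap0 by (intro mult_right_mono) auto
        then show ?thesis by (simp add: t_def power_mult_distrib mult_ac)
      qed
      moreover have "(1 - \<eta>) * (\<epsilon> * L) \<le> \<epsilon> * L"
        using \<eta> elim L mult_right_mono[of "1 - \<eta>" 1 "\<epsilon> * L"] by auto
      ultimately have "(1 - \<eta>) * (\<epsilon> * L + kap i * L ^ 2) \<le> loss \<epsilon> i L" by (simp add: distrib_left)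
      moreover have "\<epsilon> * L + kap i * L ^ 2 \<le> (1 + \<eta>) * (\<epsilon> * L + kap i * L ^ 2)"
        using nn \<eta> mult_right_mono[of 1 "1 + \<eta>" "\<epsilon> * L + kap i * L ^ 2"] by auto
      ultimately show "(1 - \<eta>) * (\<epsilon> * L + kap i * L ^ 2) \<le> loss \<epsilon> i L \<and> loss \<epsilon> i L \<le> (1 + \<eta>) * (\<epsilon> * L + kap i * L ^ 2)"
        using up by linarith
    qed
  qed
qed

lemma imm_eq: "imm \<epsilon> i y = (1 - \<epsilon>) * G i * ((cyc.avg y - r i * y i) + lam i * (1 - lst (B i) ((1 - \<epsilon>) * cyc.avg y)))
    - ln (lst (S i) ((1 - \<epsilon>) * cyc.avg y))"
  unfolding imm_def gate_def rate_sum by (simp add: rate_def r_def algebra_simps)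

lemma avg_minus: "cyc.avg y - r i * y i = (\<Sum>j\<in>UNIV - {i}. r j * y j)"
  unfolding cyc.avg_def by (simp add: sum.remove[of UNIV i])

lemma r_minus: "(\<Sum>j\<in>UNIV - {i}. r j) = 1 - r i"
  using r_sum sum.remove[of UNIV i r] by simp

lemma avg_bounds:
  assumes "\<And>j. lo \<le> y j" "\<And>j. y j \<le> hi"
  shows "lo \<le> cyc.avg y" "cyc.avg y \<le> hi" "(1 - r i) * lo \<le> cyc.avg y - r i * y i" "cyc.avg y - r i * y i \<le> (1 - r i) * hi"
proof -
  show "lo \<le> cyc.avg y" "cyc.avg y \<le> hi"
    unfolding cyc.avg_def using weighted_average_bounds[OF cyc.r_nonneg r_sum assms] by auto
  show "(1 - r i) * lo \<le> cyc.avg y - r i * y i" "cyc.avg y - r i * y i \<le> (1 - r i) * hi"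
    unfolding avg_minus r_minus[symmetric] sum_distrib_right
    by (intro sum_mono mult_left_mono assms cyc.r_nonneg; simp)+
qed

lemma r_le_1: "r i \<le> 1"
  using member_le_sum[of i UNIV r] cyc.r_nonneg r_sum by simp

lemma imm_nonneg:
  assumes \<epsilon>: "\<epsilon> \<le> 1" and y: "\<And>j. 0 \<le> y j"
  shows "0 \<le> imm \<epsilon> i y"
proof -
  interpret B: nonneg_law "B i" by (rule B_law)
  interpret S: nonneg_law "S i" by (rule S_law)
  have a: "0 \<le> cyc.avg y" unfolding cyc.avg_def by (intro sum_nonneg mult_nonneg_nonneg cyc.r_nonneg y)
  have t: "0 \<le> (1 - \<epsilon>) * cyc.avg y" using a \<epsilon> by simp
  have "0 \<le> cyc.avg y - r i * y i" unfolding avg_minus by (intro sum_nonneg mult_nonneg_nonneg cyc.r_nonneg y)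
  then have "0 \<le> (1 - \<epsilon>) * G i * ((cyc.avg y - r i * y i) + lam i * (1 - lst (B i) ((1 - \<epsilon>) * cyc.avg y)))"
    using \<epsilon> G_pos[of i] lam_pos[of i] B.lst_le_1[OF t] by (intro mult_nonneg_nonneg add_nonneg_nonneg) auto
  moreover have "0 \<le> - ln (lst (S i) ((1 - \<epsilon>) * cyc.avg y))"
    using S.minus_ln_lst(1)[OF t] S.lst_le_1[OF t] by linarith
  ultimately show ?thesis unfolding imm_eq by linarith
qed

lemma imm_crude:
  "\<forall>\<^sub>F \<epsilon> in at_right 0. \<forall>i y. (\<forall>j. 0 \<le> y j \<and> y j \<le> c1 * \<epsilon>) \<longrightarrow> 0 \<le> imm \<epsilon> i y \<and> imm \<epsilon> i y \<le> c4 * \<epsilon>"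
proof (rule eventually_all_finite)
  fix i
  interpret B: nonneg_law "B i" by (rule B_law)
  interpret S: nonneg_law "S i" by (rule S_law)
  show "\<forall>\<^sub>F \<epsilon> in at_right 0. \<forall>y. (\<forall>j. 0 \<le> y j \<and> y j \<le> c1 * \<epsilon>) \<longrightarrow> 0 \<le> imm \<epsilon> i y \<and> imm \<epsilon> i y \<le> c4 * \<epsilon>"
    using eventually_at_right_less[of 0] eventually_mult_le_at_right[of 1 1, OF zero_less_one]
      eventually_mult_le_at_right[of "1 / 2" "c1 * mean (S i)", OF half_gt_zero[OF zero_less_one]]
  proof eventually_elim
    case (elim \<epsilon>)
    show ?case
    proof (intro allI impI)
      fix y :: "'n \<Rightarrow> real" assume y: "\<forall>j. 0 \<le> y j \<and> y j \<le> c1 * \<epsilon>"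
      let ?A = "cyc.avg y" and ?t = "(1 - \<epsilon>) * cyc.avg y"
      have A: "0 \<le> ?A" "?A \<le> c1 * \<epsilon>" "?A - r i * y i \<le> (1 - r i) * (c1 * \<epsilon>)"
        using y avg_bounds[of 0 y "c1 * \<epsilon>"] by auto
      have \<epsilon>: "0 \<le> 1 - \<epsilon>" "1 - \<epsilon> \<le> 1" using elim by auto
      have t: "0 \<le> ?t" "?t \<le> c1 * \<epsilon>" using \<epsilon> A mult_right_mono[of "1 - \<epsilon>" 1 ?A] by auto
      have "lam i * (1 - lst (B i) ?t) \<le> lam i * (?t * b i)"
        using B.lst_upper[OF t(1)] lam_pos[of i] by (intro mult_left_mono) auto
      also have "\<dots> = r i * ?t" by (simp add: r_def)
      also have "\<dots> \<le> r i * (c1 * \<epsilon>)" using t cyc.r_nonneg by (intro mult_left_mono) auto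
      finally have "(?A - r i * y i) + lam i * (1 - lst (B i) ?t) \<le> c1 * \<epsilon>"
        using A(3) by (simp add: algebra_simps)
      then have "G i * ((?A - r i * y i) + lam i * (1 - lst (B i) ?t)) \<le> G i * (c1 * \<epsilon>)"
        using G_pos[of i] by (intro mult_left_mono) auto
      moreover have "(1 - \<epsilon>) * (G i * ((?A - r i * y i) + lam i * (1 - lst (B i) ?t)))
          \<le> 1 * (G i * ((?A - r i * y i) + lam i * (1 - lst (B i) ?t)))"
      proof (rule mult_right_mono[OF \<epsilon>(2)])
        have "0 \<le> ?A - r i * y i" unfolding avg_minus using y by (intro sum_nonneg mult_nonneg_nonneg cyc.r_nonneg) auto
        then show "0 \<le> G i * ((?A - r i * y i) + lam i * (1 - lst (B i) ?t))"
          using G_pos[of i] lam_pos[of i] B.lst_le_1[OF t(1)] by (intro mult_nonneg_nonneg add_nonneg_nonneg) auto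
      qed
      ultimately have g: "(1 - \<epsilon>) * G i * ((?A - r i * y i) + lam i * (1 - lst (B i) ?t)) \<le> G i * (c1 * \<epsilon>)"
        by (simp add: mult.assoc)
      have m: "?t * mean (S i) \<le> c1 * \<epsilon> * mean (S i)" using t S.mean_nonneg by (intro mult_right_mono) auto
      \<comment> \<open>Keeps the transform away from 0, so that dividing by it in the bound for the
        logarithm costs at most a factor 2.\<close>
      have h: "1 / 2 \<le> lst (S i) ?t" using S.lst_upper[OF t(1)] m elim by (simp add: mult_ac)
      have "- ln (lst (S i) ?t) \<le> ?t * mean (S i) / lst (S i) ?t" by (rule S.minus_ln_lst(2)[OF t(1)])
      also have "\<dots> \<le> (c1 * \<epsilon> * mean (S i)) / (1 / 2)"
        using m h t S.mean_nonneg by (intro frac_le) auto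
      also have "\<dots> = 2 * (c1 * \<epsilon> * mean (S i))" by (simp del: One_nat_def)
      finally have "imm \<epsilon> i y \<le> G i * (c1 * \<epsilon>) + 2 * (c1 * \<epsilon> * mean (S i))"
        unfolding imm_eq using g by linarith
      also have "\<dots> \<le> (2 * G i + 2 * mean (S i)) * (c1 * \<epsilon>)"
        using G_pos[of i] c1_pos elim by (simp add: algebra_simps)
      also have "\<dots> \<le> (\<Sum>i\<in>UNIV. 2 * G i + 2 * mean (S i)) * (c1 * \<epsilon>)"
      proof (intro mult_right_mono member_le_sum)
        fix k
        interpret Sk: nonneg_law "S k" by (rule S_law)
        show "0 \<le> 2 * G k + 2 * mean (S k)" using G_pos[of k] Sk.mean_nonneg by simp
      qed (use c1_pos elim in auto)
      finally show "0 \<le> imm \<epsilon> i y \<and> imm \<epsilon> i y \<le> c4 * \<epsilon>"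
        using imm_nonneg[of \<epsilon> y i] y elim by (simp add: c4_def mult.assoc)
    qed
  qed
qed

text \<open>For a nearly constant \<open>y\<close> the other types contribute
  \<open>(1 - r i) * h\<close> and the batch of type \<open>i\<close> contributes
  \<open>r i * h\<close>, so the glue period yields \<open>G i * h\<close>; the switch-over yields
  \<open>mean (S i) * h\<close>.\<close>

lemma imm_near:
  assumes \<eta>: "0 < \<eta>" "\<eta> < 1"
  shows "\<forall>\<^sub>F \<epsilon> in at_right 0. \<forall>i y h. 0 \<le> h \<and>
    (\<forall>j. (1 - \<eta>) * h \<le> y j \<and> y j \<le> (1 + \<eta>) * h \<and> y j \<le> c1 * \<epsilon>) \<longrightarrow>
    (1 - \<eta>) ^ 3 * (gam i * h) \<le> imm \<epsilon> i y \<and> imm \<epsilon> i y \<le> (1 + \<eta>) ^ 3 * (gam i * h)"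
proof (rule eventually_all_finite)
  fix i
  interpret B: nonneg_law "B i" by (rule B_law)
  interpret S: nonneg_law "S i" by (rule S_law)
  obtain tB where tB: "0 < tB" "\<And>t. 0 \<le> t \<Longrightarrow> t \<le> tB \<Longrightarrow> (1 - \<eta>) * (t * b i) \<le> 1 - lst (B i) t"
    by (rule B.lst_first_order_lower[OF \<eta>(1)]) (rule that; blast)
  obtain tS where tS: "0 < tS" "\<And>t. 0 \<le> t \<Longrightarrow> t \<le> tS \<Longrightarrow> (1 - \<eta>) * (t * mean (S i)) \<le> 1 - lst (S i) t"
    by (rule S.lst_first_order_lower[OF \<eta>(1)]) (rule that; blast)
  \<comment> \<open>With \<open>1 - lst\<close> below this threshold the transform is at least
    \<open>1 / (1 + \<eta>)\<close>, so the division in the bound for the logarithm costs exactly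
    one factor \<open>1 + \<eta>\<close>.\<close>
  have c: "0 < \<eta> / (1 + \<eta>)" using \<eta> by simp
  show "\<forall>\<^sub>F \<epsilon> in at_right 0. \<forall>y h. 0 \<le> h \<and>
    (\<forall>j. (1 - \<eta>) * h \<le> y j \<and> y j \<le> (1 + \<eta>) * h \<and> y j \<le> c1 * \<epsilon>) \<longrightarrow>
    (1 - \<eta>) ^ 3 * (gam i * h) \<le> imm \<epsilon> i y \<and> imm \<epsilon> i y \<le> (1 + \<eta>) ^ 3 * (gam i * h)"
    using eventually_at_right_less[of 0] eventually_mult_le_at_right[OF \<eta>(1), of 2] eventually_mult_le_at_right[OF tB(1), of c1]
      eventually_mult_le_at_right[OF tS(1), of c1] eventually_mult_le_at_right[OF c, of "c1 * mean (S i)"]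
  proof eventually_elim
    case (elim \<epsilon>)
    show ?case
    proof (intro allI impI)
      fix y :: "'n \<Rightarrow> real" and h :: real
      assume y: "0 \<le> h \<and> (\<forall>j. (1 - \<eta>) * h \<le> y j \<and> y j \<le> (1 + \<eta>) * h \<and> y j \<le> c1 * \<epsilon>)"
      let ?A = "cyc.avg y" and ?t = "(1 - \<epsilon>) * cyc.avg y"
      have h: "0 \<le> h" using y by simp
      have A: "(1 - \<eta>) * h \<le> ?A" "?A \<le> (1 + \<eta>) * h" "(1 - r i) * ((1 - \<eta>) * h) \<le> ?A - r i * y i"
        "?A - r i * y i \<le> (1 - r i) * ((1 + \<eta>) * h)"
        using avg_bounds[of "(1 - \<eta>) * h" y "(1 + \<eta>) * h"] y by auto
      have A': "?A \<le> c1 * \<epsilon>" using avg_bounds(2)[of "(1 - \<eta>) * h" y "c1 * \<epsilon>"] y by auto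
      have \<epsilon>: "0 < 1 - \<epsilon>" "1 - \<epsilon> \<le> 1" "1 - \<eta> \<le> 1 - \<epsilon>" using elim \<eta> by auto
      have "(1 - \<epsilon>) ^ 2 = 1 - 2 * \<epsilon> + \<epsilon> * \<epsilon>" by (simp add: power2_eq_square algebra_simps)
      then have \<epsilon>2: "1 - \<eta> \<le> (1 - \<epsilon>) ^ 2" using elim zero_le_square[of \<epsilon>] by linarith
      have A0: "0 \<le> ?A" using A(1) h \<eta> by (meson diff_ge_0_iff_ge less_imp_le mult_nonneg_nonneg order_trans)
      have t: "0 \<le> ?t" "?t \<le> ?A" "?t \<le> c1 * \<epsilon>" "(1 - \<epsilon>) * ((1 - \<eta>) * h) \<le> ?t" "?t \<le> (1 + \<eta>) * h"
      proof -
        show "0 \<le> ?t" using \<epsilon> A0 by simp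
        show 2: "?t \<le> ?A" using \<epsilon> A0 mult_right_mono[of "1 - \<epsilon>" 1 ?A] by simp
        show "?t \<le> c1 * \<epsilon>" "?t \<le> (1 + \<eta>) * h" using 2 A A' by auto
        show "(1 - \<epsilon>) * ((1 - \<eta>) * h) \<le> ?t" using \<epsilon> A(1) by (intro mult_left_mono) auto
      qed
      let ?g = "(?A - r i * y i) + lam i * (1 - lst (B i) ?t)"
      have v: "(1 - \<eta>) * (r i * ?t) \<le> lam i * (1 - lst (B i) ?t)" "lam i * (1 - lst (B i) ?t) \<le> r i * ?t"
      proof -
        have "lam i * ((1 - \<eta>) * (?t * b i)) \<le> lam i * (1 - lst (B i) ?t)"
          using tB(2)[of ?t] t elim lam_pos[of i] by (intro mult_left_mono) auto
        then show "(1 - \<eta>) * (r i * ?t) \<le> lam i * (1 - lst (B i) ?t)" by (simp add: r_def mult_ac)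
        have "lam i * (1 - lst (B i) ?t) \<le> lam i * (?t * b i)"
          using B.lst_upper[OF t(1)] lam_pos[of i] by (intro mult_left_mono) auto
        then show "lam i * (1 - lst (B i) ?t) \<le> r i * ?t" by (simp add: r_def mult_ac)
      qed
      have "r i * ?t \<le> r i * ((1 + \<eta>) * h)" using t cyc.r_nonneg by (intro mult_left_mono) auto
      then have g_up: "?g \<le> (1 + \<eta>) * h" using A(4) v(2) by (simp add: algebra_simps)
      have g_lo: "(1 - \<eta>) * (1 - \<epsilon>) * ((1 - \<eta>) * h) \<le> ?g"
      proof -
        have k: "(1 - \<eta>) * (1 - \<epsilon>) \<le> 1" using \<eta> \<epsilon> mult_mono[of "1 - \<eta>" 1 "1 - \<epsilon>" 1] by simp
        have z: "0 \<le> (1 - r i) * ((1 - \<eta>) * h)" using r_le_1[of i] \<eta> h by (intro mult_nonneg_nonneg) auto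
        have "(1 - \<eta>) * (1 - \<epsilon>) * ((1 - r i) * ((1 - \<eta>) * h)) \<le> 1 * ((1 - r i) * ((1 - \<eta>) * h))"
          by (rule mult_right_mono[OF k z])
        moreover have "(1 - \<eta>) * (r i * ((1 - \<epsilon>) * ((1 - \<eta>) * h))) \<le> (1 - \<eta>) * (r i * ?t)"
          
          by (rule mult_left_mono[OF mult_left_mono[OF t(4) cyc.r_nonneg]]) (use \<eta> in simp)
        moreover have "(1 - \<eta>) * (1 - \<epsilon>) * ((1 - \<eta>) * h)
            = (1 - \<eta>) * (1 - \<epsilon>) * ((1 - r i) * ((1 - \<eta>) * h)) + (1 - \<eta>) * (r i * ((1 - \<epsilon>) * ((1 - \<eta>) * h)))"
          by (simp add: algebra_simps)
        ultimately show ?thesis using A(3) v(1) by linarith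
      qed
      have g0: "0 \<le> ?g"
      proof -
        have "0 \<le> (1 - \<eta>) * (1 - \<epsilon>) * ((1 - \<eta>) * h)" using \<eta> \<epsilon> h by simp
        then show ?thesis using g_lo by linarith
      qed
      have p13: "1 + \<eta> \<le> (1 + \<eta>) ^ 3" "(1 + \<eta>) ^ 2 \<le> (1 + \<eta>) ^ 3"
        using \<eta> power_increasing[of 1 3 "1 + \<eta>"] power_increasing[of 2 3 "1 + \<eta>"] by auto
      have G_up: "(1 - \<epsilon>) * G i * ?g \<le> (1 + \<eta>) ^ 3 * (G i * h)"
      proof -
        have "(1 - \<epsilon>) * (G i * ?g) \<le> 1 * (G i * ?g)" using \<epsilon> g0 G_pos[of i] by (intro mult_right_mono) auto
        also have "\<dots> \<le> G i * ((1 + \<eta>) * h)" using g_up G_pos[of i] by simp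
        also have "\<dots> = (1 + \<eta>) * (G i * h)" by simp
        also have "\<dots> \<le> (1 + \<eta>) ^ 3 * (G i * h)" using p13 h G_pos[of i] by (intro mult_right_mono) auto
        finally show ?thesis by (simp add: mult.assoc)
      qed
      have G_lo: "(1 - \<eta>) ^ 3 * (G i * h) \<le> (1 - \<epsilon>) * G i * ?g"
      proof -
        have "(1 - \<eta>) * ((1 - \<eta>) ^ 2 * (G i * h)) \<le> (1 - \<epsilon>) ^ 2 * ((1 - \<eta>) ^ 2 * (G i * h))"
          using \<epsilon>2 h G_pos[of i] by (intro mult_right_mono) auto
        also have "\<dots> = (1 - \<epsilon>) * G i * ((1 - \<eta>) * (1 - \<epsilon>) * ((1 - \<eta>) * h))"
          by (simp add: power2_eq_square mult_ac)
        also have "\<dots> \<le> (1 - \<epsilon>) * G i * ?g" using g_lo \<epsilon> G_pos[of i] by (intro mult_left_mono) auto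
        finally show ?thesis by (simp add: power3_eq_cube power2_eq_square mult_ac)
      qed
      have S_lo: "(1 - \<eta>) ^ 3 * (mean (S i) * h) \<le> - ln (lst (S i) ?t)"
      proof -
        have "(1 - \<eta>) * ((1 - \<eta>) ^ 2 * (mean (S i) * h)) \<le> (1 - \<epsilon>) * ((1 - \<eta>) ^ 2 * (mean (S i) * h))"
          using \<epsilon> h S.mean_nonneg by (intro mult_right_mono) auto
        also have "\<dots> = (1 - \<eta>) * (((1 - \<epsilon>) * ((1 - \<eta>) * h)) * mean (S i))"
          by (simp add: power2_eq_square mult_ac)
        also have "\<dots> \<le> (1 - \<eta>) * (?t * mean (S i))" 
          by (rule mult_left_mono[OF mult_right_mono[OF t(4) S.mean_nonneg]]) (use \<eta> in simp)
        also have "\<dots> \<le> 1 - lst (S i) ?t" using tS(2)[of ?t] t elim by simp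
        also have "\<dots> \<le> - ln (lst (S i) ?t)" by (rule S.minus_ln_lst(1)[OF t(1)])
        finally show ?thesis by (simp add: power3_eq_cube power2_eq_square mult_ac)
      qed
      have S_up: "- ln (lst (S i) ?t) \<le> (1 + \<eta>) ^ 3 * (mean (S i) * h)"
      proof -
        have "?t * mean (S i) \<le> c1 * \<epsilon> * mean (S i)" using t S.mean_nonneg by (intro mult_right_mono) auto
        also have "\<dots> \<le> \<eta> / (1 + \<eta>)" using elim by (simp add: mult_ac)
        finally have "1 - lst (S i) ?t \<le> \<eta> / (1 + \<eta>)" using S.lst_upper[OF t(1)] by simp
        moreover have "1 - \<eta> / (1 + \<eta>) = 1 / (1 + \<eta>)" using \<eta> by (simp add: field_simps)
        ultimately have l: "1 / (1 + \<eta>) \<le> lst (S i) ?t" by linarith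
        have "- ln (lst (S i) ?t) \<le> ?t * mean (S i) / lst (S i) ?t" by (rule S.minus_ln_lst(2)[OF t(1)])
        also have "\<dots> \<le> ((1 + \<eta>) * h * mean (S i)) / (1 / (1 + \<eta>))"
          using l t \<eta> h S.mean_nonneg by (intro frac_le mult_right_mono mult_nonneg_nonneg) auto
        also have "\<dots> = (1 + \<eta>) ^ 2 * (mean (S i) * h)" by (simp add: power2_eq_square)
        also have "\<dots> \<le> (1 + \<eta>) ^ 3 * (mean (S i) * h)"
          using p13 h S.mean_nonneg by (intro mult_right_mono) auto
        finally show ?thesis .
      qed
      show "(1 - \<eta>) ^ 3 * (gam i * h) \<le> imm \<epsilon> i y \<and> imm \<epsilon> i y \<le> (1 + \<eta>) ^ 3 * (gam i * h)"
        using G_up G_lo S_up S_lo unfolding imm_eq gam_def distrib_left distrib_right by linarith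
    qed
  qed
qed

lemma gate_pos: "0 < gate lm G' B' i y" by (simp add: gate_def)

lemma H_0: "((\<lambda>\<epsilon>. (\<Sum>j\<in>UNIV. w 0 j * x \<epsilon> 0 j) / \<epsilon>) \<longlongrightarrow> (\<Sum>j\<in>UNIV. fluid 0 j * s j) / work) (at_right 0)"
proof -
  have d: "((\<lambda>\<epsilon>. (1 - exp (- \<epsilon> * s j)) / \<epsilon>) \<longlongrightarrow> s j) (at_right 0)" for j
  proof -
    have "((\<lambda>\<epsilon>. 1 - exp (- \<epsilon> * s j)) has_real_derivative s j) (at 0)"
      by (auto intro!: derivative_eq_intros)
    then have "((\<lambda>\<epsilon>. (1 - exp (- \<epsilon> * s j)) / \<epsilon>) \<longlongrightarrow> s j) (at 0)"
      by (simp add: has_field_derivative_iff)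
    then show ?thesis by (rule filterlim_mono) (auto intro: at_le)
  qed
  have e: "(\<Sum>j\<in>UNIV. w 0 j * x \<epsilon> 0 j) / \<epsilon> = (\<Sum>j\<in>UNIV. fluid 0 j * ((1 - exp (- \<epsilon> * s j)) / \<epsilon>)) / work" for \<epsilon>
    unfolding sum_divide_distrib
    by (intro sum.cong refl) (use b_pos in \<open>simp add: w_def x_def less_imp_neq[symmetric] mult_ac del: One_nat_def\<close>)
  show ?thesis unfolding e by (intro tendsto_divide tendsto_sum tendsto_mult tendsto_const d) (use work_pos in simp)
qed

lemma x_nonneg:
  assumes \<epsilon>: "0 \<le> \<epsilon>" "\<epsilon> \<le> 1"
  shows "0 \<le> x \<epsilon> l j"
proof -
  have "\<forall>j. 0 \<le> x \<epsilon> l j"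
  proof (induction l)
    case 0
    have "0 \<le> state \<epsilon> 0 j" for j using \<epsilon> s_nonneg[of j] by simp
    then show ?case unfolding x_def using b_pos less_imp_le by (metis divide_nonneg_pos)
  next
    case (Suc l)
    let ?i = "back_station l"
    interpret B: nonneg_law "B ?i" by (rule B_law)
    have "0 \<le> cyc.avg (x \<epsilon> l)" unfolding cyc.avg_def using Suc by (intro sum_nonneg mult_nonneg_nonneg cyc.r_nonneg) auto
    then have "lst (B ?i) ((1 - \<epsilon>) * cyc.avg (x \<epsilon> l)) \<le> 1" using \<epsilon> by (intro B.lst_le_1) simp
    then have "0 \<le> cyc.avg (x \<epsilon> l) - loss \<epsilon> ?i (cyc.avg (x \<epsilon> l))"
      using lst_loss[of ?i \<epsilon> "cyc.avg (x \<epsilon> l)"] b_pos[of ?i] by (metis diff_ge_0_iff_ge zero_le_mult_iff not_less)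
    then have "0 \<le> (1 - p ?i) * x \<epsilon> l ?i + p ?i * (cyc.avg (x \<epsilon> l) - loss \<epsilon> ?i (cyc.avg (x \<epsilon> l)))"
      using Suc p_bounds[of ?i] by (intro add_nonneg_nonneg mult_nonneg_nonneg) auto
    then show ?case unfolding x_Suc using Suc by simp
  qed
  then show ?thesis by simp
qed

lemma exp_imm:
  assumes "0 \<le> \<epsilon>" "\<epsilon> \<le> 1"
  shows "exp (- imm \<epsilon> i (x \<epsilon> l)) = gate (rate \<epsilon>) G B i (state \<epsilon> l) * lst (S i) ((1 - \<epsilon>) * cyc.avg (x \<epsilon> l))"
proof -
  interpret S: nonneg_law "S i" by (rule S_law)
  have "0 \<le> cyc.avg (x \<epsilon> l)" unfolding cyc.avg_def using x_nonneg[OF assms] by (intro sum_nonneg mult_nonneg_nonneg cyc.r_nonneg) auto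
  then have "0 < lst (S i) ((1 - \<epsilon>) * cyc.avg (x \<epsilon> l))" using assms by (intro S.lst_pos) simp
  moreover have "state \<epsilon> l = (\<lambda>j. b j * x \<epsilon> l j)" by (rule ext, rule state_x)
  then have "- imm \<epsilon> i (x \<epsilon> l) = ln (gate (rate \<epsilon>) G B i (state \<epsilon> l)) + ln (lst (S i) ((1 - \<epsilon>) * cyc.avg (x \<epsilon> l)))"
    by (simp add: imm_def del: One_nat_def)
  ultimately show ?thesis
    using gate_pos[of "rate \<epsilon>" G B i "state \<epsilon> l"] by (simp only: exp_add exp_ln)
qed

text \<open>Visit \<open>m\<close> of the forward numbering is step \<open>c * CARD('n) - m\<close>
  of the backward recursion, whose stations are the same for every \<open>c\<close>. A single
  sequence \<open>state\<close> thus serves all horizons.\<close>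

lemma back_prod_unroll:
  assumes "0 \<le> \<epsilon>" "\<epsilon> \<le> 1"
  shows "m \<le> c * CARD('n) \<Longrightarrow> back_prod (rate \<epsilon>) nu G B S m (state \<epsilon> (Suc (c * CARD('n) - m)))
    = exp (- (\<Sum>l\<in>{c * CARD('n) - m<..c * CARD('n)}. imm \<epsilon> (back_station l) (x \<epsilon> l)))"
proof (induction m)
  case (Suc m)
  let ?l = "c * CARD('n) - m"
  have l: "Suc (c * CARD('n) - Suc m) = ?l" "?l \<le> c * CARD('n)" "c * CARD('n) - ?l = m" using Suc.prems by auto
  have st: "back_station ?l = (station m :: 'n)" using back_station_cycle[OF l(2)] l(3) by simp
  have set: "{c * CARD('n) - Suc m<..c * CARD('n)} = insert ?l {?l<..c * CARD('n)}" using Suc.prems by auto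
  have "back_prod (rate \<epsilon>) nu G B S (Suc m) (state \<epsilon> ?l)
    = exp (- imm \<epsilon> (back_station ?l) (x \<epsilon> ?l)) * back_prod (rate \<epsilon>) nu G B S m (state \<epsilon> (Suc ?l))"
    unfolding exp_imm[OF assms] by (simp add: st state_sum)
  also have "\<dots> = exp (- (\<Sum>l\<in>{c * CARD('n) - Suc m<..c * CARD('n)}. imm \<epsilon> (back_station l) (x \<epsilon> l)))"
    unfolding set using Suc by (simp add: exp_add[symmetric])
  finally show ?case unfolding l(1) .
qed simp

lemma lst_switch_bounds:
  assumes "0 \<le> \<epsilon>" "\<epsilon> \<le> 1"
  shows "0 < lst (S i) ((1 - \<epsilon>) * cyc.avg (x \<epsilon> l))" "lst (S i) ((1 - \<epsilon>) * cyc.avg (x \<epsilon> l)) \<le> 1"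
    "1 - cyc.avg (x \<epsilon> l) * mean (S i) \<le> lst (S i) ((1 - \<epsilon>) * cyc.avg (x \<epsilon> l))"
proof -
  interpret S: nonneg_law "S i" by (rule S_law)
  have a: "0 \<le> cyc.avg (x \<epsilon> l)" unfolding cyc.avg_def using x_nonneg[OF assms] by (intro sum_nonneg mult_nonneg_nonneg cyc.r_nonneg) auto
  then have t: "0 \<le> (1 - \<epsilon>) * cyc.avg (x \<epsilon> l)" using assms by simp
  show "0 < lst (S i) ((1 - \<epsilon>) * cyc.avg (x \<epsilon> l))" "lst (S i) ((1 - \<epsilon>) * cyc.avg (x \<epsilon> l)) \<le> 1"
    using S.lst_pos[OF t] S.lst_le_1[OF t] by auto
  have "(1 - \<epsilon>) * cyc.avg (x \<epsilon> l) * mean (S i) \<le> 1 * cyc.avg (x \<epsilon> l) * mean (S i)"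
    using assms a S.mean_nonneg by (intro mult_right_mono) auto
  then show "1 - cyc.avg (x \<epsilon> l) * mean (S i) \<le> lst (S i) ((1 - \<epsilon>) * cyc.avg (x \<epsilon> l))"
    using S.lst_upper[OF t] by simp
qed

text \<open>Observing the end of visit \<open>c * CARD('n)\<close> involves the steps 0 to
  \<open>c * CARD('n)\<close>, one more than \<open>c\<close> full cycles.\<close>

lemma T_lim: "\<forall>\<^sub>F \<epsilon> in at_right 0. (\<lambda>C. \<Sum>l<C * CARD('n). imm \<epsilon> (back_station l) (x \<epsilon> l)) \<longlonglongrightarrow> T \<epsilon>"
  using eventually_at_right_less[of 0] eventually_mult_le_at_right[of 1 1, OF zero_less_one] P_pos P_lim
proof eventually_elim
  case (elim \<epsilon>)
  have \<epsilon>: "0 \<le> \<epsilon>" "\<epsilon> \<le> 1" using elim by auto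
  let ?N = "CARD('n)" and ?I = "\<lambda>l. imm \<epsilon> (back_station l) (x \<epsilon> l)"
  let ?s = "lst (S (station 0)) ((1 - \<epsilon>) * cyc.avg (x \<epsilon> 0))"
  have I: "0 \<le> ?I l" for l by (rule imm_nonneg[OF \<epsilon>(2) x_nonneg[OF \<epsilon>]])
  have spos: "0 < ?s" by (rule lst_switch_bounds(1)[OF \<epsilon>])
  have rt: "(\<lambda>j. (1 - \<epsilon>) * lam j) = rate \<epsilon>" by (simp add: rate_def fun_eq_iff)
  have s0: "(\<lambda>j. 1 - exp (- \<epsilon> * s j)) = state \<epsilon> 0" by simp
  have s1: "offspring (rate \<epsilon>) nu G B (station 0) (state \<epsilon> 0) = state \<epsilon> (Suc 0)"
    by (simp only: state.simps(2) back_station_0)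
  let ?P = "\<lambda>c. gate (rate \<epsilon>) G B (station 0) (state \<epsilon> 0) * back_prod (rate \<epsilon>) nu G B S (c * ?N) (state \<epsilon> (Suc 0))"
  have P: "?P \<longlonglongrightarrow> P \<epsilon>" using elim(4) unfolding rt s0 s1 .
  have e: "?P c * ?s = exp (- (\<Sum>l\<le>c * ?N. ?I l))" for c
  proof -
    have "{..c * ?N} = insert 0 {0<..c * ?N}" by auto
    then have "(\<Sum>l\<le>c * ?N. ?I l) = ?I 0 + (\<Sum>l\<in>{0<..c * ?N}. ?I l)" by simp
    then have "exp (- (\<Sum>l\<le>c * ?N. ?I l)) = exp (- ?I 0) * exp (- (\<Sum>l\<in>{0<..c * ?N}. ?I l))"
      by (simp add: exp_add[symmetric])
    also have "exp (- (\<Sum>l\<in>{0<..c * ?N}. ?I l)) = back_prod (rate \<epsilon>) nu G B S (c * ?N) (state \<epsilon> (Suc 0))"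
      using back_prod_unroll[OF \<epsilon>, of "c * ?N" c] by simp
    also have "exp (- ?I 0) = gate (rate \<epsilon>) G B (station 0) (state \<epsilon> 0) * ?s"
      unfolding exp_imm[OF \<epsilon>] back_station_0 ..
    finally show ?thesis by (simp only: mult_ac)
  qed
  have "(\<lambda>c. ?P c * ?s) \<longlonglongrightarrow> P \<epsilon> * ?s" by (intro tendsto_mult P tendsto_const)
  then have "(\<lambda>c. - ln (exp (- (\<Sum>l\<le>c * ?N. ?I l)))) \<longlonglongrightarrow> - ln (P \<epsilon> * ?s)"
    unfolding e by (intro tendsto_minus tendsto_ln) (use elim spos in auto)
  then have R: "(\<lambda>c. \<Sum>l\<le>c * ?N. ?I l) \<longlonglongrightarrow> T \<epsilon>"
    using elim spos by (simp add: T_def ln_mult)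
  \<comment> \<open>All terms are nonnegative, so a sum over full cycles lies between two of the
    sums that are known to converge.\<close>
  have "(\<lambda>C. \<Sum>l<Suc C * ?N. ?I l) \<longlonglongrightarrow> T \<epsilon>"
  proof (rule tendsto_sandwich[OF _ _ R LIMSEQ_Suc[OF R]])
    have "C * ?N < Suc C * ?N" for C by simp
    then have "{..C * ?N} \<subseteq> {..<Suc C * ?N}" for C by (meson atMost_subset_iff lessThan_iff subsetI atMost_iff le_less_trans)
    then show "\<forall>\<^sub>F C in sequentially. (\<Sum>l\<le>C * ?N. ?I l) \<le> (\<Sum>l<Suc C * ?N. ?I l)"
      by (intro always_eventually allI sum_mono2 I) auto
    show "\<forall>\<^sub>F C in sequentially. (\<Sum>l<Suc C * ?N. ?I l) \<le> (\<Sum>l\<le>Suc C * ?N. ?I l)"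
      by (intro always_eventually allI sum_mono2 I) auto
  qed
  then show ?case by (rule LIMSEQ_imp_Suc)
qed

text \<open>Here \<open>\<kappa>0\<close> is half the sum of \<open>lam i * moment 2 (B i)\<close>
  and \<open>\<gamma>0\<close> the mean total of glue and switch-over times, so the exponential of
  minus the limit of \<open>T\<close> is this power; the switch-over factor that was added tends to
  1.\<close>

theorem P_tendsto:
  "(P \<longlongrightarrow> (1 + (\<Sum>i\<in>UNIV. lam i * moment 2 (B i)) / (2 * work) * (\<Sum>j\<in>UNIV. fluid 0 j * s j))
      powr (- (2 * (\<Sum>i\<in>UNIV. mean (S i) + G i) * work / (\<Sum>i\<in>UNIV. lam i * moment 2 (B i))))) (at_right 0)"
proof -
  let ?m2 = "\<Sum>i\<in>UNIV. lam i * moment 2 (B i)" and ?h = "(\<Sum>j\<in>UNIV. fluid 0 j * s j) / work"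
  have m2: "0 < moment 2 (B i)" for i
  proof -
    interpret B: nonneg_law "B i" by (rule B_law)
    show ?thesis by (rule B.moment2_pos[OF B_second B_mean])
  qed
  have M2: "0 < ?m2" using m2 lam_pos by (intro sum_pos) auto
  have rk: "r i * kap i = lam i * moment 2 (B i) / 2" for i
    using b_pos[of i] by (simp add: r_def kap_def del: One_nat_def)
  interpret av: averaging_family "CARD('n)" back_station r p th w kap gam work c1 c4 wlow ?h x loss imm T
  proof
    show "0 < c1" using c1_pos by simp
    show "0 \<le> kap i" for i using m2[of i] b_pos[of i] by (simp add: kap_def del: One_nat_def)
    show "0 < (\<Sum>i\<in>UNIV. r i * kap i)" unfolding rk using m2 lam_pos by (intro sum_pos) auto
    show "0 \<le> gam i" for i
    proof -
      interpret S: nonneg_law "S i" by (rule S_law)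
      show ?thesis using S.mean_nonneg G_pos[of i] by (simp add: gam_def)
    qed
  qed (rule w_sum w_min wlow_pos work_pos x_Suc drop x_0 loss_asymp imm_near imm_crude H_0 T_lim; assumption?)+
  let ?s = "\<lambda>\<epsilon>. lst (S (station 0)) ((1 - \<epsilon>) * cyc.avg (x \<epsilon> 0))"
  have k0: "av.\<kappa>0 = ?m2 / 2" unfolding av.\<kappa>0_def rk by (simp add: sum_divide_distrib)
  have a0: "av.\<alpha>0 = 2 * (\<Sum>i\<in>UNIV. mean (S i) + G i) * work / ?m2"
    unfolding av.\<alpha>0_def k0 av.\<gamma>0_def gam_def by (simp add: add.commute del: One_nat_def)
  have S1: "(?s \<longlongrightarrow> 1) (at_right 0)"
  proof (rule tendsto_sandwich)
    let ?m = "mean (S (station 0))"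
    show "\<forall>\<^sub>F \<epsilon> in at_right 0. ?s \<epsilon> \<le> 1"
      using eventually_at_right_less[of 0] eventually_mult_le_at_right[of 1 1, OF zero_less_one]
      by eventually_elim (rule lst_switch_bounds(2); simp)
    show "\<forall>\<^sub>F \<epsilon> in at_right 0. 1 - c1 * \<epsilon> * ?m \<le> ?s \<epsilon>"
      using eventually_at_right_less[of 0] eventually_mult_le_at_right[of 1 1, OF zero_less_one] x_0
    proof eventually_elim
      case (elim \<epsilon>)
      interpret S: nonneg_law "S (station 0)" by (rule S_law)
      have "cyc.avg (x \<epsilon> 0) \<le> c1 * \<epsilon>" using avg_bounds(2)[of 0 "x \<epsilon> 0" "c1 * \<epsilon>"] elim(3) by auto
      then have "cyc.avg (x \<epsilon> 0) * ?m \<le> c1 * \<epsilon> * ?m" using S.mean_nonneg by (intro mult_right_mono) auto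
      then show ?case using lst_switch_bounds(3)[of \<epsilon> 0 "station 0"] elim by linarith
    qed
    have "((\<lambda>\<epsilon>. 1 - c1 * \<epsilon> * ?m) \<longlongrightarrow> 1 - c1 * 0 * ?m) (at_right 0)" by (intro tendsto_intros)
    then show "((\<lambda>\<epsilon>. 1 - c1 * \<epsilon> * ?m) \<longlongrightarrow> 1) (at_right 0)" by simp
  qed simp
  have "0 \<le> fluid 0 j * s j" for j using s_nonneg[of j] fluid_pos[of 0 j] by simp
  then have "0 \<le> ?h" using work_pos by (intro divide_nonneg_pos sum_nonneg)
  then have h0: "0 \<le> ?m2 / 2 * ?h" by (rule mult_nonneg_nonneg[rotated]) (use M2 in simp)
  have "((\<lambda>\<epsilon>. exp (- T \<epsilon>) / ?s \<epsilon>) \<longlongrightarrow> exp (- (av.\<alpha>0 * ln (1 + av.\<kappa>0 * ?h))) / 1) (at_right 0)"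
    by (intro tendsto_divide tendsto_exp tendsto_minus av.T_tendsto S1) simp
  moreover have "exp (- (av.\<alpha>0 * ln (1 + av.\<kappa>0 * ?h))) / 1 = (1 + ?m2 / (2 * work) * (\<Sum>j\<in>UNIV. fluid 0 j * s j))
      powr (- (2 * (\<Sum>i\<in>UNIV. mean (S i) + G i) * work / ?m2))"
  proof -
    have "?m2 / (2 * work) * (\<Sum>j\<in>UNIV. fluid 0 j * s j) = ?m2 / 2 * ?h" by simp
    then show ?thesis using h0 unfolding a0 k0 by (simp add: powr_def del: One_nat_def)
  qed
  moreover have "\<forall>\<^sub>F \<epsilon> in at_right 0. exp (- T \<epsilon>) / ?s \<epsilon> = P \<epsilon>"
    using eventually_at_right_less[of 0] eventually_mult_le_at_right[of 1 1, OF zero_less_one] P_pos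
  proof eventually_elim
    case (elim \<epsilon>)
    have "0 < ?s \<epsilon>" using elim by (intro lst_switch_bounds(1)) auto
    then show ?case using elim by (simp add: T_def exp_add)
  qed
  ultimately show ?thesis using tendsto_cong by fastforce
qed

end

section \<open>The heavy-traffic limit\<close>

lemma path_sum_measurable:
  assumes "\<And>w. (\<lambda>x. \<phi> w x) \<in> borel_measurable M"
  shows "(\<lambda>x. path_sum m (\<lambda>w. \<phi> w x)) \<in> borel_measurable M"
  using assms
proof (induction m arbitrary: \<phi>)
  case (Suc m)
  note [measurable] = Suc.prems
  show ?case unfolding path_sum.simps by (rule Suc.IH) measurable
qed simp

text \<open>Scheffe's lemma: pointwise convergence of probability masses to a full probability mass
  function is convergence in L1, hence against every bounded \<open>g\<close>.\<close>

lemma mass_convergence: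
  fixes f :: "nat \<Rightarrow> 'b \<Rightarrow> real" and g :: "'b \<Rightarrow> real" and p :: "'b pmf"
  assumes f: "\<And>c z. 0 \<le> f c z" "\<And>c. (\<integral>\<^sup>+z. ennreal (f c z) \<partial>count_space UNIV) = 1"
    and lim: "\<And>z. (\<lambda>c. f c z) \<longlonglongrightarrow> pmf p z" and g: "\<And>z. \<bar>g z\<bar> \<le> 1"
  shows "(\<lambda>c. \<integral>z. f c z * g z \<partial>count_space UNIV) \<longlonglongrightarrow> (\<integral>z. g z \<partial>measure_pmf p)"
proof -
  let ?C = "count_space UNIV"
  have fi: "integrable ?C (f c)" for c
    by (rule integrableI_nonneg) (auto simp: f)
  have pi: "integrable ?C (pmf p)" by (rule integrable_pmf)
  have ii: "integrable ?C (\<lambda>z. h z * g z)" if "integrable ?C h" for h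
    by (rule Bochner_Integration.integrable_bound[OF that])
      (auto intro!: AE_I2 simp: abs_mult mult_left_le g)
  have "(\<lambda>c. \<integral>\<^sup>+z. norm (f c z - pmf p z) \<partial>?C) \<longlonglongrightarrow> 0"
  proof (rule Scheffe_lemma1[OF fi pi])
    show "AE z in ?C. (\<lambda>c. f c z) \<longlonglongrightarrow> pmf p z" by (simp add: lim)
    have "(\<integral>\<^sup>+z. ennreal (pmf p z) \<partial>?C) = 1" by (simp add: nn_integral_pmf)
    then show "limsup (\<lambda>c. \<integral>\<^sup>+z. norm (f c z) \<partial>?C) \<le> (\<integral>\<^sup>+z. norm (pmf p z) \<partial>?C)"
      using f by (simp add: Limsup_const)
  qed
  moreover have "(\<integral>\<^sup>+z. norm (f c z - pmf p z) \<partial>?C) = ennreal (\<integral>z. \<bar>f c z - pmf p z\<bar> \<partial>?C)" for c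
    using fi pi by (subst nn_integral_eq_integral) auto
  ultimately have "(\<lambda>c. ennreal (\<integral>z. \<bar>f c z - pmf p z\<bar> \<partial>?C)) \<longlonglongrightarrow> ennreal 0" by simp
  then have L1: "(\<lambda>c. \<integral>z. \<bar>f c z - pmf p z\<bar> \<partial>?C) \<longlonglongrightarrow> 0" by (rule tendsto_ennrealD) auto
  have "(\<lambda>c. (\<integral>z. f c z * g z \<partial>?C) - (\<integral>z. pmf p z * g z \<partial>?C)) \<longlonglongrightarrow> 0"
  proof (rule tendsto_rabs_zero_cancel, rule tendsto_sandwich[OF _ _ tendsto_const L1])
    show "\<forall>\<^sub>F c in sequentially. \<bar>(\<integral>z. f c z * g z \<partial>?C) - (\<integral>z. pmf p z * g z \<partial>?C)\<bar> \<le> (\<integral>z. \<bar>f c z - pmf p z\<bar> \<partial>?C)"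
    proof (intro always_eventually allI)
      fix c
      have "(\<integral>z. f c z * g z \<partial>?C) - (\<integral>z. pmf p z * g z \<partial>?C) = (\<integral>z. (f c z - pmf p z) * g z \<partial>?C)"
        using ii[OF fi] ii[OF pi] by (simp add: left_diff_distrib)
      also have "\<bar>\<dots>\<bar> \<le> (\<integral>z. \<bar>(f c z - pmf p z) * g z\<bar> \<partial>?C)" by (rule integral_abs_bound)
      also have "\<dots> \<le> (\<integral>z. \<bar>f c z - pmf p z\<bar> \<partial>?C)"
        by (intro integral_mono integrable_abs ii Bochner_Integration.integrable_diff fi pi)
          (simp add: abs_mult mult_left_le g)
      finally show "\<bar>(\<integral>z. f c z * g z \<partial>?C) - (\<integral>z. pmf p z * g z \<partial>?C)\<bar> \<le> (\<integral>z. \<bar>f c z - pmf p z\<bar> \<partial>?C)" .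
    qed
  qed auto
  then have "(\<lambda>c. \<integral>z. f c z * g z \<partial>?C) \<longlonglongrightarrow> (\<integral>z. pmf p z * g z \<partial>?C)" by (rule LIM_zero_cancel)
  also have "(\<integral>z. pmf p z * g z \<partial>?C) = (\<integral>z. g z \<partial>measure_pmf p)"
    unfolding measure_pmf_eq_density by (subst integral_density) auto
  finally show ?thesis .
qed

lemma (in prob_space) expectation_countable:
  fixes I :: "'a \<Rightarrow> 'b::countable" and g :: "'b \<Rightarrow> real"
  assumes I[measurable]: "I \<in> measurable M (count_space UNIV)"
  shows "expectation (\<lambda>\<omega>. g (I \<omega>)) = (\<integral>z. prob {\<omega> \<in> space M. I \<omega> = z} * g z \<partial>count_space UNIV)"
    and "(\<integral>\<^sup>+z. ennreal (prob {\<omega> \<in> space M. I \<omega> = z}) \<partial>count_space UNIV) = 1"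
proof -
  let ?C = "count_space (UNIV :: 'b set)" and ?f = "\<lambda>z. prob {\<omega> \<in> space M. I \<omega> = z}"
  have d: "distr M ?C I = density ?C (\<lambda>z. ennreal (?f z))"
  proof (rule measure_eqI_countable[of _ UNIV])
    fix a :: 'b
    have "emeasure (distr M ?C I) {a} = ennreal (?f a)"
      by (subst emeasure_distr) (auto simp: emeasure_eq_measure intro!: arg_cong[where f = prob])
    also have "\<dots> = emeasure (density ?C (\<lambda>z. ennreal (?f z))) {a}"
      by (subst emeasure_density) (auto simp: nn_integral_count_space_indicator[symmetric])
    finally show "emeasure (distr M ?C I) {a} = emeasure (density ?C (\<lambda>z. ennreal (?f z))) {a}" .
  qed auto
  have "expectation (\<lambda>\<omega>. g (I \<omega>)) = (\<integral>z. g z \<partial>distr M ?C I)"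
    by (subst integral_distr) auto
  then show "expectation (\<lambda>\<omega>. g (I \<omega>)) = (\<integral>z. ?f z * g z \<partial>?C)"
    unfolding d by (subst (asm) integral_density) auto
  have "1 = emeasure (distr M ?C I) UNIV" by (subst emeasure_distr) (auto simp: emeasure_space_1)
  then show "(\<integral>\<^sup>+z. ennreal (?f z) \<partial>?C) = 1"
    unfolding d by (subst (asm) emeasure_density) auto
qed

lemma pmf_expectation_pos:
  fixes g :: "'b \<Rightarrow> real" and p :: "'b pmf"
  assumes g: "\<And>n. 0 < g n" "\<And>n. g n \<le> 1"
  shows "0 < (\<integral>n. g n \<partial>measure_pmf p)"
proof -
  have i: "integrable (measure_pmf p) g"
    by (rule measure_pmf.integrable_const_bound[where B = 1]) (auto simp: g less_imp_le)
  have nn: "0 \<le> (\<integral>n. g n \<partial>measure_pmf p)" by (intro integral_nonneg_AE) (simp add: g less_imp_le)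
  have "(\<integral>n. g n \<partial>measure_pmf p) \<noteq> 0"
  proof
    assume "(\<integral>n. g n \<partial>measure_pmf p) = 0"
    then have "AE n in measure_pmf p. g n = 0"
      by (subst (asm) integral_nonneg_eq_0_iff_AE[OF i]) (auto simp: g less_imp_le)
    moreover obtain n where "n \<in> set_pmf p" using set_pmf_not_empty[of p] by blast
    ultimately have "g n = 0" by (simp add: AE_measure_pmf_iff)
    then show False using g(1)[of n] by simp
  qed
  then show ?thesis using nn by simp
qed

lemma filterlim_one_minus: "filterlim (\<lambda>\<rho>. 1 - \<rho> :: real) (at_right 0) (at_left 1)"
proof (rule filterlim_at_withinI)
  have "((\<lambda>\<rho>. 1 - \<rho> :: real) \<longlongrightarrow> 1 - 1) (at_left 1)" by (intro tendsto_intros)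
  then show "((\<lambda>\<rho>. 1 - \<rho> :: real) \<longlongrightarrow> 0) (at_left 1)" by simp
  show "\<forall>\<^sub>F \<rho> in at_left 1. 1 - \<rho> \<in> {0 :: real<..} - {0}"
    by (auto simp: eventually_at_filter)
qed

context driven_glue_system
begin

text \<open>The sample path recursion takes sets of customers as states; measurability is read off
  the representation as a path sum of measurable terms instead.\<close>

lemma in_system_measurable: "(\<lambda>\<omega>. in_system G (\<lambda>s. X s \<omega>) m) \<in> measurable M (count_space UNIV)"
proof -
  have r: "(\<lambda>\<omega>. of_nat (in_system G (\<lambda>s. X s \<omega>) m j) :: ennreal) \<in> borel_measurable M" for j
  proof -
    have "(\<lambda>\<omega>. path_sum (Suc m) (\<lambda>w. (\<Prod>l<Suc m. of_bool (card (path_joined G (\<lambda>s. X s \<omega>) w l) = w l))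
        * of_nat (path_orbit G (\<lambda>s. X s \<omega>) w m j))) \<in> borel_measurable M"
    proof (rule path_sum_measurable)
      fix w
      have "(\<lambda>x. (\<Prod>l<Suc m. of_bool (card (path_joined G x w l) = w l))
          * (of_nat (path_orbit G x w m j) :: ennreal)) \<in> borel_measurable (PiM UNIV (\<lambda>_. borel))"
        by measurable
      from measurable_compose[OF X_all_measurable this]
      show "(\<lambda>\<omega>. (\<Prod>l<Suc m. of_bool (card (path_joined G (\<lambda>s. X s \<omega>) w l) = w l))
          * (of_nat (path_orbit G (\<lambda>s. X s \<omega>) w m j) :: ennreal)) \<in> borel_measurable M"
        by simp
    qed
    then show ?thesis by (simp only: path_sum_in_system[where h = "\<lambda>n. of_nat (n j)"])
  qed
  have "{\<omega> \<in> space M. in_system G (\<lambda>s. X s \<omega>) m = z} \<in> sets M" for z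
  proof -
    have "{\<omega> \<in> space M. in_system G (\<lambda>s. X s \<omega>) m = z}
      = {\<omega> \<in> space M. \<forall>j\<in>UNIV. (of_nat (in_system G (\<lambda>s. X s \<omega>) m j) :: ennreal) = of_nat (z j)}"
      by (auto simp: fun_eq_iff)
    also have "\<dots> \<in> sets M" using r by measurable
    finally show ?thesis .
  qed
  moreover have "(\<lambda>\<omega>. in_system G (\<lambda>s. X s \<omega>) m) -` {z} \<inter> space M = {\<omega> \<in> space M. in_system G (\<lambda>s. X s \<omega>) m = z}" for z
    by auto
  ultimately show ?thesis by (simp add: measurable_count_space_eq2_countable)
qed

text \<open>Visit \<open>c * CARD('n)\<close> is at the first station for every \<open>c\<close>, so
  the explicit generating functions along these visits converge to that of the limiting law.\<close>

theorem limiting_gf: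
  assumes p: "limiting_law_switch1 G M X p" and z: "\<And>j. 0 \<le> z j \<and> z j \<le> 1"
  shows "(\<lambda>c. gate lam G B (station 0) (\<lambda>j. 1 - z j)
      * back_prod lam nu G B S (c * CARD('n)) (offspring lam nu G B (station 0) (\<lambda>j. 1 - z j)))
    \<longlonglongrightarrow> (\<integral>n. (\<Prod>j\<in>UNIV. z j ^ n j) \<partial>measure_pmf p)"
proof -
  let ?g = "\<lambda>n. \<Prod>j\<in>UNIV. z j ^ n j" and ?I = "\<lambda>c \<omega>. in_system G (\<lambda>s. X s \<omega>) (c * CARD('n))"
  have g: "0 \<le> ?g n" "?g n \<le> 1" for n
    using z by (auto intro!: prod_nonneg prod_le_1 power_le_one)
  have y: "0 \<le> 1 - z j" for j using z[of j] by simp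
  have "(\<lambda>c. \<integral>n. prob {\<omega> \<in> space M. ?I c \<omega> = n} * ?g n \<partial>count_space UNIV) \<longlonglongrightarrow> (\<integral>n. ?g n \<partial>measure_pmf p)"
  proof (rule mass_convergence)
    show "(\<lambda>c. prob {\<omega> \<in> space M. ?I c \<omega> = n}) \<longlonglongrightarrow> pmf p n" for n
      using p by (simp add: limiting_law_switch1_def)
    show "\<bar>?g n\<bar> \<le> 1" for n using g[of n] by simp
  qed (use expectation_countable(2)[OF in_system_measurable] in auto)
  moreover have "(\<integral>n. prob {\<omega> \<in> space M. ?I c \<omega> = n} * ?g n \<partial>count_space UNIV)
    = gate lam G B (station 0) (\<lambda>j. 1 - z j)
      * back_prod lam nu G B S (c * CARD('n)) (offspring lam nu G B (station 0) (\<lambda>j. 1 - z j))" for c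
  proof -
    have st: "(station (c * CARD('n)) :: 'n) = station 0" by (simp add: station_def)
    have m: "(\<lambda>\<omega>. ?g (?I c \<omega>)) \<in> borel_measurable M"
      using measurable_compose[OF in_system_measurable, of "\<lambda>n. ?g n" borel] by simp
    have "expectation (\<lambda>\<omega>. ?g (?I c \<omega>)) = enn2real (\<integral>\<^sup>+\<omega>. ennreal (?g (?I c \<omega>)) \<partial>M)"
      using m by (intro integral_eq_nn_integral) (auto simp: g)
    also have "\<dots> = gate lam G B (station 0) (\<lambda>j. 1 - z j)
      * back_prod lam nu G B S (c * CARD('n)) (offspring lam nu G B (station 0) (\<lambda>j. 1 - z j))"
      unfolding in_system_gf[OF z] st
      using back_prod_nonneg[OF offspring_nonneg[of "\<lambda>j. 1 - z j" 0, OF y]] by (simp add: gate_def)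
    finally show ?thesis unfolding expectation_countable(1)[OF in_system_measurable, where g = ?g] .
  qed
  ultimately show ?thesis by simp
qed

end

theorem theorem4:
  fixes lam nu G :: "'n::{finite,linorder} \<Rightarrow> real"
    and B S :: "'n \<Rightarrow> real measure"
    and M :: "real \<Rightarrow> 'a measure"
    and X :: "real \<Rightarrow> 'n source \<Rightarrow> 'a \<Rightarrow> real"
    and Z_law :: "real \<Rightarrow> ('n \<Rightarrow> nat) pmf"
  assumes lam_pos: "\<And>i. 0 < lam i"
    and nu_pos: "\<And>i. 0 < nu i"
    and G_pos: "\<And>i. 0 < G i"
    and B_law: "\<And>i. real_distribution (B i)" "\<And>i. AE x in B i. 0 \<le> x"
    and S_law: "\<And>i. real_distribution (S i)" "\<And>i. AE x in S i. 0 \<le> x"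
    and B_mean: "\<And>i. integrable (B i) (\<lambda>x. x)" "\<And>i. 0 < mean (B i)"
    and B_second: "\<And>i. integrable (B i) (\<lambda>x. x ^ 2)"
    and S_mean: "\<And>i. integrable (S i) (\<lambda>x. x)"
    and critical: "(\<Sum>i\<in>UNIV. lam i * mean (B i)) = 1"
    and system: "\<And>\<rho>. \<lbrakk>0 < \<rho>; \<rho> < 1\<rbrakk> \<Longrightarrow>
      glue_polling_system (M \<rho>) (X \<rho>) (\<lambda>i. \<rho> * lam i) nu B S"
    and steady_state: "\<And>\<rho>. \<lbrakk>0 < \<rho>; \<rho> < 1\<rbrakk> \<Longrightarrow>
      limiting_law_switch1 G (M \<rho>) (X \<rho>) (Z_law \<rho>)"
  shows "converges_in_distribution
    (\<lambda>\<rho>. distr (measure_pmf (Z_law \<rho>)) borel (\<lambda>z. (1 - \<rho>) *\<^sub>R (\<chi> j. real (z j))))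
    (distr (gamma_law (alpha lam nu G B S) 1) borel
      (\<lambda>y. y *\<^sub>R ((mixed_moment 2 lam B / (2 * mixed_moment 1 lam B) * (1 / delta lam nu G B)) *\<^sub>R
        (\<chi> j. (if j = station 0
                then exp (- nu (station 0) * G (station 0)) * u_hat lam nu G B (station 0)
                else u_hat lam nu G B j)
             + (1 - exp (- nu (station 0) * G (station 0))) * u_hat lam nu G B (station 0)
               * lam j * mean (B (station 0))))))
    (at_left 1)"
proof -
  have B_nl: "nonneg_law (B i)" for i
    by (intro nonneg_law.intro nonneg_law_axioms.intro B_law B_mean)
  have S_nl: "nonneg_law (S i)" for i
    by (intro nonneg_law.intro nonneg_law_axioms.intro S_law S_mean)
  interpret pd: polling_data lam nu G B S
    by (intro polling_data.intro lam_pos nu_pos G_pos B_nl S_nl B_mean(2) B_second critical)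
  define M2 where "M2 = (\<Sum>i\<in>UNIV. lam i * moment 2 (B i))"
  define R where "R = (\<Sum>i\<in>UNIV. mean (S i) + G i)"
  have M2: "0 < M2"
    unfolding M2_def using nonneg_law.moment2_pos[OF B_nl B_second B_mean(2)] lam_pos by (intro sum_pos mult_pos_pos) auto
  have R: "0 < R"
    unfolding R_def using nonneg_law.mean_nonneg[OF S_nl] G_pos by (intro sum_pos add_nonneg_pos) auto
  have lam_sum: "0 < (\<Sum>i\<in>UNIV. lam i)" using lam_pos by (intro sum_pos) auto
  \<comment> \<open>Criticality makes the numerator of \<open>mixed_moment 1\<close> equal to 1, and
    the common denominator cancels; only the sum \<open>M2\<close> survives.\<close>
  have mm: "mixed_moment 1 lam B / mixed_moment 2 lam B = 1 / M2" "mixed_moment 2 lam B / (2 * mixed_moment 1 lam B) = M2 / 2"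
    using lam_sum M2 unfolding mixed_moment_def critical M2_def[symmetric] by (auto simp: field_simps)
  have al: "alpha lam nu G B S = 2 * R * pd.work / M2"
    unfolding alpha_def mm pd.work_def R_def by simp
  have al_pos: "0 < alpha lam nu G B S" unfolding al using R M2 pd.work_pos by simp
  define V :: "(real, 'n) vec" where "V = (mixed_moment 2 lam B / (2 * mixed_moment 1 lam B) * (1 / delta lam nu G B)) *\<^sub>R
        (\<chi> j. (if j = station 0
                then exp (- nu (station 0) * G (station 0)) * u_hat lam nu G B (station 0)
                else u_hat lam nu G B j)
             + (1 - exp (- nu (station 0) * G (station 0))) * u_hat lam nu G B (station 0)
               * lam j * mean (B (station 0)))"
  have v: "V $ j = M2 / (2 * pd.work) * pd.fluid 0 j" for j
    unfolding V_def mm pd.work_def[symmetric] pd.fluid_0 by simp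
  have v_nonneg: "0 \<le> V $ j" for j
    unfolding v using M2 pd.work_pos pd.fluid_pos[of 0 j] by (intro mult_nonneg_nonneg) auto
  let ?\<mu> = "\<lambda>\<rho>. distr (measure_pmf (Z_law \<rho>)) borel (\<lambda>z. (1 - \<rho>) *\<^sub>R (\<chi> j. real (z j)) :: (real, 'n) vec)"
  let ?\<nu> = "distr (gamma_law (alpha lam nu G B S) 1) borel (\<lambda>y. y *\<^sub>R V)"
  interpret g: prob_space "gamma_law (alpha lam nu G B S) 1" by (rule prob_space_gamma_law[OF al_pos])
  have vm[measurable]: "(\<lambda>y. y *\<^sub>R V) \<in> measurable (gamma_law (alpha lam nu G B S) 1) borel" by measurable
  interpret laplace_convergence ?\<mu> ?\<nu> "at_left 1"
  proof (rule laplace_convergence.intro)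
    show "prob_space (?\<mu> \<rho>)" for \<rho> by (intro measure_pmf.prob_space_distr) simp
    show "prob_space ?\<nu>" by (intro g.prob_space_distr) measurable
    show "sets (?\<mu> \<rho>) = sets borel" for \<rho> by simp
    show "sets ?\<nu> = sets borel" by simp
    have "\<forall>\<^sub>F \<rho>::real in at_left 1. \<rho> < 1" by (auto simp: eventually_at_filter)
    then show "\<forall>\<^sub>F \<rho> in at_left 1. AE x in ?\<mu> \<rho>. \<forall>j. 0 \<le> x $ j"
      by eventually_elim (subst AE_distr_iff; simp)
    show "AE x in ?\<nu>. \<forall>j. 0 \<le> x $ j"
    proof (subst AE_distr_iff[OF vm])
      show "AE y in gamma_law (alpha lam nu G B S) 1. \<forall>j. 0 \<le> (y *\<^sub>R V) $ j"
        using AE_gamma_law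
      proof eventually_elim
        case (elim y)
        then show ?case using v_nonneg by simp
      qed
    qed simp
    fix s :: "'n \<Rightarrow> nat"
    \<comment> \<open>The transform of \<open>(1 - \<rho>)\<close> times the steady state vector at
      the integer point \<open>s\<close>, with \<open>\<epsilon> = 1 - \<rho>\<close>.\<close>
    let ?P = "\<lambda>\<epsilon>. \<integral>n. (\<Prod>j\<in>UNIV. exp (- \<epsilon> * real (s j)) ^ n j) \<partial>measure_pmf (Z_law (1 - \<epsilon>))"
    have \<epsilon>1: "\<forall>\<^sub>F \<epsilon>::real in at_right 0. 0 < \<epsilon> \<and> \<epsilon> < 1"
      unfolding eventually_at_right_field by (intro exI[of _ 1]) auto
    interpret heavy_traffic lam nu G B S "\<lambda>j. real (s j)" ?P
    proof
      show "0 \<le> real (s j)" for j by simp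
      show "\<forall>\<^sub>F \<epsilon> in at_right 0. 0 < ?P \<epsilon>"
        using \<epsilon>1
      proof eventually_elim
        case (elim \<epsilon>)
        let ?g = "\<lambda>n. \<Prod>j\<in>UNIV. exp (- \<epsilon> * real (s j)) ^ n j"
        have g: "0 < ?g n" "?g n \<le> 1" for n :: "'n \<Rightarrow> nat"
          using elim by (auto intro!: prod_pos prod_le_1 power_le_one)
        show ?case by (rule pmf_expectation_pos[OF g])
      qed
      show "\<forall>\<^sub>F \<epsilon> in at_right 0.
        (\<lambda>c. gate (\<lambda>j. (1 - \<epsilon>) * lam j) G B (station 0) (\<lambda>j. 1 - exp (- \<epsilon> * real (s j)))
          * back_prod (\<lambda>j. (1 - \<epsilon>) * lam j) nu G B S (c * CARD('n))
              (offspring (\<lambda>j. (1 - \<epsilon>) * lam j) nu G B (station 0) (\<lambda>j. 1 - exp (- \<epsilon> * real (s j)))))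
        \<longlonglongrightarrow> ?P \<epsilon>"
        using \<epsilon>1
      proof eventually_elim
        case (elim \<epsilon>)
        have "driven_glue_system (M (1 - \<epsilon>)) (X (1 - \<epsilon>)) (\<lambda>i. (1 - \<epsilon>) * lam i) nu B S G"
          using elim lam_pos nu_pos G_pos B_law(2) S_law(2)
          by (intro driven_glue_system.intro driven_glue_system_axioms.intro system) auto
        then show ?case
          by (rule driven_glue_system.limiting_gf) (use elim in \<open>auto intro!: steady_state\<close>)
      qed
    qed
    let ?c = "M2 / (2 * pd.work) * (\<Sum>j\<in>UNIV. pd.fluid 0 j * real (s j))"
    have c_nonneg: "0 \<le> ?c"
      using M2 pd.work_pos pd.fluid_pos by (intro mult_nonneg_nonneg sum_nonneg) (auto simp: less_imp_le)
    have "((\<lambda>\<rho>. ?P (1 - \<rho>)) \<longlongrightarrow> (1 + ?c) powr (- alpha lam nu G B S)) (at_left 1)"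
      using filterlim_compose[OF P_tendsto filterlim_one_minus] unfolding al M2_def[symmetric] R_def[symmetric] .
    moreover have "\<forall>\<^sub>F \<rho> in at_left 1. ?P (1 - \<rho>) = (\<integral>x. exp (- (\<Sum>j\<in>UNIV. real (s j) * \<bar>x $ j\<bar>)) \<partial>?\<mu> \<rho>)"
      using \<open>\<forall>\<^sub>F \<rho>::real in at_left 1. \<rho> < 1\<close>
    proof eventually_elim
      case (elim \<rho>)
      have "(\<integral>x. exp (- (\<Sum>j\<in>UNIV. real (s j) * \<bar>x $ j\<bar>)) \<partial>?\<mu> \<rho>)
        = (\<integral>n. exp (- (\<Sum>j\<in>UNIV. real (s j) * \<bar>(1 - \<rho>) * real (n j)\<bar>)) \<partial>measure_pmf (Z_law \<rho>))"
        by (subst integral_distr) auto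
      also have "\<dots> = ?P (1 - \<rho>)"
      proof -
        have "exp (- (\<Sum>j\<in>UNIV. real (s j) * \<bar>(1 - \<rho>) * real (n j)\<bar>)) = (\<Prod>j\<in>UNIV. exp (- (1 - \<rho>) * real (s j)) ^ n j)" for n :: "'n \<Rightarrow> nat"
          unfolding exp_of_nat_mult[symmetric] exp_sum[OF finite_class.finite_UNIV, symmetric] sum_negf[symmetric]
          using elim by (intro arg_cong[where f = exp] sum.cong refl) (simp add: abs_mult, simp add: algebra_simps)
        then show ?thesis by simp
      qed
      finally show ?case by simp
    qed
    ultimately have "((\<lambda>\<rho>. \<integral>x. exp (- (\<Sum>j\<in>UNIV. real (s j) * \<bar>x $ j\<bar>)) \<partial>?\<mu> \<rho>) \<longlongrightarrow> (1 + ?c) powr (- alpha lam nu G B S)) (at_left 1)"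
      by (rule Lim_transform_eventually)
    moreover have "(\<integral>x. exp (- (\<Sum>j\<in>UNIV. real (s j) * \<bar>x $ j\<bar>)) \<partial>?\<nu>) = (1 + ?c) powr (- alpha lam nu G B S)"
    proof -
      have hm: "(\<lambda>x :: (real, 'n) vec. exp (- (\<Sum>j\<in>UNIV. real (s j) * \<bar>x $ j\<bar>))) \<in> borel_measurable borel" by measurable
      have "(\<integral>x. exp (- (\<Sum>j\<in>UNIV. real (s j) * \<bar>x $ j\<bar>)) \<partial>?\<nu>)
        = (\<integral>y. exp (- (\<Sum>j\<in>UNIV. real (s j) * \<bar>(y *\<^sub>R V) $ j\<bar>)) \<partial>gamma_law (alpha lam nu G B S) 1)"
        by (rule integral_distr[OF vm hm])
      \<comment> \<open>The limiting vector is a fixed direction times one scalar, so its joint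
        transform is the gamma transform at the inner product \<open>?c\<close> of \<open>s\<close>
        with that direction.\<close>
      also have "\<dots> = (\<integral>y. exp (- ?c * y) \<partial>gamma_law (alpha lam nu G B S) 1)"
      proof (rule integral_cong_AE)
        show "AE y in gamma_law (alpha lam nu G B S) 1. exp (- (\<Sum>j\<in>UNIV. real (s j) * \<bar>(y *\<^sub>R V) $ j\<bar>)) = exp (- ?c * y)"
          using AE_gamma_law
        proof eventually_elim
          case (elim y)
          have "\<bar>(y *\<^sub>R V) $ j\<bar> = y * (M2 / (2 * pd.work) * pd.fluid 0 j)" for j
          proof -
            have "0 \<le> y * V $ j" using elim v_nonneg[of j] by simp
            then have "\<bar>(y *\<^sub>R V) $ j\<bar> = y * V $ j" by simp
            then show ?thesis by (simp only: v)
          qed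
          then have "(\<Sum>j\<in>UNIV. real (s j) * \<bar>(y *\<^sub>R V) $ j\<bar>) = (\<Sum>j\<in>UNIV. real (s j) * (y * (M2 / (2 * pd.work) * pd.fluid 0 j)))"
            by (simp only:)
          also have "\<dots> = ?c * y" by (simp add: sum_distrib_left sum_distrib_right mult_ac)
          finally show ?case by simp
        qed
        show "(\<lambda>y. exp (- (\<Sum>j\<in>UNIV. real (s j) * \<bar>(y *\<^sub>R V) $ j\<bar>))) \<in> borel_measurable (gamma_law (alpha lam nu G B S) 1)"
          using measurable_compose[OF vm hm] .
      qed measurable
      also have "\<dots> = enn2real (\<integral>\<^sup>+y. ennreal (exp (- ?c * y)) \<partial>gamma_law (alpha lam nu G B S) 1)"
        by (rule integral_eq_nn_integral) auto
      also have "\<dots> = (1 + ?c) powr (- alpha lam nu G B S)"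
        unfolding nn_integral_gamma_law_exp[OF al_pos c_nonneg] by simp
      finally show ?thesis .
    qed
    ultimately show "((\<lambda>\<rho>. \<integral>x. exp (- (\<Sum>j\<in>UNIV. real (s j) * \<bar>x $ j\<bar>)) \<partial>?\<mu> \<rho>) \<longlongrightarrow>
      (\<integral>x. exp (- (\<Sum>j\<in>UNIV. real (s j) * \<bar>x $ j\<bar>)) \<partial>?\<nu>)) (at_left 1)"
      by (simp only:)
  qed
  show ?thesis using converges unfolding V_def .
qed

end
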